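(* Let $C\subset(\mathbb{C}^* )^n$ be a real irreducible curve with $C\cap(\mathbb{R}^* )^n\neq\emptyset$, let $f$ be a polynomial system such that $C$ is an irreducible component of multiplicity one of the solution set of $f=0$, and let $v\in(\mathbb{R}^* )^{n+1}$ satisfy $$\{x\in\mathbb{P}^n \mid v\cdot x=0\}\cap\{x\in\overline{C}\mid \text{some coordinate } x_i \text{ is zero}\}=\emptyset ,$$ where $\overline{C}\subset\mathbb{P}^n$ is the closure of $C$. Then the procedure $\mathcal{A}_{\mathbb{R}}$ described in the context, applied to $(C,f,v)$ (for any admissible choice of the numbers $\tau_j$), computes the primitive vectors with signs of the real tropical curve $\mathrm{Trop}_{\mathbb{R}}(C)$. That is, the set of pairs $(u,\sigma)\in\mathbb{Z}^n\times\{\pm1\}^n$ in its output is exactly the set of primitive vectors with signs of $\mathrm{Trop}_{\mathbb{R}}(C)$.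
   Context: **Real tropical curve.** $\mathbb{R}\{\!\{t\}\!\}=\bigcup_{m\ge1}\mathbb{R}((t^{1/m}))$ is the field of real Puiseux series; for a nonzero series, $\mathrm{val}$ is its smallest exponent with nonzero coefficient and $\mathrm{coeff}$ is that coefficient; both are applied coordinatewise. A curve $C\subset(\mathbb{C}^* )^n$ is real if it is defined by polynomials with real coefficients; let $I\subset\mathbb{R}[x_1,\dots,x_n]$ be the ideal of real polynomials vanishing on $C$. $\mathrm{Trop}_{\mathbb{R}}(C)\subset\mathbb{R}^n$ is the Euclidean closure of $\{-\mathrm{val}(y)\mid y\in(\mathbb{R}\{\!\{t\}\!\}^* )^n,\ g(y)=0\ \forall g\in I\}$. A *primitive vector with sign* of $\mathrm{Trop}_{\mathbb{R}}(C)$ is a pair $(u,\sigma)$ with $u\in\mathbb{Z}^n\setminus\{0\}$ primitive (gcd of entries $1$) and $\sigma\in\{\pm1\}^n$ for which there is $y\in(\mathbb{R}\{\!\{t\}\!\}^* )^n$ in the zero set of $I$ such that $-\mathrm{val}(y)$ is a positive multiple of $u$ and $\mathrm{sign}(\mathrm{coeff}(y))=\sigma$. **Multiplicity one component.** A curve $X$ is an irreducible component of multiplicity one of the solution set of a system if it is an irreducible component of the solution set at whose generic point the scheme defined by the system is reduced. **Affine patch.** $\overline{C}\subset\mathbb{P}^n$ is the closure of $\{[1:y_1:\dots:y_n]\mid y\in C\}$, with homogeneous coordinates $x_0,\dots,x_n$; $\widehat{C}\subset\mathbb{C}^{n+1}$ is the intersection of the affine cone over $\overline{C}$ with the hyperplane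 $v\cdot x=1$; $\widehat f=\overline f\cup\{v\cdot x-1\}$, where $\overline f$ is the homogenization of $f$ with respect to $x_0$. Write $\mathcal{V}(\cdot)$ for zero sets in $\mathbb{C}^{n+1}$. **Procedure $\mathcal{A}_{\mathbb{R}}$** (all computations understood to be exact). 1. Let $\Lambda=\widehat{C}\cap\mathcal{V}(x_0x_1\cdots x_n)$. If $\Lambda=\emptyset$, return $\mathrm{Trop}_{\mathbb{R}}(C)=\{0\}$ (there are then no primitive vectors). Let $\Lambda_j=\{x\in\Lambda\mid x_0,\dots,x_{j-1}\ne0,\ x_j=0\}$ for $j=0,\dots,n$. Start with the empty output. 2. For each $j\in\{0,\dots,n\}$ with $\Lambda_j\neq\emptyset$: (a) Let $S_j$ be the set of $x\in\widehat{C}$ at which the Jacobian matrix of $\widehat f$ with the column of $\partial/\partial x_j$ removed has a nonzero null vector. Let $T_j^*$ be the set of nonzero numbers among $|x_j|$ for $x\in S_j\cup\Lambda$. Choose any $\tau_j$ with $0<\tau_j<\min T_j^*$ (any $\tau_j>0$ if $T_j^*=\emptyset$). (b) For each $\tau\in\{\tau_j,-\tau_j\}$ consider all real points $p\in\widehat{C}\cap\mathcal{V}(x_j-\tau)\cap\mathbb{R}^{n+1}$ such that the continuous path $P(s)\in\widehat{C}\cap\mathcal{V}(x_j-\tau s)$, $s\in[0,1]$, with $P(1)=p$, ends (at $s=0$) at a point of $\Lambda_j$. (c) For each such $p$: write $\theta\mapsto P(e^{i\theta})$, $\theta\ge0$, for the continuous path in $\widehat{C}$ starting at $p$ at $\theta=0$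 whose $j$-th coordinate is $\tau e^{i\theta}$ (obtained by continuation along the circle). Let $c$ be the cycle number, the least positive integer such that this path returns to $p$ at $\theta=2\pi c$. For $k=0,\dots,n$ let $u_k$ be the least integer $\ge0$ with $\int_0^{2\pi}P_k(e^{c\,i\theta})\,e^{-iu_k\theta}\,d\theta\neq0$. Put $u=(u_0,\dots,u_n)$ and $r=u/\gcd(u)$. Add to the output the vector $(r_0-r_1,\dots,r_0-r_n)$ with sign $(\mathrm{sign}(p_0p_1),\dots,\mathrm{sign}(p_0p_n))$. 3. Return the set of all vectors with signs obtained. *)

theory Defs
  imports
    "HOL-Analysis.Analysis"
    "HOL-Library.Poly_Mapping"
    "HOL-Library.FuncSet"
    "HOL-Computational_Algebra.Formal_Laurent_Series"
begin

section \<open>Puiseux series\<close>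

text \<open>
  A pair \<open>(m, F)\<close> with \<open>m > 0\<close> stands for \<open>F(t\<^bsup>1/m\<^esup>)\<close>. Two pairs \<open>(m, F)\<close> and \<open>(k, G)\<close> denote
  the same series iff \<open>F(s\<^sup>k) = G(s\<^sup>m)\<close>, as one sees by writing \<open>t = s\<^bsup>mk\<^esup>\<close>. The quotient is the
  directed union of the fields \<open>K((t\<^bsup>1/m\<^esup>))\<close>.
\<close>

definition puiseux_rel :: "nat \<times> 'a::field fls \<Rightarrow> nat \<times> 'a fls \<Rightarrow> bool" where
  "puiseux_rel p q \<longleftrightarrow> fst p > 0 \<and> fst q > 0 \<and>
     fls_compose_power (snd p) (fst q) = fls_compose_power (snd q) (fst p)"

lemma fls_compose_power_compose:
  fixes F :: "'a::zero fls"
  assumes "a > 0" "b > 0"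
  shows "fls_compose_power (fls_compose_power F a) b = fls_compose_power F (a * b)"
proof (rule fls_eqI)
  fix n :: int
  show "fls_nth (fls_compose_power (fls_compose_power F a) b) n = fls_nth (fls_compose_power F (a * b)) n"
  proof (cases "int b dvd n")
    case True
    then obtain k where n: "n = int b * k" by (elim dvdE)
    have "int a dvd k \<longleftrightarrow> int b * int a dvd int b * k" using assms by simp
    moreover have "(int b * k) div (int a * int b) = k div int a"
      using assms by (simp add: mult.commute[of "int a"])
    ultimately show ?thesis using assms n
      by (simp add: fls_nth_compose_power mult.commute)
  next
    case False
    hence "\<not> int (a * b) dvd n" by (metis dvd_mult_right of_nat_mult)
    thus ?thesis using assms False by (simp add: fls_nth_compose_power)
  qed
qed

lemma fls_compose_power_cancel:
  fixes F G :: "'a::zero fls"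
  assumes "a > 0" "fls_compose_power F a = fls_compose_power G a"
  shows "F = G"
proof (rule fls_eqI)
  fix n :: int
  have "fls_nth (fls_compose_power F a) (int a * n) = fls_nth (fls_compose_power G a) (int a * n)"
    using assms by simp
  thus "fls_nth F n = fls_nth G n" using assms(1) by (simp add: fls_nth_compose_power)
qed

lemma fls_subdegree_compose_power:
  fixes F :: "'a::zero fls"
  assumes "d > 0"
  shows "fls_subdegree (fls_compose_power F d) = int d * fls_subdegree F"
proof (cases "F = 0")
  case False
  show ?thesis
  proof (rule fls_subdegree_eqI)
    show "fls_nth (fls_compose_power F d) (int d * fls_subdegree F) \<noteq> 0"
      using False assms by (simp add: fls_nth_compose_power)
    fix n assume n: "n < int d * fls_subdegree F"
    show "fls_nth (fls_compose_power F d) n = 0"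
    proof (cases "int d dvd n")
      case True
      then obtain k where "n = int d * k" by (elim dvdE)
      thus ?thesis using n assms by (simp add: fls_nth_compose_power)
    qed (use assms in \<open>simp add: fls_nth_compose_power\<close>)
  qed
qed simp

lemma part_equivp_puiseux_rel: "part_equivp (puiseux_rel :: nat \<times> 'a::field fls \<Rightarrow> _)"
proof (rule part_equivpI)
  show "\<exists>x. puiseux_rel x (x :: nat \<times> 'a fls)"
    by (rule exI[of _ "(1, 0)"]) (simp add: puiseux_rel_def)
  show "symp (puiseux_rel :: nat \<times> 'a fls \<Rightarrow> _)" by (auto simp: puiseux_rel_def intro!: sympI)
  show "transp (puiseux_rel :: nat \<times> 'a fls \<Rightarrow> _)"
  proof (rule transpI)
    fix p q r :: "nat \<times> 'a fls"
    assume a: "puiseux_rel p q" "puiseux_rel q r"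
    obtain i F j G k H where e: "p = (i, F)" "q = (j, G)" "r = (k, H)"
      by (cases p, cases q, cases r) auto
    have pos: "i > 0" "j > 0" "k > 0" using a e by (auto simp: puiseux_rel_def)
    have 1: "fls_compose_power F j = fls_compose_power G i"
      and 2: "fls_compose_power G k = fls_compose_power H j"
      using a e by (auto simp: puiseux_rel_def)
    have "fls_compose_power (fls_compose_power F k) j = fls_compose_power (fls_compose_power F j) k"
      using pos by (simp add: fls_compose_power_compose mult.commute)
    also have "\<dots> = fls_compose_power (fls_compose_power G k) i"
      using pos 1 by (simp add: fls_compose_power_compose mult.commute)
    also have "\<dots> = fls_compose_power (fls_compose_power H i) j"
      using pos 2 by (simp add: fls_compose_power_compose mult.commute)
    finally have "fls_compose_power F k = fls_compose_power H i"
      using fls_compose_power_cancel pos by blast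
    thus "puiseux_rel p r" using pos e by (simp add: puiseux_rel_def)
  qed
qed

quotient_type (overloaded) 'a puiseux = "nat \<times> 'a::field fls" / partial: puiseux_rel
  by (rule part_equivp_puiseux_rel)

lemma puiseux_relD:
  assumes "puiseux_rel p q"
  shows "fst p > 0" "fst q > 0"
    "fls_compose_power (snd p) (fst q * d) = fls_compose_power (snd q) (fst p * d)"
proof -
  show *: "fst p > 0" "fst q > 0" using assms by (auto simp: puiseux_rel_def)
  show "fls_compose_power (snd p) (fst q * d) = fls_compose_power (snd q) (fst p * d)"
  proof (cases "d = 0")
    case False
    thus ?thesis using assms *
      by (simp flip: fls_compose_power_compose add: puiseux_rel_def)
  qed simp
qed

instantiation puiseux :: (field) comm_ring_1
begin

lift_definition zero_puiseux :: "'a puiseux" is "(1, 0)"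
  by (simp add: puiseux_rel_def)

lift_definition one_puiseux :: "'a puiseux" is "(1, 1)"
  by (simp add: puiseux_rel_def)

lift_definition plus_puiseux :: "'a puiseux \<Rightarrow> 'a puiseux \<Rightarrow> 'a puiseux" is
  "\<lambda>p q. (fst p * fst q, fls_compose_power (snd p) (fst q) + fls_compose_power (snd q) (fst p))"
proof -
  fix p p' q q' :: "nat \<times> 'a fls"
  assume a: "puiseux_rel p p'" "puiseux_rel q q'"
  note d = puiseux_relD[OF a(1)] puiseux_relD[OF a(2)]
  show "puiseux_rel
     (fst p * fst q, fls_compose_power (snd p) (fst q) + fls_compose_power (snd q) (fst p))
     (fst p' * fst q', fls_compose_power (snd p') (fst q') + fls_compose_power (snd q') (fst p'))"
    using d(1,2,4,5) d(3)[of "fst q * fst q'"] d(6)[of "fst p * fst p'"]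
    by (simp add: puiseux_rel_def fls_compose_power_compose mult_ac)
qed

lift_definition uminus_puiseux :: "'a puiseux \<Rightarrow> 'a puiseux" is "\<lambda>p. (fst p, - snd p)"
  by (simp add: puiseux_rel_def)

definition minus_puiseux :: "'a puiseux \<Rightarrow> 'a puiseux \<Rightarrow> 'a puiseux" where
  "minus_puiseux x y = x + - y"

lift_definition times_puiseux :: "'a puiseux \<Rightarrow> 'a puiseux \<Rightarrow> 'a puiseux" is
  "\<lambda>p q. (fst p * fst q, fls_compose_power (snd p) (fst q) * fls_compose_power (snd q) (fst p))"
proof -
  fix p p' q q' :: "nat \<times> 'a fls"
  assume a: "puiseux_rel p p'" "puiseux_rel q q'"
  note d = puiseux_relD[OF a(1)] puiseux_relD[OF a(2)]
  show "puiseux_rel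
     (fst p * fst q, fls_compose_power (snd p) (fst q) * fls_compose_power (snd q) (fst p))
     (fst p' * fst q', fls_compose_power (snd p') (fst q') * fls_compose_power (snd q') (fst p'))"
    using d(1,2,4,5) d(3)[of "fst q * fst q'"] d(6)[of "fst p * fst p'"]
    by (simp add: puiseux_rel_def fls_compose_power_compose mult_ac)
qed

instance
proof
  fix x y z :: "'a puiseux"
  show "x + y + z = x + (y + z)"
    by transfer (auto simp: puiseux_rel_def fls_compose_power_compose mult_ac add_ac)
  show "x + y = y + x"
    by transfer (auto simp: puiseux_rel_def fls_compose_power_compose mult_ac add_ac)
  show "0 + x = x"
    by transfer (auto simp: puiseux_rel_def fls_compose_power_compose mult_ac add_ac)
  show "- x + x = 0"
    by transfer (auto simp: puiseux_rel_def fls_compose_power_compose mult_ac add_ac)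
  show "x - y = x + - y" by (simp add: minus_puiseux_def)
  show "x * y * z = x * (y * z)"
    by transfer (auto simp: puiseux_rel_def fls_compose_power_compose mult_ac)
  show "x * y = y * x"
    by transfer (auto simp: puiseux_rel_def fls_compose_power_compose mult_ac)
  show "1 * x = x"
    by transfer (auto simp: puiseux_rel_def fls_compose_power_compose mult_ac)
  show "(x + y) * z = x * z + y * z"
    by transfer (auto simp: puiseux_rel_def fls_compose_power_compose algebra_simps)
  show "(0::'a puiseux) \<noteq> 1"
    by transfer (auto simp: puiseux_rel_def)
qed

end

lemma fls_compose_power_inverse:
  fixes F :: "'a::field fls"
  assumes "d > 0"
  shows "fls_compose_power (inverse F) d = inverse (fls_compose_power F d)"
proof (cases "F = 0")
  case False
  hence "inverse F * F = 1" by simp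
  hence "fls_compose_power (inverse F) d * fls_compose_power F d = 1"
    using assms by (metis fls_compose_power_mult fls_compose_power_1_left)
  thus ?thesis by (metis inverse_unique inverse_inverse_eq)
qed simp

instantiation puiseux :: (field) field
begin

lift_definition inverse_puiseux :: "'a puiseux \<Rightarrow> 'a puiseux" is "\<lambda>p. (fst p, inverse (snd p))"
  by (simp add: puiseux_rel_def fls_compose_power_inverse)

definition divide_puiseux :: "'a puiseux \<Rightarrow> 'a puiseux \<Rightarrow> 'a puiseux" where
  "divide_puiseux x y = x * inverse y"

instance
proof
  fix x y :: "'a puiseux"
  show "x \<noteq> 0 \<Longrightarrow> inverse x * x = 1"
  proof transfer
    fix p :: "nat \<times> 'a fls"
    assume a: "puiseux_rel p p" "\<not> puiseux_rel p (1, 0)"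
    have pos: "fst p > 0" using a by (auto simp: puiseux_rel_def)
    hence "snd p \<noteq> 0" using a
      by (auto simp: puiseux_rel_def dest: fls_compose_power_cancel[of 1 "snd p" 0])
    hence "inverse (snd p) * snd p = 1" by simp
    hence "fls_compose_power (inverse (snd p)) (fst p) * fls_compose_power (snd p) (fst p) = 1"
      using pos by (metis fls_compose_power_mult fls_compose_power_1_left)
    thus "puiseux_rel (fst (fst p, inverse (snd p)) * fst p,
        fls_compose_power (snd (fst p, inverse (snd p))) (fst p) *
        fls_compose_power (snd p) (fst (fst p, inverse (snd p)))) (1, 1)"
      using pos by (simp add: puiseux_rel_def del: fls_compose_power_mult)
  qed
  show "x div y = x * inverse y" by (simp add: divide_puiseux_def)
  show "inverse (0::'a puiseux) = 0"
    by transfer (auto simp: puiseux_rel_def)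
qed

end

lift_definition puiseux_const :: "'a::field \<Rightarrow> 'a puiseux" is "\<lambda>a. (1, fls_const a)"
  by (simp add: puiseux_rel_def)

text \<open>Both of the following are only meaningful for nonzero series.\<close>

lift_definition puiseux_val :: "'a::field puiseux \<Rightarrow> real" is
  "\<lambda>p. real_of_int (fls_subdegree (snd p)) / real (fst p)"
proof -
  fix p q :: "nat \<times> 'a fls"
  assume a: "puiseux_rel p q"
  hence pos: "fst p > 0" "fst q > 0" by (auto simp: puiseux_rel_def)
  have "int (fst q) * fls_subdegree (snd p) = int (fst p) * fls_subdegree (snd q)"
    using a pos by (metis fls_subdegree_compose_power puiseux_rel_def)
  hence "real (fst q) * real_of_int (fls_subdegree (snd p)) =
         real (fst p) * real_of_int (fls_subdegree (snd q))"
    by (metis of_int_mult of_int_of_nat_eq)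
  thus "real_of_int (fls_subdegree (snd p)) / real (fst p) =
        real_of_int (fls_subdegree (snd q)) / real (fst q)"
    using pos by (simp add: field_simps)
qed

lift_definition puiseux_coeff :: "'a::field puiseux \<Rightarrow> 'a" is
  "\<lambda>p. fls_nth (snd p) (fls_subdegree (snd p))"
proof -
  fix p q :: "nat \<times> 'a fls"
  assume a: "puiseux_rel p q"
  have lead: "fls_nth (fls_compose_power F d) (fls_subdegree (fls_compose_power F d)) = fls_nth F (fls_subdegree F)"
    if "d > 0" for d and F :: "'a fls"
    using that by (simp add: fls_subdegree_compose_power fls_nth_compose_power)
  show "fls_nth (snd p) (fls_subdegree (snd p)) = fls_nth (snd q) (fls_subdegree (snd q))"
    using a lead[of "fst q" "snd p"] lead[of "fst p" "snd q"] by (simp add: puiseux_rel_def)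
qed


section \<open>Polynomials in several variables\<close>

text \<open>
  A monomial is a finitely supported exponent vector; the variables are indexed by naturals.
\<close>

type_synonym 'a mvpoly = "(nat \<Rightarrow>\<^sub>0 nat) \<Rightarrow>\<^sub>0 'a"

definition polys_in :: "nat set \<Rightarrow> 'a::zero mvpoly set" where
  "polys_in A = {g. \<forall>m \<in> Poly_Mapping.keys g. Poly_Mapping.keys m \<subseteq> A}"

text \<open>The argument \<open>\<phi>\<close> embeds the coefficients into the ring where the variables take values.\<close>

definition eval_with :: "('a::zero \<Rightarrow> 'b::comm_ring_1) \<Rightarrow> 'a mvpoly \<Rightarrow> (nat \<Rightarrow> 'b) \<Rightarrow> 'b" where
  "eval_with \<phi> g x = (\<Sum>m \<in> Poly_Mapping.keys g. \<phi> (Poly_Mapping.lookup g m) *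
     (\<Prod>i \<in> Poly_Mapping.keys m. x i ^ Poly_Mapping.lookup m i))"

abbreviation eval :: "complex mvpoly \<Rightarrow> (nat \<Rightarrow> complex) \<Rightarrow> complex" where
  "eval \<equiv> eval_with (\<lambda>a. a)"

definition monom_degree :: "(nat \<Rightarrow>\<^sub>0 nat) \<Rightarrow> nat" where
  "monom_degree m = (\<Sum>i \<in> Poly_Mapping.keys m. Poly_Mapping.lookup m i)"

definition total_degree :: "'a::zero mvpoly \<Rightarrow> nat" where
  "total_degree g = Max (insert 0 (monom_degree ` Poly_Mapping.keys g))"

definition homogeneous :: "'a::zero mvpoly \<Rightarrow> bool" where
  "homogeneous g \<longleftrightarrow> (\<exists>d. \<forall>m \<in> Poly_Mapping.keys g. monom_degree m = d)"

text \<open>Homogenization with respect to the variable of index 0.\<close>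

definition homogenize :: "'a::comm_ring_1 mvpoly \<Rightarrow> 'a mvpoly" where
  "homogenize g = (\<Sum>m \<in> Poly_Mapping.keys g. Poly_Mapping.single
     (m + Poly_Mapping.single 0 (total_degree g - monom_degree m)) (Poly_Mapping.lookup g m))"

text \<open>Terms free of the variable \<open>k\<close> have exponent 0 there and hence contribute \<open>single _ 0 = 0\<close>.\<close>

definition partial_deriv :: "nat \<Rightarrow> 'a::comm_ring_1 mvpoly \<Rightarrow> 'a mvpoly" where
  "partial_deriv k g = (\<Sum>m \<in> Poly_Mapping.keys g. Poly_Mapping.single
     (m - Poly_Mapping.single k 1) (of_nat (Poly_Mapping.lookup m k) * Poly_Mapping.lookup g m))"

text \<open>The ideal of the polynomial ring in the variables \<open>A\<close> generated by a finite set \<open>F\<close>.\<close>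

definition ideal_generated :: "nat set \<Rightarrow> 'a::comm_ring_1 mvpoly set \<Rightarrow> 'a mvpoly set" where
  "ideal_generated A F = {(\<Sum>g \<in> F. h g * g) |h. \<forall>g \<in> F. h g \<in> polys_in A}"


section \<open>Curves in the torus\<close>

text \<open>
  The coordinates of the torus are indexed by \<open>1, \<dots>, n\<close>, the homogeneous coordinates and those of
  affine \<open>(n+1)\<close>-space by \<open>0, \<dots>, n\<close>. Points are functions that are \<open>undefined\<close> at all
  other indices.
\<close>

definition torus :: "nat \<Rightarrow> (nat \<Rightarrow> complex) set" where
  "torus n = {1..n} \<rightarrow>\<^sub>E (UNIV - {0})"

definition real_torus :: "nat \<Rightarrow> (nat \<Rightarrow> complex) set" where
  "real_torus n = {1..n} \<rightarrow>\<^sub>E (\<real> - {0})"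

definition solution_set :: "nat \<Rightarrow> complex mvpoly set \<Rightarrow> (nat \<Rightarrow> complex) set" where
  "solution_set n G = {y \<in> torus n. \<forall>g \<in> G. eval g y = 0}"

definition zariski_closed :: "nat \<Rightarrow> (nat \<Rightarrow> complex) set \<Rightarrow> bool" where
  "zariski_closed n X \<longleftrightarrow> (\<exists>G \<subseteq> polys_in {1..n}. X = solution_set n G)"

definition irreducible_variety :: "nat \<Rightarrow> (nat \<Rightarrow> complex) set \<Rightarrow> bool" where
  "irreducible_variety n X \<longleftrightarrow> zariski_closed n X \<and> X \<noteq> {} \<and>
     (\<forall>A B. zariski_closed n A \<and> zariski_closed n B \<and> X \<subseteq> A \<union> B \<longrightarrow> X \<subseteq> A \<or> X \<subseteq> B)"

definition irreducible_chain :: "nat \<Rightarrow> nat \<Rightarrow> (nat \<Rightarrow> (nat \<Rightarrow> complex) set) \<Rightarrow> bool" where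
  "irreducible_chain n d Z \<longleftrightarrow>
     (\<forall>i \<le> d. irreducible_variety n (Z i)) \<and> (\<forall>i < d. Z i \<subset> Z (Suc i))"

text \<open>Krull dimension: the greatest length of a strict chain of irreducible closed subsets.\<close>

definition has_dimension :: "nat \<Rightarrow> (nat \<Rightarrow> complex) set \<Rightarrow> nat \<Rightarrow> bool" where
  "has_dimension n X d \<longleftrightarrow> (\<exists>Z. irreducible_chain n d Z \<and> Z d \<subseteq> X) \<and>
     \<not> (\<exists>Z. irreducible_chain n (Suc d) Z \<and> Z (Suc d) \<subseteq> X)"

definition irreducible_curve :: "nat \<Rightarrow> (nat \<Rightarrow> complex) set \<Rightarrow> bool" where
  "irreducible_curve n C \<longleftrightarrow> irreducible_variety n C \<and> has_dimension n C 1"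

definition defined_over_reals :: "nat \<Rightarrow> (nat \<Rightarrow> complex) set \<Rightarrow> bool" where
  "defined_over_reals n C \<longleftrightarrow> (\<exists>G :: real mvpoly set. G \<subseteq> polys_in {1..n} \<and>
     C = {y \<in> torus n. \<forall>g \<in> G. eval_with complex_of_real g y = 0})"

definition irreducible_component ::
  "nat \<Rightarrow> (nat \<Rightarrow> complex) set \<Rightarrow> (nat \<Rightarrow> complex) set \<Rightarrow> bool" where
  "irreducible_component n X S \<longleftrightarrow> irreducible_variety n X \<and> X \<subseteq> S \<and>
     (\<forall>Y. irreducible_variety n Y \<and> X \<subseteq> Y \<and> Y \<subseteq> S \<longrightarrow> Y = X)"

definition vanishing_ideal :: "nat \<Rightarrow> (nat \<Rightarrow> complex) set \<Rightarrow> complex mvpoly set" where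
  "vanishing_ideal n X = {g \<in> polys_in {1..n}. \<forall>y \<in> X. eval g y = 0}"

text \<open>
  For irreducible \<open>X\<close> the vanishing ideal is a prime \<open>P\<close>, and the local ring at the generic point
  of \<open>X\<close> of the scheme defined by \<open>F\<close> is the localization of \<open>\<complex>[x\<^sub>1, \<dots>, x\<^sub>n] / (F)\<close> at \<open>P\<close>. There
  \<open>g/s = 0\<close> (with \<open>s \<notin> P\<close>) iff \<open>h g \<in> (F)\<close> for some \<open>h \<notin> P\<close>, whatever \<open>s\<close> is. Inverting
  the variables first makes no difference, as they do not lie in \<open>P\<close>.
\<close>

definition zero_at_generic_point ::
  "nat \<Rightarrow> complex mvpoly set \<Rightarrow> (nat \<Rightarrow> complex) set \<Rightarrow> complex mvpoly \<Rightarrow> bool" where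
  "zero_at_generic_point n F X g \<longleftrightarrow>
     (\<exists>h \<in> polys_in {1..n} - vanishing_ideal n X. h * g \<in> ideal_generated {1..n} F)"

definition reduced_at_generic_point ::
  "nat \<Rightarrow> complex mvpoly set \<Rightarrow> (nat \<Rightarrow> complex) set \<Rightarrow> bool" where
  "reduced_at_generic_point n F X \<longleftrightarrow> (\<forall>g \<in> polys_in {1..n}. \<forall>k.
     zero_at_generic_point n F X (g ^ k) \<longrightarrow> zero_at_generic_point n F X g)"

definition component_of_multiplicity_one ::
  "nat \<Rightarrow> (nat \<Rightarrow> complex) set \<Rightarrow> complex mvpoly set \<Rightarrow> bool" where
  "component_of_multiplicity_one n X F \<longleftrightarrow>
     irreducible_component n X (solution_set n F) \<and> reduced_at_generic_point n F X"


section \<open>Projective closure and affine patch\<close>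

text \<open>
  A subset of projective \<open>n\<close>-space is represented by the set of all homogeneous coordinate vectors
  of its points. The closure is the Zariski closure; \<open>y(0 := 1)\<close> is \<open>[1 : y\<^sub>1 : \<dots> : y\<^sub>n]\<close>.
\<close>

definition projective_closure :: "nat \<Rightarrow> (nat \<Rightarrow> complex) set \<Rightarrow> (nat \<Rightarrow> complex) set" where
  "projective_closure n C = {x \<in> {0..n} \<rightarrow>\<^sub>E UNIV. (\<exists>i \<le> n. x i \<noteq> 0) \<and>
     (\<forall>g \<in> polys_in {0..n}. homogeneous g \<and> (\<forall>y \<in> C. eval g (y(0 := 1)) = 0) \<longrightarrow> eval g x = 0)}"

definition affine_cone :: "nat \<Rightarrow> (nat \<Rightarrow> complex) set \<Rightarrow> (nat \<Rightarrow> complex) set" where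
  "affine_cone n C = insert (\<lambda>i \<in> {0..n}. 0) (projective_closure n C)"

definition linear_form :: "nat \<Rightarrow> (nat \<Rightarrow> real) \<Rightarrow> complex mvpoly" where
  "linear_form n v =
     (\<Sum>i \<le> n. Poly_Mapping.single (Poly_Mapping.single i 1) (complex_of_real (v i)))"

definition affine_patch :: "nat \<Rightarrow> (nat \<Rightarrow> complex) set \<Rightarrow> (nat \<Rightarrow> real) \<Rightarrow> (nat \<Rightarrow> complex) set" where
  "affine_patch n C v = {x \<in> affine_cone n C. (\<Sum>i \<le> n. complex_of_real (v i) * x i) = 1}"

definition patch_system :: "nat \<Rightarrow> complex mvpoly set \<Rightarrow> (nat \<Rightarrow> real) \<Rightarrow> complex mvpoly set" where
  "patch_system n F v = insert (linear_form n v - 1) (homogenize ` F)"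


section \<open>Primitive vectors with signs\<close>

definition real_ideal :: "nat \<Rightarrow> (nat \<Rightarrow> complex) set \<Rightarrow> real mvpoly set" where
  "real_ideal n C = {g \<in> polys_in {1..n}. \<forall>y \<in> C. eval_with complex_of_real g y = 0}"

definition real_puiseux_points :: "nat \<Rightarrow> (nat \<Rightarrow> complex) set \<Rightarrow> (nat \<Rightarrow> real puiseux) set" where
  "real_puiseux_points n C = {y \<in> {1..n} \<rightarrow>\<^sub>E (UNIV - {0}).
     \<forall>g \<in> real_ideal n C. eval_with puiseux_const g y = 0}"

text \<open>Signs are the reals \<open>1\<close> and \<open>-1\<close>.\<close>

definition primitive_vectors_with_signs ::
  "nat \<Rightarrow> (nat \<Rightarrow> complex) set \<Rightarrow> ((nat \<Rightarrow> int) \<times> (nat \<Rightarrow> real)) set" where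
  "primitive_vectors_with_signs n C = {(u, \<sigma>).
     u \<in> {1..n} \<rightarrow>\<^sub>E UNIV \<and> \<sigma> \<in> {1..n} \<rightarrow>\<^sub>E {1, -1} \<and>
     (\<exists>i \<in> {1..n}. u i \<noteq> 0) \<and> Gcd (u ` {1..n}) = 1 \<and>
     (\<exists>y \<in> real_puiseux_points n C.
        (\<exists>a > 0. \<forall>i \<in> {1..n}. - puiseux_val (y i) = a * real_of_int (u i)) \<and>
        (\<forall>i \<in> {1..n}. sgn (puiseux_coeff (y i)) = \<sigma> i))}"


section \<open>The procedure\<close>

definition boundary :: "nat \<Rightarrow> (nat \<Rightarrow> complex) set \<Rightarrow> (nat \<Rightarrow> real) \<Rightarrow> (nat \<Rightarrow> complex) set" where
  "boundary n C v = {x \<in> affine_patch n C v. (\<Prod>i \<le> n. x i) = 0}"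

definition boundary_part ::
  "nat \<Rightarrow> (nat \<Rightarrow> complex) set \<Rightarrow> (nat \<Rightarrow> real) \<Rightarrow> nat \<Rightarrow> (nat \<Rightarrow> complex) set" where
  "boundary_part n C v j = {x \<in> boundary n C v. (\<forall>i < j. x i \<noteq> 0) \<and> x j = 0}"

definition critical_points ::
  "nat \<Rightarrow> (nat \<Rightarrow> complex) set \<Rightarrow> complex mvpoly set \<Rightarrow> (nat \<Rightarrow> real) \<Rightarrow> nat \<Rightarrow> (nat \<Rightarrow> complex) set" where
  "critical_points n C F v j = {x \<in> affine_patch n C v.
     \<exists>w. (\<exists>k \<in> {0..n} - {j}. w k \<noteq> 0) \<and>
         (\<forall>g \<in> patch_system n F v. (\<Sum>k \<in> {0..n} - {j}. eval (partial_deriv k g) x * w k) = 0)}"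

definition critical_radii ::
  "nat \<Rightarrow> (nat \<Rightarrow> complex) set \<Rightarrow> complex mvpoly set \<Rightarrow> (nat \<Rightarrow> real) \<Rightarrow> nat \<Rightarrow> real set" where
  "critical_radii n C F v j =
     (\<lambda>x. cmod (x j)) ` (critical_points n C F v j \<union> boundary n C v) - {0}"

definition admissible_radii ::
  "nat \<Rightarrow> (nat \<Rightarrow> complex) set \<Rightarrow> complex mvpoly set \<Rightarrow> (nat \<Rightarrow> real) \<Rightarrow> (nat \<Rightarrow> real) \<Rightarrow> bool" where
  "admissible_radii n C F v \<tau> \<longleftrightarrow> (\<forall>j \<le> n. boundary_part n C v j \<noteq> {} \<longrightarrow>
     0 < \<tau> j \<and> (\<forall>\<rho> \<in> critical_radii n C F v j. \<tau> j < \<rho>))"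

text \<open>Continuity below refers to the product topology, that is, it is coordinatewise.\<close>

definition radial_path ::
  "nat \<Rightarrow> (nat \<Rightarrow> complex) set \<Rightarrow> (nat \<Rightarrow> real) \<Rightarrow> nat \<Rightarrow> real \<Rightarrow> (nat \<Rightarrow> complex) \<Rightarrow>
   (real \<Rightarrow> nat \<Rightarrow> complex) \<Rightarrow> bool" where
  "radial_path n C v j \<tau> p P \<longleftrightarrow> continuous_on {0..1} P \<and> P 1 = p \<and>
     (\<forall>s \<in> {0..1}. P s \<in> affine_patch n C v \<and> P s j = complex_of_real (\<tau> * s))"

text \<open>\<open>Q \<theta>\<close> is the point reached by continuation to \<open>x\<^sub>j = \<tau> e\<^bsup>i\<theta>\<^esup>\<close>.\<close>

definition circular_path ::
  "nat \<Rightarrow> (nat \<Rightarrow> complex) set \<Rightarrow> (nat \<Rightarrow> real) \<Rightarrow> nat \<Rightarrow> real \<Rightarrow> (nat \<Rightarrow> complex) \<Rightarrow>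
   (real \<Rightarrow> nat \<Rightarrow> complex) \<Rightarrow> bool" where
  "circular_path n C v j \<tau> p Q \<longleftrightarrow> continuous_on {0..} Q \<and> Q 0 = p \<and>
     (\<forall>\<theta> \<ge> 0. Q \<theta> \<in> affine_patch n C v \<and> Q \<theta> j = complex_of_real \<tau> * cis \<theta>)"

definition is_least :: "(nat \<Rightarrow> bool) \<Rightarrow> nat \<Rightarrow> bool" where
  "is_least A k \<longleftrightarrow> A k \<and> (\<forall>l < k. \<not> A l)"

definition cycle_number :: "(real \<Rightarrow> nat \<Rightarrow> complex) \<Rightarrow> nat \<Rightarrow> bool" where
  "cycle_number Q c \<longleftrightarrow> is_least (\<lambda>c. 0 < c \<and> Q (2 * pi * real c) = Q 0) c"

definition fourier_order :: "(real \<Rightarrow> nat \<Rightarrow> complex) \<Rightarrow> nat \<Rightarrow> nat \<Rightarrow> nat \<Rightarrow> bool" where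
  "fourier_order Q c k l \<longleftrightarrow>
     is_least (\<lambda>l. integral {0..2 * pi} (\<lambda>\<theta>. Q (real c * \<theta>) k * cis (- (real l * \<theta>))) \<noteq> 0) l"

definition reduced_vector :: "nat \<Rightarrow> (nat \<Rightarrow> nat) \<Rightarrow> nat \<Rightarrow> nat" where
  "reduced_vector n u k = u k div Gcd (u ` {0..n})"

definition circle_output ::
  "nat \<Rightarrow> (nat \<Rightarrow> complex) set \<Rightarrow> (nat \<Rightarrow> real) \<Rightarrow> nat \<Rightarrow> real \<Rightarrow>
   ((nat \<Rightarrow> int) \<times> (nat \<Rightarrow> real)) set" where
  "circle_output n C v j \<tau> =
     {(\<lambda>i \<in> {1..n}. int (reduced_vector n u 0) - int (reduced_vector n u i),
       \<lambda>i \<in> {1..n}. sgn (Re (p 0 * p i))) |p P Q c u.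
        p \<in> affine_patch n C v \<and> p j = complex_of_real \<tau> \<and> (\<forall>k \<le> n. p k \<in> \<real>) \<and>
        radial_path n C v j \<tau> p P \<and> P 0 \<in> boundary_part n C v j \<and>
        circular_path n C v j \<tau> p Q \<and> cycle_number Q c \<and>
        (\<forall>k \<le> n. fourier_order Q c k (u k))}"

definition procedure_output ::
  "nat \<Rightarrow> (nat \<Rightarrow> complex) set \<Rightarrow> (nat \<Rightarrow> real) \<Rightarrow> (nat \<Rightarrow> real) \<Rightarrow>
   ((nat \<Rightarrow> int) \<times> (nat \<Rightarrow> real)) set" where
  "procedure_output n C v \<tau> =
     (if boundary n C v = {} then {}
      else \<Union>j \<in> {j. j \<le> n \<and> boundary_part n C v j \<noteq> {}}.
        circle_output n C v j (\<tau> j) \<union> circle_output n C v j (- \<tau> j))"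

end

theory Submission
  imports Defs "HOL-Complex_Analysis.Complex_Analysis" "HOL-Computational_Algebra.Fundamental_Theorem_Algebra"
begin

text \<open>
  Over the punctured disc \<open>0 < \<bar>x\<^sub>j\<bar> \<le> \<tau>\<^sub>j\<close> the affine patch has no critical points of \<open>x\<^sub>j\<close> and stays
  bounded, so after the substitution \<open>x\<^sub>j = \<tau> e\<^sup>\<zeta>\<close> its one-dimensional branches lift to the half-plane
  \<open>Re \<zeta> \<le> 0\<close>. Two lifts agreeing at one point coincide, and each is invariant under a shift by
  \<open>2\<pi>ic\<close>; hence a branch is parametrized by power series \<open>A\<^sub>k(w)\<close> in \<open>w = e\<^bsup>\<zeta>/c\<^esup>\<close>, whose coefficients
  are the Fourier integrals of the procedure. A lift with a real base point commutes with conjugation, so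
  the \<open>A\<^sub>k\<close> are real and \<open>A\<^sub>k/A\<^sub>0\<close> is a real Puiseux point of the curve with the asserted valuations and signs.

  Conversely, any two coordinate functions on a curve are algebraically dependent, so the coordinates of
  a real Puiseux point are algebraic over one with nonzero valuation; taking a suitable root
  of that coordinate as parameter, they become convergent series and trace a real arc in the curve. Rescaled to
  the affine patch, the arc tends to a boundary point, and by uniqueness of lifts it runs on one of the
  branches above. Comparing the two parametrizations shows that the orders of vanishing are proportional.
\<close>

section \<open>Evaluation of polynomials\<close>

text \<open>The Jacobian condition only gives trivial kernels: near a noncritical point the patch
  lies inside the graph of one holomorphic function of the \<open>j\<close>-th coordinate. As the
  system may have more equations than unknowns, nothing yet forces that graph into the patch, and
  the projective closure is merely a set of common zeros without any dimension theory. This obstacle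
  shapes the continuation argument: fibres consist of accumulation points of the patch, and the
  identity theorem carries the equations from the accumulating points to the whole graph. A base
  point of the procedure is an accumulation point because its radial path runs into it; a real arc
  tending to the boundary contains one because it is not constant.

  Dimension one enters through algebraic dependence: two independent functions would give a prime
  ideal whose zero set lies strictly between a point and the curve. As polynomials here have
  infinitely many variables, the Nullstellensatz behind this counts dimensions over the uncountable
  field instead of using finiteness of the ring. A formal point of the curve need not converge, but
  it does so once one of its coordinates has been made a monomial.\<close>

definition monom_val :: "(nat \<Rightarrow>\<^sub>0 nat) \<Rightarrow> (nat \<Rightarrow> 'b::comm_ring_1) \<Rightarrow> 'b" where
  "monom_val m x = (\<Prod>i \<in> Poly_Mapping.keys m. x i ^ Poly_Mapping.lookup m i)"

lemma monom_val_superset: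
  assumes "finite A" "Poly_Mapping.keys m \<subseteq> A"
  shows "monom_val m x = (\<Prod>i \<in> A. x i ^ Poly_Mapping.lookup m i)"
  unfolding monom_val_def
  by (rule prod.mono_neutral_left) (use assms in \<open>auto simp: in_keys_iff\<close>)

lemma monom_val_0 [simp]: "monom_val 0 x = 1"
  by (simp add: monom_val_def)

lemma monom_val_single [simp]: "monom_val (Poly_Mapping.single i k) x = x i ^ k"
  by (cases "k = 0") (simp_all add: monom_val_def)

lemma monom_val_add: "monom_val (m + m') x = monom_val m x * monom_val m' x"
proof -
  let ?A = "Poly_Mapping.keys m \<union> Poly_Mapping.keys m'"
  have "monom_val (m + m') x = (\<Prod>i \<in> ?A. x i ^ Poly_Mapping.lookup (m + m') i)"
    by (rule monom_val_superset) (auto simp: in_keys_iff lookup_add)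
  also have "\<dots> = monom_val m x * monom_val m' x"
    by (simp add: monom_val_superset[of ?A m] monom_val_superset[of ?A m'] lookup_add power_add prod.distrib)
  finally show ?thesis .
qed

lemma monom_val_sum: "finite A \<Longrightarrow> monom_val (sum f A) x = (\<Prod>i \<in> A. monom_val (f i) x)"
  by (induction A rule: finite_induct) (auto simp: monom_val_add)

lemma monom_degree_superset:
  assumes "finite A" "Poly_Mapping.keys m \<subseteq> A"
  shows "monom_degree m = (\<Sum>i \<in> A. Poly_Mapping.lookup m i)"
  unfolding monom_degree_def
  by (rule sum.mono_neutral_left) (use assms in \<open>auto simp: in_keys_iff\<close>)

lemma monom_degree_add: "monom_degree (m + m') = monom_degree m + monom_degree m'"
proof -
  let ?A = "Poly_Mapping.keys m \<union> Poly_Mapping.keys m'"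
  have "monom_degree (m + m') = (\<Sum>i \<in> ?A. Poly_Mapping.lookup (m + m') i)"
    by (rule monom_degree_superset) (auto simp: in_keys_iff lookup_add)
  also have "\<dots> = monom_degree m + monom_degree m'"
    by (simp add: monom_degree_superset[of ?A m] monom_degree_superset[of ?A m'] lookup_add sum.distrib)
  finally show ?thesis .
qed

lemma monom_degree_single [simp]: "monom_degree (Poly_Mapping.single i k) = k"
  by (cases "k = 0") (simp_all add: monom_degree_def)

lemma monom_val_scale: "monom_val m (\<lambda>i. c * x i) = c ^ monom_degree m * monom_val m x"
  by (simp add: monom_val_def monom_degree_def power_mult_distrib prod.distrib power_sum)

lemma monom_val_divide:
  fixes x :: "nat \<Rightarrow> 'b::field"
  shows "monom_val m (\<lambda>i. x i / c) = monom_val m x / c ^ monom_degree m"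
  by (simp add: monom_val_def monom_degree_def power_divide prod_dividef power_sum)

lemma monom_val_cong:
  "(\<And>i. i \<in> Poly_Mapping.keys m \<Longrightarrow> x i = y i) \<Longrightarrow> monom_val m x = monom_val m y"
  by (simp add: monom_val_def)

lemma eval_with_altdef:
  "eval_with \<phi> g x = (\<Sum>m \<in> Poly_Mapping.keys g. \<phi> (Poly_Mapping.lookup g m) * monom_val m x)"
  by (simp add: eval_with_def monom_val_def)

lemma eval_with_superset:
  assumes "finite A" "Poly_Mapping.keys g \<subseteq> A" "\<phi> 0 = 0"
  shows "eval_with \<phi> g x = (\<Sum>m \<in> A. \<phi> (Poly_Mapping.lookup g m) * monom_val m x)"
  unfolding eval_with_altdef
  by (rule sum.mono_neutral_left) (use assms in \<open>auto simp: in_keys_iff\<close>)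

lemma eval_with_cong:
  assumes "g \<in> polys_in A" "\<And>i. i \<in> A \<Longrightarrow> x i = y i"
  shows "eval_with \<phi> g x = eval_with \<phi> g y"
  unfolding eval_with_altdef
proof (rule sum.cong[OF refl])
  fix m assume "m \<in> Poly_Mapping.keys g"
  hence "monom_val m x = monom_val m y"
    using assms by (intro monom_val_cong) (auto simp: polys_in_def)
  thus "\<phi> (Poly_Mapping.lookup g m) * monom_val m x = \<phi> (Poly_Mapping.lookup g m) * monom_val m y" by simp
qed

text \<open>Any relation compatible with the ring operations passes to values of polynomials. The
  instances are conjugation, congruence modulo an ideal, change of coefficient ring, composition of
  series, and convergence together with the value of the sum.\<close>

lemma eval_with_rel:
  assumes g: "g \<in> polys_in A"
    and R: "R 0 0" "R 1 1" "\<And>a b a' b'. R a a' \<Longrightarrow> R b b' \<Longrightarrow> R (a + b) (a' + b')"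
      "\<And>a b a' b'. R a a' \<Longrightarrow> R b b' \<Longrightarrow> R (a * b) (a' * b')"
    and x: "\<And>i. i \<in> A \<Longrightarrow> R (x i) (x' i)" and c: "\<And>c. R (\<phi> c) (\<phi>' c)"
  shows "R (eval_with \<phi> g x) (eval_with \<phi>' g x')"
proof -
  have pow: "R (a ^ k) (a' ^ k)" if "R a a'" for a a' and k :: nat
    using that R by (induction k) auto
  have prd: "R (\<Prod>i \<in> B. f i) (\<Prod>i \<in> B. f' i)" if "finite B" "\<And>i. i \<in> B \<Longrightarrow> R (f i) (f' i)"
    for f f' and B :: "nat set"
    using that by (induction B rule: finite_induct) (auto intro: R)
  have sm: "R (\<Sum>i \<in> B. f i) (\<Sum>i \<in> B. f' i)" if "finite B" "\<And>i. i \<in> B \<Longrightarrow> R (f i) (f' i)"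
    for f f' and B :: "(nat \<Rightarrow>\<^sub>0 nat) set"
    using that by (induction B rule: finite_induct) (auto intro: R)
  show ?thesis
    unfolding eval_with_def
    by (intro sm R(4) c prd pow x) (use g in \<open>auto simp: polys_in_def\<close>)
qed

text \<open>Serves two roles: coefficient embeddings such as \<open>complex_of_real\<close> and
  \<open>fls_const\<close>, for which evaluation becomes a ring homomorphism, and plain ring maps
  such as \<open>puiseux_of_fls m\<close> and \<open>fps_to_fls\<close>.\<close>

locale ring_hom_fun =
  fixes \<phi> :: "'a::comm_ring_1 \<Rightarrow> 'b::comm_ring_1"
  assumes hom_0: "\<phi> 0 = 0" and hom_1: "\<phi> 1 = 1"
    and hom_add: "\<phi> (a + b) = \<phi> a + \<phi> b" and hom_mult: "\<phi> (a * b) = \<phi> a * \<phi> b"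
begin

lemma hom_sum: "finite A \<Longrightarrow> \<phi> (sum f A) = (\<Sum>i\<in>A. \<phi> (f i))"
  by (induction A rule: finite_induct) (auto simp: hom_0 hom_add)

lemma eval_0 [simp]: "eval_with \<phi> 0 x = 0"
  by (simp add: eval_with_altdef)

lemma eval_single [simp]: "eval_with \<phi> (Poly_Mapping.single m c) x = \<phi> c * monom_val m x"
  by (simp add: eval_with_altdef hom_0)

lemma eval_1 [simp]: "eval_with \<phi> 1 x = 1"
  using eval_single[of 0 1 x] by (simp add: hom_1 del: eval_single)

lemma eval_add: "eval_with \<phi> (g + h) x = eval_with \<phi> g x + eval_with \<phi> h x"
proof -
  let ?A = "Poly_Mapping.keys g \<union> Poly_Mapping.keys h"
  have "eval_with \<phi> (g + h) x = (\<Sum>m \<in> ?A. \<phi> (Poly_Mapping.lookup (g + h) m) * monom_val m x)"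
    by (rule eval_with_superset) (auto simp: in_keys_iff lookup_add hom_0)
  also have "\<dots> = eval_with \<phi> g x + eval_with \<phi> h x"
    by (simp add: eval_with_superset[of ?A g] eval_with_superset[of ?A h] lookup_add hom_0 hom_add
        distrib_right sum.distrib)
  finally show ?thesis .
qed

lemma eval_sum: "finite A \<Longrightarrow> eval_with \<phi> (sum f A) x = (\<Sum>i\<in>A. eval_with \<phi> (f i) x)"
  by (induction A rule: finite_induct) (auto simp: eval_add)

lemma eval_uminus: "eval_with \<phi> (- g) x = - eval_with \<phi> g x"
  using eval_add[of g "- g" x] by (simp add: eq_neg_iff_add_eq_0 add.commute)

lemma eval_diff: "eval_with \<phi> (g - h) x = eval_with \<phi> g x - eval_with \<phi> h x"
  using eval_add[of g "- h" x] by (simp add: eval_uminus)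

end

lemma poly_mapping_sum_singles:
  "g = (\<Sum>m \<in> Poly_Mapping.keys g. Poly_Mapping.single m (Poly_Mapping.lookup g m))"
proof (rule poly_mapping_eqI)
  fix k
  have "Poly_Mapping.lookup (\<Sum>m \<in> Poly_Mapping.keys g. Poly_Mapping.single m (Poly_Mapping.lookup g m)) k
      = (\<Sum>m \<in> Poly_Mapping.keys g. if m = k then Poly_Mapping.lookup g m else 0)"
    unfolding lookup_sum by (intro sum.cong) (auto simp: lookup_single when_def)
  also have "\<dots> = Poly_Mapping.lookup g k"
    by (simp add: in_keys_iff)
  finally show "Poly_Mapping.lookup g k = Poly_Mapping.lookup (\<Sum>m \<in> Poly_Mapping.keys g. Poly_Mapping.single m (Poly_Mapping.lookup g m)) k"
    by simp
qed

context ring_hom_fun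
begin

lemma eval_mult: "eval_with \<phi> (g * h) x = eval_with \<phi> g x * eval_with \<phi> h x"
proof -
  have "g * h = (\<Sum>m \<in> Poly_Mapping.keys g. \<Sum>m' \<in> Poly_Mapping.keys h.
      Poly_Mapping.single (m + m') (Poly_Mapping.lookup g m * Poly_Mapping.lookup h m'))"
    by (subst (1) poly_mapping_sum_singles[of g], subst (1) poly_mapping_sum_singles[of h])
      (simp add: sum_product mult_single)
  hence "eval_with \<phi> (g * h) x = (\<Sum>m \<in> Poly_Mapping.keys g. \<Sum>m' \<in> Poly_Mapping.keys h.
      \<phi> (Poly_Mapping.lookup g m) * monom_val m x * (\<phi> (Poly_Mapping.lookup h m') * monom_val m' x))"
    by (simp add: eval_sum hom_mult monom_val_add mult_ac)
  thus ?thesis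
    by (simp add: eval_with_altdef sum_product)
qed

lemma eval_prod: "finite A \<Longrightarrow> eval_with \<phi> (prod f A) x = (\<Prod>i\<in>A. eval_with \<phi> (f i) x)"
  by (induction A rule: finite_induct) (auto simp: eval_mult)

end

interpretation id_hom: ring_hom_fun "\<lambda>a::'a::comm_ring_1. a"
  by unfold_locales auto

interpretation of_real_hom: ring_hom_fun complex_of_real
  by unfold_locales auto

lemma polys_in_single: "Poly_Mapping.keys m \<subseteq> A \<Longrightarrow> Poly_Mapping.single m c \<in> polys_in A"
  by (auto simp: polys_in_def)

lemma polys_in_0: "0 \<in> polys_in A"
  by (simp add: polys_in_def)

lemma polys_in_add: "g \<in> polys_in A \<Longrightarrow> h \<in> polys_in A \<Longrightarrow> g + h \<in> polys_in A"
  using keys_add[of g h] by (fastforce simp: polys_in_def)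

lemma polys_in_sum: "(\<And>i. i \<in> B \<Longrightarrow> f i \<in> polys_in A) \<Longrightarrow> sum f B \<in> polys_in A"
  by (induction B rule: infinite_finite_induct) (auto simp: polys_in_0 polys_in_add)

lemma polys_in_UNIV [simp]: "g \<in> polys_in UNIV"
  by (simp add: polys_in_def)

lemma polys_in_map: "g \<in> polys_in A \<Longrightarrow> Poly_Mapping.map f g \<in> polys_in A"
  by (auto simp: polys_in_def in_keys_iff map.rep_eq when_def split: if_splits)

lemma eval_with_map:
  assumes "f 0 = 0" "\<phi> 0 = 0"
  shows "eval_with \<phi> (Poly_Mapping.map f g) x = eval_with (\<lambda>c. \<phi> (f c)) g x"
proof -
  have "eval_with \<phi> (Poly_Mapping.map f g) x =
      (\<Sum>m\<in>Poly_Mapping.keys g. \<phi> (Poly_Mapping.lookup (Poly_Mapping.map f g) m) * monom_val m x)"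
    by (rule eval_with_superset) (use assms in \<open>auto simp: in_keys_iff map.rep_eq when_def split: if_splits\<close>)
  also have "\<dots> = eval_with (\<lambda>c. \<phi> (f c)) g x"
    unfolding eval_with_altdef
    by (intro sum.cong) (auto simp: map.rep_eq in_keys_iff when_def)
  finally show ?thesis .
qed

lemma eval_cnj:
  assumes "g \<in> polys_in A" "\<And>i. i \<in> A \<Longrightarrow> y i = cnj (x i)"
  shows "eval (Poly_Mapping.map cnj g) y = cnj (eval g x)"
proof -
  have "eval (Poly_Mapping.map cnj g) y = eval_with cnj g y"
    by (simp add: eval_with_map)
  moreover have "eval_with cnj g y = cnj (eval g x)"
    by (rule eval_with_rel[OF assms(1), of "\<lambda>a b. a = cnj b"]) (auto simp: assms)
  ultimately show ?thesis by simp
qed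

lemma eval_with_of_real_cnj:
  assumes "g \<in> polys_in A" "\<And>i. i \<in> A \<Longrightarrow> y i = cnj (x i)"
  shows "eval_with complex_of_real g y = cnj (eval_with complex_of_real g x)"
  by (rule eval_with_rel[OF assms(1), of "\<lambda>a b. a = cnj b"]) (auto simp: assms)

section \<open>Homogeneous polynomials and homogenization\<close>

lemma homogeneous_scale:
  assumes "homogeneous g"
  obtains d where "\<And>c x. eval g (\<lambda>i. c * x i) = c ^ d * eval g x"
proof -
  obtain d where d: "\<And>m. m \<in> Poly_Mapping.keys g \<Longrightarrow> monom_degree m = d"
    using assms by (auto simp: homogeneous_def)
  have "eval g (\<lambda>i. c * x i) = c ^ d * eval g x" for c x
    by (simp add: eval_with_altdef monom_val_scale d sum_distrib_left mult_ac)
  thus ?thesis using that by blast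
qed

lemma monom_degree_le_total_degree: "m \<in> Poly_Mapping.keys g \<Longrightarrow> monom_degree m \<le> total_degree g"
  unfolding total_degree_def by (intro Max_ge) auto

lemma homogeneous_homogenize:
  shows "homogeneous (homogenize g)"
  unfolding homogeneous_def
proof (intro exI[of _ "total_degree g"] ballI)
  fix m assume "m \<in> Poly_Mapping.keys (homogenize g)"
  then obtain k where "k \<in> Poly_Mapping.keys g"
      "m \<in> Poly_Mapping.keys (Poly_Mapping.single
        (k + Poly_Mapping.single 0 (total_degree g - monom_degree k)) (Poly_Mapping.lookup g k))"
    unfolding homogenize_def using keys_sum by fastforce
  thus "monom_degree m = total_degree g"
    using monom_degree_le_total_degree[of k g]
    by (auto simp: monom_degree_add split: if_splits)
qed

lemma homogenize_in:
  assumes "g \<in> polys_in {1..n}"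
  shows "homogenize g \<in> polys_in {0..n}"
  unfolding homogenize_def
proof (intro polys_in_sum polys_in_single)
  fix m assume "m \<in> Poly_Mapping.keys g"
  hence "Poly_Mapping.keys m \<subseteq> {1..n}" using assms by (auto simp: polys_in_def)
  thus "Poly_Mapping.keys (m + Poly_Mapping.single 0 (total_degree g - monom_degree m)) \<subseteq> {0..n}"
    using keys_add[of m "Poly_Mapping.single 0 (total_degree g - monom_degree m)"]
    by (fastforce split: if_splits)
qed

text \<open>The target is an arbitrary field because the same identity is applied to complex points,
  real points and Laurent series.\<close>

lemma eval_homogenize:
  fixes x :: "nat \<Rightarrow> 'b::field"
  assumes "ring_hom_fun \<phi>" "x 0 \<noteq> 0"
  shows "eval_with \<phi> (homogenize g) x = x 0 ^ total_degree g * eval_with \<phi> g (\<lambda>i. x i / x 0)"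
proof -
  interpret ring_hom_fun \<phi> by fact
  have "eval_with \<phi> (homogenize g) x = (\<Sum>m \<in> Poly_Mapping.keys g. \<phi> (Poly_Mapping.lookup g m) *
      (monom_val m x * x 0 ^ (total_degree g - monom_degree m)))"
    by (simp add: homogenize_def eval_sum monom_val_add)
  also have "\<dots> = (\<Sum>m \<in> Poly_Mapping.keys g. x 0 ^ total_degree g *
      (\<phi> (Poly_Mapping.lookup g m) * monom_val m (\<lambda>i. x i / x 0)))"
    using assms(2) by (intro sum.cong refl)
      (simp add: monom_val_divide power_diff monom_degree_le_total_degree field_simps)
  finally show ?thesis by (simp add: eval_with_altdef sum_distrib_left)
qed

lemma eval_linear_form: "eval (linear_form n v) x = (\<Sum>i\<le>n. complex_of_real (v i) * x i)"
  by (simp add: linear_form_def id_hom.eval_sum)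

text \<open>Outside \<open>1, \<dots>, n\<close> a point has the constant coordinate \<open>undefined\<close>, so polynomials in all
  variables define no further functions on the torus.\<close>

lemma torus_reduce:
  fixes g :: "complex mvpoly"
  obtains g' where "g' \<in> polys_in {1..n}" "\<And>y. y \<in> torus n \<Longrightarrow> eval g' y = eval g y"
proof -
  define r where "r m = (\<Sum>i \<in> Poly_Mapping.keys m \<inter> {1..n}. Poly_Mapping.single i (Poly_Mapping.lookup m i))" for m :: "nat \<Rightarrow>\<^sub>0 nat"
  define k where "k m = (\<Prod>i \<in> Poly_Mapping.keys m - {1..n}. (undefined::complex) ^ Poly_Mapping.lookup m i)" for m :: "nat \<Rightarrow>\<^sub>0 nat"
  define g' where "g' = (\<Sum>m \<in> Poly_Mapping.keys g. Poly_Mapping.single (r m) (Poly_Mapping.lookup g m * k m))"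
  have "Poly_Mapping.keys (r m) \<subseteq> {1..n}" for m
    unfolding r_def using keys_sum by (rule order_trans) (auto split: if_splits)
  hence "g' \<in> polys_in {1..n}" unfolding g'_def by (intro polys_in_sum polys_in_single)
  moreover have "eval g' y = eval g y" if y: "y \<in> torus n" for y
  proof -
    have *: "monom_val m y = k m * monom_val (r m) y" for m
    proof -
      have "k m = (\<Prod>i \<in> Poly_Mapping.keys m - {1..n}. y i ^ Poly_Mapping.lookup m i)"
        unfolding k_def using y by (intro prod.cong) (auto simp: torus_def PiE_def extensional_def)
      moreover have "monom_val (r m) y = (\<Prod>i \<in> Poly_Mapping.keys m \<inter> {1..n}. y i ^ Poly_Mapping.lookup m i)"
        unfolding r_def by (simp add: monom_val_sum)
      ultimately show ?thesis
        unfolding monom_val_def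
        using prod.Int_Diff[of "Poly_Mapping.keys m" "\<lambda>i. y i ^ Poly_Mapping.lookup m i" "{1..n}"]
        by (simp add: mult.commute)
    qed
    have "eval g' y = (\<Sum>m \<in> Poly_Mapping.keys g. Poly_Mapping.lookup g m * (k m * monom_val (r m) y))"
      by (simp add: g'_def id_hom.eval_sum mult_ac)
    also have "\<dots> = eval g y"
      unfolding eval_with_altdef by (intro sum.cong refl arg_cong2[where f = "(*)"] *[symmetric])
    finally show ?thesis .
  qed
  ultimately show ?thesis using that by blast
qed

lemma holomorphic_on_eval:
  assumes "g \<in> polys_in A" "\<And>i. i \<in> A \<Longrightarrow> (\<lambda>z. f z i) holomorphic_on S"
  shows "(\<lambda>z. eval g (f z)) holomorphic_on S"
  unfolding eval_with_def
  by (intro holomorphic_intros assms) (use assms in \<open>auto simp: polys_in_def\<close>)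

lemma tendsto_eval:
  assumes "g \<in> polys_in A" "\<And>i. i \<in> A \<Longrightarrow> ((\<lambda>z. f z i) \<longlongrightarrow> y i) F"
  shows "((\<lambda>z. eval g (f z)) \<longlongrightarrow> eval g y) F"
  unfolding eval_with_def
  by (intro tendsto_intros assms) (use assms in \<open>auto simp: polys_in_def\<close>)

section \<open>Prime ideals and the Nullstellensatz\<close>

definition ring_ideal :: "'a::comm_ring_1 set \<Rightarrow> bool" where
  "ring_ideal I \<longleftrightarrow> 0 \<in> I \<and> (\<forall>x\<in>I. \<forall>y\<in>I. x + y \<in> I) \<and> (\<forall>r. \<forall>x\<in>I. r * x \<in> I)"

definition prime_ideal :: "'a::comm_ring_1 set \<Rightarrow> bool" where
  "prime_ideal P \<longleftrightarrow> ring_ideal P \<and> 1 \<notin> P \<and> (\<forall>x y. x * y \<in> P \<longrightarrow> x \<in> P \<or> y \<in> P)"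

lemma ring_idealD:
  assumes "ring_ideal I"
  shows "0 \<in> I" "x \<in> I \<Longrightarrow> y \<in> I \<Longrightarrow> x + y \<in> I" "x \<in> I \<Longrightarrow> r * x \<in> I" "x \<in> I \<Longrightarrow> x * r \<in> I"
  using assms by (auto simp: ring_ideal_def mult.commute)

lemma ring_ideal_diff:
  assumes "ring_ideal I" "x \<in> I" "y \<in> I"
  shows "x - y \<in> I"
  using ring_idealD(2)[OF assms(1,2) ring_idealD(3)[OF assms(1,3), of "-1"]] by simp

lemma ring_ideal_sum:
  assumes "ring_ideal I" "\<And>i. i \<in> A \<Longrightarrow> f i \<in> I"
  shows "sum f A \<in> I"
  using assms(2) by (induction A rule: infinite_finite_induct) (auto intro: ring_idealD[OF assms(1)])

lemma prime_idealD:
  assumes "prime_ideal P"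
  shows "ring_ideal P" "1 \<notin> P" "x * y \<in> P \<Longrightarrow> x \<in> P \<or> y \<in> P"
  using assms by (auto simp: prime_ideal_def)

lemma prime_ideal_power:
  assumes "prime_ideal P" "x ^ k \<in> P"
  shows "x \<in> P"
  using assms(2) by (induction k) (use prime_idealD[OF assms(1)] in auto)

text \<open>Krull's argument: an ideal maximal among those containing \<open>I\<close> and missing
  \<open>S\<close> is prime. The last conclusion keeps the maximality, which says that every element
  outside \<open>P\<close> divides an element of \<open>S\<close> modulo \<open>P\<close>; the
  Nullstellensatz needs it.\<close>

lemma prime_ideal_avoiding:
  fixes I S :: "'a::comm_ring_1 set"
  assumes I: "ring_ideal I" and S: "1 \<in> S" "\<And>s t. s \<in> S \<Longrightarrow> t \<in> S \<Longrightarrow> s * t \<in> S" and "I \<inter> S = {}"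
  obtains P where "prime_ideal P" "I \<subseteq> P" "P \<inter> S = {}"
    "\<And>x. x \<notin> P \<Longrightarrow> \<exists>s\<in>S. \<exists>r. s - r * x \<in> P"
proof -
  let ?A = "{J. ring_ideal J \<and> I \<subseteq> J \<and> J \<inter> S = {}}"
  have "\<exists>M\<in>?A. \<forall>X\<in>?A. M \<subseteq> X \<longrightarrow> X = M"
  proof (rule subset_Zorn_nonempty)
    show "?A \<noteq> {}" using assms by auto
    fix \<C> assume ne: "\<C> \<noteq> {}" and ch: "subset.chain ?A \<C>"
    have sub: "\<C> \<subseteq> ?A" and tot: "\<And>X Y. X \<in> \<C> \<Longrightarrow> Y \<in> \<C> \<Longrightarrow> X \<subseteq> Y \<or> Y \<subseteq> X"
      using ch by (auto simp: subset_chain_def)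
    have "ring_ideal (\<Union>\<C>)"
      unfolding ring_ideal_def
    proof (intro conjI ballI allI)
      show "0 \<in> \<Union>\<C>" using ne sub ring_idealD(1) by fastforce
      show "x + y \<in> \<Union>\<C>" if "x \<in> \<Union>\<C>" "y \<in> \<Union>\<C>" for x y
      proof -
        obtain X Y where XY: "X \<in> \<C>" "Y \<in> \<C>" "x \<in> X" "y \<in> Y" using \<open>x \<in> \<Union>\<C>\<close> \<open>y \<in> \<Union>\<C>\<close> by auto
        obtain Z where "Z \<in> \<C>" "x \<in> Z" "y \<in> Z" using tot[OF XY(1,2)] XY by auto
        moreover have "ring_ideal Z" using sub \<open>Z \<in> \<C>\<close> by auto
        ultimately show ?thesis using ring_idealD(2) by blast
      qed
      show "r * x \<in> \<Union>\<C>" if "x \<in> \<Union>\<C>" for r x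
        using that sub ring_idealD(3) by fastforce
    qed
    thus "\<Union>\<C> \<in> ?A" using ne sub by auto
  qed
  then obtain P where P: "ring_ideal P" "I \<subseteq> P" "P \<inter> S = {}"
    and max: "\<And>X. ring_ideal X \<Longrightarrow> X \<inter> S = {} \<Longrightarrow> P \<subseteq> X \<Longrightarrow> X = P" by auto
  note idl = ring_idealD[OF P(1)]
  have ex: "\<exists>s\<in>S. \<exists>r. s - r * x \<in> P" if x: "x \<notin> P" for x
  proof -
    let ?J = "{p + r * x |p r. p \<in> P}"
    have "ring_ideal ?J"
      unfolding ring_ideal_def
    proof (intro conjI ballI allI)
      show "0 \<in> ?J" using idl(1) by (auto intro!: exI[of _ 0])
      show "y + z \<in> ?J" if yz: "y \<in> ?J" "z \<in> ?J" for y z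
      proof -
        obtain p r q t where "p \<in> P" "q \<in> P" "y = p + r * x" "z = q + t * x" using yz by auto
        hence "y + z = (p + q) + (r + t) * x" "p + q \<in> P" using idl(2) by (auto simp: algebra_simps)
        thus ?thesis by blast
      qed
      show "s * y \<in> ?J" if y: "y \<in> ?J" for s y
      proof -
        obtain p r where "p \<in> P" "y = p + r * x" using y by auto
        hence "s * y = s * p + (s * r) * x" "s * p \<in> P" using idl(3) by (auto simp: algebra_simps)
        thus ?thesis by blast
      qed
    qed
    moreover have "P \<subseteq> ?J"
    proof
      fix p assume "p \<in> P"
      moreover have "p = p + 0 * x" by simp
      ultimately show "p \<in> ?J" by blast
    qed
    moreover have "x \<in> ?J" using idl(1) by (intro CollectI exI[of _ 0] exI[of _ 1]) simp
    ultimately have "?J \<inter> S \<noteq> {}" using max[of ?J] x by auto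
    then obtain p r where "p \<in> P" "p + r * x \<in> S" by auto
    thus ?thesis by (intro bexI[of _ "p + r * x"] exI[of _ r]) auto
  qed
  have "prime_ideal P"
    unfolding prime_ideal_def
  proof (intro conjI allI impI P(1))
    show "1 \<notin> P" using S(1) P(3) by auto
    show "x \<in> P \<or> y \<in> P" if xy: "x * y \<in> P" for x y
    proof (rule ccontr)
      assume "\<not> (x \<in> P \<or> y \<in> P)"
      then obtain s r t q where s: "s \<in> S" "s - r * x \<in> P" and t: "t \<in> S" "t - q * y \<in> P"
        using ex[of x] ex[of y] by blast
      \<comment> \<open>Modulo \<open>P\<close> one has \<open>s = r x\<close> and
        \<open>t = q y\<close>, so \<open>s t\<close> is a multiple of \<open>x y\<close> and falls
        into \<open>P\<close>, although it belongs to \<open>S\<close>.\<close>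
      have "s * t = s * (t - q * y) + (q * y) * (s - r * x) + (q * r) * (x * y)"
        by (simp add: algebra_simps)
      also have "\<dots> \<in> P" by (intro idl(2) idl(3) s(2) t(2) xy)
      finally show False using S(2)[OF s(1) t(1)] P(3) by auto
    qed
  qed
  thus ?thesis using that P ex by blast
qed

text \<open>Gauss elimination by induction on the coordinates. Vectors are plain families of
  coordinates, so that the coefficients of polynomials can be inserted directly.\<close>

lemma linear_dependence:
  fixes b :: "'t \<Rightarrow> 'k \<Rightarrow> 'a::field"
  assumes "finite K" "finite T" "card T > card K"
  shows "\<exists>l. (\<exists>t\<in>T. l t \<noteq> 0) \<and> (\<forall>k\<in>K. (\<Sum>t\<in>T. l t * b t k) = 0)"
  using assms
proof (induction K arbitrary: T b rule: finite_induct)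
  case empty
  then obtain t where "t \<in> T" by fastforce
  thus ?case by (intro exI[of _ "\<lambda>_. 1"]) auto
next
  case (insert k K)
  show ?case
  proof (cases "\<forall>t\<in>T. b t k = 0")
    case True
    thus ?thesis using insert.IH[of T b] insert.prems insert.hyps by auto
  next
    case False
    then obtain t0 where t0: "t0 \<in> T" "b t0 k \<noteq> 0" by auto
    define T' where "T' = T - {t0}"
    have T: "T = insert t0 T'" "t0 \<notin> T'" "finite T'" using t0 insert.prems by (auto simp: T'_def)
    \<comment> \<open>Subtracting \<open>c t\<close> times the pivot vector \<open>b t0\<close>
      kills coordinate \<open>k\<close> of \<open>b t\<close>.\<close>
    define c where "c t = b t k / b t0 k" for t
    have "card T' > card K" using insert.prems insert.hyps T by auto
    then obtain l where l: "\<exists>t\<in>T'. l t \<noteq> 0"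
      "\<And>i. i \<in> K \<Longrightarrow> (\<Sum>t\<in>T'. l t * (b t i - c t * b t0 i)) = 0"
      using insert.IH[OF T(3), of "\<lambda>t i. b t i - c t * b t0 i"] by auto
    \<comment> \<open>The pivot gets the coefficient that turns a relation among the reduced vectors
      into one among the original vectors.\<close>
    define l' where "l' = l(t0 := - (\<Sum>t\<in>T'. l t * c t))"
    have "(\<Sum>t\<in>T. l' t * b t i) = (\<Sum>t\<in>T'. l t * (b t i - c t * b t0 i))" for i
    proof -
      have "(\<Sum>t\<in>T'. l' t * b t i) = (\<Sum>t\<in>T'. l t * b t i)"
        by (rule sum.cong) (use T in \<open>auto simp: l'_def\<close>)
      thus ?thesis
        using T by (simp add: l'_def algebra_simps sum_subtractf sum_distrib_left sum_distrib_right)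
    qed
    note red = this
    have "(\<Sum>t\<in>T. l' t * b t k) = 0" unfolding red c_def using t0 by simp
    moreover have "(\<Sum>t\<in>T. l' t * b t i) = 0" if "i \<in> K" for i
      unfolding red by (rule l(2)[OF that])
    ultimately have "\<forall>i\<in>insert k K. (\<Sum>t\<in>T. l' t * b t i) = 0" by blast
    moreover have "\<exists>t\<in>T. l' t \<noteq> 0" using l(1) T by (auto simp: l'_def)
    ultimately show ?thesis by blast
  qed
qed

lemma countable_monomials: "countable (UNIV :: (nat \<Rightarrow>\<^sub>0 nat) set)"
proof -
  let ?f = "\<lambda>m. (\<lambda>i. (i, Poly_Mapping.lookup m i)) ` Poly_Mapping.keys (m :: nat \<Rightarrow>\<^sub>0 nat)"
  have "inj ?f"
  proof (rule injI)
    fix m m' assume eq: "?f m = ?f m'"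
    show "m = m'"
    proof (rule poly_mapping_eqI)
      fix i
      have "(i, k) \<in> ?f m \<longleftrightarrow> Poly_Mapping.lookup m i = k \<and> k \<noteq> 0" for k and m :: "nat \<Rightarrow>\<^sub>0 nat"
        by (auto simp: in_keys_iff)
      thus "Poly_Mapping.lookup m i = Poly_Mapping.lookup m' i" using eq by metis
    qed
  qed
  moreover have "countable (range ?f)"
    by (rule countable_subset[OF _ countable_Collect_finite]) auto
  ultimately show ?thesis by (simp add: countable_image_inj_eq)
qed

abbreviation mconst :: "complex \<Rightarrow> complex mvpoly" where
  "mconst c \<equiv> Poly_Mapping.single 0 c"

abbreviation mvar :: "nat \<Rightarrow> complex mvpoly" where
  "mvar i \<equiv> Poly_Mapping.single (Poly_Mapping.single i 1) 1"

lemma mconst_mult: "mconst (a * b) = mconst a * mconst b"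
  by (simp add: mult_single)

text \<open>The polynomial ring has countable dimension over the uncountable field of complex numbers,
  so among the uncountably many \<open>\<beta>\<close> below there are finitely many linearly dependent ones.\<close>

lemma uncountable_dependence:
  fixes M :: "complex mvpoly set"
  assumes M: "prime_ideal M" and m: "m \<notin> M"
    and ex: "\<And>a. \<exists>k. \<exists>s\<in>T. \<exists>\<beta>. s * m ^ k - \<beta> * (g - mconst a) \<in> M"
  obtains A l s where "finite A" "\<exists>a\<in>A. l a \<noteq> 0" "\<And>a. s a \<in> T"
    "(\<Sum>a\<in>A. mconst (l a) * s a * (\<Prod>b\<in>A - {a}. g - mconst b)) \<in> M"
proof -
  obtain k s \<beta> where ks: "\<And>a. s a \<in> T" "\<And>a. s a * m ^ k a - \<beta> a * (g - mconst a) \<in> M"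
    using ex by metis
  \<comment> \<open>Exponent and support of \<open>\<beta> a\<close> range over a countable set,
    whereas \<open>a\<close> runs through all complex numbers; hence one class is infinite.\<close>
  define \<kappa> where "\<kappa> a = (k a, Poly_Mapping.keys (\<beta> a))" for a
  have cnt: "countable (range \<kappa>)"
  proof (rule countable_subset)
    show "range \<kappa> \<subseteq> UNIV \<times> {A. finite A \<and> A \<subseteq> UNIV}" by (auto simp: \<kappa>_def)
    show "countable ((UNIV :: nat set) \<times> {A. finite A \<and> A \<subseteq> (UNIV :: (nat \<Rightarrow>\<^sub>0 nat) set)})"
      by (rule countable_SIGMA[OF countableI_type countable_Collect_finite_subset[OF countable_monomials]])
  qed
  have "\<exists>v. infinite (\<kappa> -` {v})"
  proof (rule ccontr)
    assume "\<not> ?thesis"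
    hence "countable (\<Union>v\<in>range \<kappa>. \<kappa> -` {v})"
      using cnt by (intro countable_UN) (auto intro: countable_finite)
    moreover have "(\<Union>v\<in>range \<kappa>. \<kappa> -` {v}) = UNIV" by auto
    ultimately show False using uncountable_UNIV_complex by simp
  qed
  then obtain k0 K where inf: "infinite (\<kappa> -` {(k0, K)})" by auto
  \<comment> \<open>One element more than there are monomials in the common support \<open>K\<close>
    forces a linear dependence among the \<open>\<beta> a\<close>.\<close>
  obtain A where A: "A \<subseteq> \<kappa> -` {(k0, K)}" "finite A" "card A = Suc (card K)"
    using infinite_arbitrarily_large[OF inf] by blast
  have A': "k a = k0" "Poly_Mapping.keys (\<beta> a) = K" if "a \<in> A" for a
    using A(1) that by (auto simp: \<kappa>_def)
  obtain a0 where "a0 \<in> A" using A(3) by fastforce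
  hence K: "finite K" using A'(2)[of a0] by (metis finite_keys)
  obtain l where l: "\<exists>a\<in>A. l a \<noteq> 0"
    "\<And>i. i \<in> K \<Longrightarrow> (\<Sum>a\<in>A. l a * Poly_Mapping.lookup (\<beta> a) i) = 0"
    using linear_dependence[OF K A(2), of "\<lambda>a i. Poly_Mapping.lookup (\<beta> a) i"] A(3) by auto
  have lk: "Poly_Mapping.lookup (mconst c * p) i = c * Poly_Mapping.lookup p i" for c p i
    by (simp flip: mult_map_scale_conv_mult add: map.rep_eq when_def)
  have dep: "(\<Sum>a\<in>A. mconst (l a) * \<beta> a) = 0"
  proof (rule poly_mapping_eqI)
    fix i
    show "Poly_Mapping.lookup (\<Sum>a\<in>A. mconst (l a) * \<beta> a) i = Poly_Mapping.lookup 0 i"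
    proof (cases "i \<in> K")
      case True thus ?thesis using l(2) by (simp add: lookup_sum lk)
    next
      case False
      hence "\<forall>a\<in>A. Poly_Mapping.lookup (\<beta> a) i = 0" using A'(2) by (metis in_keys_iff)
      thus ?thesis by (simp add: lookup_sum lk)
    qed
  qed
  let ?Q = "\<lambda>a. \<Prod>b\<in>A - {a}. g - mconst b"
  let ?R = "\<Sum>a\<in>A. mconst (l a) * s a * ?Q a"
  \<comment> \<open>Multiplying the relation for \<open>a\<close> by the remaining linear factors
    turns \<open>\<beta> a * (g - mconst a)\<close> into \<open>\<beta> a\<close> times the full
    product. This product is common to all \<open>a\<close>, so the dependence removes these
    terms.\<close>
  have "(\<Sum>a\<in>A. mconst (l a) * ?Q a * (s a * m ^ k0 - \<beta> a * (g - mconst a))) \<in> M"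
    using ks(2) A' prime_idealD(1)[OF M] by (intro ring_ideal_sum ring_idealD(3)) metis+
  also have "(\<Sum>a\<in>A. mconst (l a) * ?Q a * (s a * m ^ k0 - \<beta> a * (g - mconst a)))
      = (\<Sum>a\<in>A. m ^ k0 * (mconst (l a) * s a * ?Q a) - mconst (l a) * \<beta> a * (\<Prod>b\<in>A. g - mconst b))"
    by (intro sum.cong refl) (simp add: prod.remove[OF A(2)] algebra_simps)
  also have "\<dots> = m ^ k0 * ?R - (\<Sum>a\<in>A. mconst (l a) * \<beta> a) * (\<Prod>b\<in>A. g - mconst b)"
    by (simp add: sum_subtractf sum_distrib_left sum_distrib_right)
  finally have "m ^ k0 * ?R \<in> M" by (simp add: dep)
  hence "?R \<in> M" using prime_idealD(3)[OF M] prime_ideal_power[OF M] m by blast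
  thus ?thesis using that A(2) l(1) ks(1) by blast
qed

section \<open>Univariate polynomials evaluated at a multivariate polynomial\<close>

definition poly_subst :: "complex poly \<Rightarrow> complex mvpoly \<Rightarrow> complex mvpoly" where
  "poly_subst p h = poly (map_poly mconst p) h"

lemma poly_subst_0 [simp]: "poly_subst 0 h = 0"
  by (simp add: poly_subst_def)

lemma poly_subst_pCons [simp]: "poly_subst (pCons a p) h = mconst a + h * poly_subst p h"
  by (simp add: poly_subst_def map_poly_pCons)

lemma poly_subst_1 [simp]: "poly_subst 1 h = 1"
  by (simp add: one_pCons)

lemma poly_subst_add: "poly_subst (p + q) h = poly_subst p h + poly_subst q h"
  by (induction p q rule: poly_induct2) (auto simp: single_add algebra_simps)

lemma poly_subst_smult: "poly_subst (smult c p) h = mconst c * poly_subst p h"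
  by (induction p) (auto simp: mconst_mult algebra_simps)

lemma poly_subst_mult: "poly_subst (p * q) h = poly_subst p h * poly_subst q h"
  by (induction p) (auto simp: poly_subst_add poly_subst_smult algebra_simps)

lemma poly_subst_sum: "poly_subst (sum f A) h = (\<Sum>i\<in>A. poly_subst (f i) h)"
  by (induction A rule: infinite_finite_induct) (auto simp: poly_subst_add)

lemma poly_subst_prod: "poly_subst (prod f A) h = (\<Prod>i\<in>A. poly_subst (f i) h)"
  by (induction A rule: infinite_finite_induct) (auto simp: poly_subst_mult)

lemma poly_subst_linear: "poly_subst [:- b, 1:] h = h - mconst b"
  by (simp add: single_uminus)

lemma eval_poly_subst: "eval (poly_subst p h) y = poly p (eval h y)"
  by (induction p) (auto simp: id_hom.eval_add id_hom.eval_mult)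

text \<open>Over the complex numbers \<open>q\<close> splits into linear factors, and a prime ideal
  containing the product contains one of them.\<close>

lemma prime_ideal_poly_root:
  assumes M: "prime_ideal M" and "q \<noteq> 0" "poly_subst q h \<in> M"
  shows "\<exists>c. h - mconst c \<in> M"
  using assms(2,3)
proof (induction "degree q" arbitrary: q)
  case 0
  then obtain c where c: "q = [:c:]" "c \<noteq> 0" by (metis degree_eq_zeroE pCons_0_0)
  hence "mconst (inverse c) * poly_subst q h \<in> M"
    using 0 ring_idealD(3)[OF prime_idealD(1)[OF M]] by blast
  moreover have "mconst (inverse c) * poly_subst q h = 1"
    using c by (simp add: mult_single)
  ultimately show ?case using prime_idealD(2)[OF M] by simp
next
  case (Suc d)
  have "\<not> constant (poly q)" using Suc(2) by (metis constant_degree nat.simps(3))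
  then obtain c where "poly q c = 0" using fundamental_theorem_of_algebra by blast
  then obtain p where q: "q = [:-c, 1:] * p" by (metis dvdE poly_eq_0_iff_dvd)
  hence "p \<noteq> 0" using Suc(3) by auto
  hence "degree p = d" using Suc(2) q by (simp add: degree_mult_eq del: mult_pCons_left)
  moreover have "h - mconst c \<in> M \<or> poly_subst p h \<in> M"
    using Suc(4) prime_idealD(3)[OF M] unfolding q poly_subst_mult poly_subst_linear by blast
  ultimately show ?case using Suc(1)[of p] \<open>p \<noteq> 0\<close> by blast
qed

text \<open>At \<open>a\<close> every product still containing the factor of \<open>a\<close>
  vanishes. This shows that the combination delivered by \<open>uncountable_dependence\<close> is
  not the zero polynomial.\<close>

lemma lagrange_nonzero:
  fixes l :: "'a::field \<Rightarrow> 'a"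
  assumes "finite A" "a \<in> A"
  shows "(\<Sum>b\<in>A. l b * s b * (\<Prod>c\<in>A - {b}. a - c)) = l a * s a * (\<Prod>c\<in>A - {a}. a - c)"
    and "(\<Prod>c\<in>A - {a}. a - c) \<noteq> 0"
proof -
  have "(\<Prod>c\<in>A - {b}. a - c) = 0" if "b \<in> A - {a}" for b
    using assms that by (intro prod_zero) auto
  hence "(\<Sum>b\<in>A - {a}. l b * s b * (\<Prod>c\<in>A - {b}. a - c)) = 0"
    by (intro sum.neutral) auto
  thus "(\<Sum>b\<in>A. l b * s b * (\<Prod>c\<in>A - {b}. a - c)) = l a * s a * (\<Prod>c\<in>A - {a}. a - c)"
    using assms by (subst sum.remove[of A a]) auto
  show "(\<Prod>c\<in>A - {a}. a - c) \<noteq> 0" using assms by auto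
qed

text \<open>Let \<open>M\<close> be maximal among the ideals over \<open>P\<close> that contain no
  power of \<open>f\<close>. Each variable turns out to be constant modulo \<open>M\<close>, and
  these constants are the coordinates of the desired zero.\<close>

theorem nullstellensatz_prime:
  fixes P :: "complex mvpoly set"
  assumes P: "prime_ideal P" and f: "f \<notin> P"
  obtains c where "\<And>g. g \<in> P \<Longrightarrow> eval g c = 0" "eval f c \<noteq> 0"
proof -
  have "P \<inter> range (\<lambda>k. f ^ k) = {}"
    using prime_ideal_power[OF P] f by auto
  note disj = this
  have S: "1 \<in> range (\<lambda>k. f ^ k)" by (rule range_eqI[of _ _ 0]) simp
  have S': "s * t \<in> range (\<lambda>k. f ^ k)" if "s \<in> range (\<lambda>k. f ^ k)" "t \<in> range (\<lambda>k. f ^ k)" for s t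
    using that by (auto simp flip: power_add)
  obtain M where M: "prime_ideal M" "P \<subseteq> M" "M \<inter> range (\<lambda>k. f ^ k) = {}"
    and max: "\<And>x. x \<notin> M \<Longrightarrow> \<exists>s\<in>range (\<lambda>k. f ^ k). \<exists>r. s - r * x \<in> M"
    using prime_ideal_avoiding[OF prime_idealD(1)[OF P] S S' disj] by blast
  have fM: "f \<notin> M" using M(3) by (metis IntI empty_iff power_one_right rangeI)
  \<comment> \<open>Otherwise every \<open>mvar i - mconst a\<close> divides a power of
    \<open>f\<close> modulo \<open>M\<close>, and the dependence among the cofactors puts a nonzero
    polynomial in this one variable into \<open>M\<close>; one of its roots gives the constant after
    all.\<close>
  have "\<exists>a. mvar i - mconst a \<in> M" for i
  proof (rule ccontr)
    assume neg: "\<nexists>a. mvar i - mconst a \<in> M"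
    have "\<exists>k. \<exists>s\<in>{1}. \<exists>\<beta>. s * f ^ k - \<beta> * (mvar i - mconst a) \<in> M" for a
      using max[of "mvar i - mconst a"] neg by auto
    note ex = this
    obtain A l s where A: "finite A" "\<exists>a\<in>A. l a \<noteq> 0" "\<And>a. s a \<in> {1}"
      "(\<Sum>a\<in>A. mconst (l a) * s a * (\<Prod>b\<in>A - {a}. mvar i - mconst b)) \<in> M"
      by (rule uncountable_dependence[OF M(1) fM ex]) (rule that; assumption)
    have s: "s a = 1" for a using A(3)[of a] by simp
    define q where "q = (\<Sum>a\<in>A. smult (l a) (\<Prod>b\<in>A - {a}. [:- b, 1:]))"
    have "poly_subst q (mvar i) \<in> M"
      using A(4) s by (simp add: q_def poly_subst_sum poly_subst_smult poly_subst_prod poly_subst_linear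
          del: poly_subst_pCons)
    moreover have "q \<noteq> 0"
    proof
      assume "q = 0"
      obtain a where a: "a \<in> A" "l a \<noteq> 0" using A(2) by auto
      have "poly q a = (\<Sum>b\<in>A. l b * 1 * (\<Prod>c\<in>A - {b}. a - c))"
        by (simp add: q_def poly_sum poly_prod)
      thus False using lagrange_nonzero(1)[OF A(1) a(1), of l "\<lambda>_. 1"] lagrange_nonzero(2)[OF A(1) a(1)] a(2) \<open>q = 0\<close> by simp
    qed
    ultimately show False using prime_ideal_poly_root[OF M(1)] neg by blast
  qed
  then obtain c where c: "\<And>i. mvar i - mconst (c i) \<in> M" by metis
  note idl = ring_idealD[OF prime_idealD(1)[OF M(1)]]
  \<comment> \<open>Being congruent to a constant modulo \<open>M\<close> is compatible with the
    ring operations, so it spreads from the variables to every polynomial.\<close>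
  have "g - mconst (eval g c) \<in> M" for g
  proof -
    let ?R = "\<lambda>a b. a - mconst b \<in> M"
    have "?R (eval_with mconst g mvar) (eval g c)"
    proof (rule eval_with_rel[of g UNIV])
      show "a + b - mconst (a' + b') \<in> M" if "?R a a'" "?R b b'" for a b a' b'
        using idl(2)[OF that] by (simp add: single_add algebra_simps)
      show "a * b - mconst (a' * b') \<in> M" if "?R a a'" "?R b b'" for a b a' b'
      proof -
        have "a * b - mconst (a' * b') = b * (a - mconst a') + mconst a' * (b - mconst b')"
          by (simp add: mconst_mult algebra_simps)
        thus ?thesis using idl(2)[OF idl(3)[OF that(1)] idl(3)[OF that(2)]] by simp
      qed
    qed (use c idl in auto)
    moreover have "eval_with mconst g mvar = g"
    proof -
      have pw: "mvar i ^ k = Poly_Mapping.single (Poly_Mapping.single i k) 1" for i k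
        by (induction k) (auto simp: mult_single simp flip: single_add)
      have "(\<Prod>i\<in>A. Poly_Mapping.single (f i) (1::complex)) = Poly_Mapping.single (sum f A) 1" if "finite A" for A and f :: "nat \<Rightarrow> nat \<Rightarrow>\<^sub>0 nat"
        using that by (induction A rule: finite_induct) (auto simp: mult_single)
      hence "monom_val m mvar = Poly_Mapping.single m (1::complex)" for m
        unfolding monom_val_def pw
        using poly_mapping_sum_singles[of m] by simp
      thus ?thesis
        by (simp add: eval_with_altdef mult_single poly_mapping_sum_singles[symmetric])
    qed
    ultimately show ?thesis by simp
  qed
  note ev = this
  have "eval g c = 0" if "g \<in> P" for g
  proof (rule ccontr)
    assume nz: "eval g c \<noteq> 0"
    have "g \<in> M" using that M(2) by auto
    hence "g - (g - mconst (eval g c)) \<in> M"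
      using ev[of g] ring_ideal_diff[OF prime_idealD(1)[OF M(1)]] by blast
    hence "mconst (inverse (eval g c)) * mconst (eval g c) \<in> M" using idl(3) by simp
    thus False using nz prime_idealD(2)[OF M(1)] by (simp add: mult_single)
  qed
  moreover have "eval f c \<noteq> 0" using ev[of f] fM by auto
  ultimately show ?thesis using that by blast
qed

section \<open>Functions on a curve are algebraically dependent\<close>

text \<open>Unlike \<open>vanishing_ideal\<close> it admits all variables, so that it is an ideal of
  the whole polynomial type, where \<open>prime_ideal\<close> lives.\<close>

definition vanishing :: "(nat \<Rightarrow> complex) set \<Rightarrow> complex mvpoly set" where
  "vanishing X = {g. \<forall>y\<in>X. eval g y = 0}"

lemma zariski_closed_solution_set: "zariski_closed n (solution_set n G)"
proof -
  have "\<forall>g. \<exists>g'. g' \<in> polys_in {1..n} \<and> (\<forall>y\<in>torus n. eval g' y = eval g y)"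
    proof
    fix g :: "complex mvpoly"
    show "\<exists>g'. g' \<in> polys_in {1..n} \<and> (\<forall>y\<in>torus n. eval g' y = eval g y)"
      by (rule torus_reduce[of n g]) blast
  qed
  then obtain r where r: "\<And>g. r g \<in> polys_in {1..n}" "\<And>g y. y \<in> torus n \<Longrightarrow> eval (r g) y = eval g y"
    by (subst (asm) choice_iff) blast
  have "solution_set n G = solution_set n (r ` G)"
    using r(2) by (auto simp: solution_set_def)
  thus ?thesis unfolding zariski_closed_def using r(1) by blast
qed

lemma zariski_closedD:
  assumes "zariski_closed n X"
  shows "X = solution_set n (vanishing X)"
  using assms by (auto simp: zariski_closed_def solution_set_def vanishing_def)

lemma ring_ideal_vanishing: "ring_ideal (vanishing X)"
  by (auto simp: ring_ideal_def vanishing_def id_hom.eval_add id_hom.eval_mult)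

lemma prime_ideal_vanishing:
  assumes "irreducible_variety n X"
  shows "prime_ideal (vanishing X)"
  unfolding prime_ideal_def
proof (intro conjI allI impI ring_ideal_vanishing)
  have X: "zariski_closed n X" "X \<noteq> {}" "\<And>A B. zariski_closed n A \<Longrightarrow> zariski_closed n B \<Longrightarrow> X \<subseteq> A \<union> B \<Longrightarrow> X \<subseteq> A \<or> X \<subseteq> B"
    using assms by (auto simp: irreducible_variety_def)
  have Xt: "X \<subseteq> torus n" using zariski_closedD[OF X(1)] by (auto simp: solution_set_def)
  show "1 \<notin> vanishing X" using X(2) by (auto simp: vanishing_def)
  fix g h assume "g * h \<in> vanishing X"
  hence "X \<subseteq> solution_set n {g} \<union> solution_set n {h}"
    using Xt by (auto simp: vanishing_def solution_set_def id_hom.eval_mult)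
  from X(3)[OF zariski_closed_solution_set zariski_closed_solution_set this]
  show "g \<in> vanishing X \<or> h \<in> vanishing X" by (auto simp: vanishing_def solution_set_def)
qed

text \<open>The two side conditions force zeros into the torus: the product of the coordinates can
  be kept nonzero, and the coordinates outside the range get the value \<open>undefined\<close>. The
  Nullstellensatz, applied to \<open>f\<close> times that product, then finds enough points.\<close>

lemma irreducible_solution_set_prime:
  assumes P: "prime_ideal P" and nz: "(\<Prod>i\<in>{1..n}. mvar i) \<notin> P"
    and out: "\<And>i. i \<notin> {1..n} \<Longrightarrow> mvar i - mconst undefined \<in> P"
  shows "vanishing (solution_set n P) = P" "irreducible_variety n (solution_set n P)"
proof -
  let ?Z = "solution_set n P"
  have ex: "\<exists>y\<in>?Z. eval f y \<noteq> 0" if f: "f \<notin> P" for f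
  proof -
    let ?f = "f * (\<Prod>i\<in>{1..n}. mvar i)"
    have "?f \<notin> P" using f nz prime_idealD(3)[OF P] by blast
    then obtain y where y: "\<And>g. g \<in> P \<Longrightarrow> eval g y = 0" "eval ?f y \<noteq> 0"
      by (rule nullstellensatz_prime[OF P]) blast
    have "y i \<noteq> 0" if "i \<in> {1..n}" for i
      using y(2) that by (auto simp: id_hom.eval_mult id_hom.eval_prod)
    moreover have "y i = undefined" if "i \<notin> {1..n}" for i
      using y(1)[OF out[OF that]] by (simp add: id_hom.eval_diff)
    ultimately have "y \<in> torus n" unfolding torus_def by (intro PiE_I) auto
    thus ?thesis using y by (intro bexI[of _ y]) (auto simp: solution_set_def id_hom.eval_mult)
  qed
  show van: "vanishing ?Z = P"
    using ex by (auto simp: vanishing_def solution_set_def)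
  show "irreducible_variety n ?Z"
    unfolding irreducible_variety_def
  proof (intro conjI allI impI zariski_closed_solution_set)
    show "?Z \<noteq> {}" using ex[OF prime_idealD(2)[OF P]] by auto
    fix A B assume AB: "zariski_closed n A \<and> zariski_closed n B \<and> ?Z \<subseteq> A \<union> B"
    show "?Z \<subseteq> A \<or> ?Z \<subseteq> B"
    proof (rule ccontr)
      assume "\<not> ?thesis"
      then obtain a b where ab: "a \<in> ?Z" "a \<notin> A" "b \<in> ?Z" "b \<notin> B" by auto
      have t: "a \<in> torus n" "b \<in> torus n" using ab by (auto simp: solution_set_def)
      obtain g h where g: "g \<in> vanishing A" "eval g a \<noteq> 0" and h: "h \<in> vanishing B" "eval h b \<noteq> 0"
        using ab t zariski_closedD[of n A] zariski_closedD[of n B] AB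
        unfolding solution_set_def by blast
      have "g * h \<in> vanishing ?Z"
        using g(1) h(1) AB by (auto simp: vanishing_def id_hom.eval_mult)
      hence "g \<in> P \<or> h \<in> P" using van prime_idealD(3)[OF P] by blast
      thus False using g(2) h(2) ab by (auto simp: solution_set_def)
    qed
  qed
qed

lemma irreducible_variety_point:
  assumes "z \<in> torus n"
  shows "irreducible_variety n {z}"
proof -
  have eq: "{z} = solution_set n ((\<lambda>i. mvar i - mconst (z i)) ` UNIV)"
    using assms by (auto simp: solution_set_def id_hom.eval_diff)
  have "zariski_closed n {z}" unfolding eq by (rule zariski_closed_solution_set)
  thus ?thesis by (auto simp: irreducible_variety_def)
qed

text \<open>Assume \<open>g\<close> and \<open>h\<close> independent on \<open>C\<close>. If for
  some \<open>a\<close> the ideal of \<open>C\<close> together with \<open>g - a\<close> misses all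
  nonzero polynomials in \<open>h\<close> times monomials in \<open>m\<close>, a prime above it
  defines a variety strictly between a point and \<open>C\<close>, against dimension one. If it
  meets them for every \<open>a\<close>, uncountably many relations combine into a polynomial
  relation between \<open>g\<close> and \<open>h\<close>.\<close>

theorem curve_algebraic_dependence:
  assumes C: "irreducible_curve n C"
  obtains R :: "complex poly poly"
  where "R \<noteq> 0" "\<And>y. y \<in> C \<Longrightarrow> poly (poly R [:eval g y:]) (eval h y) = 0"
proof (rule ccontr)
  assume "\<not> thesis"
  hence indep: "R = 0" if "\<And>y. y \<in> C \<Longrightarrow> poly (poly R [:eval g y:]) (eval h y) = 0" for R :: "complex poly poly"
    using that \<open>\<And>R. \<lbrakk>R \<noteq> 0; \<And>y. y \<in> C \<Longrightarrow> poly (poly R [:eval g y:]) (eval h y) = 0\<rbrakk> \<Longrightarrow> thesis\<close> by blast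
  have irr: "irreducible_variety n C" and dim: "has_dimension n C 1"
    using C by (auto simp: irreducible_curve_def)
  have zC: "zariski_closed n C" and ne: "C \<noteq> {}" using irr by (auto simp: irreducible_variety_def)
  note I = prime_ideal_vanishing[OF irr]
  have Ct: "C \<subseteq> torus n" using zariski_closedD[OF zC] by (auto simp: solution_set_def)
  define m :: "complex mvpoly" where "m = (\<Prod>i\<in>{1..n}. mvar i)"
  have m_nz: "eval m y \<noteq> 0" if "y \<in> torus n" for y
    using that by (auto simp: m_def id_hom.eval_prod torus_def)
  have mI: "m \<notin> vanishing C" using ne m_nz Ct by (auto simp: vanishing_def)
  have hI: "poly_subst p h \<notin> vanishing C" if "p \<noteq> 0" for p
  proof
    assume "poly_subst p h \<in> vanishing C"
    hence "[:p:] = 0" by (intro indep) (auto simp: vanishing_def eval_poly_subst)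
    thus False using that by simp
  qed
  have gI: "g - mconst a \<notin> vanishing C" for a
  proof
    assume "g - mconst a \<in> vanishing C"
    hence "[:-[:a:], 1:] = (0 :: complex poly poly)"
      by (intro indep) (auto simp: vanishing_def id_hom.eval_diff)
    thus False by simp
  qed
  \<comment> \<open>Polynomials in \<open>h\<close> keep \<open>h\<close> from becoming constant on
    the variety of \<open>P\<close>; the powers of \<open>m\<close> keep that variety inside the
    torus.\<close>
  define S where "S = {poly_subst p h * m ^ k |p k. p \<noteq> 0}"
  show False
  proof (cases "\<exists>a. \<forall>s\<in>S. \<forall>\<beta>. s - \<beta> * (g - mconst a) \<notin> vanishing C")
    case True
    then obtain a where a: "\<And>s \<beta>. s \<in> S \<Longrightarrow> s - \<beta> * (g - mconst a) \<notin> vanishing C" by blast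
    let ?J = "{f. \<exists>\<beta>. f - \<beta> * (g - mconst a) \<in> vanishing C}"
    have J: "ring_ideal ?J"
      unfolding ring_ideal_def
    proof (intro conjI ballI allI)
      note idl = ring_idealD[OF ring_ideal_vanishing[of C]]
      show "0 \<in> ?J" using idl(1) by (auto intro!: exI[of _ 0])
      show "x + y \<in> ?J" if xy: "x \<in> ?J" "y \<in> ?J" for x y
      proof -
        obtain \<beta> \<gamma> where "x - \<beta> * (g - mconst a) \<in> vanishing C" "y - \<gamma> * (g - mconst a) \<in> vanishing C"
          using xy by auto
        hence "(x + y) - (\<beta> + \<gamma>) * (g - mconst a) \<in> vanishing C"
          using idl(2) by (fastforce simp: algebra_simps)
        thus ?thesis by blast
      qed
      show "r * x \<in> ?J" if x: "x \<in> ?J" for r x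
      proof -
        obtain \<beta> where "x - \<beta> * (g - mconst a) \<in> vanishing C" using x by auto
        hence "r * (x - \<beta> * (g - mconst a)) \<in> vanishing C" using idl(3) by blast
        hence "r * x - (r * \<beta>) * (g - mconst a) \<in> vanishing C" by (simp add: algebra_simps)
        thus ?thesis by blast
      qed
    qed
    have "1 = poly_subst 1 h * m ^ 0" "(1 :: complex poly) \<noteq> 0" by simp_all
    hence S1: "1 \<in> S" unfolding S_def by blast
    have Sm: "s * t \<in> S" if st: "s \<in> S" "t \<in> S" for s t
    proof -
      obtain p k q l where "p \<noteq> 0" "q \<noteq> 0" "s = poly_subst p h * m ^ k" "t = poly_subst q h * m ^ l"
        using st by (auto simp: S_def)
      hence "s * t = poly_subst (p * q) h * m ^ (k + l)" "p * q \<noteq> 0"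
        by (auto simp: poly_subst_mult power_add algebra_simps)
      thus ?thesis unfolding S_def by blast
    qed
    have "?J \<inter> S = {}" using a by blast
    obtain P where P: "prime_ideal P" "?J \<subseteq> P" "P \<inter> S = {}"
      by (rule prime_ideal_avoiding[OF J S1 Sm \<open>?J \<inter> S = {}\<close>])
    have CP: "vanishing C \<subseteq> P" using P(2) by (auto intro!: exI[of _ 0])
    have gP: "g - mconst a \<in> P"
      using P(2) ring_idealD(1)[OF ring_ideal_vanishing[of C]] by (auto intro!: exI[of _ 1])
    have mP: "(\<Prod>i\<in>{1..n}. mvar i) \<notin> P"
    proof -
      have "poly_subst 1 h * m ^ 1 \<in> S" unfolding S_def
        by (intro CollectI exI[of _ "1 :: complex poly"] exI[of _ "1 :: nat"] conjI refl one_neq_zero)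
      thus ?thesis using P(3) by (auto simp: m_def)
    qed
    have out: "mvar i - mconst undefined \<in> P" if "i \<notin> {1..n}" for i
      using that Ct CP by (force simp: vanishing_def id_hom.eval_diff torus_def PiE_def extensional_def)
    define Z where "Z = solution_set n P"
    have Z: "irreducible_variety n Z" "vanishing Z = P"
      using irreducible_solution_set_prime[OF P(1) mP out] by (auto simp: Z_def)
    have ZC: "Z \<subseteq> C" using zariski_closedD[OF zC] CP by (auto simp: Z_def solution_set_def)
    have "Z \<noteq> C" using Z(2) gP gI by blast
    obtain z where z: "z \<in> Z" using Z(1) by (auto simp: irreducible_variety_def)
    \<comment> \<open>On a single point the function \<open>h\<close> minus its value there would
      vanish, but that polynomial lies in \<open>S\<close>.\<close>
    have "Z \<noteq> {z}"
    proof
      assume "Z = {z}"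
      hence "poly_subst [:- eval h z, 1:] h \<in> P"
        unfolding Z(2)[symmetric] by (auto simp: vanishing_def eval_poly_subst simp del: poly_subst_pCons)
      moreover have "poly_subst [:- eval h z, 1:] h * m ^ 0 \<in> S"
        unfolding S_def by (intro CollectI exI[of _ "[:- eval h z, 1:]"] exI[of _ "0 :: nat"] conjI refl) simp
      ultimately show False using P(3) by auto
    qed
    have "irreducible_chain n 2 (\<lambda>i. if i = 0 then {z} else if i = 1 then Z else C)"
      unfolding irreducible_chain_def
      using irr Z(1) \<open>Z \<noteq> C\<close> \<open>Z \<noteq> {z}\<close> z ZC Ct irreducible_variety_point[of z n] by (auto simp: less_2_cases_iff)
    hence "\<exists>W. irreducible_chain n (Suc 1) W \<and> W (Suc 1) \<subseteq> C"
      by (intro exI[of _ "\<lambda>i. if i = 0 then {z} else if i = 1 then Z else C"])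
        (auto simp: numeral_2_eq_2)
    thus False using dim by (auto simp: has_dimension_def)
  next
    case False
    have ex: "\<exists>k. \<exists>s\<in>{poly_subst p h |p. p \<noteq> 0}. \<exists>\<beta>. s * m ^ k - \<beta> * (g - mconst a) \<in> vanishing C" for a
      using False unfolding S_def by blast
    obtain A l s where A: "finite A" "\<exists>a\<in>A. l a \<noteq> 0" "\<And>a. s a \<in> {poly_subst p h |p. p \<noteq> 0}"
      "(\<Sum>a\<in>A. mconst (l a) * s a * (\<Prod>b\<in>A - {a}. g - mconst b)) \<in> vanishing C"
      by (rule uncountable_dependence[OF I mI ex]) (rule that; assumption)
    obtain p where p: "\<And>a. s a = poly_subst (p a) h" "\<And>a. p a \<noteq> 0"
      using A(3) by (simp only: mem_Collect_eq) metis
    \<comment> \<open>The outer variable stands for \<open>g\<close>, the inner one for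
      \<open>h\<close>.\<close>
    define R where "R = (\<Sum>a\<in>A. smult (smult (l a) (p a)) (\<Prod>b\<in>A - {a}. [:- [:b:], 1:]))"
    have ev: "poly (poly R [:x:]) z = (\<Sum>a\<in>A. l a * poly (p a) z * (\<Prod>b\<in>A - {a}. x - b))" for x z
      by (simp add: R_def poly_sum poly_prod mult.assoc)
    have "R = 0"
    proof (rule indep)
      fix y assume "y \<in> C"
      hence "eval (\<Sum>a\<in>A. mconst (l a) * s a * (\<Prod>b\<in>A - {a}. g - mconst b)) y = 0"
        using A(4) by (auto simp: vanishing_def)
      thus "poly (poly R [:eval g y:]) (eval h y) = 0"
        using A(1) by (simp add: ev id_hom.eval_sum id_hom.eval_mult id_hom.eval_prod p(1)
            eval_poly_subst id_hom.eval_diff mult.assoc)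
    qed
    \<comment> \<open>With the outer variable set to \<open>a\<close> only the term of
      \<open>a\<close> survives, a nonzero multiple of \<open>p a\<close>; evaluating at a non-root
      \<open>z\<close> contradicts \<open>R = 0\<close>.\<close>
    obtain a where a: "a \<in> A" "l a \<noteq> 0" using A(2) by auto
    obtain z where z: "poly (p a) z \<noteq> 0" using p(2)[of a] poly_all_0_iff_0 by blast
    show False
      using lagrange_nonzero(1)[OF A(1) a(1), of l "\<lambda>a. poly (p a) z"] lagrange_nonzero(2)[OF A(1) a(1)] ev[of a z] \<open>R = 0\<close> a z by simp
  qed
qed

section \<open>The affine patch\<close>

text \<open>The coordinates beyond \<open>n\<close> run through the singleton of
  \<open>undefined\<close>, so the box is a product of compact sets over all indices.\<close>

lemma compact_box: "compact ({0..n} \<rightarrow>\<^sub>E cball (0::complex) M :: (nat \<Rightarrow> complex) set)"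
proof -
  let ?S = "\<lambda>i. if i \<in> {0..n} then cball (0::complex) M else {undefined}"
  have "compactin (product_topology (\<lambda>i. euclidean) UNIV) (PiE UNIV ?S)"
    by (simp add: compactin_PiE)
  moreover have "PiE UNIV ?S = {0..n} \<rightarrow>\<^sub>E cball 0 M"
    by (auto simp: PiE_def extensional_def Pi_def split: if_splits)
  ultimately show ?thesis by (simp add: euclidean_product_topology)
qed

lemma tendsto_coordinate:
  fixes f :: "'a \<Rightarrow> 'i \<Rightarrow> 'b::topological_space"
  assumes "(f \<longlongrightarrow> l) F"
  shows "((\<lambda>x. f x i) \<longlongrightarrow> l i) F"
  using continuous_on_tendsto_compose[OF continuous_on_product_coordinates assms] by simp

definition cone_equations :: "nat \<Rightarrow> (nat \<Rightarrow> complex) set \<Rightarrow> complex mvpoly set" where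
  "cone_equations n C = {g \<in> polys_in {0..n}. homogeneous g \<and> (\<forall>y \<in> C. eval g (y(0 := 1)) = 0)}"

lemma projective_closure_iff:
  "x \<in> projective_closure n C \<longleftrightarrow> x \<in> {0..n} \<rightarrow>\<^sub>E UNIV \<and> (\<exists>i \<le> n. x i \<noteq> 0) \<and>
     (\<forall>g \<in> cone_equations n C. eval g x = 0)"
  unfolding projective_closure_def cone_equations_def by blast

text \<open>The apex of the cone disappears because the normalization \<open>v x = 1\<close>
  excludes the zero vector; the patch is thus cut out by polynomial equations alone.\<close>

lemma affine_patch_iff:
  "x \<in> affine_patch n C v \<longleftrightarrow> x \<in> {0..n} \<rightarrow>\<^sub>E UNIV \<and> (\<forall>g \<in> cone_equations n C. eval g x = 0) \<and>
     (\<Sum>i\<le>n. complex_of_real (v i) * x i) = 1"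
proof -
  have "\<exists>i\<le>n. x i \<noteq> 0" if "(\<Sum>i\<le>n. complex_of_real (v i) * x i) = 1"
  proof (rule ccontr)
    assume "\<not> ?thesis"
    hence "(\<Sum>i\<le>n. complex_of_real (v i) * x i) = 0" by (intro sum.neutral) auto
    thus False using that by simp
  qed
  thus ?thesis
    unfolding affine_patch_def affine_cone_def by (auto simp: projective_closure_iff)
qed

lemma cone_equations_scale:
  assumes "g \<in> cone_equations n C" "eval g x = 0" "\<And>i. i \<le> n \<Longrightarrow> z i = c * x i"
  shows "eval g z = 0"
proof -
  obtain d where d: "\<And>c x. eval g (\<lambda>i. c * x i) = c ^ d * eval g x"
    using assms(1) homogeneous_scale by (auto simp: cone_equations_def)
  have "eval g z = eval g (\<lambda>i. c * x i)"
    by (rule eval_with_cong[of g "{0..n}"]) (use assms in \<open>auto simp: cone_equations_def\<close>)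
  thus ?thesis using d assms(2) by simp
qed

lemma projective_closure_limit:
  assumes "F \<noteq> bot" "\<forall>\<^sub>F t in F. \<forall>g\<in>cone_equations n C. eval g (f t) = 0"
    and "\<And>i. i \<le> n \<Longrightarrow> ((\<lambda>t. f t i) \<longlongrightarrow> z i) F" "z \<in> {0..n} \<rightarrow>\<^sub>E UNIV" "\<exists>i\<le>n. z i \<noteq> 0"
  shows "z \<in> projective_closure n C"
  unfolding projective_closure_iff
proof (intro conjI ballI assms(4,5))
  fix g assume g: "g \<in> cone_equations n C"
  have "((\<lambda>t. eval g (f t)) \<longlongrightarrow> eval g z) F"
    by (rule tendsto_eval[of g "{0..n}"]) (use g assms in \<open>auto simp: cone_equations_def\<close>)
  moreover have "((\<lambda>t. eval g (f t)) \<longlongrightarrow> 0) F"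
    using assms(2) g by (intro tendsto_eventually) (auto elim: eventually_mono)
  ultimately show "eval g z = 0" using tendsto_unique[OF assms(1)] by blast
qed

lemma homogenize_in_cone_equations:
  assumes "g \<in> polys_in {1..n}" "\<And>y. y \<in> C \<Longrightarrow> eval g y = 0"
  shows "homogenize g \<in> cone_equations n C"
  unfolding cone_equations_def
proof (intro CollectI conjI ballI homogenize_in[OF assms(1)] homogeneous_homogenize)
  fix y assume "y \<in> C"
  have "eval (homogenize g) (y(0 := 1)) = eval g (\<lambda>i. (y(0 := 1)) i / 1)"
    using eval_homogenize[OF id_hom.ring_hom_fun_axioms, of "y(0 := 1)" g] by simp
  also have "\<dots> = eval g y"
    by (rule eval_with_cong[OF assms(1)]) auto
  finally show "eval (homogenize g) (y(0 := 1)) = 0" using assms(2)[OF \<open>y \<in> C\<close>] by simp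
qed

lemma patch_to_curve:
  assumes C: "zariski_closed n C" and x: "x \<in> affine_patch n C v" "\<And>i. i \<le> n \<Longrightarrow> x i \<noteq> 0"
  shows "(\<lambda>i\<in>{1..n}. x i / x 0) \<in> C"
proof -
  obtain G where G: "G \<subseteq> polys_in {1..n}" "C = solution_set n G"
    using C by (auto simp: zariski_closed_def)
  let ?y = "\<lambda>i\<in>{1..n}. x i / x 0"
  have "eval g ?y = 0" if g: "g \<in> G" for g
  proof -
    have "homogenize g \<in> cone_equations n C"
      using g G by (intro homogenize_in_cone_equations) (auto simp: solution_set_def)
    hence "eval (homogenize g) x = 0" using x by (auto simp: affine_patch_iff)
    hence "eval g (\<lambda>i. x i / x 0) = 0"
      using eval_homogenize[OF id_hom.ring_hom_fun_axioms, of x g] x(2)[of 0] by simp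
    moreover have "eval g ?y = eval g (\<lambda>i. x i / x 0)"
      by (rule eval_with_cong[of g "{1..n}"]) (use g G in auto)
    ultimately show ?thesis by simp
  qed
  moreover have "?y \<in> torus n" using x(2) by (auto simp: torus_def)
  ultimately show ?thesis unfolding G(2) solution_set_def by blast
qed

text \<open>Points of unbounded size with bounded \<open>j\<close>-th coordinate, divided by the sum
  of their absolute values, accumulate at a point of the projective closure. There both the
  \<open>j\<close>-th coordinate and the form \<open>v\<close> vanish, which the general position of
  \<open>v\<close> forbids.\<close>

lemma affine_patch_bounded:
  assumes gen: "{x \<in> projective_closure n C. (\<Sum>i \<le> n. complex_of_real (v i) * x i) = 0} \<inter>
         {x \<in> projective_closure n C. \<exists>i \<le> n. x i = 0} = {}" and j: "j \<le> n"
  shows "\<exists>M. \<forall>x\<in>affine_patch n C v. cmod (x j) \<le> \<rho> \<longrightarrow> (\<forall>i\<le>n. cmod (x i) \<le> M)"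
proof (rule ccontr)
  assume "\<not> ?thesis"
  hence "\<forall>m::nat. \<exists>x\<in>affine_patch n C v. cmod (x j) \<le> \<rho> \<and> (\<exists>i\<le>n. cmod (x i) > real m)"
    by (metis not_le_imp_less)
  then obtain X where X: "\<And>m. X m \<in> affine_patch n C v" "\<And>m. cmod (X m j) \<le> \<rho>"
    "\<And>m. \<exists>i\<le>n. cmod (X m i) > real m" by metis
  define S where "S m = (\<Sum>i\<le>n. cmod (X m i))" for m
  have Sge: "cmod (X m i) \<le> S m" if "i \<le> n" for i m
    unfolding S_def using that by (intro member_le_sum) auto
  have Sm: "S m > real m" for m
    using X(3)[of m] Sge[of _ m] by (meson less_le_trans)
  have Spos: "S m > 0" for m using Sm[of m] by (meson of_nat_0_le_iff le_less_trans)
  define Z where "Z m = (\<lambda>i\<in>{0..n}. X m i / complex_of_real (S m))" for m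
  have "Z m \<in> {0..n} \<rightarrow>\<^sub>E cball 0 1" for m
    using Sge[of _ m] Spos[of m] by (auto simp: Z_def norm_divide divide_le_eq_1)
  then obtain z r where z: "z \<in> {0..n} \<rightarrow>\<^sub>E cball 0 1" "strict_mono r" "(Z \<circ> r) \<longlonglongrightarrow> z"
    using compact_box[of n 1] unfolding compact_eq_seq_compact_metric seq_compact_def by metis
  have lim: "(\<lambda>m. Z (r m) i) \<longlonglongrightarrow> z i" for i
    using tendsto_coordinate[OF z(3)] by (simp add: o_def)
  have inv0: "(\<lambda>m. 1 / S (r m)) \<longlonglongrightarrow> 0"
  proof (rule tendsto_sandwich[OF _ _ tendsto_const lim_1_over_n])
    show "\<forall>\<^sub>F m in sequentially. 0 \<le> 1 / S (r m)" using Spos by (intro always_eventually) (auto intro: less_imp_le)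
    have "1 / S (r m) \<le> 1 / real m" if "m > 0" for m
    proof (rule divide_left_mono)
      show "real m \<le> S (r m)"
        using Sm[of "r m"] seq_suble[OF z(2), of m] by (meson less_imp_le le_trans of_nat_le_iff order_trans)
      show "0 < S (r m) * real m" using Spos[of "r m"] that by simp
    qed simp
    thus "\<forall>\<^sub>F m in sequentially. 1 / S (r m) \<le> 1 / real m"
      by (intro eventually_mono[OF eventually_gt_at_top[of "0::nat"]])
  qed
  have nz: "\<exists>i\<le>n. z i \<noteq> 0"
  proof (rule ccontr)
    assume "\<not> ?thesis"
    hence "(\<lambda>m. \<Sum>i\<le>n. cmod (Z (r m) i)) \<longlonglongrightarrow> (\<Sum>i\<le>n. cmod (0::complex))"
      using lim by (intro tendsto_sum tendsto_norm) (metis atMost_iff)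
    moreover have "(\<Sum>i\<le>n. cmod (Z m i)) = 1" for m
    proof -
      have "(\<Sum>i\<le>n. cmod (Z m i)) = (\<Sum>i\<le>n. cmod (X m i) / S m)"
        using Spos[of m] by (intro sum.cong) (auto simp: Z_def norm_divide)
      also have "\<dots> = S m / S m" unfolding sum_divide_distrib[symmetric] S_def ..
      finally show ?thesis using Spos[of m] by simp
    qed
    ultimately have "(\<lambda>m::nat. 1::real) \<longlonglongrightarrow> 0" by simp
    thus False by (simp add: LIMSEQ_const_iff)
  qed
  have zcl: "z \<in> projective_closure n C"
  proof (rule projective_closure_limit[OF sequentially_bot _ lim _ nz])
    show "\<forall>\<^sub>F t in sequentially. \<forall>g\<in>cone_equations n C. eval g (Z (r t)) = 0"
    proof (intro always_eventually allI ballI)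
      fix t g assume g: "g \<in> cone_equations n C"
      show "eval g (Z (r t)) = 0"
        by (rule cone_equations_scale[OF g, of "X (r t)" _ "1 / complex_of_real (S (r t))"])
          (use X(1) g in \<open>auto simp: affine_patch_iff Z_def\<close>)
    qed
  qed (use z in auto)
  have "z j = 0"
  proof (rule tendsto_unique[OF sequentially_bot lim[of j]])
    show "(\<lambda>m. Z (r m) j) \<longlonglongrightarrow> 0"
    proof (rule Lim_null_comparison)
      show "\<forall>\<^sub>F m in sequentially. norm (Z (r m) j) \<le> \<rho> * (1 / S (r m))"
      proof (intro always_eventually allI)
        fix m
        have "norm (Z (r m) j) = cmod (X (r m) j) / S (r m)"
          using j Spos[of "r m"] by (simp add: Z_def norm_divide)
        also have "\<dots> \<le> \<rho> / S (r m)"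
          using X(2)[of "r m"] Spos[of "r m"] by (intro divide_right_mono) auto
        finally show "norm (Z (r m) j) \<le> \<rho> * (1 / S (r m))" by simp
      qed
      show "(\<lambda>m. \<rho> * (1 / S (r m))) \<longlonglongrightarrow> 0" using tendsto_mult_right[OF inv0, of \<rho>] by simp
    qed
  qed
  moreover have "(\<Sum>i\<le>n. complex_of_real (v i) * z i) = 0"
  proof (rule tendsto_unique[OF sequentially_bot])
    show "(\<lambda>m. \<Sum>i\<le>n. complex_of_real (v i) * Z (r m) i) \<longlonglongrightarrow> (\<Sum>i\<le>n. complex_of_real (v i) * z i)"
      by (intro tendsto_intros lim)
    have "(\<Sum>i\<le>n. complex_of_real (v i) * Z m i) = complex_of_real (1 / S m)" for m
    proof -
      have "(\<Sum>i\<le>n. complex_of_real (v i) * Z m i) = (\<Sum>i\<le>n. complex_of_real (v i) * X m i) / complex_of_real (S m)"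
        unfolding sum_divide_distrib by (intro sum.cong) (auto simp: Z_def)
      thus ?thesis using X(1)[of m] by (simp add: affine_patch_iff)
    qed
    thus "(\<lambda>m. \<Sum>i\<le>n. complex_of_real (v i) * Z (r m) i) \<longlonglongrightarrow> 0"
      using tendsto_of_real[OF inv0, where 'a = complex] by simp
  qed
  ultimately show False using gen zcl j by blast
qed

section \<open>Complex conjugation on the curve and its patch\<close>

lemma real_variety_cnj:
  assumes "defined_over_reals n C" "y \<in> C"
  shows "(\<lambda>i\<in>{1..n}. cnj (y i)) \<in> C"
proof -
  obtain G where G: "G \<subseteq> polys_in {1..n}"
    "C = {y \<in> torus n. \<forall>g \<in> G. eval_with complex_of_real g y = 0}"
    using assms(1) by (auto simp: defined_over_reals_def)
  have "eval_with complex_of_real g (\<lambda>i\<in>{1..n}. cnj (y i)) = cnj (eval_with complex_of_real g y)"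
    if "g \<in> G" for g
    by (rule eval_with_of_real_cnj[of g "{1..n}"]) (use that G in auto)
  thus ?thesis using assms(2) unfolding G(2) by (auto simp: torus_def)
qed

text \<open>The cone equations have complex coefficients. Conjugating these coefficients gives cone
  equations again, because \<open>C\<close> is closed under conjugation.\<close>

lemma affine_patch_cnj:
  assumes "defined_over_reals n C" "x \<in> affine_patch n C v"
  shows "(\<lambda>i\<in>{0..n}. cnj (x i)) \<in> affine_patch n C v"
  unfolding affine_patch_iff
proof (intro conjI ballI)
  let ?x = "\<lambda>i\<in>{0..n}. cnj (x i)"
  have "(\<Sum>i\<le>n. complex_of_real (v i) * ?x i) = cnj (\<Sum>i\<le>n. complex_of_real (v i) * x i)"
    by simp
  also have "(\<Sum>i\<le>n. complex_of_real (v i) * x i) = 1" using assms(2) unfolding affine_patch_iff by blast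
  finally show "(\<Sum>i\<le>n. complex_of_real (v i) * ?x i) = 1" by simp
  fix g assume g: "g \<in> cone_equations n C"
  let ?g = "Poly_Mapping.map cnj g"
  have g': "?g \<in> cone_equations n C"
    unfolding cone_equations_def
  proof (intro CollectI conjI ballI)
    show "?g \<in> polys_in {0..n}" using g by (auto simp: cone_equations_def polys_in_map)
    show "homogeneous ?g"
      using g by (auto simp: cone_equations_def homogeneous_def in_keys_iff map.rep_eq when_def
          split: if_splits)
    fix y assume "y \<in> C"
    have "eval ?g (y(0 := 1)) = cnj (eval g ((\<lambda>i\<in>{1..n}. cnj (y i))(0 := 1)))"
      by (rule eval_cnj[of g "{0..n}"]) (use g in \<open>auto simp: cone_equations_def\<close>)
    thus "eval ?g (y(0 := 1)) = 0"
      using g real_variety_cnj[OF assms(1) \<open>y \<in> C\<close>] by (auto simp: cone_equations_def)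
  qed
  have "eval (Poly_Mapping.map cnj ?g) ?x = cnj (eval ?g x)"
    by (rule eval_cnj[of ?g "{0..n}"]) (use g' in \<open>auto simp: cone_equations_def\<close>)
  moreover have "Poly_Mapping.map cnj ?g = g"
    by (rule poly_mapping_eqI) (auto simp: map.rep_eq when_def in_keys_iff)
  ultimately show "eval g ?x = 0" using assms(2) g' by (auto simp: affine_patch_iff)
qed auto

lemma linear_form_in: "linear_form n v - 1 \<in> polys_in {0..n}"
proof -
  have "linear_form n v + (- 1) \<in> polys_in {0..n}"
    unfolding linear_form_def
    by (intro polys_in_add polys_in_sum polys_in_single) (auto simp: polys_in_def)
  thus ?thesis by simp
qed

lemma patch_system_in: "F \<subseteq> polys_in {1..n} \<Longrightarrow> patch_system n F v \<subseteq> polys_in {0..n}"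
  unfolding patch_system_def using linear_form_in[of n v] homogenize_in[of _ n] by blast

lemma patch_system_vanishes:
  assumes "F \<subseteq> polys_in {1..n}" "C \<subseteq> solution_set n F" "x \<in> affine_patch n C v" "g \<in> patch_system n F v"
  shows "eval g x = 0"
proof -
  have "homogenize f \<in> cone_equations n C" if "f \<in> F" for f
    using that assms by (intro homogenize_in_cone_equations) (auto simp: solution_set_def)
  thus ?thesis using assms(3,4)
    by (auto simp: patch_system_def affine_patch_iff id_hom.eval_diff eval_linear_form)
qed

text \<open>\<open>E\<close> cuts out \<open>V\<close> exactly but may be infinite; the finite
  system \<open>G\<close> merely vanishes on \<open>V\<close> and supplies the Jacobian. The
  parameter \<open>\<tau>\<close> carries a sign, so that the two base values of the procedure are
  two instances with the same disc.\<close>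

locale patch_curve =
  fixes n j :: nat and V :: "(nat \<Rightarrow> complex) set" and E G :: "complex mvpoly set" and \<tau> :: real
  assumes j: "j \<le> n" and V: "V = {x \<in> {0..n} \<rightarrow>\<^sub>E UNIV. \<forall>g\<in>E. eval g x = 0}"
    and E: "E \<subseteq> polys_in {0..n}" and G: "finite G" "G \<subseteq> polys_in {0..n}"
    and G_vanishes: "\<And>g x. g \<in> G \<Longrightarrow> x \<in> V \<Longrightarrow> eval g x = 0"
    and noncritical: "\<And>x w k. x \<in> V \<Longrightarrow> x j \<noteq> 0 \<Longrightarrow> cmod (x j) \<le> \<bar>\<tau>\<bar> \<Longrightarrow>
      (\<And>g. g \<in> G \<Longrightarrow> (\<Sum>k \<in> {0..n} - {j}. eval (partial_deriv k g) x * w k) = 0) \<Longrightarrow>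
      k \<in> {0..n} - {j} \<Longrightarrow> w k = 0"
    and bounded: "\<exists>M. \<forall>x\<in>V. cmod (x j) \<le> \<bar>\<tau>\<bar> \<longrightarrow> (\<forall>i\<le>n. cmod (x i) \<le> M)"
    and nonzero: "\<And>x i. x \<in> V \<Longrightarrow> x j \<noteq> 0 \<Longrightarrow> cmod (x j) \<le> \<bar>\<tau>\<bar> \<Longrightarrow> i \<le> n \<Longrightarrow> x i \<noteq> 0"
    and V_cnj: "\<And>x. x \<in> V \<Longrightarrow> (\<lambda>i\<in>{0..n}. cnj (x i)) \<in> V"
    and tau: "\<tau> \<noteq> 0"

text \<open>Critical radii collect the nonzero values of \<open>cmod (x j)\<close> at critical and
  at boundary points alike. Staying below them therefore yields \<open>noncritical\<close> and
  \<open>nonzero\<close> at once.\<close>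

lemma patch_curve_affine_patch:
  assumes "defined_over_reals n C" "finite F" "F \<subseteq> polys_in {1..n}" "C \<subseteq> solution_set n F"
    and gen: "{x \<in> projective_closure n C. (\<Sum>i \<le> n. complex_of_real (v i) * x i) = 0} \<inter>
         {x \<in> projective_closure n C. \<exists>i \<le> n. x i = 0} = {}"
    and adm: "admissible_radii n C F v \<tau>" and j: "j \<le> n" "boundary_part n C v j \<noteq> {}" and t: "\<bar>t\<bar> = \<tau> j"
  shows "patch_curve n j (affine_patch n C v) (insert (linear_form n v - 1) (cone_equations n C)) (patch_system n F v) t"
proof
  have \<tau>: "0 < \<tau> j" "\<And>\<rho>. \<rho> \<in> critical_radii n C F v j \<Longrightarrow> \<tau> j < \<rho>"
    using adm j by (auto simp: admissible_radii_def)
  have crit: "x \<notin> critical_points n C F v j" "x \<notin> boundary n C v"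
    if "x \<in> affine_patch n C v" "x j \<noteq> 0" "cmod (x j) \<le> \<bar>t\<bar>" for x
    using \<tau>(2)[of "cmod (x j)"] that t by (auto simp: critical_radii_def)
  show "affine_patch n C v = {x \<in> {0..n} \<rightarrow>\<^sub>E UNIV. \<forall>g\<in>insert (linear_form n v - 1) (cone_equations n C). eval g x = 0}"
    by (intro set_eqI, simp only: affine_patch_iff mem_Collect_eq ball_simps id_hom.eval_diff
        eval_linear_form id_hom.eval_1 right_minus_eq) blast
  show "insert (linear_form n v - 1) (cone_equations n C) \<subseteq> polys_in {0..n}"
    using linear_form_in by (auto simp: cone_equations_def)
  show "finite (patch_system n F v)" using assms(2) by (auto simp: patch_system_def)
  show "w k = 0" if "x \<in> affine_patch n C v" "x j \<noteq> 0" "cmod (x j) \<le> \<bar>t\<bar>"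
    "\<And>g. g \<in> patch_system n F v \<Longrightarrow> (\<Sum>k \<in> {0..n} - {j}. eval (partial_deriv k g) x * w k) = 0"
    "k \<in> {0..n} - {j}" for x w k
    using crit(1)[OF that(1-3)] that unfolding critical_points_def by blast
  show "x i \<noteq> 0" if "x \<in> affine_patch n C v" "x j \<noteq> 0" "cmod (x j) \<le> \<bar>t\<bar>" "i \<le> n" for x i
    using crit(2)[OF that(1-3)] that by (auto simp: boundary_def)
  show "t \<noteq> 0" using t \<tau> by auto
  show "patch_system n F v \<subseteq> polys_in {0..n}" using patch_system_in[OF assms(3)] .
  show "eval g x = 0" if "g \<in> patch_system n F v" "x \<in> affine_patch n C v" for g x
    using patch_system_vanishes[OF assms(3,4) that(2,1)] .
  show "\<exists>M. \<forall>x\<in>affine_patch n C v. cmod (x j) \<le> \<bar>t\<bar> \<longrightarrow> (\<forall>i\<le>n. cmod (x i) \<le> M)"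
    using affine_patch_bounded[OF gen j(1)] .
  show "(\<lambda>i\<in>{0..n}. cnj (x i)) \<in> affine_patch n C v" if "x \<in> affine_patch n C v" for x
    using affine_patch_cnj[OF assms(1) that] .
qed (rule j(1))

section \<open>Local sections of the coordinate function\<close>

lemma eval_box_continuous:
  assumes p: "p \<in> polys_in {0..n}" and "\<epsilon> > 0"
  shows "\<exists>\<delta>>0. \<forall>z. (\<forall>i\<le>n. cmod (z i - q i) < \<delta>) \<longrightarrow> cmod (eval p z - eval p q) < \<epsilon>"
proof (rule ccontr)
  assume "\<not> ?thesis"
  hence "\<forall>m::nat. \<exists>z. (\<forall>i\<le>n. cmod (z i - q i) < 1 / real (Suc m)) \<and> \<not> cmod (eval p z - eval p q) < \<epsilon>"
    by (metis of_nat_0_less_iff zero_less_Suc zero_less_divide_1_iff)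
  then obtain z where z: "\<And>m i. i \<le> n \<Longrightarrow> cmod (z m i - q i) < 1 / real (Suc m)"
    "\<And>m::nat. \<not> cmod (eval p (z m) - eval p q) < \<epsilon>" by metis
  have "(\<lambda>m. eval p (z m)) \<longlonglongrightarrow> eval p q"
  proof (rule tendsto_eval[OF p])
    fix i assume "i \<in> {0..n}"
    hence "(\<lambda>m. z m i - q i) \<longlonglongrightarrow> 0"
      using z(1) by (intro Lim_null_comparison[OF _ LIMSEQ_inverse_real_of_nat])
        (auto intro!: always_eventually less_imp_le simp: inverse_eq_divide)
    thus "(\<lambda>m. z m i) \<longlonglongrightarrow> q i" by (simp add: LIM_zero_iff)
  qed
  hence "\<forall>\<^sub>F m in sequentially. dist (eval p (z m)) (eval p q) < \<epsilon>"
    using assms(2) by (rule tendstoD)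
  thus False using z(2) by (auto simp: dist_norm eventually_sequentially)
qed

lemma eval_partial_deriv:
  "eval (partial_deriv k g) x = (\<Sum>m\<in>Poly_Mapping.keys g. Poly_Mapping.lookup g m *
     (of_nat (Poly_Mapping.lookup m k) * monom_val (m - Poly_Mapping.single k 1) x))"
  unfolding partial_deriv_def by (simp add: id_hom.eval_sum mult_ac)

lemma partial_deriv_in:
  assumes "g \<in> polys_in A"
  shows "partial_deriv k g \<in> polys_in A"
  unfolding partial_deriv_def
proof (intro polys_in_sum polys_in_single)
  fix m assume "m \<in> Poly_Mapping.keys g"
  hence "Poly_Mapping.keys m \<subseteq> A" using assms by (auto simp: polys_in_def)
  thus "Poly_Mapping.keys (m - Poly_Mapping.single k 1) \<subseteq> A"
    by (auto simp: in_keys_iff lookup_minus)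
qed

lemma has_field_derivative_eval_line:
  assumes g: "g \<in> polys_in {0..n}"
  shows "((\<lambda>t. eval g (\<lambda>i. a i + t * b i)) has_field_derivative
    (\<Sum>k\<in>{0..n}. eval (partial_deriv k g) (\<lambda>i. a i + t * b i) * b k)) (at t within S)"
proof -
  let ?x = "\<lambda>t i. a i + t * b i"
  have mono: "((\<lambda>t. monom_val m (?x t)) has_field_derivative
      (\<Sum>k\<in>{0..n}. of_nat (Poly_Mapping.lookup m k) * monom_val (m - Poly_Mapping.single k 1) (?x t) * b k)) (at t)"
    if m: "Poly_Mapping.keys m \<subseteq> {0..n}" for m
  proof -
    let ?l = "Poly_Mapping.lookup m"
    have "((\<lambda>t. \<Prod>i\<in>{0..n}. ?x t i ^ ?l i) has_field_derivative
      (\<Sum>k\<in>{0..n}. (of_nat (?l k) * (b k * ?x t k ^ (?l k - Suc 0))) * (\<Prod>i\<in>{0..n} - {k}. ?x t i ^ ?l i))) (at t)"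
      by (rule has_field_derivative_prod) (auto intro!: derivative_eq_intros)
    also have "(\<Sum>k\<in>{0..n}. (of_nat (?l k) * (b k * ?x t k ^ (?l k - Suc 0))) * (\<Prod>i\<in>{0..n} - {k}. ?x t i ^ ?l i))
      = (\<Sum>k\<in>{0..n}. of_nat (?l k) * monom_val (m - Poly_Mapping.single k 1) (?x t) * b k)"
    proof (intro sum.cong refl)
      fix k assume k: "k \<in> {0..n}"
      have "monom_val (m - Poly_Mapping.single k 1) (?x t) =
          (\<Prod>i\<in>{0..n}. ?x t i ^ Poly_Mapping.lookup (m - Poly_Mapping.single k 1) i)"
        by (rule monom_val_superset) (use m in \<open>auto simp: in_keys_iff lookup_minus\<close>)
      also have "\<dots> = ?x t k ^ (?l k - Suc 0) * (\<Prod>i\<in>{0..n} - {k}. ?x t i ^ ?l i)"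
        using k by (subst prod.remove[of _ k])
          (auto simp: lookup_minus lookup_single intro!: prod.cong)
      finally show "(of_nat (?l k) * (b k * ?x t k ^ (?l k - Suc 0))) * (\<Prod>i\<in>{0..n} - {k}. ?x t i ^ ?l i)
        = of_nat (?l k) * monom_val (m - Poly_Mapping.single k 1) (?x t) * b k" by simp
    qed
    finally show ?thesis by (simp add: monom_val_superset[OF _ m])
  qed
  have "((\<lambda>t. \<Sum>m\<in>Poly_Mapping.keys g. Poly_Mapping.lookup g m * monom_val m (?x t)) has_field_derivative
     (\<Sum>m\<in>Poly_Mapping.keys g. Poly_Mapping.lookup g m * (\<Sum>k\<in>{0..n}. of_nat (Poly_Mapping.lookup m k) * monom_val (m - Poly_Mapping.single k 1) (?x t) * b k))) (at t)"
    by (intro DERIV_sum DERIV_cmult mono) (use g in \<open>auto simp: polys_in_def\<close>)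
  also have "(\<Sum>m\<in>Poly_Mapping.keys g. Poly_Mapping.lookup g m * (\<Sum>k\<in>{0..n}. of_nat (Poly_Mapping.lookup m k) * monom_val (m - Poly_Mapping.single k 1) (?x t) * b k))
     = (\<Sum>k\<in>{0..n}. eval (partial_deriv k g) (?x t) * b k)"
    unfolding eval_partial_deriv sum_distrib_left sum_distrib_right
    by (subst sum.swap) (simp add: mult.assoc)
  finally show ?thesis by (simp add: eval_with_altdef has_field_derivative_at_within)
qed

text \<open>Strict differentiability at \<open>q\<close>: the linearization error is small relative
  to \<open>x - y\<close> for both points near \<open>q\<close>, not just for \<open>y = q\<close>.
  A contraction estimate needs this stronger form.\<close>

lemma eval_increment:
  assumes g: "g \<in> polys_in {0..n}" and "\<epsilon> > 0"
  shows "\<exists>\<delta>>0. \<forall>x y. (\<forall>i\<le>n. cmod (x i - q i) < \<delta> \<and> cmod (y i - q i) < \<delta>) \<longrightarrow>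
    cmod (eval g x - eval g y - (\<Sum>k\<in>{0..n}. eval (partial_deriv k g) q * (x k - y k)))
      \<le> \<epsilon> * (\<Sum>k\<in>{0..n}. cmod (x k - y k))"
proof -
  have "\<exists>\<delta>>0. \<forall>k\<in>K. \<forall>z. (\<forall>i\<le>n. cmod (z i - q i) < \<delta>) \<longrightarrow>
      cmod (eval (partial_deriv k g) z - eval (partial_deriv k g) q) < \<epsilon>" if "finite K" for K
    using that
  proof (induction K rule: finite_induct)
    case empty
    show ?case by (intro exI[of _ 1]) auto
  next
    case (insert k K)
    obtain \<delta> where \<delta>: "\<delta> > 0" "\<forall>k\<in>K. \<forall>z. (\<forall>i\<le>n. cmod (z i - q i) < \<delta>) \<longrightarrow>
      cmod (eval (partial_deriv k g) z - eval (partial_deriv k g) q) < \<epsilon>" using insert.IH by blast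
    obtain \<eta> where \<eta>: "\<eta> > 0" "\<forall>z. (\<forall>i\<le>n. cmod (z i - q i) < \<eta>) \<longrightarrow>
      cmod (eval (partial_deriv k g) z - eval (partial_deriv k g) q) < \<epsilon>"
      using eval_box_continuous[OF partial_deriv_in[OF g] \<open>\<epsilon> > 0\<close>] by blast
    show ?case by (rule exI[of _ "min \<delta> \<eta>"]) (use \<delta> \<eta> in auto)
  qed
  from this[of "{0..n}"] obtain \<delta> where \<delta>: "\<delta> > 0" "\<And>k z. k \<le> n \<Longrightarrow> (\<forall>i\<le>n. cmod (z i - q i) < \<delta>) \<Longrightarrow>
      cmod (eval (partial_deriv k g) z - eval (partial_deriv k g) q) < \<epsilon>" by auto
  show ?thesis
  proof (intro exI[of _ \<delta>] conjI allI impI \<delta>(1))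
    fix x y :: "nat \<Rightarrow> complex"
    assume xy: "\<forall>i\<le>n. cmod (x i - q i) < \<delta> \<and> cmod (y i - q i) < \<delta>"
    define b where "b i = x i - y i" for i
    define D where "D = (\<Sum>k\<in>{0..n}. eval (partial_deriv k g) q * b k)"
    let ?z = "\<lambda>t i. y i + t * b i"
    \<comment> \<open>Removing the linear part leaves a function on the segment from
      \<open>y\<close> to \<open>x\<close> whose derivative is small, so the mean value inequality
      applies.\<close>
    let ?f = "\<lambda>t. eval g (?z t) - t * D"
    have der: "(?f has_field_derivative ((\<Sum>k\<in>{0..n}. eval (partial_deriv k g) (?z t) * b k) - D))
        (at t within closed_segment 0 1)" for t
      by (rule DERIV_diff[OF has_field_derivative_eval_line[OF g]]) (auto intro!: derivative_eq_intros)
    have "cmod (?f 1 - ?f 0) \<le> (\<epsilon> * (\<Sum>k\<in>{0..n}. cmod (b k))) * cmod (1 - 0)"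
    proof (rule field_differentiable_bound[OF convex_closed_segment der])
      fix t :: complex assume "t \<in> closed_segment 0 1"
      then obtain u where u: "t = of_real u" "0 \<le> u" "u \<le> 1"
        by (auto simp: in_segment scaleR_conv_of_real)
      have box: "\<forall>i\<le>n. cmod (?z t i - q i) < \<delta>"
      proof (intro allI impI)
        fix i assume "i \<le> n"
        have "(1 - u) *\<^sub>R y i + u *\<^sub>R x i \<in> ball (q i) \<delta>"
          using xy \<open>i \<le> n\<close> u by (intro convexD[OF convex_ball]) (auto simp: dist_norm norm_minus_commute)
        moreover have "(1 - u) *\<^sub>R y i + u *\<^sub>R x i = ?z t i"
          by (simp add: u b_def scaleR_conv_of_real algebra_simps)
        ultimately show "cmod (?z t i - q i) < \<delta>" by (simp add: dist_norm norm_minus_commute)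
      qed
      have "(\<Sum>k\<in>{0..n}. eval (partial_deriv k g) (?z t) * b k) - D =
          (\<Sum>k\<in>{0..n}. (eval (partial_deriv k g) (?z t) - eval (partial_deriv k g) q) * b k)"
        by (simp add: D_def algebra_simps sum_subtractf)
      also have "cmod \<dots> \<le> (\<Sum>k\<in>{0..n}. \<epsilon> * cmod (b k))"
      proof (rule sum_norm_le)
        fix k assume "k \<in> {0..n}"
        thus "cmod ((eval (partial_deriv k g) (?z t) - eval (partial_deriv k g) q) * b k) \<le> \<epsilon> * cmod (b k)"
          unfolding norm_mult using \<delta>(2)[OF _ box, of k] by (intro mult_right_mono) auto
      qed
      finally show "cmod ((\<Sum>k\<in>{0..n}. eval (partial_deriv k g) (?z t) * b k) - D) \<le> \<epsilon> * (\<Sum>k\<in>{0..n}. cmod (b k))"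
        by (simp add: sum_distrib_left)
    qed auto
    moreover have "eval g (?z 1) = eval g x" by (simp add: b_def)
    ultimately show "cmod (eval g x - eval g y - (\<Sum>k\<in>{0..n}. eval (partial_deriv k g) q * (x k - y k)))
      \<le> \<epsilon> * (\<Sum>k\<in>{0..n}. cmod (x k - y k))"
      by (simp add: D_def b_def algebra_simps)
  qed
qed

text \<open>Columns that admit no nontrivial relation have a left inverse, built one column at a
  time; the rows may outnumber the columns.\<close>

lemma left_inverse_exists:
  fixes J :: "'g \<Rightarrow> 'k \<Rightarrow> 'a::field"
  assumes "finite K" "finite G"
    "\<And>w. (\<And>g. g \<in> G \<Longrightarrow> (\<Sum>k\<in>K. J g k * w k) = 0) \<Longrightarrow> \<forall>k\<in>K. w k = 0"
  shows "\<exists>L. \<forall>k\<in>K. \<forall>i\<in>K. (\<Sum>g\<in>G. L k g * J g i) = (if i = k then 1 else 0)"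
  using assms(1,3)
proof (induction K rule: finite_induct)
  case empty
  show ?case by simp
next
  case (insert k0 K)
  have "\<forall>w. (\<forall>g\<in>G. (\<Sum>k\<in>K. J g k * w k) = 0) \<longrightarrow> (\<forall>k\<in>K. w k = 0)"
  proof (intro allI impI)
    fix w :: "'k \<Rightarrow> 'a" assume w: "\<forall>g\<in>G. (\<Sum>k\<in>K. J g k * w k) = 0"
    have "(\<Sum>k\<in>K. J g k * (w(k0 := 0)) k) = (\<Sum>k\<in>K. J g k * w k)" for g
      using insert.hyps by (intro sum.cong) auto
    hence "\<forall>k\<in>insert k0 K. (w(k0 := 0)) k = 0"
      using w insert.hyps by (intro insert.prems) simp
    thus "\<forall>k\<in>K. w k = 0" using insert.hyps by (metis fun_upd_other insertCI)
  qed
  hence "\<exists>L. \<forall>k\<in>K. \<forall>i\<in>K. (\<Sum>g\<in>G. L k g * J g i) = (if i = k then 1 else 0)"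
    by (intro insert.IH) auto
  then obtain L where L': "\<forall>k\<in>K. \<forall>i\<in>K. (\<Sum>g\<in>G. L k g * J g i) = (if i = k then 1 else 0)" ..
  have L: "(\<Sum>g\<in>G. L k g * J g i) = (if i = k then 1 else 0)" if "k \<in> K" "i \<in> K" for k i
    using L' that by simp
  \<comment> \<open>\<open>c\<close> would be the coordinates of the new column along the old ones;
    the residue \<open>d\<close> is nonzero exactly because the new column is independent of
    them.\<close>
  define c where "c k = (\<Sum>g\<in>G. L k g * J g k0)" for k
  define d where "d g = J g k0 - (\<Sum>i\<in>K. J g i * c i)" for g
  have "\<exists>g0\<in>G. d g0 \<noteq> 0"
  proof (rule ccontr)
    assume neg: "\<not> ?thesis"
    let ?w = "\<lambda>k. if k = k0 then 1 else - c k"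
    have "\<forall>k\<in>insert k0 K. ?w k = 0"
    proof (rule insert.prems)
      fix g assume "g \<in> G"
      have "(\<Sum>k\<in>insert k0 K. J g k * ?w k) = J g k0 + (\<Sum>k\<in>K. J g k * ?w k)"
        using insert.hyps by simp
      also have "(\<Sum>k\<in>K. J g k * ?w k) = (\<Sum>k\<in>K. - (J g k * c k))"
        using insert.hyps by (intro sum.cong) auto
      also have "J g k0 + \<dots> = d g" by (simp add: d_def sum_negf)
      also have "\<dots> = 0" using neg \<open>g \<in> G\<close> by blast
      finally show "(\<Sum>k\<in>insert k0 K. J g k * ?w k) = 0" .
    qed
    thus False by simp
  qed
  then obtain g0 where g0: "g0 \<in> G" "d g0 \<noteq> 0" by blast
  \<comment> \<open>Reading off the residue in a row where it does not vanish gives a functional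
    that kills the old columns and takes the value 1 on the new one.\<close>
  define M where "M g = ((if g = g0 then 1 else 0) - (\<Sum>i\<in>K. J g0 i * L i g)) / d g0" for g
  have Msum: "(\<Sum>g\<in>G. M g * y g) = (y g0 - (\<Sum>i\<in>K. J g0 i * (\<Sum>g\<in>G. L i g * y g))) / d g0" for y
  proof -
    have "(\<Sum>g\<in>G. M g * y g) = (\<Sum>g\<in>G. (if g = g0 then y g else 0) - (\<Sum>i\<in>K. J g0 i * L i g * y g)) / d g0"
      unfolding sum_divide_distrib M_def by (intro sum.cong refl) (simp add: algebra_simps sum_distrib_left)
    also have "\<dots> = (y g0 - (\<Sum>i\<in>K. J g0 i * (\<Sum>g\<in>G. L i g * y g))) / d g0"
      using g0 assms(2) by (simp add: sum_subtractf sum_distrib_left mult.assoc sum.swap[of _ G K])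
    finally show ?thesis .
  qed
  have MK: "(\<Sum>g\<in>G. M g * J g i) = 0" if "i \<in> K" for i
  proof -
    have "(\<Sum>k\<in>K. J g0 k * (\<Sum>g\<in>G. L k g * J g i)) = (\<Sum>k\<in>K. if i = k then J g0 k else 0)"
      using L that by (intro sum.cong) auto
    thus ?thesis using that insert.hyps by (simp add: Msum)
  qed
  have M0: "(\<Sum>g\<in>G. M g * J g k0) = 1"
    using g0 by (simp add: Msum d_def c_def)
  define L' where "L' k g = (if k = k0 then M g else L k g - c k * M g)" for k g
  have red: "(\<Sum>g\<in>G. L' k g * y g) = (\<Sum>g\<in>G. L k g * y g) - c k * (\<Sum>g\<in>G. M g * y g)" if "k \<noteq> k0" for k y
    using that by (simp add: L'_def algebra_simps sum_subtractf sum_distrib_left)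
  have red0: "(\<Sum>g\<in>G. L' k0 g * y g) = (\<Sum>g\<in>G. M g * y g)" for y
    by (simp add: L'_def)
  have "(\<Sum>g\<in>G. L' k g * J g i) = (if i = k then 1 else 0)" if "k \<in> insert k0 K" "i \<in> insert k0 K" for k i
  proof (cases "k = k0")
    case True
    thus ?thesis using that MK M0 insert.hyps by (auto simp: red0)
  next
    case False
    hence k: "k \<in> K" using that by auto
    show ?thesis
    proof (cases "i = k0")
      case True thus ?thesis using k False M0 by (simp add: red flip: c_def)
    next
      case i: False
      thus ?thesis using k False that L MK by (auto simp: red)
    qed
  qed
  thus ?case by blast
qed

context patch_curve
begin

definition near :: "real \<Rightarrow> (nat \<Rightarrow> complex) \<Rightarrow> (nat \<Rightarrow> complex) \<Rightarrow> bool" where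
  "near \<delta> q x \<longleftrightarrow> (\<forall>i\<le>n. cmod (x i - q i) < \<delta>)"

text \<open>The last clause says that nearby points of \<open>V\<close> lie on the graph of \<phi>.
  The converse inclusion is deliberately absent; it is obtained later and only near accumulation
  points.\<close>

definition section_at ::
  "(nat \<Rightarrow> complex) \<Rightarrow> real \<Rightarrow> real \<Rightarrow> (complex \<Rightarrow> nat \<Rightarrow> complex) \<Rightarrow> bool" where
  "section_at q \<delta> r \<phi> \<longleftrightarrow> 0 < r \<and> 0 < \<delta> \<and> (\<forall>i\<le>n. (\<lambda>a. \<phi> a i) holomorphic_on ball (q j) r) \<and>
     (\<forall>a\<in>ball (q j) r. \<phi> a \<in> {0..n} \<rightarrow>\<^sub>E UNIV \<and> \<phi> a j = a \<and> near \<delta> q (\<phi> a)) \<and>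
     (\<forall>x\<in>V. x j \<in> ball (q j) r \<and> near \<delta> q x \<longrightarrow> x = \<phi> (x j))"

text \<open>With a left inverse \<open>L\<close> of the Jacobian at \<open>q\<close>, the simplified Newton map \<open>x - L g(x)\<close> is a
  contraction near \<open>q\<close>. It fixes the points of \<open>V\<close>, so these lie on the graph of its fixed point,
  which depends holomorphically on the \<open>j\<close>-th coordinate.\<close>

lemma newton_contraction:
  assumes q: "q \<in> V" "q j \<noteq> 0" "cmod (q j) \<le> \<bar>\<tau>\<bar>"
  obtains \<delta> L where "\<delta> > 0"
    "\<And>x y. near \<delta> q x \<Longrightarrow> near \<delta> q y \<Longrightarrow> x j = y j \<Longrightarrow>
      (\<Sum>k\<in>{0..n} - {j}. cmod ((x k - y k) - (\<Sum>g\<in>G. L k g * (eval g x - eval g y))))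
        \<le> (1/2) * (\<Sum>k\<in>{0..n} - {j}. cmod (x k - y k))"
proof -
  let ?K = "{0..n} - {j}" and ?J = "\<lambda>g k. eval (partial_deriv k g) q"
  obtain L :: "nat \<Rightarrow> complex mvpoly \<Rightarrow> complex" where
    L: "\<forall>k\<in>?K. \<forall>i\<in>?K. (\<Sum>g\<in>G. L k g * ?J g i) = (if i = k then 1 else 0)"
    using left_inverse_exists[of ?K G ?J] G(1) noncritical[OF q] by blast
  define B where "B = (\<Sum>k\<in>?K. \<Sum>g\<in>G. cmod (L k g))"
  have B: "B \<ge> 0" unfolding B_def by (intro sum_nonneg) auto
  \<comment> \<open>\<open>B\<close> bounds the size of \<open>L\<close>; this \<epsilon> makes the
    resulting contraction factor at most one half.\<close>
  define \<epsilon> where "\<epsilon> = 1 / (2 * (B + 1))"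
  have \<epsilon>: "\<epsilon> > 0" "B * \<epsilon> \<le> 1/2" using B by (auto simp: \<epsilon>_def field_simps)
  let ?inc = "\<lambda>g x y. eval g x - eval g y - (\<Sum>k\<in>{0..n}. ?J g k * (x k - y k))"
  have "\<exists>\<delta>>0. \<forall>g\<in>H. \<forall>x y. near \<delta> q x \<and> near \<delta> q y \<longrightarrow>
      cmod (?inc g x y) \<le> \<epsilon> * (\<Sum>k\<in>{0..n}. cmod (x k - y k))" if "finite H" "H \<subseteq> G" for H
    using that
  proof (induction H rule: finite_induct)
    case empty
    show ?case by (intro exI[of _ 1]) auto
  next
    case (insert g H)
    then obtain \<delta> where \<delta>: "\<delta> > 0" "\<forall>g\<in>H. \<forall>x y. near \<delta> q x \<and> near \<delta> q y \<longrightarrow>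
      cmod (?inc g x y) \<le> \<epsilon> * (\<Sum>k\<in>{0..n}. cmod (x k - y k))" by auto
    have "g \<in> polys_in {0..n}" using insert.prems G(2) by auto
    then obtain \<eta> where \<eta>: "\<eta> > 0" "\<forall>x y. near \<eta> q x \<and> near \<eta> q y \<longrightarrow>
      cmod (?inc g x y) \<le> \<epsilon> * (\<Sum>k\<in>{0..n}. cmod (x k - y k))"
      using eval_increment[OF _ \<epsilon>(1), of g n q] unfolding near_def by auto
    have mono: "near \<delta> q x" "near \<eta> q x" if "near (min \<delta> \<eta>) q x" for x
      using that by (auto simp: near_def)
    show ?case
      by (rule exI[of _ "min \<delta> \<eta>"]) (use \<delta> \<eta> mono in auto)
  qed
  from this[OF G(1) order_refl] obtain \<delta> where \<delta>: "\<delta> > 0"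
    "\<And>g x y. g \<in> G \<Longrightarrow> near \<delta> q x \<Longrightarrow> near \<delta> q y \<Longrightarrow>
      cmod (?inc g x y) \<le> \<epsilon> * (\<Sum>k\<in>{0..n}. cmod (x k - y k))" by blast
  have "(\<Sum>k\<in>?K. cmod ((x k - y k) - (\<Sum>g\<in>G. L k g * (eval g x - eval g y))))
        \<le> (1/2) * (\<Sum>k\<in>?K. cmod (x k - y k))"
    if xy: "near \<delta> q x" "near \<delta> q y" "x j = y j" for x y
  proof -
    define D where "D = (\<Sum>k\<in>?K. cmod (x k - y k))"
    have rem: "(\<Sum>k\<in>{0..n}. h k) = h j + (\<Sum>k\<in>?K. h k)" for h :: "nat \<Rightarrow> 'c::comm_monoid_add"
      using j by (intro sum.remove) auto
    have D: "(\<Sum>k\<in>{0..n}. cmod (x k - y k)) = D" "D \<ge> 0"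
      unfolding D_def by (auto simp: rem xy(3) intro: sum_nonneg)
    have "(\<Sum>k\<in>?K. cmod ((x k - y k) - (\<Sum>g\<in>G. L k g * (eval g x - eval g y))))
       \<le> (\<Sum>k\<in>?K. (\<Sum>g\<in>G. cmod (L k g)) * (\<epsilon> * D))"
    proof (rule sum_mono)
      fix k assume k: "k \<in> ?K"
      have "(\<Sum>g\<in>G. L k g * (\<Sum>i\<in>{0..n}. ?J g i * (x i - y i))) = (\<Sum>i\<in>?K. (\<Sum>g\<in>G. L k g * ?J g i) * (x i - y i))"
        by (simp add: rem xy(3) sum_distrib_left sum_distrib_right mult.assoc sum.swap[of _ G])
      also have "\<dots> = (\<Sum>i\<in>?K. if i = k then x i - y i else 0)"
        using L k by (intro sum.cong refl) auto
      also have "\<dots> = x k - y k" using k by (subst sum.delta) auto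
      finally have "(x k - y k) - (\<Sum>g\<in>G. L k g * (eval g x - eval g y)) = - (\<Sum>g\<in>G. L k g * ?inc g x y)"
        by (simp only: right_diff_distrib sum_subtractf) simp
      hence "cmod ((x k - y k) - (\<Sum>g\<in>G. L k g * (eval g x - eval g y))) = cmod (\<Sum>g\<in>G. L k g * ?inc g x y)"
        by (simp only: norm_minus_cancel)
      also have "\<dots> \<le> (\<Sum>g\<in>G. cmod (L k g) * (\<epsilon> * D))"
      proof (rule sum_norm_le)
        fix g assume "g \<in> G"
        show "cmod (L k g * ?inc g x y) \<le> cmod (L k g) * (\<epsilon> * D)"
          unfolding norm_mult using \<delta>(2)[OF \<open>g \<in> G\<close> xy(1,2)] D(1)
          by (intro mult_left_mono) auto
      qed
      finally show "cmod ((x k - y k) - (\<Sum>g\<in>G. L k g * (eval g x - eval g y))) \<le> (\<Sum>g\<in>G. cmod (L k g)) * (\<epsilon> * D)"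
        by (simp only: sum_distrib_right)
    qed
    also have "\<dots> = B * \<epsilon> * D" by (simp add: B_def sum_distrib_right mult.assoc)
    also have "\<dots> \<le> (1/2) * D" using \<epsilon>(2) D(2) by (rule mult_right_mono)
    finally show ?thesis by (simp add: D_def)
  qed
  thus ?thesis using that \<delta>(1) by blast
qed

text \<open>With the \<open>j\<close>-th coordinate frozen at \<open>a\<close>, each Newton iterate
  is holomorphic in \<open>a\<close>. The iterates converge uniformly on a small disc, so the limit
  is holomorphic too.\<close>

lemma local_section:
  assumes q: "q \<in> V" "q j \<noteq> 0" "cmod (q j) \<le> \<bar>\<tau>\<bar>"
  shows "\<exists>\<delta> r \<phi>. section_at q \<delta> r \<phi>"
proof -
  let ?K = "{0..n} - {j}"
  obtain \<delta> L where \<delta>: "\<delta> > 0" and contr: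
    "\<And>x y. near \<delta> q x \<Longrightarrow> near \<delta> q y \<Longrightarrow> x j = y j \<Longrightarrow>
      (\<Sum>k\<in>?K. cmod ((x k - y k) - (\<Sum>g\<in>G. L k g * (eval g x - eval g y))))
        \<le> (1/2) * (\<Sum>k\<in>?K. cmod (x k - y k))"
    using newton_contraction[OF q] by blast
  define T where "T a x = (\<lambda>k\<in>{0..n}. if k = j then a else x k - (\<Sum>g\<in>G. L k g * eval g x))"
    for a :: complex and x :: "nat \<Rightarrow> complex"
  define dd where "dd x y = (\<Sum>k\<in>?K. cmod (x k - y k))" for x y :: "nat \<Rightarrow> complex"
  have dd_nn: "dd x y \<ge> 0" for x y unfolding dd_def by (intro sum_nonneg) auto
  have dd_ge: "cmod (x k - y k) \<le> dd x y" if "k \<in> ?K" for x y k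
    unfolding dd_def using that by (intro member_le_sum) auto
  have dd_tri: "dd x z \<le> dd x y + dd y z" for x y z
    unfolding dd_def sum.distrib[symmetric] by (intro sum_mono norm_diff_triangle_le[OF order_refl order_refl])
  have Tj: "T a x j = a" "T a x \<in> {0..n} \<rightarrow>\<^sub>E UNIV" for a x using j by (auto simp: T_def)
  have T_contr: "dd (T a x) (T a y) \<le> dd x y / 2" if "near \<delta> q x" "near \<delta> q y" "x j = a" "y j = a" for a x y
  proof -
    have "dd (T a x) (T a y) = (\<Sum>k\<in>?K. cmod ((x k - y k) - (\<Sum>g\<in>G. L k g * (eval g x - eval g y))))"
      unfolding dd_def
      by (intro sum.cong refl arg_cong[where f = cmod]) (auto simp: T_def algebra_simps sum_subtractf)
    thus ?thesis using contr[OF that(1,2)] that(3,4) by (simp add: dd_def)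
  qed
  have T_fix: "T (x j) x = x" if "x \<in> V" for x
  proof -
    have "eval g x = 0" if "g \<in> G" for g using G_vanishes[OF that \<open>x \<in> V\<close>] .
    moreover have "x \<in> {0..n} \<rightarrow>\<^sub>E UNIV" using \<open>x \<in> V\<close> V by auto
    ultimately show ?thesis by (intro ext) (auto simp: T_def PiE_def extensional_def)
  qed
  \<comment> \<open>The iteration starts at \<open>q\<close> with its \<open>j\<close>-th coordinate
    replaced by \<open>a\<close>; every step leaves that coordinate fixed.\<close>
  define \<phi>s where "\<phi>s m a = (T a ^^ m) (q(j := a))" for m a
  have \<phi>s_Suc: "\<phi>s (Suc m) a = T a (\<phi>s m a)" and \<phi>s_0: "\<phi>s 0 a = q(j := a)" for m a
    by (auto simp: \<phi>s_def)
  have \<phi>sj: "\<phi>s m a j = a" for m a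
    by (cases m) (auto simp: \<phi>s_0 \<phi>s_Suc Tj)
  have hol_\<phi>s: "(\<lambda>a. \<phi>s m a k) holomorphic_on UNIV" if "k \<in> {0..n}" for m k
    using that
  proof (induction m arbitrary: k)
    case 0
    show ?case by (cases "k = j") (auto simp: \<phi>s_0)
  next
    case (Suc m)
    have "(\<lambda>a. \<phi>s m a k - (\<Sum>g\<in>G. L k g * eval g (\<phi>s m a))) holomorphic_on UNIV"
      using Suc G(2) by (intro holomorphic_intros holomorphic_on_eval[of _ "{0..n}"]) auto
    thus ?case using Suc.prems by (cases "k = j") (simp_all add: \<phi>s_Suc T_def)
  qed
  \<comment> \<open>A first step below a quarter of \<delta> and halving afterwards bound the total
    movement by half of \<delta>, so the iteration never leaves the region of contraction. The bound
    \<open>r \<le> \<delta>\<close> takes care of the \<open>j\<close>-th coordinate.\<close>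
  have "\<exists>r>0. r \<le> \<delta> \<and> (\<forall>a\<in>ball (q j) r. dd (\<phi>s 1 a) (\<phi>s 0 a) < \<delta> / 4)"
  proof -
    have "continuous_on UNIV (\<lambda>a. dd (\<phi>s 1 a) (\<phi>s 0 a))"
      unfolding dd_def using hol_\<phi>s
      by (intro continuous_intros holomorphic_on_imp_continuous_on) auto
    hence "continuous (at (q j)) (\<lambda>a. dd (\<phi>s 1 a) (\<phi>s 0 a))"
      by (simp add: continuous_on_eq_continuous_at)
    moreover have "dd (\<phi>s 1 (q j)) (\<phi>s 0 (q j)) = 0"
      using T_fix[OF q(1)] by (simp add: \<phi>s_Suc \<phi>s_0 dd_def)
    ultimately have "\<forall>\<^sub>F a in at (q j). dd (\<phi>s 1 a) (\<phi>s 0 a) < \<delta> / 4"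
      using \<delta> by (intro order_tendstoD(2)[where y = 0]) (auto simp: continuous_at)
    then obtain r where r: "r > 0" "\<And>a. a \<noteq> q j \<Longrightarrow> dist a (q j) < r \<Longrightarrow> dd (\<phi>s 1 a) (\<phi>s 0 a) < \<delta> / 4"
      unfolding eventually_at by auto
    have "dd (\<phi>s 1 a) (\<phi>s 0 a) < \<delta> / 4" if "a \<in> ball (q j) r" for a
      using r(2)[of a] that \<delta> \<open>dd (\<phi>s 1 (q j)) (\<phi>s 0 (q j)) = 0\<close> by (cases "a = q j") (auto simp: dist_commute)
    thus ?thesis using r(1) \<delta> by (intro exI[of _ "min r \<delta>"]) auto
  qed
  then obtain r where r: "r > 0" "r \<le> \<delta>" "\<And>a. a \<in> ball (q j) r \<Longrightarrow> dd (\<phi>s 1 a) (\<phi>s 0 a) < \<delta> / 4" by auto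
  have iter: "dd (\<phi>s (Suc m) a) (\<phi>s m a) \<le> (\<delta> / 4) * (1/2) ^ m \<and> dd (\<phi>s m a) q \<le> (\<delta> / 2) * (1 - (1/2) ^ m)"
    if a: "a \<in> ball (q j) r" for m a
  proof (induction m)
    case 0
    have "dd (\<phi>s 0 a) q = 0" unfolding dd_def by (auto simp: \<phi>s_0)
    thus ?case using r(3)[OF a] by simp
  next
    case (Suc m)
    have nr: "near \<delta> q x" if "dd x q \<le> (\<delta> / 2) * (1 - (1/2) ^ l)" "x j = a" for x l
      unfolding near_def
    proof (intro allI impI)
      fix i assume "i \<le> n"
      have "(\<delta> / 2) * (1 - (1/2) ^ l) \<le> \<delta> / 2 * 1" using \<delta> by (intro mult_left_mono) auto
      hence "dd x q < \<delta>" using that(1) \<delta> by linarith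
      thus "cmod (x i - q i) < \<delta>"
        using dd_ge[of i x q] \<open>i \<le> n\<close> that(2) a r(2) by (cases "i = j") (auto simp: dist_norm norm_minus_commute)
    qed
    have "dd (\<phi>s (Suc m) a) q \<le> dd (\<phi>s (Suc m) a) (\<phi>s m a) + dd (\<phi>s m a) q" by (rule dd_tri)
    also have "\<dots> \<le> (\<delta> / 4) * (1/2) ^ m + (\<delta> / 2) * (1 - (1/2) ^ m)" using Suc by (intro add_mono) auto
    also have "\<dots> = (\<delta> / 2) * (1 - (1/2) ^ Suc m)" by (simp add: field_simps)
    finally have 1: "dd (\<phi>s (Suc m) a) q \<le> (\<delta> / 2) * (1 - (1/2) ^ Suc m)" .
    have "dd (\<phi>s (Suc (Suc m)) a) (\<phi>s (Suc m) a) \<le> dd (\<phi>s (Suc m) a) (\<phi>s m a) / 2"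
      unfolding \<phi>s_Suc[of "Suc m"] \<phi>s_Suc[of m a]
      using nr[OF 1 \<phi>sj] nr[of "\<phi>s m a" m] Suc \<phi>sj
      by (intro T_contr) (auto simp: \<phi>s_Suc[symmetric])
    also have "\<dots> \<le> (\<delta> / 4) * (1/2) ^ Suc m" using Suc by simp
    finally show ?case using 1 by blast
  qed
  have near_\<phi>s: "near \<delta> q (\<phi>s m a)" if a: "a \<in> ball (q j) r" for m a
    unfolding near_def
  proof (intro allI impI)
    fix i assume "i \<le> n"
    have "(\<delta> / 2) * (1 - (1/2) ^ m) \<le> \<delta> / 2 * 1" using \<delta> by (intro mult_left_mono) auto
    hence "dd (\<phi>s m a) q < \<delta>" using iter[OF a, of m] \<delta> by linarith
    thus "cmod (\<phi>s m a i - q i) < \<delta>"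
      using dd_ge[of i "\<phi>s m a" q] \<open>i \<le> n\<close> \<phi>sj[of m a] a r(2)
      by (cases "i = j") (auto simp: dist_norm norm_minus_commute)
  qed
  \<comment> \<open>The limit is written as a telescoping series so that the Weierstrass test gives
    uniform convergence.\<close>
  define \<phi> where "\<phi> a = (\<lambda>k\<in>{0..n}. if k = j then a else q k + (suminf (\<lambda>m. \<phi>s (Suc m) a k - \<phi>s m a k)))" for a
  have ulim: "uniform_limit (ball (q j) r) (\<lambda>m a. \<phi>s m a k) (\<lambda>a. \<phi> a k) sequentially" if k: "k \<in> ?K" for k
  proof -
    have "uniform_limit (ball (q j) r) (\<lambda>m a. \<Sum>l<m. \<phi>s (Suc l) a k - \<phi>s l a k)
        (\<lambda>a. suminf (\<lambda>m. \<phi>s (Suc m) a k - \<phi>s m a k)) sequentially"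
    proof (rule Weierstrass_m_test)
      fix m a assume "a \<in> ball (q j) r"
      thus "cmod (\<phi>s (Suc m) a k - \<phi>s m a k) \<le> (\<delta> / 4) * (1/2) ^ m"
        using iter[of a m] dd_ge[OF k, of "\<phi>s (Suc m) a" "\<phi>s m a"] by linarith
    qed (intro summable_mult summable_geometric, simp)
    hence "uniform_limit (ball (q j) r) (\<lambda>m a. \<phi>s m a k - q k) (\<lambda>a. suminf (\<lambda>m. \<phi>s (Suc m) a k - \<phi>s m a k)) sequentially"
    proof -
      have "(\<Sum>l<m. \<phi>s (Suc l) a k - \<phi>s l a k) = \<phi>s m a k - q k" for m a
        using k sum_lessThan_telescope[of "\<lambda>l. \<phi>s l a k" m] by (simp add: \<phi>s_0)
      thus "uniform_limit (ball (q j) r) (\<lambda>m a. \<Sum>l<m. \<phi>s (Suc l) a k - \<phi>s l a k)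
          (\<lambda>a. suminf (\<lambda>m. \<phi>s (Suc m) a k - \<phi>s m a k)) sequentially \<Longrightarrow> ?thesis" by simp
    qed
    hence "uniform_limit (ball (q j) r) (\<lambda>m a. q k + (\<phi>s m a k - q k))
        (\<lambda>a. q k + (suminf (\<lambda>m. \<phi>s (Suc m) a k - \<phi>s m a k))) sequentially"
      by (intro uniform_limit_intros)
    thus ?thesis using k by (simp add: \<phi>_def)
  qed
  have lim: "(\<lambda>m. \<phi>s m a k) \<longlonglongrightarrow> \<phi> a k" if "a \<in> ball (q j) r" "k \<in> ?K" for a k
    using tendsto_uniform_limitI[OF ulim that(1)] that(2) by blast
  have "section_at q \<delta> r \<phi>"
    unfolding section_at_def
  proof (intro conjI allI impI ballI \<delta> r(1))
    fix i assume "i \<le> n"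
    show "(\<lambda>a. \<phi> a i) holomorphic_on ball (q j) r"
    proof (cases "i = j")
      case True thus ?thesis using j by (simp add: \<phi>_def)
    next
      case False
      show ?thesis
      proof (rule holomorphic_uniform_sequence[OF open_ball])
        show "(\<lambda>a. \<phi>s m a i) holomorphic_on ball (q j) r" for m
          using hol_\<phi>s[of i m] \<open>i \<le> n\<close> by (auto intro: holomorphic_on_subset)
        fix a assume "a \<in> ball (q j) r"
        then obtain d where "d > 0" "cball a d \<subseteq> ball (q j) r" by (meson open_ball open_contains_cball)
        moreover have "uniform_limit (ball (q j) r) (\<lambda>m a. \<phi>s m a i) (\<lambda>a. \<phi> a i) sequentially"
          using ulim False \<open>i \<le> n\<close> by auto
        ultimately show "\<exists>d>0. cball a d \<subseteq> ball (q j) r \<and> uniform_limit (cball a d) (\<lambda>m a. \<phi>s m a i) (\<lambda>a. \<phi> a i) sequentially"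
          using uniform_limit_on_subset by blast
      qed
    qed
  next
    fix a assume a: "a \<in> ball (q j) r"
    show "\<phi> a \<in> {0..n} \<rightarrow>\<^sub>E UNIV" "\<phi> a j = a" using j by (auto simp: \<phi>_def)
    show "near \<delta> q (\<phi> a)"
      unfolding near_def
    proof (intro allI impI)
      fix i assume i: "i \<le> n"
      show "cmod (\<phi> a i - q i) < \<delta>"
      proof (cases "i = j")
        case True thus ?thesis using a r(2) j by (simp add: \<phi>_def dist_norm norm_minus_commute)
      next
        case False
        hence iK: "i \<in> ?K" using i by auto
        have "cmod (\<phi> a i - q i) \<le> \<delta> / 2"
        proof (rule tendsto_upperbound)
          show "(\<lambda>m. cmod (\<phi>s m a i - q i)) \<longlonglongrightarrow> cmod (\<phi> a i - q i)"
            by (intro tendsto_intros lim[OF a iK])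
          have "cmod (\<phi>s m a i - q i) \<le> \<delta> / 2" for m
          proof -
            have "(\<delta> / 2) * (1 - (1/2) ^ m) \<le> \<delta> / 2 * 1" using \<delta> by (intro mult_left_mono) auto
            thus ?thesis using iter[OF a, of m] dd_ge[OF iK, of "\<phi>s m a" q] by linarith
          qed
          thus "\<forall>\<^sub>F m in sequentially. cmod (\<phi>s m a i - q i) \<le> \<delta> / 2" by simp
        qed simp
        thus ?thesis using \<delta> by simp
      qed
    qed
  next
    \<comment> \<open>A point of \<open>V\<close> is fixed by the Newton map, hence the iterates
      contract towards it and their limit is this point.\<close>
    fix x assume x: "x \<in> V" "x j \<in> ball (q j) r \<and> near \<delta> q x"
    define a where "a = x j"
    have a: "a \<in> ball (q j) r" using x by (simp add: a_def)
    have "dd (\<phi>s m a) x \<le> dd (\<phi>s 0 a) x * (1/2) ^ m" for m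
    proof (induction m)
      case (Suc m)
      have "dd (\<phi>s (Suc m) a) x = dd (T a (\<phi>s m a)) (T a x)"
        using T_fix[OF x(1)] by (simp add: \<phi>s_Suc a_def)
      also have "\<dots> \<le> dd (\<phi>s m a) x / 2"
        using x near_\<phi>s[OF a] \<phi>sj by (intro T_contr) (auto simp: a_def)
      finally show ?case using Suc by simp
    qed simp
    note decay = this
    have "\<phi> a k = x k" if k: "k \<in> ?K" for k
    proof -
      have "(\<lambda>m. \<phi>s m a k - x k) \<longlonglongrightarrow> 0"
      proof (rule Lim_null_comparison)
        show "\<forall>\<^sub>F m in sequentially. norm (\<phi>s m a k - x k) \<le> dd (\<phi>s 0 a) x * (1/2) ^ m"
          using decay dd_ge[OF k] by (intro always_eventually allI) (meson order_trans)
        show "(\<lambda>m. dd (\<phi>s 0 a) x * (1/2) ^ m) \<longlonglongrightarrow> 0"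
          by (intro tendsto_mult_right_zero LIMSEQ_power_zero) simp
      qed
      thus ?thesis using lim[OF a k] LIMSEQ_unique by (auto simp: LIM_zero_iff)
    qed
    moreover have "x \<in> {0..n} \<rightarrow>\<^sub>E UNIV" using x V by auto
    ultimately have "x = \<phi> a"
      by (intro ext) (auto simp: \<phi>_def a_def PiE_def extensional_def)
    thus "x = \<phi> (x j)" by (simp add: a_def)
  qed
  thus ?thesis by blast
qed

end

section \<open>Lifting the exponential\<close>

lemma continuous_on_locally:
  fixes f :: "'a::t2_space \<Rightarrow> 'b::topological_space"
  assumes "\<And>x. x \<in> S \<Longrightarrow> \<exists>T. open T \<and> x \<in> T \<and> continuous_on (S \<inter> T) f"
  shows "continuous_on S f"
  unfolding continuous_on_eq_continuous_within
proof
  fix x assume x: "x \<in> S"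
  then obtain T where T: "open T" "x \<in> T" "continuous_on (S \<inter> T) f" using assms by blast
  have "at x within S = at x within (S \<inter> T)"
    by (rule at_within_nhd[OF T(2,1)]) auto
  thus "continuous (at x within S) f"
    using T x by (simp add: continuous_on_eq_continuous_within)
qed

text \<open>A covering enters only through its fibres inside one fixed space, so no total space or
  projection has to be formed.\<close>

definition lift_over :: "(complex \<Rightarrow> 'p::topological_space set) \<Rightarrow> complex set \<Rightarrow> (complex \<Rightarrow> 'p) \<Rightarrow> bool" where
  "lift_over \<F> A X \<longleftrightarrow> continuous_on A X \<and> (\<forall>z\<in>A. X z \<in> \<F> z)"

definition unique_lifts :: "(complex \<Rightarrow> 'p::topological_space set) \<Rightarrow> complex set \<Rightarrow> bool" where
  "unique_lifts \<F> H \<longleftrightarrow> (\<forall>A X Y. A \<subseteq> H \<longrightarrow> connected A \<longrightarrow> lift_over \<F> A X \<longrightarrow> lift_over \<F> A Y \<longrightarrow>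
     (\<exists>t\<in>A. X t = Y t) \<longrightarrow> (\<forall>t\<in>A. X t = Y t))"

lemma lift_over_subset: "lift_over \<F> A X \<Longrightarrow> B \<subseteq> A \<Longrightarrow> lift_over \<F> B X"
  unfolding lift_over_def using continuous_on_subset by blast

lemma unique_liftsD:
  assumes "unique_lifts \<F> H" "A \<subseteq> H" "connected A" "lift_over \<F> A X" "lift_over \<F> A Y"
    "s \<in> A" "X s = Y s" "t \<in> A"
  shows "X t = Y t"
  using assms unfolding unique_lifts_def by blast

lemma unique_lifts_subset: "unique_lifts \<F> H \<Longrightarrow> H' \<subseteq> H \<Longrightarrow> unique_lifts \<F> H'"
  unfolding unique_lifts_def by blast

text \<open>Uniqueness makes lifts with the same value at the base point agree on the smaller set.
  The open sets in \<open>exhaust\<close> ensure that the union of the lifts is continuous.\<close>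

lemma glue_lifts:
  fixes A :: "nat \<Rightarrow> complex set"
  assumes uniq: "unique_lifts \<F> H"
    and A: "\<And>k. A k \<subseteq> H" "\<And>k. connected (A k)" "\<And>k l. k \<le> l \<Longrightarrow> A k \<subseteq> A l" "\<zeta>0 \<in> A 0"
    and exhaust: "\<And>z. z \<in> H \<Longrightarrow> \<exists>k T. open T \<and> z \<in> T \<and> H \<inter> T \<subseteq> A k"
    and lifts: "\<And>k. \<exists>X. lift_over \<F> (A k) X \<and> X \<zeta>0 = q"
  shows "\<exists>X. lift_over \<F> H X \<and> X \<zeta>0 = q"
proof -
  obtain X where X: "\<And>k. lift_over \<F> (A k) (X k)" "\<And>k. X k \<zeta>0 = q" using lifts by metis
  have A0: "\<zeta>0 \<in> A k" for k using A(3)[OF le0, of k] A(4) by blast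
  have le: "X k z = X l z" if "k \<le> l" "z \<in> A k" for k l z
    by (rule unique_liftsD[OF uniq A(1) A(2) X(1) lift_over_subset[OF X(1) A(3)[OF that(1)]] A0 _ that(2)])
      (simp add: X(2))
  have eq: "X k z = X l z" if "z \<in> A k" "z \<in> A l" for k l z
  proof (cases "k \<le> l")
    case True
    show ?thesis by (rule le[OF True that(1)])
  next
    case False
    show ?thesis by (rule le[symmetric]) (use False that in auto)
  qed
  define \<kappa> where "\<kappa> z = (SOME k. z \<in> A k)" for z
  have \<kappa>: "z \<in> A (\<kappa> z)" if "z \<in> H" for z
  proof -
    from exhaust[OF that] obtain k T where "z \<in> T" "H \<inter> T \<subseteq> A k" by blast
    hence "\<exists>k. z \<in> A k" using that by (intro exI[of _ k]) auto
    thus ?thesis unfolding \<kappa>_def by (rule someI_ex)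
  qed
  define Y where "Y z = X (\<kappa> z) z" for z
  have YX: "Y z = X k z" if "z \<in> A k" for z k
    unfolding Y_def using eq[OF \<kappa> that] that A(1)[of k] by auto
  have "continuous_on H Y"
  proof (rule continuous_on_locally)
    fix z assume "z \<in> H"
    then obtain k T where T: "open T" "z \<in> T" "H \<inter> T \<subseteq> A k" using exhaust by blast
    have "continuous_on (H \<inter> T) (X k)"
      using X(1)[of k] T(3) continuous_on_subset unfolding lift_over_def by blast
    moreover have "Y w = X k w" if "w \<in> H \<inter> T" for w using YX that T(3) by blast
    ultimately have "continuous_on (H \<inter> T) Y" by (metis continuous_on_eq)
    thus "\<exists>T. open T \<and> z \<in> T \<and> continuous_on (H \<inter> T) Y" using T by blast
  qed
  moreover have "Y z \<in> \<F> z" if "z \<in> H" for z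
    using X(1)[of "\<kappa> z"] \<kappa>[OF that] by (simp add: Y_def lift_over_def)
  moreover have "Y \<zeta>0 = q" using YX[OF A0[of 0]] X(2)[of 0] by simp
  ultimately show ?thesis unfolding lift_over_def by blast
qed

text \<open>Monodromy without homotopies: if local lifts exist on balls of one common radius, a lift
  on a disc around the base point extends to the disc that is larger by half that radius.\<close>

lemma convex_lift:
  assumes H: "convex H" and r: "r > 0" and uniq: "unique_lifts \<F> H"
    and sect: "\<And>\<zeta> q. \<zeta> \<in> H \<Longrightarrow> q \<in> \<F> \<zeta> \<Longrightarrow> \<exists>\<Phi>. lift_over \<F> (ball \<zeta> r \<inter> H) \<Phi> \<and> \<Phi> \<zeta> = q"
    and start: "\<zeta>0 \<in> H" "q \<in> \<F> \<zeta>0"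
  shows "\<exists>X. lift_over \<F> H X \<and> X \<zeta>0 = q"
proof -
  define A where "A k = cball \<zeta>0 (real k * (r / 2)) \<inter> H" for k :: nat
  have cvx: "convex (A k)" for k unfolding A_def by (intro convex_Int convex_cball H)
  have A0: "\<zeta>0 \<in> A k" for k using start r by (auto simp: A_def)
  have AH: "A k \<subseteq> H" for k by (auto simp: A_def)
  have step: "\<exists>X. lift_over \<F> (A k) X \<and> X \<zeta>0 = q" for k
  proof (induction k)
    case 0
    have "A 0 = {\<zeta>0}" using start by (auto simp: A_def)
    thus ?case using start by (intro exI[of _ "\<lambda>_. q"]) (auto simp: lift_over_def)
  next
    case (Suc k)
    then obtain X where X: "lift_over \<F> (A k) X" "X \<zeta>0 = q" by blast
    \<comment> \<open>Shrinking towards the base point maps the larger piece into the smaller one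
      and moves each point by at most \<open>r / 2\<close>, so the local lift at
      \<open>\<rho> z\<close> reaches \<open>z\<close>.\<close>
    define \<rho> where "\<rho> z = \<zeta>0 + (real k / real (Suc k)) *\<^sub>R (z - \<zeta>0)" for z
    have \<rho>A: "\<rho> z \<in> A k" if z: "z \<in> A (Suc k)" for z
    proof -
      have "\<rho> z = (1 - real k / real (Suc k)) *\<^sub>R \<zeta>0 + (real k / real (Suc k)) *\<^sub>R z"
        by (simp add: \<rho>_def algebra_simps)
      also have "\<dots> \<in> H" using z start AH by (intro convexD[OF H]) auto
      finally have "\<rho> z \<in> H" .
      have "dist \<zeta>0 (\<rho> z) = (real k / real (Suc k)) * dist \<zeta>0 z"
        by (simp add: \<rho>_def dist_norm norm_minus_commute)
      also have "\<dots> \<le> (real k / real (Suc k)) * (real (Suc k) * (r / 2))"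
        using z by (intro mult_left_mono) (auto simp: A_def)
      finally show ?thesis using \<open>\<rho> z \<in> H\<close> by (simp add: A_def del: of_nat_Suc)
    qed
    have \<rho>d: "dist (\<rho> z) z \<le> r / 2" if z: "z \<in> A (Suc k)" for z
    proof -
      have "\<rho> z - z = - (1 / real (Suc k)) *\<^sub>R (z - \<zeta>0)"
      proof -
        have "real k / real (Suc k) = 1 - 1 / real (Suc k)" by (simp add: field_simps)
        hence "\<rho> z = \<zeta>0 + (1 - 1 / real (Suc k)) *\<^sub>R (z - \<zeta>0)" by (simp only: \<rho>_def)
        thus ?thesis by (simp only: scaleR_diff_left scaleR_one scaleR_minus_left) simp
      qed
      hence "dist (\<rho> z) z = (1 / real (Suc k)) * dist \<zeta>0 z"
        by (simp add: dist_norm norm_minus_commute del: of_nat_Suc)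
      also have "\<dots> \<le> (1 / real (Suc k)) * (real (Suc k) * (r / 2))"
        using z by (intro mult_left_mono) (auto simp: A_def)
      finally show ?thesis by (simp del: of_nat_Suc)
    qed
    have \<rho>lip: "dist (\<rho> z) (\<rho> w) \<le> dist z w" for z w
    proof -
      have "\<rho> z - \<rho> w = (real k / real (Suc k)) *\<^sub>R (z - w)" by (simp add: \<rho>_def algebra_simps)
      hence "dist (\<rho> z) (\<rho> w) = (real k / real (Suc k)) * dist z w" by (simp add: dist_norm del: of_nat_Suc)
      also have "\<dots> \<le> 1 * dist z w" by (intro mult_right_mono) auto
      finally show ?thesis by simp
    qed
    have "\<forall>w\<in>A k. \<exists>\<Phi>. lift_over \<F> (ball w r \<inter> H) \<Phi> \<and> \<Phi> w = X w"
    proof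
      fix w assume "w \<in> A k"
      thus "\<exists>\<Phi>. lift_over \<F> (ball w r \<inter> H) \<Phi> \<and> \<Phi> w = X w"
        using X(1) AH[of k] sect[of w "X w"] by (auto simp: lift_over_def)
    qed
    then obtain \<Phi> where \<Phi>: "\<And>w. w \<in> A k \<Longrightarrow> lift_over \<F> (ball w r \<inter> H) (\<Phi> w)" "\<And>w. w \<in> A k \<Longrightarrow> \<Phi> w w = X w"
      by (subst (asm) bchoice_iff) blast
    define Y where "Y z = \<Phi> (\<rho> z) z" for z
    \<comment> \<open>Near \<open>z1\<close> the local lift based at \<open>\<rho> z1\<close> can
      replace the one based at \<open>\<rho> z\<close>, since the two agree at
      \<open>\<rho> z\<close>. Continuity of \<open>Y\<close> follows.\<close>
    have loc: "Y z = \<Phi> (\<rho> z1) z" if z: "z \<in> A (Suc k)" "z1 \<in> A (Suc k)" "dist z z1 < r / 2" for z z1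
    proof -
      let ?w = "\<rho> z" and ?w1 = "\<rho> z1"
      have w: "?w \<in> A k" "?w1 \<in> A k" using \<rho>A z by auto
      have wb: "?w \<in> ball ?w1 r" using \<rho>lip[of z1 z] z(3) r by (simp add: dist_commute)
      have "X ?w = \<Phi> ?w1 ?w"
      proof (rule unique_liftsD[OF uniq, of "ball ?w1 r \<inter> A k" _ _ ?w1])
        show "connected (ball ?w1 r \<inter> A k)" by (intro convex_connected convex_Int convex_ball cvx)
        show "lift_over \<F> (ball ?w1 r \<inter> A k) X" by (rule lift_over_subset[OF X(1)]) auto
        show "lift_over \<F> (ball ?w1 r \<inter> A k) (\<Phi> ?w1)" by (rule lift_over_subset[OF \<Phi>(1)]) (use w AH in auto)
      qed (use w AH wb r \<Phi>(2) in auto)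
      hence at_w: "\<Phi> ?w ?w = \<Phi> ?w1 ?w" using \<Phi>(2) w by simp
      have "dist ?w1 z \<le> dist ?w1 z1 + dist z1 z" by (rule dist_triangle)
      hence zb: "dist ?w1 z < r" using \<rho>d[OF z(2)] z(3) by (simp add: dist_commute)
      show ?thesis unfolding Y_def
      proof (rule unique_liftsD[OF uniq, of "ball ?w r \<inter> (ball ?w1 r \<inter> H)" "\<Phi> ?w" "\<Phi> ?w1" ?w z])
        show "connected (ball ?w r \<inter> (ball ?w1 r \<inter> H))" by (intro convex_connected convex_Int convex_ball H)
        show "lift_over \<F> (ball ?w r \<inter> (ball ?w1 r \<inter> H)) (\<Phi> ?w)" by (rule lift_over_subset[OF \<Phi>(1)]) (use w in auto)
        show "lift_over \<F> (ball ?w r \<inter> (ball ?w1 r \<inter> H)) (\<Phi> ?w1)" by (rule lift_over_subset[OF \<Phi>(1)]) (use w in auto)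
        show "z \<in> ball ?w r \<inter> (ball ?w1 r \<inter> H)" using \<rho>d[OF z(1)] zb z(1) AH r by auto
      qed (use w AH wb r at_w in auto)
    qed
    have "continuous_on (A (Suc k)) Y"
    proof (rule continuous_on_locally)
      fix z1 assume z1: "z1 \<in> A (Suc k)"
      have sub: "A (Suc k) \<inter> ball z1 (r / 2) \<subseteq> ball (\<rho> z1) r \<inter> H"
      proof
        fix z assume z: "z \<in> A (Suc k) \<inter> ball z1 (r / 2)"
        have "dist (\<rho> z1) z \<le> dist (\<rho> z1) z1 + dist z1 z" by (rule dist_triangle)
        thus "z \<in> ball (\<rho> z1) r \<inter> H" using \<rho>d[OF z1] z AH by auto
      qed
      have "continuous_on (A (Suc k) \<inter> ball z1 (r / 2)) (\<Phi> (\<rho> z1))"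
        using \<Phi>(1)[OF \<rho>A[OF z1]] continuous_on_subset[OF _ sub] unfolding lift_over_def by blast
      moreover have "Y z = \<Phi> (\<rho> z1) z" if "z \<in> A (Suc k) \<inter> ball z1 (r / 2)" for z
        using that by (intro loc z1) (auto simp: dist_commute)
      ultimately have "continuous_on (A (Suc k) \<inter> ball z1 (r / 2)) Y" by (metis continuous_on_eq)
      thus "\<exists>T. open T \<and> z1 \<in> T \<and> continuous_on (A (Suc k) \<inter> T) Y"
        using r by (intro exI[of _ "ball z1 (r / 2)"]) auto
    qed
    moreover have "Y z \<in> \<F> z" if "z \<in> A (Suc k)" for z
    proof -
      have "z \<in> ball (\<rho> z) r \<inter> H" using \<rho>d[OF that] r that AH by auto
      thus ?thesis using \<Phi>(1)[OF \<rho>A[OF that]] by (simp add: Y_def lift_over_def)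
    qed
    moreover have "Y \<zeta>0 = q"
    proof -
      have "\<rho> \<zeta>0 = \<zeta>0" by (simp add: \<rho>_def)
      thus ?thesis using \<Phi>(2)[OF A0] X(2) by (simp add: Y_def)
    qed
    ultimately show ?case unfolding lift_over_def by blast
  qed
  show ?thesis
  proof (rule glue_lifts[OF uniq AH convex_connected[OF cvx] _ A0 _ step])
    show "A k \<subseteq> A l" if "k \<le> l" for k l
    proof -
      have "real k * (r / 2) \<le> real l * (r / 2)" using that r by (intro mult_right_mono) auto
      thus ?thesis by (auto simp: A_def)
    qed
    fix z assume "z \<in> H"
    obtain k :: nat where "dist \<zeta>0 z / (r / 2) < real k" using reals_Archimedean2 by blast
    hence "dist \<zeta>0 z < real k * (r / 2)" using r by (simp add: field_simps)
    thus "\<exists>k T. open T \<and> z \<in> T \<and> H \<inter> T \<subseteq> A k"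
      by (intro exI[of _ k] exI[of _ "ball \<zeta>0 (real k * (r / 2))"]) (auto simp: A_def)
  qed
qed

section \<open>Lifts of the patch over the left half-plane\<close>

context patch_curve
begin

text \<open>The nonisolated points of \<open>V\<close>. They stand in for the one-dimensional part
  of the patch, for which no dimension theory is developed.\<close>

definition accum :: "(nat \<Rightarrow> complex) \<Rightarrow> bool" where
  "accum q \<longleftrightarrow> q \<in> V \<and> (\<forall>\<epsilon>>0. \<exists>x\<in>V. x \<noteq> q \<and> near \<epsilon> q x)"

lemma eventually_near:
  assumes "\<And>i. i \<le> n \<Longrightarrow> ((\<lambda>t. f t i) \<longlongrightarrow> q i) F" "\<delta> > 0"
  shows "\<forall>\<^sub>F t in F. near \<delta> q (f t)"
proof -
  have "\<forall>\<^sub>F t in F. \<forall>i\<in>{..n}. cmod (f t i - q i) < \<delta>"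
  proof (rule eventually_ball_finite)
    show "\<forall>i\<in>{..n}. \<forall>\<^sub>F t in F. cmod (f t i - q i) < \<delta>"
      using tendstoD[OF assms(1) assms(2)] by (auto simp: dist_norm)
  qed auto
  thus ?thesis by (rule eventually_mono) (simp add: near_def)
qed

lemma near_nhd:
  assumes "near \<delta> q q'"
  obtains \<epsilon> where "\<epsilon> > 0" "\<And>x. near \<epsilon> q' x \<Longrightarrow> near \<delta> q x"
proof
  let ?\<epsilon> = "Min ((\<lambda>i. \<delta> - cmod (q' i - q i)) ` {..n})"
  show "?\<epsilon> > 0" using assms by (subst Min_gr_iff) (auto simp: near_def)
  fix x assume x: "near ?\<epsilon> q' x"
  show "near \<delta> q x"
    unfolding near_def
  proof (intro allI impI)
    fix i assume i: "i \<le> n"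
    have "?\<epsilon> \<le> \<delta> - cmod (q' i - q i)" using i by (intro Min_le) auto
    hence "cmod (x i - q' i) + cmod (q' i - q i) < \<delta>" using x i by (force simp: near_def)
    thus "cmod (x i - q i) < \<delta>" by (rule le_less_trans[OF norm_diff_triangle_le[OF order_refl order_refl]])
  qed
qed

lemma V_ext: "x \<in> V \<Longrightarrow> x \<in> {0..n} \<rightarrow>\<^sub>E UNIV"
  using V by auto

lemma ext_eqI: "x \<in> {0..n} \<rightarrow>\<^sub>E UNIV \<Longrightarrow> y \<in> {0..n} \<rightarrow>\<^sub>E UNIV \<Longrightarrow> (\<And>i. i \<le> n \<Longrightarrow> x i = y i) \<Longrightarrow> x = y"
  by (rule PiE_ext[of _ "{0..n}"]) auto

lemma V_limit:
  assumes "F \<noteq> bot" "\<forall>\<^sub>F t in F. f t \<in> V" "\<And>i. i \<le> n \<Longrightarrow> ((\<lambda>t. f t i) \<longlongrightarrow> z i) F"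
    and "z \<in> {0..n} \<rightarrow>\<^sub>E UNIV"
  shows "z \<in> V"
proof -
  have "eval g z = 0" if g: "g \<in> E" for g
  proof -
    have "((\<lambda>t. eval g (f t)) \<longlongrightarrow> eval g z) F"
      by (rule tendsto_eval[of g "{0..n}"]) (use g E assms in auto)
    moreover have "((\<lambda>t. eval g (f t)) \<longlongrightarrow> 0) F"
      using assms(2) g V by (intro tendsto_eventually) (auto elim: eventually_mono)
    ultimately show ?thesis using tendsto_unique[OF assms(1)] by blast
  qed
  thus ?thesis using assms(4) V by auto
qed

lemma section_at_tendsto:
  assumes "section_at q \<delta> r \<phi>" "a \<in> ball (q j) r" "i \<le> n"
  shows "((\<lambda>b. \<phi> b i) \<longlongrightarrow> \<phi> a i) (at a)"
proof -
  have "continuous_on (ball (q j) r) (\<lambda>b. \<phi> b i)"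
    using assms by (intro holomorphic_on_imp_continuous_on) (auto simp: section_at_def)
  thus ?thesis using assms(2) by (metis continuous_at continuous_on_eq_continuous_at open_ball)
qed

text \<open>Along the section each equation of \<open>V\<close> is a holomorphic function of the
  \<open>j\<close>-th coordinate with zeros accumulating inside a connected disc; hence it vanishes
  identically, and the entire graph consists of accumulation points.\<close>

lemma section_at_accum:
  assumes s: "section_at q \<delta> r \<phi>" and q': "accum q'" "near \<delta> q q'" "q' j \<in> ball (q j) r"
    and a: "a \<in> ball (q j) r"
  shows "accum (\<phi> a)"
proof -
  have graph: "x = \<phi> (x j)" if "x \<in> V" "x j \<in> ball (q j) r" "near \<delta> q x" for x
    using s that by (auto simp: section_at_def)
  have ext: "\<phi> b \<in> {0..n} \<rightarrow>\<^sub>E UNIV" "\<phi> b j = b" if "b \<in> ball (q j) r" for b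
    using s that by (auto simp: section_at_def)
  have q'V: "q' \<in> V" using q' by (auto simp: accum_def)
  let ?U = "{b \<in> ball (q j) r. \<phi> b \<in> V}"
  \<comment> \<open>Points of \<open>V\<close> close to \<open>q'\<close> lie on the same graph, so
    distinct points have distinct \<open>j\<close>-th coordinates and these accumulate at
    \<open>q' j\<close>.\<close>
  have lp: "q' j islimpt ?U"
    unfolding islimpt_approachable
  proof (intro allI impI)
    fix e :: real assume "e > 0"
    obtain \<epsilon> where \<epsilon>: "\<epsilon> > 0" "\<And>x. near \<epsilon> q' x \<Longrightarrow> near \<delta> q x" using near_nhd[OF q'(2)] by blast
    obtain e' where e': "e' > 0" "ball (q' j) e' \<subseteq> ball (q j) r" using q'(3) by (meson open_ball open_contains_ball)
    obtain x where x: "x \<in> V" "x \<noteq> q'" "near (min \<epsilon> (min e e')) q' x"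
      using q'(1) \<epsilon>(1) e' \<open>e > 0\<close> unfolding accum_def by (metis min_less_iff_conj)
    have "near \<epsilon> q' x" using x(3) by (auto simp: near_def)
    have d: "dist (x j) (q' j) < e" "dist (x j) (q' j) < e'" using x(3) j by (auto simp: near_def dist_norm)
    have xb: "x j \<in> ball (q j) r" using d(2) e'(2) by (metis dist_commute mem_ball subsetD)
    have "x = \<phi> (x j)" using graph[OF x(1) xb \<epsilon>(2)[OF \<open>near \<epsilon> q' x\<close>]] .
    moreover have "q' = \<phi> (q' j)" using graph[OF q'V q'(3,2)] .
    ultimately have "x j \<noteq> q' j" using x(2) by metis
    thus "\<exists>b\<in>?U. b \<noteq> q' j \<and> dist b (q' j) < e"
      using xb d(1) \<open>x = \<phi> (x j)\<close> x(1) by (intro bexI[of _ "x j"]) auto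
  qed
  have inV: "\<phi> b \<in> V" if b: "b \<in> ball (q j) r" for b
  proof -
    have "eval g (\<phi> b) = 0" if g: "g \<in> E" for g
    proof (rule analytic_continuation[OF _ open_ball connected_ball _ q'(3) lp _ b])
      show "(\<lambda>a. eval g (\<phi> a)) holomorphic_on ball (q j) r"
        by (rule holomorphic_on_eval[of g "{0..n}"]) (use s g E in \<open>auto simp: section_at_def\<close>)
    qed (use g V in auto)
    thus ?thesis using ext[OF b] V by auto
  qed
  show ?thesis
    unfolding accum_def
  proof (intro conjI allI impI inV a)
    fix \<epsilon> :: real assume "\<epsilon> > 0"
    have "\<forall>\<^sub>F b in at a. near \<epsilon> (\<phi> a) (\<phi> b)"
      using section_at_tendsto[OF s a] \<open>\<epsilon> > 0\<close> by (intro eventually_near)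
    moreover have "\<forall>\<^sub>F b in at a. b \<in> ball (q j) r" using a by (intro eventually_at_in_open') auto
    moreover have "\<forall>\<^sub>F b in at a. b \<noteq> a" by (simp add: eventually_at_filter)
    ultimately have "\<forall>\<^sub>F b in at a. near \<epsilon> (\<phi> a) (\<phi> b) \<and> b \<in> ball (q j) r \<and> b \<noteq> a" by eventually_elim auto
    from eventually_happens'[OF at_neq_bot this]
    obtain b where "near \<epsilon> (\<phi> a) (\<phi> b)" "b \<in> ball (q j) r" "b \<noteq> a" by blast
    thus "\<exists>x\<in>V. x \<noteq> \<phi> a \<and> near \<epsilon> (\<phi> a) x"
      using ext(2)[of b] ext(2)[OF a] inV by (intro bexI[of _ "\<phi> b"]) auto
  qed
qed

text \<open>The coincidence set is closed, and open because a local section is determined by the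
  \<open>j\<close>-th coordinate. The domain is any connected space, so that the lemma covers
  subsets of the half-plane, circular paths and real arcs.\<close>

lemma path_unique:
  fixes A :: "'b::topological_space set"
  assumes A: "connected A" and cont: "\<And>i. i \<le> n \<Longrightarrow> continuous_on A (\<lambda>t. X t i)" "\<And>i. i \<le> n \<Longrightarrow> continuous_on A (\<lambda>t. Y t i)"
    and V: "\<And>t. t \<in> A \<Longrightarrow> X t \<in> V" "\<And>t. t \<in> A \<Longrightarrow> Y t \<in> V"
    and jj: "\<And>t. t \<in> A \<Longrightarrow> X t j = Y t j" "\<And>t. t \<in> A \<Longrightarrow> X t j \<noteq> 0" "\<And>t. t \<in> A \<Longrightarrow> cmod (X t j) \<le> \<bar>\<tau>\<bar>"
    and eq: "s \<in> A" "X s = Y s" and t: "t \<in> A"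
  shows "X t = Y t"
proof -
  have "(X s = Y s) = (X t = Y t)"
  proof (rule connected_local_const[OF A eq(1) t])
    show "\<forall>a\<in>A. \<forall>\<^sub>F b in at a within A. (X a = Y a) = (X b = Y b)"
    proof
      fix a assume a: "a \<in> A"
      have lim: "((\<lambda>t. X t i) \<longlongrightarrow> X a i) (at a within A)" "((\<lambda>t. Y t i) \<longlongrightarrow> Y a i) (at a within A)" if "i \<le> n" for i
        using cont[OF that] a by (auto simp: continuous_on_def)
      show "\<forall>\<^sub>F b in at a within A. (X a = Y a) = (X b = Y b)"
      proof (cases "X a = Y a")
        case True
        obtain \<delta> r \<phi> where s: "section_at (X a) \<delta> r \<phi>" using local_section V(1) jj(2,3) a by blast
        hence \<delta>: "\<delta> > 0" "r > 0" by (auto simp: section_at_def)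
        have "\<forall>\<^sub>F b in at a within A. near \<delta> (X a) (X b)" "\<forall>\<^sub>F b in at a within A. near r (X a) (X b)"
          "\<forall>\<^sub>F b in at a within A. near \<delta> (X a) (Y b)"
          using lim True \<delta> by (auto intro!: eventually_near)
        moreover have "\<forall>\<^sub>F b in at a within A. b \<in> A" by (simp add: eventually_at_filter)
        ultimately show ?thesis
        proof eventually_elim
          case (elim b)
          hence "X b j \<in> ball (X a j) r" using j by (auto simp: near_def dist_norm norm_minus_commute)
          have graph: "x = \<phi> (x j)" if "x \<in> V" "x j \<in> ball (X a j) r" "near \<delta> (X a) x" for x
            using s that by (auto simp: section_at_def)
          have "X b = \<phi> (X b j)" using graph[OF V(1)] elim \<open>X b j \<in> _\<close> by blast
          also have "X b j = Y b j" using jj(1) elim by blast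
          also have "\<phi> (Y b j) = Y b"
            using graph[OF V(2), of b] elim \<open>X b j \<in> _\<close> jj(1)[of b] by simp
          finally show ?case using True by simp
        qed
      next
        case False
        then obtain i where i: "i \<le> n" "X a i \<noteq> Y a i" using V a by (metis V_ext ext_eqI)
        have "\<forall>\<^sub>F b in at a within A. X b i - Y b i \<noteq> 0"
          using i by (intro tendsto_imp_eventually_ne[OF tendsto_diff[OF lim]]) auto
        thus ?thesis by (rule eventually_mono) (use False in auto)
      qed
    qed
  qed
  thus ?thesis using eq by simp
qed

text \<open>Pulls the patch back to the universal cover of the punctured disc: the imaginary axis
  covers the circle of the procedure, the negative real axis the radial segment.\<close>

definition fibre :: "complex \<Rightarrow> (nat \<Rightarrow> complex) set" where
  "fibre \<zeta> = {q. accum q \<and> q j = complex_of_real \<tau> * exp \<zeta>}"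

definition left_half :: "complex set" where
  "left_half = {\<zeta>. Re \<zeta> \<le> 0}"

lemma fibreD:
  assumes "q \<in> fibre \<zeta>" "\<zeta> \<in> left_half"
  shows "q \<in> V" "q j \<noteq> 0" "cmod (q j) \<le> \<bar>\<tau>\<bar>"
  using assms tau by (auto simp: fibre_def left_half_def accum_def norm_mult mult_left_le)

lemma convex_left_half: "convex left_half"
  unfolding left_half_def using convex_halfspace_Re_le[of 0] by simp

lemma unique_lifts_left_half: "unique_lifts fibre left_half"
  unfolding unique_lifts_def
proof (intro allI impI ballI)
  fix A X Y t
  assume A: "A \<subseteq> left_half" "connected A" and X: "lift_over fibre A X" and Y: "lift_over fibre A Y"
    and ex: "\<exists>t\<in>A. X t = Y t" and t: "t \<in> A"
  have X': "X t \<in> fibre t" "Y t \<in> fibre t" if "t \<in> A" for t using X Y that by (auto simp: lift_over_def)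
  obtain s where s: "s \<in> A" "X s = Y s" using ex by blast
  have cont: "continuous_on A (\<lambda>t. X t i)" "continuous_on A (\<lambda>t. Y t i)" for i
    using X Y unfolding lift_over_def by (blast intro: continuous_on_product_then_coordinatewise)+
  have jj: "X t j = Y t j" if "t \<in> A" for t using X'[OF that] by (simp add: fibre_def)
  show "X t = Y t"
  proof (rule path_unique[of A X Y s t])
    fix u assume u: "u \<in> A"
    show "X u \<in> V" "Y u \<in> V" "X u j \<noteq> 0" "cmod (X u j) \<le> \<bar>\<tau>\<bar>"
      using fibreD[OF X'(1)[OF u]] fibreD[OF X'(2)[OF u]] A(1) u by blast+
  qed (use A(2) cont jj s t in auto)
qed

text \<open>Compactness of the part of \<open>V\<close> with
  \<open>\<eta> \<le> cmod (x j) \<le> \<bar>\<tau>\<bar>\<close>: points whose admissible radii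
  shrink to zero would accumulate at a point of \<open>V\<close>, and the section there serves all
  nearby points with half its radius.\<close>

lemma uniform_sections:
  assumes \<eta>: "\<eta> > 0"
  shows "\<exists>r>0. \<forall>q. accum q \<longrightarrow> \<eta> \<le> cmod (q j) \<longrightarrow> cmod (q j) \<le> \<bar>\<tau>\<bar> \<longrightarrow>
    (\<exists>\<phi>. (\<forall>i\<le>n. continuous_on (ball (q j) r) (\<lambda>a. \<phi> a i)) \<and> \<phi> (q j) = q \<and>
      (\<forall>a\<in>ball (q j) r. accum (\<phi> a) \<and> \<phi> a j = a))"
proof (rule ccontr)
  define P where "P q r \<phi> \<longleftrightarrow> (\<forall>i\<le>n. continuous_on (ball (q j) r) (\<lambda>a. \<phi> a i)) \<and> \<phi> (q j) = q \<and>
      (\<forall>a\<in>ball (q j) r. accum (\<phi> a) \<and> \<phi> a j = a)" for q :: "nat \<Rightarrow> complex" and r and \<phi> :: "complex \<Rightarrow> nat \<Rightarrow> complex"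
  assume "\<not> ?thesis"
  hence "\<forall>m::nat. \<exists>q. accum q \<and> \<eta> \<le> cmod (q j) \<and> cmod (q j) \<le> \<bar>\<tau>\<bar> \<and> (\<nexists>\<phi>. P q (1 / real (Suc m)) \<phi>)"
    unfolding P_def by (metis of_nat_0_less_iff zero_less_Suc zero_less_divide_1_iff)
  then obtain q where "\<forall>m::nat. accum (q m) \<and> \<eta> \<le> cmod (q m j) \<and> cmod (q m j) \<le> \<bar>\<tau>\<bar> \<and>
      (\<nexists>\<phi>. P (q m) (1 / real (Suc m)) \<phi>)"
    by (subst (asm) choice_iff) blast
  hence q: "\<And>m. accum (q m)" "\<And>m. \<eta> \<le> cmod (q m j)" "\<And>m. cmod (q m j) \<le> \<bar>\<tau>\<bar>"
    "\<And>m::nat. \<nexists>\<phi>. P (q m) (1 / real (Suc m)) \<phi>" by blast+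
  have qV: "q m \<in> V" for m using q(1) by (auto simp: accum_def)
  obtain M where M: "\<And>x i. x \<in> V \<Longrightarrow> cmod (x j) \<le> \<bar>\<tau>\<bar> \<Longrightarrow> i \<le> n \<Longrightarrow> cmod (x i) \<le> M"
    using bounded by blast
  have "q m \<in> {0..n} \<rightarrow>\<^sub>E cball 0 M" for m
    using M[OF qV q(3)] V_ext[OF qV] by (auto simp: PiE_def)
  then obtain z s where z: "z \<in> {0..n} \<rightarrow>\<^sub>E cball 0 M" "strict_mono s" "(q \<circ> s) \<longlonglongrightarrow> z"
    using compact_box[of n M] unfolding compact_eq_seq_compact_metric seq_compact_def by metis
  have lim: "(\<lambda>m. q (s m) i) \<longlonglongrightarrow> z i" for i
    using tendsto_coordinate[OF z(3)] by (simp add: o_def)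
  have zV: "z \<in> V"
    by (rule V_limit[OF sequentially_bot _ lim]) (use qV z(1) in \<open>auto simp: PiE_def\<close>)
  have "\<eta> \<le> cmod (z j)"
    using q(2) by (intro tendsto_lowerbound[OF tendsto_norm[OF lim[of j]]]) auto
  hence zj: "z j \<noteq> 0" using \<eta> by auto
  have "cmod (z j) \<le> \<bar>\<tau>\<bar>"
    using q(3) by (intro tendsto_upperbound[OF tendsto_norm[OF lim[of j]]]) auto
  from local_section[OF zV zj this] obtain \<delta> r \<phi> where sec: "section_at z \<delta> r \<phi>" by blast
  hence pos: "\<delta> > 0" "r > 0" by (auto simp: section_at_def)
  have "\<forall>\<^sub>F m in sequentially. near \<delta> z (q (s m))" "\<forall>\<^sub>F m in sequentially. near (r/2) z (q (s m))"
    using lim pos by (auto intro!: eventually_near)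
  moreover have "\<forall>\<^sub>F m in sequentially. 1 / real (Suc m) < r / 2"
    using order_tendstoD(2)[OF LIMSEQ_inverse_real_of_nat, of "r/2"] pos by (simp add: inverse_eq_divide)
  ultimately have "\<forall>\<^sub>F m in sequentially. near \<delta> z (q (s m)) \<and> near (r/2) z (q (s m)) \<and> 1 / real (Suc m) < r / 2"
    by eventually_elim auto
  from eventually_happens'[OF sequentially_bot this]
  obtain m where m: "near \<delta> z (q (s m))" "near (r/2) z (q (s m))" "1 / real (Suc m) < r / 2" by blast
  let ?q = "q (s m)" and ?r = "1 / real (Suc (s m))"
  have "?r \<le> 1 / real (Suc m)"
    using seq_suble[OF z(2), of m] by (intro divide_left_mono) auto
  hence "?r < r / 2" using m(3) by linarith
  have d: "dist (z j) (?q j) < r / 2" using m(2) j by (auto simp: near_def dist_norm norm_minus_commute)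
  have sub: "ball (?q j) ?r \<subseteq> ball (z j) r"
  proof
    fix a assume "a \<in> ball (?q j) ?r"
    thus "a \<in> ball (z j) r" using d \<open>?r < r / 2\<close> dist_triangle[of "z j" a "?q j"] by auto
  qed
  have qb: "?q j \<in> ball (z j) r" using d pos by auto
  have "P ?q ?r \<phi>"
    unfolding P_def
  proof (intro conjI allI impI ballI)
    fix i assume "i \<le> n"
    hence "(\<lambda>a. \<phi> a i) holomorphic_on ball (z j) r" using sec by (auto simp: section_at_def)
    thus "continuous_on (ball (?q j) ?r) (\<lambda>a. \<phi> a i)"
      using holomorphic_on_imp_continuous_on continuous_on_subset[OF _ sub] by blast
  next
    show "\<phi> (?q j) = ?q" using sec qV m(1) qb by (auto simp: section_at_def)
  next
    fix a assume "a \<in> ball (?q j) ?r"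
    hence a: "a \<in> ball (z j) r" using sub by blast
    show "accum (\<phi> a)" by (rule section_at_accum[OF sec q(1) m(1) qb a])
    show "\<phi> a j = a" using sec a by (auto simp: section_at_def)
  qed
  thus False using q(4) by blast
qed

lemma exp_lipschitz_left_half:
  assumes "w \<in> left_half" "z \<in> left_half"
  shows "cmod (exp z - exp w) \<le> cmod (z - w)"
proof -
  have "cmod (exp z - exp w) \<le> 1 * cmod (z - w)"
    by (rule field_differentiable_bound[OF convex_left_half, of exp exp])
      (use assms in \<open>auto simp: left_half_def intro!: derivative_eq_intros\<close>)
  thus ?thesis by simp
qed

text \<open>The radius of sections degenerates as the real part tends to minus infinity, because the
  \<open>j\<close>-th coordinate tends to zero. Hence lifts are built on vertical strips, where it
  is bounded below, and glued.\<close>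

lemma lift_exists:
  assumes "\<zeta>0 \<in> left_half" "q \<in> fibre \<zeta>0"
  shows "\<exists>X. lift_over fibre left_half X \<and> X \<zeta>0 = q"
proof -
  \<comment> \<open>The offset makes every strip contain the base point.\<close>
  define m0 where "m0 = nat \<lceil>- Re \<zeta>0\<rceil>"
  define A where "A k = {\<zeta>. Re \<zeta> \<le> 0 \<and> - real (k + m0) \<le> Re \<zeta>}" for k
  have cvx: "convex (A k)" for k
    unfolding A_def using convex_Int[OF convex_halfspace_Re_le[of 0] convex_halfspace_Re_ge[of "- real (k + m0)"]]
    by (simp add: Int_def)
  have sub: "A k \<subseteq> left_half" for k by (auto simp: A_def left_half_def)
  have start: "\<zeta>0 \<in> A k" for k
  proof -
    have "- Re \<zeta>0 \<le> real m0" unfolding m0_def by linarith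
    thus ?thesis using assms(1) by (auto simp: A_def left_half_def)
  qed
  show ?thesis
  proof (rule glue_lifts[OF unique_lifts_left_half sub convex_connected[OF cvx] _ start])
    show "A k \<subseteq> A l" if "k \<le> l" for k l using that by (auto simp: A_def)
    show "\<exists>k T. open T \<and> z \<in> T \<and> left_half \<inter> T \<subseteq> A k" if "z \<in> left_half" for z
    proof -
      obtain k :: nat where "- Re z < real k" using reals_Archimedean2 by blast
      moreover have "open {\<zeta>. - real k < Re \<zeta>}" using open_halfspace_Re_gt by blast
      ultimately show ?thesis
        by (intro exI[of _ k] exI[of _ "{\<zeta>. - real k < Re \<zeta>}"]) (auto simp: A_def left_half_def)
    qed
    fix k
    define \<eta> where "\<eta> = \<bar>\<tau>\<bar> * exp (- real (k + m0))"
    have "\<eta> > 0" using tau by (simp add: \<eta>_def)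
    then obtain r where r: "r > 0" "\<And>q. accum q \<Longrightarrow> \<eta> \<le> cmod (q j) \<Longrightarrow> cmod (q j) \<le> \<bar>\<tau>\<bar> \<Longrightarrow>
      \<exists>\<phi>. (\<forall>i\<le>n. continuous_on (ball (q j) r) (\<lambda>a. \<phi> a i)) \<and> \<phi> (q j) = q \<and>
      (\<forall>a\<in>ball (q j) r. accum (\<phi> a) \<and> \<phi> a j = a)"
      using uniform_sections by blast
    show "\<exists>X. lift_over fibre (A k) X \<and> X \<zeta>0 = q"
    proof (rule convex_lift[OF cvx _ unique_lifts_subset[OF unique_lifts_left_half sub] _ start assms(2)])
      \<comment> \<open>On the left half-plane \<open>exp\<close> is 1-Lipschitz, so dividing by
        \<open>\<bar>\<tau>\<bar>\<close> converts a radius for the \<open>j\<close>-th coordinate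
        into one for \<zeta>.\<close>
      show "r / \<bar>\<tau>\<bar> > 0" using r(1) tau by simp
      fix \<zeta> q assume \<zeta>: "\<zeta> \<in> A k" and q: "q \<in> fibre \<zeta>"
      have qj: "q j = complex_of_real \<tau> * exp \<zeta>" "accum q" using q by (auto simp: fibre_def)
      have "\<eta> \<le> cmod (q j)"
        unfolding qj(1) \<eta>_def norm_mult using \<zeta> by (auto simp: A_def intro!: mult_left_mono)
      moreover have "cmod (q j) \<le> \<bar>\<tau>\<bar>" using fibreD[OF q] \<zeta> sub by blast
      ultimately obtain \<phi> where \<phi>: "\<And>i. i \<le> n \<Longrightarrow> continuous_on (ball (q j) r) (\<lambda>a. \<phi> a i)" "\<phi> (q j) = q"
        "\<And>a. a \<in> ball (q j) r \<Longrightarrow> accum (\<phi> a)" "\<And>a. a \<in> ball (q j) r \<Longrightarrow> \<phi> a j = a"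
        using r(2)[OF qj(2)] by blast
      let ?B = "ball \<zeta> (r / \<bar>\<tau>\<bar>) \<inter> A k" and ?e = "\<lambda>z. complex_of_real \<tau> * exp z"
      have eB: "?e z \<in> ball (q j) r" if z: "z \<in> ?B" for z
      proof -
        have "dist (q j) (?e z) = \<bar>\<tau>\<bar> * cmod (exp z - exp \<zeta>)"
          by (simp add: qj dist_norm norm_minus_commute norm_mult flip: right_diff_distrib)
        also have "\<dots> \<le> \<bar>\<tau>\<bar> * cmod (z - \<zeta>)"
          using z \<zeta> sub by (intro mult_left_mono exp_lipschitz_left_half) auto
        also have "\<dots> < r" using z tau by (auto simp: dist_norm norm_minus_commute field_simps)
        finally show ?thesis by simp
      qed
      have "continuous_on ?B (\<lambda>z. \<phi> (?e z))"
      proof (rule continuous_on_coordinatewise_then_product)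
        fix i
        show "continuous_on ?B (\<lambda>z. \<phi> (?e z) i)"
        proof (cases "i \<le> n")
          case True
          show ?thesis
            by (rule continuous_on_compose2[OF \<phi>(1)[OF True]]) (use eB in \<open>auto intro!: continuous_intros\<close>)
        next
          case False
          have "\<phi> (?e z) i = undefined" if "z \<in> ?B" for z
            using \<phi>(3)[OF eB[OF that]] V_ext False by (auto simp: accum_def PiE_def extensional_def)
          thus ?thesis by (intro continuous_on_eq[OF continuous_on_const[of _ undefined]]) simp
        qed
      qed
      thus "\<exists>\<Phi>. lift_over fibre ?B \<Phi> \<and> \<Phi> \<zeta> = q"
        using \<phi> eB qj by (intro exI[of _ "\<lambda>z. \<phi> (?e z)"]) (auto simp: lift_over_def fibre_def)
    qed
  qed
qed

lemma lift_unique: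
  assumes "lift_over fibre left_half X" "lift_over fibre left_half Y" "s \<in> left_half" "X s = Y s" "t \<in> left_half"
  shows "X t = Y t"
  using unique_liftsD[OF unique_lifts_left_half order_refl convex_connected[OF convex_left_half]] assms by blast

text \<open>Locally the lift is a holomorphic section composed with
  \<open>\<tau> * exp \<zeta>\<close>.\<close>

lemma lift_holomorphic:
  assumes X: "lift_over fibre left_half X" and i: "i \<le> n"
  shows "(\<lambda>\<zeta>. X \<zeta> i) holomorphic_on {\<zeta>. Re \<zeta> < 0}"
  unfolding holomorphic_on_def
proof
  fix \<zeta> assume \<zeta>: "\<zeta> \<in> {\<zeta>. Re \<zeta> < 0}"
  have op: "open {\<zeta>. Re \<zeta> < 0}" by (rule open_halfspace_Re_lt)
  have \<zeta>': "\<zeta> \<in> left_half" using \<zeta> by (auto simp: left_half_def)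
  have "X \<zeta> \<in> fibre \<zeta>" using X \<zeta>' by (auto simp: lift_over_def)
  from local_section[OF fibreD[OF this \<zeta>']]
  obtain \<delta> r \<phi> where s: "section_at (X \<zeta>) \<delta> r \<phi>" by blast
  hence pos: "\<delta> > 0" "r > 0" by (auto simp: section_at_def)
  have lim: "((\<lambda>z. X z k) \<longlongrightarrow> X \<zeta> k) (nhds \<zeta>)" for k
  proof -
    have sub: "{\<zeta>. Re \<zeta> < 0} \<subseteq> left_half" by (auto simp: left_half_def)
    have "continuous_on left_half X" using X by (simp add: lift_over_def)
    from continuous_on_product_then_coordinatewise[OF continuous_on_subset[OF this sub]]
    have "isCont (\<lambda>\<zeta>. X \<zeta> k) \<zeta>" using \<zeta> op by (simp add: continuous_on_eq_continuous_at)
    thus ?thesis using tendsto_at_iff_tendsto_nhds[of "\<lambda>z. X z k" \<zeta>] by (simp add: isCont_def)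
  qed
  have "\<forall>\<^sub>F z in nhds \<zeta>. near \<delta> (X \<zeta>) (X z)" "\<forall>\<^sub>F z in nhds \<zeta>. near r (X \<zeta>) (X z)"
    using lim pos by (auto intro!: eventually_near)
  moreover have "\<forall>\<^sub>F z in nhds \<zeta>. z \<in> {\<zeta>. Re \<zeta> < 0}" using op \<zeta> by (rule eventually_nhds_in_open)
  ultimately have "\<forall>\<^sub>F z in nhds \<zeta>. X z = \<phi> (complex_of_real \<tau> * exp z)"
  proof eventually_elim
    case (elim z)
    have z: "z \<in> left_half" using elim by (auto simp: left_half_def)
    have "X z \<in> fibre z" using X z by (auto simp: lift_over_def)
    note fz = this
    have "X z j \<in> ball (X \<zeta> j) r" using elim j by (auto simp: near_def dist_norm norm_minus_commute)
    hence "X z = \<phi> (X z j)" using s elim fibreD(1)[OF fz z] by (auto simp: section_at_def)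
    thus ?case using fz by (simp add: fibre_def)
  qed
  hence ev: "\<forall>\<^sub>F z in nhds \<zeta>. \<phi> (complex_of_real \<tau> * exp z) i = X z i" by eventually_elim simp
  have "(\<lambda>a. \<phi> a i) holomorphic_on ball (X \<zeta> j) r" using s i by (auto simp: section_at_def)
  hence "(\<lambda>a. \<phi> a i) field_differentiable at (complex_of_real \<tau> * exp \<zeta>)"
    using \<open>X \<zeta> \<in> fibre \<zeta>\<close> pos by (auto simp: fibre_def intro!: holomorphic_on_imp_differentiable_at)
  hence "((\<lambda>a. \<phi> a i) \<circ> (\<lambda>z. complex_of_real \<tau> * exp z)) field_differentiable at \<zeta>"
    by (intro field_differentiable_compose) (auto intro!: derivative_intros field_differentiable_within_exp)
  then obtain D where "((\<lambda>z. \<phi> (complex_of_real \<tau> * exp z) i) has_field_derivative D) (at \<zeta>)"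
    by (auto simp: field_differentiable_def o_def)
  hence "((\<lambda>z. X z i) has_field_derivative D) (at \<zeta>)"
    using DERIV_cong_ev[OF refl ev refl] by blast
  thus "(\<lambda>\<zeta>. X \<zeta> i) field_differentiable at \<zeta> within {\<zeta>. Re \<zeta> < 0}"
    using field_differentiable_def field_differentiable_at_within by blast
qed

end

section \<open>Puiseux parametrization of a branch\<close>

text \<open>Cauchy's formula for derivatives on the unit circle. Only continuity is assumed on the
  circle itself, since lifts are defined on the closed half-plane and the circle of the procedure is
  its boundary.\<close>

lemma fourier_coefficient:
  fixes f :: "complex \<Rightarrow> complex"
  assumes "continuous_on (cball 0 1) f" "f holomorphic_on ball 0 1"
  shows "integral {0..2 * pi} (\<lambda>\<theta>. f (cis \<theta>) * cis (- (real l * \<theta>))) = 2 * pi / fact l * (deriv ^^ l) f 0"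
proof -
  have "((\<lambda>u. f u / (u - 0) ^ Suc l) has_contour_integral ((2 * pi * \<i>) / (fact l) * (deriv ^^ l) f 0)) (part_circlepath 0 1 0 (2 * pi))"
    using Cauchy_has_contour_integral_higher_derivative_circlepath[OF assms, of 0 l]
    by (simp add: circlepath_def)
  hence "((\<lambda>t. f (cis t) / (cis t) ^ Suc l * \<i> * cis t) has_integral ((2 * pi * \<i>) / (fact l) * (deriv ^^ l) f 0)) {0..2 * pi}"
    by (subst (asm) has_contour_integral_part_circlepath_iff) auto
  hence "((\<lambda>t. - \<i> * (f (cis t) / (cis t) ^ Suc l * \<i> * cis t)) has_integral - \<i> * ((2 * pi * \<i>) / (fact l) * (deriv ^^ l) f 0)) {0..2 * pi}"
    by (rule has_integral_mult_right)
  also have "(\<lambda>t. - \<i> * (f (cis t) / (cis t) ^ Suc l * \<i> * cis t)) = (\<lambda>t. f (cis t) * cis (- (real l * t)))"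
  proof
    fix t
    have "cis t ^ l = cis (real l * t)" by (rule Complex.DeMoivre)
    hence "inverse (cis t ^ l) = cis (- (real l * t))" by (simp add: cis_inverse)
    moreover have "f u / u ^ Suc l * \<i> * u = \<i> * (f u * inverse (u ^ l))" if "u \<noteq> 0" for u
      using that by (simp add: divide_inverse)
    ultimately have "f (cis t) / (cis t) ^ Suc l * \<i> * cis t = \<i> * (f (cis t) * cis (- (real l * t)))"
      by simp
    thus "- \<i> * (f (cis t) / (cis t) ^ Suc l * \<i> * cis t) = f (cis t) * cis (- (real l * t))"
      by (simp only:) (simp flip: mult.assoc)
  qed
  also have "- \<i> * ((2 * pi * \<i>) / (fact l) * (deriv ^^ l) f 0) = 2 * pi / fact l * (deriv ^^ l) f 0"
    by (simp add: field_simps)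
  finally show ?thesis by (rule integral_unique)
qed

lemma higher_deriv_cnj:
  assumes "f holomorphic_on ball 0 1" "\<And>z. z \<in> ball 0 1 \<Longrightarrow> f (cnj z) = cnj (f z)"
  shows "z \<in> ball 0 1 \<Longrightarrow> (deriv ^^ l) f (cnj z) = cnj ((deriv ^^ l) f z)"
proof (induction l arbitrary: z)
  case 0
  thus ?case using assms(2) by simp
next
  case (Suc l)
  let ?g = "(deriv ^^ l) f"
  have hol: "?g holomorphic_on ball 0 1" by (rule holomorphic_higher_deriv[OF assms(1) open_ball])
  have z': "cnj z \<in> ball 0 1" using Suc.prems by simp
  have "(?g has_field_derivative deriv ?g (cnj z)) (at (cnj z))"
    by (rule holomorphic_derivI[OF hol open_ball z'])
  hence "(cnj \<circ> ?g \<circ> cnj has_field_derivative cnj (deriv ?g (cnj z))) (at z)"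
    using has_field_derivative_cnj_cnj[of ?g "deriv ?g (cnj z)" z] by simp
  moreover have "\<forall>\<^sub>F w in nhds z. (cnj \<circ> ?g \<circ> cnj) w = ?g w"
    using eventually_nhds_in_open[OF open_ball Suc.prems] by eventually_elim (simp add: Suc.IH)
  ultimately have "(?g has_field_derivative cnj (deriv ?g (cnj z))) (at z)"
    using DERIV_cong_ev[OF refl] by blast
  hence "deriv ?g z = cnj (deriv ?g (cnj z))" by (rule DERIV_imp_deriv)
  thus ?case by simp
qed

section \<open>Periodicity, descent to the unit disc and complex conjugation of lifts\<close>

context patch_curve
begin

lemma lift_shift:
  assumes "lift_over fibre left_half X"
  shows "lift_over fibre left_half (\<lambda>\<zeta>. X (\<zeta> + 2 * pi * of_int m * \<i>))"
  unfolding lift_over_def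
proof (intro conjI ballI)
  show "continuous_on left_half (\<lambda>\<zeta>. X (\<zeta> + 2 * pi * of_int m * \<i>))"
  proof (rule continuous_on_compose2[of left_half X])
    show "continuous_on left_half X" using assms by (simp add: lift_over_def)
  qed (auto intro!: continuous_intros simp: left_half_def)
  fix \<zeta> assume "\<zeta> \<in> left_half"
  hence "\<zeta> + 2 * pi * of_int m * \<i> \<in> left_half" by (simp add: left_half_def)
  hence "X (\<zeta> + 2 * pi * of_int m * \<i>) \<in> fibre (\<zeta> + 2 * pi * of_int m * \<i>)"
    using assms by (simp add: lift_over_def)
  moreover have "exp (\<zeta> + 2 * pi * of_int m * \<i>) = exp \<zeta>"
    unfolding exp_eq by (intro exI[of _ m]) simp
  ultimately show "X (\<zeta> + 2 * pi * of_int m * \<i>) \<in> fibre \<zeta>" by (simp add: fibre_def)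
qed

text \<open>A shifted lift is again a lift; agreement at the single point \<open>s\<close> therefore
  gives agreement everywhere. Negative multiples reduce to positive ones at the shifted
  point.\<close>

lemma lift_periodic:
  assumes X: "lift_over fibre left_half X" and "s \<in> left_half" "X (s + 2 * pi * real c * \<i>) = X s"
    and \<zeta>: "\<zeta> \<in> left_half"
  shows "X (\<zeta> + 2 * pi * (real c * of_int m) * \<i>) = X \<zeta>"
proof -
  have 1: "X (\<zeta> + 2 * pi * real c * \<i>) = X \<zeta>" if "\<zeta> \<in> left_half" for \<zeta>
    using lift_unique[OF lift_shift[OF X, of "int c"] X assms(2) _ that] assms(3) by simp
  have 2: "X (\<zeta> + 2 * pi * (real c * real k) * \<i>) = X \<zeta>" if "\<zeta> \<in> left_half" for \<zeta> and k :: nat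
  proof (induction k)
    case (Suc k)
    have "\<zeta> + 2 * pi * (real c * real k) * \<i> \<in> left_half" using that by (simp add: left_half_def)
    from 1[OF this] Suc show ?case by (simp add: algebra_simps)
  qed simp
  show ?thesis
  proof (cases "m \<ge> 0")
    case True
    thus ?thesis using 2[OF \<zeta>, of "nat m"] by simp
  next
    case False
    define \<zeta>' where "\<zeta>' = \<zeta> + 2 * pi * (real c * of_int m) * \<i>"
    have "\<zeta>' \<in> left_half" using \<zeta> by (simp add: left_half_def \<zeta>'_def)
    from 2[OF this, of "nat (- m)"] have "X (\<zeta>' + 2 * pi * (real c * (- of_int m)) * \<i>) = X \<zeta>'"
      using False by simp
    moreover have "\<zeta>' + 2 * pi * (real c * (- of_int m)) * \<i> = \<zeta>" by (simp add: \<zeta>'_def)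
    ultimately show ?thesis by (simp add: \<zeta>'_def)
  qed
qed

text \<open>By periodicity \<open>X (c * Ln z)\<close> does not depend on the branch of the
  logarithm, so it descends to the punctured disc. It is bounded there, and Riemann's theorem fills
  in the centre.\<close>

lemma disc_parametrization:
  assumes X: "lift_over fibre left_half X" and c: "c > 0" "X (2 * pi * real c * \<i>) = X 0"
  obtains W where
    "\<And>k. k \<le> n \<Longrightarrow> (\<lambda>z. W z k) holomorphic_on ball 0 1"
    "\<And>k. k \<le> n \<Longrightarrow> continuous_on (cball 0 1) (\<lambda>z. W z k)"
    "\<And>z. z \<in> cball 0 1 \<Longrightarrow> W z \<in> V"
    "\<And>z. z \<in> cball 0 1 \<Longrightarrow> W z j = complex_of_real \<tau> * z ^ c"
    "\<And>w. w \<in> left_half \<Longrightarrow> W (exp w) = X (of_nat c * w)"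
proof -
  define W0 where "W0 z = X (of_nat c * Ln z)" for z
  have cl: "of_nat c * w \<in> left_half" if "w \<in> left_half" for w
    using that by (simp add: left_half_def mult_nonneg_nonpos)
  have W0: "W0 (exp w) = X (of_nat c * w)" if w: "w \<in> left_half" for w
  proof -
    have "exp (Ln (exp w)) = exp w" by simp
    then obtain m where m: "Ln (exp w) = w + (of_int (2 * m) * pi) * \<i>"
      unfolding exp_eq by blast
    have "X (of_nat c * w + 2 * pi * (real c * of_int m) * \<i>) = X (of_nat c * w)"
      by (rule lift_periodic[OF X _ _ cl[OF w], of 0]) (use c in \<open>auto simp: left_half_def\<close>)
    thus ?thesis by (simp add: W0_def m algebra_simps)
  qed
  have log: "exp (Ln z) = z" "Ln z \<in> left_half" if "z \<in> cball 0 1" "z \<noteq> 0" for z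
  proof -
    show "exp (Ln z) = z" using that by simp
    have "ln (cmod z) \<le> 0" using that by (subst ln_le_zero_iff) auto
    thus "Ln z \<in> left_half" using that by (simp add: left_half_def)
  qed
  have fib: "W0 z \<in> fibre (of_nat c * Ln z)" if "z \<in> cball 0 1" "z \<noteq> 0" for z
    using X cl[OF log(2)[OF that]] by (simp add: W0_def lift_over_def)
  have W0V: "W0 z \<in> V" "W0 z j = complex_of_real \<tau> * z ^ c" "cmod (W0 z j) \<le> \<bar>\<tau>\<bar>" if "z \<in> cball 0 1" "z \<noteq> 0" for z
    using fib[OF that] fibreD[OF fib[OF that] cl[OF log(2)[OF that]]] that
    by (auto simp: fibre_def exp_of_nat_mult)
  \<comment> \<open>A logarithm that is continuous on the disc about \<open>z0\<close> reaching to
    the origin, also across the cut of \<open>Ln\<close>.\<close>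
  define f where "f z0 z = Ln (z / z0) + Ln z0" for z0 z :: complex
  have dom: "z \<noteq> 0 \<and> z / z0 \<notin> \<real>\<^sub>\<le>\<^sub>0" if "z \<in> ball z0 (cmod z0)" for z z0
  proof -
    have z0: "z0 \<noteq> 0" using that by auto
    have "cmod (1 - z / z0) = cmod ((z0 - z) / z0)" using z0 by (simp add: diff_divide_distrib)
    also have "\<dots> < 1" using that z0 by (simp add: norm_divide dist_norm)
    finally have "\<bar>Re (1 - z / z0)\<bar> < 1" using abs_Re_le_cmod[of "1 - z / z0"] by linarith
    hence "Re (z / z0) > 0" by simp
    thus ?thesis by (auto simp: complex_nonpos_Reals_iff)
  qed
  have f_exp: "exp (f z0 z) = z" if "z \<in> ball z0 (cmod z0)" for z z0
  proof -
    have "z0 \<noteq> 0" using that by auto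
    thus ?thesis using dom[OF that] by (simp add: f_def exp_add)
  qed
  have f_Re: "Re (f z0 z) = ln (cmod z)" if "z \<in> ball z0 (cmod z0)" for z z0
    using f_exp[OF that] by (metis ln_exp norm_exp_eq_Re)
  have f_left: "f z0 z \<in> left_half" if "z \<in> ball z0 (cmod z0)" "z \<in> cball 0 1" for z z0
    using f_Re[OF that(1)] dom[OF that(1)] that(2) by (simp add: left_half_def)
  have W0f: "W0 z = X (of_nat c * f z0 z)" if "z \<in> ball z0 (cmod z0)" "z \<in> cball 0 1" for z z0
    using W0[OF f_left[OF that]] f_exp[OF that(1)] by simp
  have cont0: "continuous_on (cball 0 1 - {0}) (\<lambda>z. W0 z k)" for k
  proof (rule continuous_on_locally)
    fix z0 :: complex assume z0: "z0 \<in> cball 0 1 - {0}"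
    let ?S = "(cball 0 1 - {0}) \<inter> ball z0 (cmod z0)"
    have "continuous_on left_half (\<lambda>\<zeta>. X \<zeta> k)"
      using X by (auto simp: lift_over_def intro: continuous_on_product_then_coordinatewise)
    moreover have "continuous_on ?S (\<lambda>z. of_nat c * f z0 z)"
      unfolding f_def using dom z0 by (auto intro!: continuous_intros)
    ultimately have "continuous_on ?S (\<lambda>z. X (of_nat c * f z0 z) k)"
      using f_left cl by (elim continuous_on_compose2) auto
    hence "continuous_on ?S (\<lambda>z. W0 z k)"
      by (rule continuous_on_eq) (use W0f in auto)
    thus "\<exists>T. open T \<and> z0 \<in> T \<and> continuous_on ((cball 0 1 - {0}) \<inter> T) (\<lambda>z. W0 z k)"
      using z0 by (intro exI[of _ "ball z0 (cmod z0)"]) auto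
  qed
  have hol0: "(\<lambda>z. W0 z k) holomorphic_on ball 0 1 - {0}" if k: "k \<le> n" for k
    unfolding holomorphic_on_def
  proof
    fix z0 :: complex assume z0: "z0 \<in> ball 0 1 - {0}"
    let ?B = "ball z0 (cmod z0) \<inter> ball 0 1"
    have "(\<lambda>z. of_nat c * f z0 z) holomorphic_on ?B"
      unfolding f_def using dom z0 by (auto intro!: holomorphic_intros)
    moreover have "of_nat c * f z0 z \<in> {\<zeta>. Re \<zeta> < 0}" if "z \<in> ?B" for z
    proof -
      have "ln (cmod z) < 0" using that dom by (subst ln_less_zero_iff) auto
      thus ?thesis using f_Re[of z z0] that c by (simp add: mult_pos_neg)
    qed
    ultimately have "((\<lambda>\<zeta>. X \<zeta> k) \<circ> (\<lambda>z. of_nat c * f z0 z)) holomorphic_on ?B"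
      by (intro holomorphic_on_compose_gen[OF _ lift_holomorphic[OF X k]]) auto
    hence "(\<lambda>z. W0 z k) holomorphic_on ?B"
      by (rule holomorphic_transform) (use W0f in auto)
    hence "(\<lambda>z. W0 z k) field_differentiable at z0"
      by (rule holomorphic_on_imp_differentiable_at) (use z0 in auto)
    thus "(\<lambda>z. W0 z k) field_differentiable at z0 within ball 0 1 - {0}"
      by (rule field_differentiable_at_within)
  qed
  obtain M where M: "\<And>x i. x \<in> V \<Longrightarrow> cmod (x j) \<le> \<bar>\<tau>\<bar> \<Longrightarrow> i \<le> n \<Longrightarrow> cmod (x i) \<le> M"
    using bounded by blast
  have ev: "\<forall>\<^sub>F z in at (0::complex). z \<in> cball 0 1 \<and> z \<noteq> 0"
    using eventually_at_in_open[of "ball (0::complex) 1" 0] by (auto elim!: eventually_mono)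
  \<comment> \<open>Removable singularity: \<open>V\<close> is bounded over the disc.\<close>
  have ext: "\<exists>g. g holomorphic_on ball 0 1 \<and> (\<forall>z\<in>ball 0 1 - {0}. g z = W0 z k)" if k: "k \<le> n" for k
  proof -
    have "\<forall>\<^sub>F z in at 0. cmod (W0 z k) \<le> M"
      using ev by eventually_elim (use M W0V k in auto)
    thus ?thesis
      by (subst holomorphic_on_extend_bounded[OF hol0[OF k]]) auto
  qed
  then obtain g where g: "\<And>k. k \<le> n \<Longrightarrow> g k holomorphic_on ball 0 1"
    "\<And>k z. k \<le> n \<Longrightarrow> z \<in> ball 0 1 - {0} \<Longrightarrow> g k z = W0 z k"
    by metis
  define W where "W z = (if z = 0 then (\<lambda>k\<in>{0..n}. g k 0) else W0 z)" for z
  have Wg: "W z k = g k z" if "k \<le> n" "z \<in> ball 0 1" for z k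
    using g(2)[of k z] that by (auto simp: W_def)
  have hol: "(\<lambda>z. W z k) holomorphic_on ball 0 1" if "k \<le> n" for k
    using g(1)[OF that] by (rule holomorphic_transform) (use Wg that in auto)
  have cont: "continuous_on (cball 0 1) (\<lambda>z. W z k)" if k: "k \<le> n" for k
  proof (rule continuous_on_locally)
    fix z :: complex assume z: "z \<in> cball 0 1"
    show "\<exists>T. open T \<and> z \<in> T \<and> continuous_on (cball 0 1 \<inter> T) (\<lambda>z. W z k)"
    proof (cases "z = 0")
      case True
      have "continuous_on (cball 0 1 \<inter> ball 0 1) (\<lambda>z. W z k)"
        by (rule continuous_on_subset[OF holomorphic_on_imp_continuous_on[OF hol[OF k]]]) auto
      thus ?thesis using True by (intro exI[of _ "ball 0 1"]) auto
    next
      case False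
      have "continuous_on (cball 0 1 \<inter> - {0}) (\<lambda>z. W z k)"
        by (rule continuous_on_eq[OF continuous_on_subset[OF cont0]]) (auto simp: W_def)
      thus ?thesis using False by (intro exI[of _ "- {0}"]) auto
    qed
  qed
  have lim0: "((\<lambda>z. W z k) \<longlongrightarrow> W 0 k) (at 0)" if "k \<le> n" for k
  proof -
    have "continuous (at 0) (\<lambda>z. W z k)"
      using holomorphic_on_imp_continuous_on[OF hol[OF that]]
      by (metis centre_in_ball continuous_on_eq_continuous_at open_ball zero_less_one)
    thus ?thesis by (simp add: continuous_at)
  qed
  have "W 0 \<in> V"
  proof (rule V_limit[OF at_neq_bot _ lim0])
    show "\<forall>\<^sub>F t in at 0. W t \<in> V" using ev by eventually_elim (use W0V in \<open>auto simp: W_def\<close>)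
  qed (auto simp: W_def)
  moreover have "W 0 j = complex_of_real \<tau> * 0 ^ c"
  proof (rule tendsto_unique[OF at_neq_bot lim0[OF j]])
    have "((\<lambda>z. complex_of_real \<tau> * z ^ c) \<longlongrightarrow> complex_of_real \<tau> * 0 ^ c) (at 0)"
      by (intro tendsto_intros)
    moreover have "\<forall>\<^sub>F z in at 0. complex_of_real \<tau> * z ^ c = W z j"
      using ev by eventually_elim (use W0V in \<open>auto simp: W_def\<close>)
    ultimately show "((\<lambda>z. W z j) \<longlongrightarrow> complex_of_real \<tau> * 0 ^ c) (at 0)"
      by (rule Lim_transform_eventually)
  qed
  ultimately have "W z \<in> V" "W z j = complex_of_real \<tau> * z ^ c" if "z \<in> cball 0 1" for z
    using W0V[OF that] by (cases "z = 0"; simp add: W_def)+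
  moreover have "W (exp w) = X (of_nat c * w)" if "w \<in> left_half" for w
    using W0[OF that] by (simp add: W_def)
  ultimately show ?thesis using that hol cont by blast
qed

lemma accum_cnj:
  assumes "accum q"
  shows "accum (\<lambda>i\<in>{0..n}. cnj (q i))"
  unfolding accum_def
proof (intro conjI allI impI)
  let ?c = "\<lambda>q. \<lambda>i\<in>{0..n}. cnj (q i)"
  show "?c q \<in> V" using assms V_cnj by (auto simp: accum_def)
  fix \<epsilon> :: real assume "\<epsilon> > 0"
  then obtain x where x: "x \<in> V" "x \<noteq> q" "near \<epsilon> q x" using assms by (auto simp: accum_def)
  have "?c x \<noteq> ?c q"
  proof
    assume eq: "?c x = ?c q"
    have "x i = q i" if "i \<le> n" for i using fun_cong[OF eq, of i] that by simp
    thus False using x(1,2) assms V_ext ext_eqI by (metis accum_def)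
  qed
  moreover have "near \<epsilon> (?c q) (?c x)"
    using x(3) by (simp add: near_def flip: complex_cnj_diff)
  ultimately show "\<exists>x\<in>V. x \<noteq> ?c q \<and> near \<epsilon> (?c q) x" using V_cnj[OF x(1)] by blast
qed

text \<open>Conjugating argument and value gives another lift; a real point over the negative real
  axis makes the two coincide.\<close>

lemma lift_cnj:
  assumes X: "lift_over fibre left_half X" and real: "r \<le> 0" "\<And>i. i \<le> n \<Longrightarrow> X (complex_of_real r) i \<in> \<real>"
    and \<zeta>: "\<zeta> \<in> left_half" and i: "i \<le> n"
  shows "X (cnj \<zeta>) i = cnj (X \<zeta> i)"
proof -
  define Y where "Y \<zeta> = (\<lambda>i\<in>{0..n}. cnj (X (cnj \<zeta>) i))" for \<zeta>
  have "lift_over fibre left_half Y"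
    unfolding lift_over_def
  proof (intro conjI ballI continuous_on_coordinatewise_then_product)
    fix i
    have "continuous_on left_half (\<lambda>\<zeta>. cnj (X (cnj \<zeta>) i))"
    proof (intro continuous_on_cnj continuous_on_compose2[of left_half "\<lambda>\<zeta>. X \<zeta> i" left_half cnj])
      show "continuous_on left_half (\<lambda>\<zeta>. X \<zeta> i)"
        using X by (auto simp: lift_over_def intro: continuous_on_product_then_coordinatewise)
    qed (auto intro!: continuous_intros simp: left_half_def)
    thus "continuous_on left_half (\<lambda>\<zeta>. Y \<zeta> i)"
      by (cases "i \<le> n") (auto simp: Y_def)
  next
    fix \<zeta> assume "\<zeta> \<in> left_half"
    hence "X (cnj \<zeta>) \<in> fibre (cnj \<zeta>)" using X by (auto simp: lift_over_def left_half_def)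
    thus "Y \<zeta> \<in> fibre \<zeta>" using accum_cnj j by (auto simp: fibre_def Y_def exp_cnj)
  qed
  moreover have base: "complex_of_real r \<in> left_half" using real(1) by (simp add: left_half_def)
  moreover have "Y (complex_of_real r) = X (complex_of_real r)"
  proof (rule ext_eqI)
    have "X (complex_of_real r) \<in> fibre (complex_of_real r)" using X base by (auto simp: lift_over_def)
    thus "X (complex_of_real r) \<in> {0..n} \<rightarrow>\<^sub>E UNIV" using fibreD[OF _ base] V_ext by blast
    show "Y (complex_of_real r) i = X (complex_of_real r) i" if "i \<le> n" for i
      using real(2)[OF that] that by (simp add: Y_def Reals_cnj_iff)
  qed (auto simp: Y_def)
  ultimately have "Y (cnj \<zeta>) = X (cnj \<zeta>)"
    using lift_unique[OF _ X, of Y "complex_of_real r" "cnj \<zeta>"] \<zeta> by (simp add: left_half_def)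
  from fun_cong[OF this, of i] show ?thesis using i by (simp add: Y_def)
qed

end

section \<open>Convergent real power series near zero from the right\<close>

lemma eval_fps_split:
  fixes F :: "real fps"
  assumes "ereal \<bar>s\<bar> < fps_conv_radius F"
  shows "eval_fps F s = s ^ subdegree F * eval_fps (fps_shift (subdegree F) F) s"
proof -
  have "eval_fps (fps_shift (subdegree F) F * fps_X ^ subdegree F) s =
      eval_fps (fps_shift (subdegree F) F) s * eval_fps (fps_X ^ subdegree F) s"
    using assms by (intro eval_fps_mult) auto
  thus ?thesis by (simp flip: subdegree_decompose)
qed

lemma fps_shift_tendsto:
  fixes F :: "real fps"
  assumes "fps_conv_radius F > 0"
  shows "((\<lambda>s. eval_fps (fps_shift (subdegree F) F) s) \<longlongrightarrow> fps_nth F (subdegree F)) (at_right 0)"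
proof -
  have "isCont (eval_fps (fps_shift (subdegree F) F)) 0"
    using assms by (intro continuous_eval_fps) (auto simp: zero_ereal_def)
  thus ?thesis
    by (simp add: isCont_def eval_fps_at_0 filterlim_at_split)
qed

lemma eventually_conv_radius:
  fixes F :: "real fps"
  assumes "fps_conv_radius F > 0"
  shows "\<forall>\<^sub>F s in at_right 0. s > 0 \<and> ereal \<bar>s\<bar> < fps_conv_radius F"
proof -
  obtain r where r: "0 < r" "ereal r < fps_conv_radius F"
    using ereal_dense2[OF assms] by (auto simp: zero_ereal_def)
  have "\<forall>\<^sub>F s in at_right 0. s \<in> {0<..<r}" by (rule eventually_at_right_real[OF r(1)])
  thus ?thesis by eventually_elim (use r in \<open>auto intro: less_trans[of _ "ereal r"]\<close>)
qed

lemma eventually_sgn_eval_fps: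
  fixes F :: "real fps"
  assumes "fps_conv_radius F > 0"
  shows "\<forall>\<^sub>F s in at_right 0. sgn (eval_fps F s) = sgn (fps_nth F (subdegree F))"
proof (cases "F = 0")
  case False
  let ?l = "fps_nth F (subdegree F)" and ?G = "fps_shift (subdegree F) F"
  have lead: "?l \<noteq> 0" using False by simp
  have lim: "(eval_fps ?G \<longlongrightarrow> ?l) (at_right 0)" by (rule fps_shift_tendsto[OF assms])
  have "\<forall>\<^sub>F s in at_right 0. sgn (eval_fps ?G s) = sgn ?l"
  proof (cases "?l > 0")
    case True
    have "\<forall>\<^sub>F s in at_right 0. 0 < eval_fps ?G s" by (rule order_tendstoD(1)[OF lim True])
    thus ?thesis by (rule eventually_mono) (use True in \<open>simp add: sgn_pos\<close>)
  next
    case neg: False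
    hence neg: "?l < 0" using lead by linarith
    have "\<forall>\<^sub>F s in at_right 0. eval_fps ?G s < 0" by (rule order_tendstoD(2)[OF lim neg])
    thus ?thesis by (rule eventually_mono) (use neg in \<open>simp add: sgn_neg\<close>)
  qed
  thus ?thesis using eventually_conv_radius[OF assms]
    by eventually_elim (subst eval_fps_split, auto simp: sgn_mult)
qed simp

text \<open>The sign of the leading coefficient of the difference is the sign of its values near
  zero, which is zero. One-sided agreement suffices, as arcs are known for positive parameters
  only.\<close>

lemma real_fps_eqI:
  fixes F G :: "real fps"
  assumes "fps_conv_radius F > 0" "fps_conv_radius G > 0"
    and "\<forall>\<^sub>F s in at_right 0. eval_fps F s = eval_fps G s"
  shows "F = G"
proof -
  have "fps_conv_radius (F - G) > 0"
    using fps_conv_radius_diff[of F G] assms(1,2) by (auto simp: min_def split: if_splits intro: less_le_trans)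
  from eventually_sgn_eval_fps[OF this] assms(3) eventually_conv_radius[OF assms(1)] eventually_conv_radius[OF assms(2)]
  have "\<forall>\<^sub>F s in at_right 0. eval_fps (F - G) s = 0 \<and> sgn (eval_fps (F - G) s) = sgn (fps_nth (F - G) (subdegree (F - G)))"
  proof eventually_elim
    case (elim s)
    have "eval_fps (F - G) s = eval_fps F s - eval_fps G s"
      by (rule eval_fps_diff) (use elim in auto)
    thus ?case using elim by simp
  qed
  from eventually_happens'[OF trivial_limit_at_right_real this]
  have "sgn (fps_nth (F - G) (subdegree (F - G))) = 0" by auto
  hence "fps_nth (F - G) (subdegree (F - G)) = 0" by (simp only: sgn_0_0)
  hence "F - G = 0" by (simp only: nth_subdegree_zero_iff)
  thus ?thesis by simp
qed

lemma sgn_const: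
  fixes g :: "'a::topological_space \<Rightarrow> real"
  assumes "connected S" "continuous_on S g" "\<And>s. s \<in> S \<Longrightarrow> g s \<noteq> 0" "a \<in> S" "b \<in> S"
  shows "sgn (g a) = sgn (g b)"
proof (rule ccontr)
  assume neq: "sgn (g a) \<noteq> sgn (g b)"
  have "connected (g ` S)" using connected_continuous_image[OF assms(2,1)] .
  moreover have "g a < 0 \<and> 0 < g b \<or> g b < 0 \<and> 0 < g a"
    using assms(3)[OF assms(4)] assms(3)[OF assms(5)] neq by (auto simp: sgn_if split: if_splits)
  ultimately have "0 \<in> g ` S"
    using assms(4,5) connectedD_interval[of "g ` S" "g a" "g b" 0] connectedD_interval[of "g ` S" "g b" "g a" 0]
    by auto
  thus False using assms(3) by auto
qed

context patch_curve
begin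

lemma lift_Real:
  assumes "lift_over fibre left_half X" "r \<le> 0" "\<And>i. i \<le> n \<Longrightarrow> X (complex_of_real r) i \<in> \<real>" "x \<le> 0" "i \<le> n"
  shows "X (complex_of_real x) i \<in> \<real>"
  using lift_cnj[OF assms(1-3), of "complex_of_real x" i] assms(4,5)
  by (simp add: Reals_cnj_iff left_half_def)

lemma lift_nonzero:
  assumes "lift_over fibre left_half X" "\<zeta> \<in> left_half" "i \<le> n"
  shows "X \<zeta> i \<noteq> 0"
proof -
  have "X \<zeta> \<in> fibre \<zeta>" using assms by (simp add: lift_over_def)
  from fibreD[OF this assms(2)] show ?thesis using assms(3) by (rule nonzero)
qed

lemma continuous_on_lift_Real:
  assumes "lift_over fibre left_half X"
  shows "continuous_on {..0} (\<lambda>x. X (complex_of_real x) i)"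
proof (rule continuous_on_compose2[of left_half "\<lambda>\<zeta>. X \<zeta> i"])
  show "continuous_on left_half (\<lambda>\<zeta>. X \<zeta> i)"
    using assms unfolding lift_over_def by (blast intro: continuous_on_product_then_coordinatewise)
  show "continuous_on {..0} complex_of_real" by (intro continuous_on_of_real continuous_on_id)
qed (auto simp: left_half_def)

text \<open>Real coordinates that never vanish keep their sign along the connected negative axis;
  this transports the sign at the base point to the boundary.\<close>

lemma lift_sgn:
  assumes "lift_over fibre left_half X" "\<And>i. i \<le> n \<Longrightarrow> X 0 i \<in> \<real>" "x \<le> 0" "i \<le> n"
  shows "sgn (Re (X (complex_of_real x) i)) = sgn (Re (X 0 i))"
proof -
  have "sgn (Re (X (complex_of_real x) i)) = sgn (Re (X (complex_of_real 0) i))"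
  proof (rule sgn_const[of "{..0}" "\<lambda>x. Re (X (complex_of_real x) i)"])
    show "continuous_on {..0} (\<lambda>x. Re (X (complex_of_real x) i))"
      by (intro continuous_intros continuous_on_lift_Real assms)
    fix s :: real assume "s \<in> {..0}"
    hence "X (complex_of_real s) i \<noteq> 0" "X (complex_of_real s) i \<in> \<real>"
      using lift_nonzero[OF assms(1) _ assms(4)] lift_Real[OF assms(1) order_refl _ _ assms(4)] assms(2)
      by (auto simp: left_half_def)
    thus "Re (X (complex_of_real s) i) \<noteq> 0" by (metis Reals_cases Re_complex_of_real of_real_0)
  qed (use assms in \<open>auto intro: convex_connected\<close>)
  thus ?thesis by simp
qed

text \<open>Bundles what both directions need about a real branch: its series, their relation to the
  Fourier integrals and the signs, and the radial path. \<open>c\<close> may be any positive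
  period.\<close>

lemma real_branch:
  assumes X: "lift_over fibre left_half X" and real: "\<And>i. i \<le> n \<Longrightarrow> X 0 i \<in> \<real>"
    and c: "c > 0" "X (2 * pi * real c * \<i>) = X 0"
  obtains A :: "nat \<Rightarrow> real fps" and P where
    "\<And>k. k \<le> n \<Longrightarrow> fps_conv_radius (A k) \<ge> 1"
    "\<And>k s. k \<le> n \<Longrightarrow> 0 < s \<Longrightarrow> s < 1 \<Longrightarrow> X (complex_of_real (real c * ln s)) k = complex_of_real (eval_fps (A k) s)"
    "\<And>k. k \<le> n \<Longrightarrow> A k \<noteq> 0"
    "\<And>k l. k \<le> n \<Longrightarrow> integral {0..2 * pi} (\<lambda>\<theta>. X (\<i> * complex_of_real (real c * \<theta>)) k * cis (- (real l * \<theta>)))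
       = 2 * pi * complex_of_real (fps_nth (A k) l)"
    "\<And>k. k \<le> n \<Longrightarrow> sgn (fps_nth (A k) (subdegree (A k))) = sgn (Re (X 0 k))"
    "subdegree (A j) = c"
    "P 0 = (\<lambda>k\<in>{0..n}. complex_of_real (fps_nth (A k) 0))" "P 1 = X 0" "continuous_on {0..1} P"
    "\<And>s. s \<in> {0..1} \<Longrightarrow> P s \<in> V \<and> P s j = complex_of_real (\<tau> * s)"
    "\<And>s. 0 < s \<Longrightarrow> s \<le> 1 \<Longrightarrow> P s = X (complex_of_real (ln s))"
proof -
  obtain W where W: "\<And>k. k \<le> n \<Longrightarrow> (\<lambda>z. W z k) holomorphic_on ball 0 1"
    "\<And>k. k \<le> n \<Longrightarrow> continuous_on (cball 0 1) (\<lambda>z. W z k)"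
    "\<And>z. z \<in> cball 0 1 \<Longrightarrow> W z \<in> V"
    "\<And>z. z \<in> cball 0 1 \<Longrightarrow> W z j = complex_of_real \<tau> * z ^ c"
    "\<And>w. w \<in> left_half \<Longrightarrow> W (exp w) = X (of_nat c * w)"
    using disc_parametrization[OF X c] by blast
  have cl: "of_nat c * w \<in> left_half" if "w \<in> left_half" for w
    using that by (simp add: left_half_def mult_nonneg_nonpos)
  have Wr: "W (complex_of_real s) = X (complex_of_real (real c * ln s))" if "0 < s" "s \<le> 1" for s
    using W(5)[of "complex_of_real (ln s)"] that by (simp add: left_half_def exp_of_real)
  \<comment> \<open>Away from the origin this is the symmetry of the lift; the origin follows by
    continuity.\<close>
  have Wcnj: "W (cnj z) k = cnj (W z k)" if z: "z \<in> ball 0 1" and k: "k \<le> n" for z k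
  proof -
    have 1: "W (cnj z) k = cnj (W z k)" if z: "z \<in> ball 0 1" "z \<noteq> 0" for z
    proof -
      define w where "w = Ln z"
      have "ln (cmod z) \<le> 0" using z by (subst ln_le_zero_iff) auto
      hence w: "exp w = z" "w \<in> left_half" "cnj w \<in> left_half" using z by (auto simp: w_def left_half_def)
      have "W (cnj z) k = X (of_nat c * cnj w) k"
        using W(5)[OF w(3)] w(1) by (simp flip: exp_cnj)
      also have "\<dots> = X (cnj (of_nat c * w)) k" by simp
      also have "\<dots> = cnj (X (of_nat c * w) k)" by (rule lift_cnj[OF X order_refl _ cl[OF w(2)] k]) (use real in simp)
      also have "X (of_nat c * w) k = W z k" using W(5)[OF w(2)] w(1) by simp
      finally show ?thesis .
    qed
    show ?thesis
    proof (cases "z = 0")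
      case True
      have lim: "((\<lambda>z. W z k) \<longlongrightarrow> W 0 k) (at 0)"
        using holomorphic_on_imp_continuous_on[OF W(1)[OF k]]
        by (metis centre_in_ball continuous_at continuous_on_eq_continuous_at open_ball zero_less_one)
      have "((\<lambda>z. W (cnj z) k) \<longlongrightarrow> W 0 k) (at 0)"
      proof (rule filterlim_compose[OF lim])
        show "filterlim cnj (at 0) (at 0)"
          by (intro filterlim_atI tendsto_eq_intros refl) (auto simp: eventually_at_filter)
      qed
      moreover have "\<forall>\<^sub>F z in at 0. W (cnj z) k = cnj (W z k)"
        using eventually_at_in_open[of "ball (0::complex) 1" 0] by (auto elim!: eventually_mono simp: 1)
      ultimately have "((\<lambda>z. cnj (W z k)) \<longlongrightarrow> W 0 k) (at 0)" by (rule Lim_transform_eventually)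
      moreover have "((\<lambda>z. cnj (W z k)) \<longlongrightarrow> cnj (W 0 k)) (at 0)" by (intro tendsto_intros lim)
      ultimately have "W 0 k = cnj (W 0 k)" by (rule tendsto_unique[OF at_neq_bot])
      thus ?thesis using True by simp
    qed (use 1 z in auto)
  qed
  define D where "D k l = (deriv ^^ l) (\<lambda>z. W z k) 0" for k l
  have Dreal: "D k l = complex_of_real (Re (D k l))" if k: "k \<le> n" for k l
  proof -
    have "D k l = cnj (D k l)"
      unfolding D_def using higher_deriv_cnj[OF W(1)[OF k] Wcnj[OF _ k], of 0 l] by simp
    thus ?thesis by (metis Reals_cnj_iff of_real_Re)
  qed
  define A where "A k = Abs_fps (\<lambda>l. Re (D k l) / fact l)" for k
  have sums: "(\<lambda>l. fps_nth (A k) l * s ^ l) sums Re (W (complex_of_real s) k)" if k: "k \<le> n" and s: "\<bar>s\<bar> < 1" for k s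
  proof -
    have "(\<lambda>l. D k l / fact l * (complex_of_real s - 0) ^ l) sums W (complex_of_real s) k"
      unfolding D_def by (rule holomorphic_power_series[OF W(1)[OF k]]) (use s in auto)
    hence "(\<lambda>l. Re (D k l / fact l * (complex_of_real s - 0) ^ l)) sums Re (W (complex_of_real s) k)"
      by (rule sums_Re)
    also have "(\<lambda>l. Re (D k l / fact l * (complex_of_real s - 0) ^ l)) = (\<lambda>l. fps_nth (A k) l * s ^ l)"
    proof
      fix l
      have "D k l / fact l * (complex_of_real s - 0) ^ l = complex_of_real (Re (D k l) / fact l * s ^ l)"
        by (subst Dreal[OF k]) simp
      hence "Re (D k l / fact l * (complex_of_real s - 0) ^ l) = Re (D k l) / fact l * s ^ l"
        by (simp only: Re_complex_of_real)
      thus "Re (D k l / fact l * (complex_of_real s - 0) ^ l) = fps_nth (A k) l * s ^ l"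
        by (simp add: A_def)
    qed
    finally show ?thesis .
  qed
  have rad: "fps_conv_radius (A k) \<ge> 1" if k: "k \<le> n" for k
    unfolding fps_conv_radius_def
  proof (rule conv_radius_geI_ex)
    fix r :: real assume "0 < r" "ereal r < 1"
    thus "\<exists>z. norm z = r \<and> summable (\<lambda>l. fps_nth (A k) l * z ^ l)"
      using sums[OF k, of r] by (intro exI[of _ r]) (auto simp: sums_iff one_ereal_def)
  qed
  have Wreal: "W (complex_of_real s) k \<in> \<real>" if "\<bar>s\<bar> < 1" "k \<le> n" for s k
    using Wcnj[of "complex_of_real s" k] that by (simp add: Reals_cnj_iff)
  have ev: "W (complex_of_real s) k = complex_of_real (eval_fps (A k) s)" if "\<bar>s\<bar> < 1" "k \<le> n" for s k
    using sums[OF that(2,1)] Wreal[OF that] by (simp add: eval_fps_def sums_iff of_real_Re)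
  have evX: "X (complex_of_real (real c * ln s)) k = complex_of_real (eval_fps (A k) s)" if "k \<le> n" "0 < s" "s < 1" for s k
    using ev[of s k] Wr[of s] that by simp
  have neg: "complex_of_real (real c * ln s) \<in> left_half" if "0 < s" "s < 1" for s
    using that by (simp add: left_half_def mult_nonneg_nonpos)
  have nz: "A k \<noteq> 0" if k: "k \<le> n" for k
    using evX[OF k, of "1/2"] lift_nonzero[OF X neg[of "1/2"] k] by auto
  have fourier: "integral {0..2 * pi} (\<lambda>\<theta>. X (\<i> * complex_of_real (real c * \<theta>)) k * cis (- (real l * \<theta>)))
       = 2 * pi * complex_of_real (fps_nth (A k) l)" if k: "k \<le> n" for k l
  proof -
    have "X (\<i> * complex_of_real (real c * \<theta>)) k = W (cis \<theta>) k" for \<theta>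
      using W(5)[of "\<i> * complex_of_real \<theta>"] by (simp add: left_half_def cis_conv_exp mult_ac)
    hence "integral {0..2 * pi} (\<lambda>\<theta>. X (\<i> * complex_of_real (real c * \<theta>)) k * cis (- (real l * \<theta>)))
       = 2 * pi / fact l * D k l"
      using fourier_coefficient[OF W(2)[OF k] W(1)[OF k], of l] by (simp add: D_def)
    also have "\<dots> = 2 * pi * complex_of_real (fps_nth (A k) l)"
      by (subst Dreal[OF k]) (simp add: A_def)
    finally show ?thesis .
  qed
  have sgnA: "sgn (fps_nth (A k) (subdegree (A k))) = sgn (Re (X 0 k))" if k: "k \<le> n" for k
  proof -
    have "fps_conv_radius (A k) > 0" using rad[OF k] by (simp add: less_le_trans[of 0 1])
    from eventually_sgn_eval_fps[OF this] eventually_at_right_real[of 0 1]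
    have "\<forall>\<^sub>F s in at_right 0. s \<in> {0<..<1} \<and> sgn (eval_fps (A k) s) = sgn (fps_nth (A k) (subdegree (A k)))"
      by (simp add: eventually_conj_iff)
    from eventually_happens'[OF trivial_limit_at_right_real this]
    obtain s :: real where s: "0 < s" "s < 1" "sgn (eval_fps (A k) s) = sgn (fps_nth (A k) (subdegree (A k)))" by auto
    note s(3)
    moreover have "sgn (eval_fps (A k) s) = sgn (Re (X (complex_of_real (real c * ln s)) k))"
      using evX[OF k s(1,2)] by simp
    moreover have "\<dots> = sgn (Re (X 0 k))"
      by (rule lift_sgn[OF X real _ k]) (use s in \<open>auto intro: mult_nonneg_nonpos\<close>)
    ultimately show ?thesis by simp
  qed
  have sub: "subdegree (A j) = c"
  proof -
    \<comment> \<open>The \<open>j\<close>-th coordinate is exactly a monomial in the disc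
      parameter, so its order is the period itself.\<close>
    have "A j = fps_const \<tau> * fps_X ^ c"
    proof (rule real_fps_eqI)
      show "fps_conv_radius (A j) > 0" using rad[OF j] by (simp add: less_le_trans[of 0 1])
      show "fps_conv_radius (fps_const \<tau> * fps_X ^ c) > 0"
        using fps_conv_radius_mult[of "fps_const \<tau>" "fps_X ^ c"] by simp
      have "\<forall>\<^sub>F s in at_right (0::real). s \<in> {0<..<1}" by (rule eventually_at_right_real) simp
      thus "\<forall>\<^sub>F s in at_right 0. eval_fps (A j) s = eval_fps (fps_const \<tau> * fps_X ^ c) s"
      proof eventually_elim
        case (elim s)
        have "complex_of_real (eval_fps (A j) s) = complex_of_real (\<tau> * s ^ c)"
          using ev[of s j] W(4)[of "complex_of_real s"] elim j by simp
        hence "eval_fps (A j) s = \<tau> * s ^ c" by (simp only: of_real_eq_iff)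
        thus ?case by (simp add: eval_fps_mult)
      qed
    qed
    thus ?thesis using tau by simp
  qed
  \<comment> \<open>Since the \<open>j\<close>-th coordinate of \<open>W z\<close> is
    \<open>\<tau> * z ^ c\<close>, the real \<open>c\<close>-th root yields the path with
    \<open>j\<close>-th coordinate \<open>\<tau> * s\<close>.\<close>
  define P where "P s = W (complex_of_real (root c s))" for s
  have root01: "complex_of_real (root c s) \<in> cball 0 1" if "s \<in> {0..1}" for s
    using that c real_root_le_1_iff[of c s] by (auto simp: real_root_ge_zero)
  have P0: "P 0 = (\<lambda>k\<in>{0..n}. complex_of_real (fps_nth (A k) 0))"
  proof (rule ext_eqI)
    show "P 0 \<in> {0..n} \<rightarrow>\<^sub>E UNIV" using V_ext[OF W(3)[of 0]] by (simp add: P_def)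
    show "P 0 i = (\<lambda>k\<in>{0..n}. complex_of_real (fps_nth (A k) 0)) i" if "i \<le> n" for i
      using ev[of 0 i] that by (simp add: P_def eval_fps_at_0)
  qed auto
  have P1: "P 1 = X 0" using Wr[of 1] c by (simp add: P_def)
  have Pcont: "continuous_on {0..1} P"
  proof (rule continuous_on_coordinatewise_then_product)
    fix i
    show "continuous_on {0..1} (\<lambda>s. P s i)"
    proof (cases "i \<le> n")
      case True
      show ?thesis unfolding P_def
        by (rule continuous_on_compose2[OF W(2)[OF True]]) (use root01 in \<open>auto intro!: continuous_intros\<close>)
    next
      case False
      have "P s i = undefined" if "s \<in> {0..1}" for s
        using V_ext[OF W(3)[OF root01[OF that]]] False by (auto simp: P_def PiE_def extensional_def)
      thus ?thesis by (intro continuous_on_eq[OF continuous_on_const[of _ undefined]]) simp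
    qed
  qed
  have PV: "P s \<in> V \<and> P s j = complex_of_real (\<tau> * s)" if s: "s \<in> {0..1}" for s
  proof -
    have "complex_of_real (root c s) ^ c = complex_of_real s"
      using s c real_root_pow_pos2[of c s] by (simp flip: of_real_power)
    thus ?thesis using W(3,4)[OF root01[OF s]] by (simp add: P_def)
  qed
  have PX: "P s = X (complex_of_real (ln s))" if "0 < s" "s \<le> 1" for s
  proof -
    have "ln (root c s) = ln s / real c" using that c by (simp add: ln_root)
    thus ?thesis using Wr[of "root c s"] that c by (simp add: P_def real_root_gt_zero)
  qed
  show ?thesis using that[of A P] rad evX nz fourier sgnA sub P0 P1 Pcont PV PX by blast
qed

end

section \<open>Puiseux series with a given denominator\<close>

text \<open>The series \<open>F\<close> in the variable \<open>t\<close> to the power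
  \<open>1/m\<close>. Working with a fixed \<open>m\<close> replaces the quotient by Laurent
  series.\<close>

definition puiseux_of_fls :: "nat \<Rightarrow> 'a::field fls \<Rightarrow> 'a puiseux" where
  "puiseux_of_fls m F = abs_puiseux (m, F)"

lemma puiseux_of_fls_eq_iff:
  assumes "m > 0" "k > 0"
  shows "puiseux_of_fls m F = puiseux_of_fls k G \<longleftrightarrow> fls_compose_power F k = fls_compose_power G m"
  unfolding puiseux_of_fls_def
  using Quotient3_rel[OF Quotient3_puiseux, of "(m, F)" "(k, G)"] assms by (simp add: puiseux_rel_def)

lemma puiseux_of_fls_inj: "m > 0 \<Longrightarrow> puiseux_of_fls m F = puiseux_of_fls m G \<longleftrightarrow> F = G"
  by (auto simp: puiseux_of_fls_eq_iff dest: fls_compose_power_cancel)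

lemma puiseux_of_fls_compose:
  assumes "m > 0" "k > 0"
  shows "puiseux_of_fls (m * k) (fls_compose_power F k) = puiseux_of_fls m F"
  using assms by (simp add: puiseux_of_fls_eq_iff fls_compose_power_compose mult.commute)

lemma puiseux_of_fls_exists: "\<exists>m F. m > 0 \<and> y = puiseux_of_fls m F"
proof -
  have "puiseux_rel (rep_puiseux y) (rep_puiseux y)"
    by (rule Quotient3_rep_reflp[OF Quotient3_puiseux])
  hence "fst (rep_puiseux y) > 0" by (simp add: puiseux_rel_def)
  moreover have "y = puiseux_of_fls (fst (rep_puiseux y)) (snd (rep_puiseux y))"
    unfolding puiseux_of_fls_def by (simp add: Quotient3_abs_rep[OF Quotient3_puiseux])
  ultimately show ?thesis by blast
qed

lemma ring_hom_puiseux_of_fls: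
  assumes "m > 0"
  shows "ring_hom_fun (puiseux_of_fls m :: 'a::field fls \<Rightarrow> _)"
proof
  have rel: "puiseux_rel (k, F) (k, F)" if "k > 0" for k and F :: "'a fls"
    using that by (simp add: puiseux_rel_def)
  show "puiseux_of_fls m (0 :: 'a fls) = 0"
    using assms puiseux_of_fls_eq_iff[of m 1 0 "0 :: 'a fls"] by (simp add: puiseux_of_fls_def zero_puiseux.abs_eq)
  show "puiseux_of_fls m (1 :: 'a fls) = 1"
    using assms puiseux_of_fls_eq_iff[of m 1 1 "1 :: 'a fls"] by (simp add: puiseux_of_fls_def one_puiseux.abs_eq)
  fix F G :: "'a fls"
  have "puiseux_of_fls m F + puiseux_of_fls m G = puiseux_of_fls (m * m) (fls_compose_power (F + G) m)"
    using assms by (simp add: puiseux_of_fls_def plus_puiseux.abs_eq rel)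
  thus "puiseux_of_fls m (F + G) = puiseux_of_fls m F + puiseux_of_fls m G"
    using puiseux_of_fls_compose[OF assms assms] by metis
  have "puiseux_of_fls m F * puiseux_of_fls m G = puiseux_of_fls (m * m) (fls_compose_power (F * G) m)"
    using assms by (simp add: puiseux_of_fls_def times_puiseux.abs_eq rel)
  thus "puiseux_of_fls m (F * G) = puiseux_of_fls m F * puiseux_of_fls m G"
    using puiseux_of_fls_compose[OF assms assms] by metis
qed

lemma puiseux_const_altdef: "m > 0 \<Longrightarrow> puiseux_const c = puiseux_of_fls m (fls_const c)"
  using puiseux_of_fls_eq_iff[of 1 m "fls_const c" "fls_const c"]
  by (simp add: puiseux_of_fls_def puiseux_const.abs_eq)

lemma puiseux_val_of_fls: "m > 0 \<Longrightarrow> puiseux_val (puiseux_of_fls m F) = real_of_int (fls_subdegree F) / real m"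
  by (simp add: puiseux_of_fls_def puiseux_val.abs_eq puiseux_rel_def)

lemma puiseux_coeff_of_fls: "m > 0 \<Longrightarrow> puiseux_coeff (puiseux_of_fls m F) = fls_nth F (fls_subdegree F)"
  by (simp add: puiseux_of_fls_def puiseux_coeff.abs_eq puiseux_rel_def)

lemma eval_with_puiseux_of_fls:
  assumes m: "m > 0" and "g \<in> polys_in A" "\<And>i. i \<in> A \<Longrightarrow> y i = puiseux_of_fls m (F i)"
  shows "eval_with puiseux_const g y = puiseux_of_fls m (eval_with fls_const g F)"
proof -
  interpret ring_hom_fun "puiseux_of_fls m :: 'a fls \<Rightarrow> _" by (rule ring_hom_puiseux_of_fls[OF m])
  show ?thesis
    by (rule eval_with_rel[OF assms(2), of "\<lambda>a b. a = puiseux_of_fls m b"])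
      (use assms in \<open>auto simp: hom_0 hom_1 hom_add hom_mult puiseux_const_altdef\<close>)
qed

interpretation fls_const_hom: ring_hom_fun "fls_const :: 'a::field \<Rightarrow> 'a fls"
  by unfold_locales (auto simp: fls_plus_const fls_const_mult_const)

lemma eval_with_fps_to_fls:
  fixes A :: "nat \<Rightarrow> 'a::field fps"
  shows "eval_with fls_const g (\<lambda>i. fps_to_fls (A i)) = fps_to_fls (eval_with fps_const g A)"
  by (rule eval_with_rel[of g UNIV "\<lambda>a b. a = fps_to_fls b"])
    (auto simp: fls_times_fps_to_fls)

text \<open>Radius and value are carried along together, since evaluating a product at
  \<open>s\<close> requires the factors to converge there.\<close>

lemma eval_fps_eval_with:
  fixes A :: "nat \<Rightarrow> real fps"
  assumes g: "g \<in> polys_in I" and A: "\<And>i. i \<in> I \<Longrightarrow> fps_conv_radius (A i) \<ge> R" and s: "ereal \<bar>s\<bar> < R"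
  shows "fps_conv_radius (eval_with fps_const g A) \<ge> R \<and>
    eval_fps (eval_with fps_const g A) s = eval_with (\<lambda>a. a) g (\<lambda>i. eval_fps (A i) s)"
proof (rule eval_with_rel[OF g, of "\<lambda>F a. fps_conv_radius F \<ge> R \<and> eval_fps F s = a"])
  fix F G :: "real fps" and a b
  assume FG: "fps_conv_radius F \<ge> R \<and> eval_fps F s = a" "fps_conv_radius G \<ge> R \<and> eval_fps G s = b"
  hence r: "ereal (norm s) < fps_conv_radius F" "ereal (norm s) < fps_conv_radius G"
    using s less_le_trans[of "ereal \<bar>s\<bar>" R] by auto
  have "R \<le> fps_conv_radius (F + G)" "R \<le> fps_conv_radius (F * G)"
    using FG fps_conv_radius_add[of F G] fps_conv_radius_mult[of F G] by (meson min.boundedI order_trans)+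
  thus "fps_conv_radius (F + G) \<ge> R \<and> eval_fps (F + G) s = a + b"
    "fps_conv_radius (F * G) \<ge> R \<and> eval_fps (F * G) s = a * b"
    using FG r by (auto simp: eval_fps_add eval_fps_mult)
qed (use A in auto)

lemma eval_with_of_real:
  "eval_with complex_of_real g (\<lambda>i. complex_of_real (x i)) = complex_of_real (eval_with (\<lambda>a. a) g x)"
  by (rule eval_with_rel[of g UNIV "\<lambda>a b. a = complex_of_real b"]) auto

lemma patch_real_ideal:
  assumes "zariski_closed n C" "x \<in> affine_patch n C v" "\<And>i. i \<le> n \<Longrightarrow> x i \<noteq> 0" "g \<in> real_ideal n C"
  shows "eval_with complex_of_real (homogenize g) x = 0"
proof -
  have "eval_with complex_of_real g (\<lambda>i. x i / x 0) = eval_with complex_of_real g (\<lambda>i\<in>{1..n}. x i / x 0)"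
    by (rule eval_with_cong[of g "{1..n}"]) (use assms(4) in \<open>auto simp: real_ideal_def\<close>)
  also have "\<dots> = 0" using patch_to_curve[OF assms(1-3)] assms(4) by (auto simp: real_ideal_def)
  finally show ?thesis
    using eval_homogenize[OF of_real_hom.ring_hom_fun_axioms, of x g] assms(3)[of 0] by simp
qed

section \<open>Soundness of the procedure\<close>

lemma Gcd_div_eq_1:
  fixes u :: "nat \<Rightarrow> nat"
  assumes "Gcd (u ` A) \<noteq> 0"
  shows "Gcd ((\<lambda>k. u k div Gcd (u ` A)) ` A) = 1"
proof -
  let ?g = "Gcd (u ` A)"
  have "u k = ?g * (u k div ?g)" if "k \<in> A" for k
    using Gcd_dvd[of "u k" "u ` A"] that by simp
  hence "u ` A = (*) ?g ` (\<lambda>k. u k div ?g) ` A" by (force simp: image_image)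
  hence "?g = ?g * Gcd ((\<lambda>k. u k div ?g) ` A)"
    using Gcd_mult[of ?g "(\<lambda>k. u k div ?g) ` A"] by simp
  thus ?thesis using assms by simp
qed

text \<open>A common divisor of the differences divides \<open>r 0\<close>, because
  \<open>r k = 0\<close>, and then every \<open>r i\<close>. Hence passing from homogeneous to
  affine exponents keeps a vector primitive.\<close>

lemma Gcd_differences:
  fixes r :: "nat \<Rightarrow> nat"
  assumes "Gcd (r ` {0..n}) = 1" "k \<le> n" "r k = 0"
  shows "Gcd ((\<lambda>i. int (r 0) - int (r i)) ` {1..n}) = 1"
proof -
  let ?D = "Gcd ((\<lambda>i. int (r 0) - int (r i)) ` {1..n})"
  have d: "?D dvd int (r 0) - int (r i)" if "i \<le> n" for i
    using that by (cases "i = 0") (auto intro!: Gcd_dvd)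
  have "?D dvd int (r 0)" using d[OF assms(2)] assms(3) by simp
  hence "?D dvd int (r i)" if "i \<le> n" for i
    using d[OF that] by (metis dvd_diff_commute dvd_diff_right_iff diff_zero dvd_0_right dvd_diff dvd_minus_iff minus_diff_eq add_diff_cancel_left' diff_diff_eq2)
  moreover have D: "?D = int (nat ?D)" by (simp add: Gcd_int_greater_eq_0)
  ultimately have "nat ?D dvd r i" if "i \<le> n" for i
    using that by (metis int_dvd_int_iff)
  hence "nat ?D dvd Gcd (r ` {0..n})" by (intro Gcd_greatest) auto
  hence "nat ?D = 1" using assms(1) by simp
  thus ?thesis using D by simp
qed

lemma is_least_fps_nth:
  assumes "is_least (\<lambda>l. fps_nth F l \<noteq> 0) k"
  shows "k = subdegree F"
  using assms by (intro subdegreeI[symmetric]) (auto simp: is_least_def)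

text \<open>The quotients of the branch series by the zeroth one form a Puiseux point; their orders
  are differences of the computed \<open>u k\<close>, and their leading signs are those at the base
  point.\<close>

lemma circle_output_sound:
  assumes C: "zariski_closed n C"
    and pc: "patch_curve n j (affine_patch n C v) E G t"
    and out: "(u', \<sigma>) \<in> circle_output n C v j t"
  shows "(u', \<sigma>) \<in> primitive_vectors_with_signs n C"
proof -
  interpret patch_curve n j "affine_patch n C v" E G t by (rule pc)
  obtain p P Q c u where
    u': "u' = (\<lambda>i\<in>{1..n}. int (reduced_vector n u 0) - int (reduced_vector n u i))"
    and \<sigma>: "\<sigma> = (\<lambda>i\<in>{1..n}. sgn (Re (p 0 * p i)))"
    and p: "p \<in> affine_patch n C v" "p j = complex_of_real t" "\<And>k. k \<le> n \<Longrightarrow> p k \<in> \<real>"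
    and P: "radial_path n C v j t p P"
    and Q: "circular_path n C v j t p Q" "cycle_number Q c" "\<And>k. k \<le> n \<Longrightarrow> fourier_order Q c k (u k)"
    using out unfolding circle_output_def by blast
  have zero: "(0::complex) \<in> left_half" by (simp add: left_half_def)
  \<comment> \<open>The radial path approaches \<open>p\<close> through points of the patch with
    different \<open>j\<close>-th coordinate.\<close>
  have "accum p"
    unfolding accum_def
  proof (intro conjI allI impI p(1))
    fix \<epsilon> :: real assume "\<epsilon> > 0"
    have Pc: "continuous_on {0..1} P" "P 1 = p" and PV: "\<And>s. s \<in> {0..1} \<Longrightarrow> P s \<in> affine_patch n C v \<and> P s j = complex_of_real (t * s)"
      using P by (auto simp: radial_path_def)
    have "((\<lambda>s. P s i) \<longlongrightarrow> p i) (at 1 within {0..1})" for i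
      using continuous_on_product_then_coordinatewise[OF Pc(1), of i] Pc(2) by (auto simp: continuous_on_def)
    hence "\<forall>\<^sub>F s in at 1 within {0..1}. near \<epsilon> p (P s)" using \<open>\<epsilon> > 0\<close> by (intro eventually_near)
    moreover have "\<forall>\<^sub>F s in at 1 within {0..1}. s \<in> {0..1} \<and> s \<noteq> (1::real)" by (simp add: eventually_at_filter)
    ultimately have ev: "\<forall>\<^sub>F s in at 1 within {0..1}. near \<epsilon> p (P s) \<and> s \<in> {0..1} \<and> s \<noteq> (1::real)" by eventually_elim auto
    have "at (1::real) within {0..1} \<noteq> bot"
      by (simp add: at_within_Icc_at_left)
    from eventually_happens'[OF this ev] obtain s where s: "near \<epsilon> p (P s)" "s \<in> {0..1}" "s \<noteq> 1" by blast
    have "P s j \<noteq> p j" using PV[OF s(2)] s(3) p(2) tau by simp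
    thus "\<exists>x\<in>affine_patch n C v. x \<noteq> p \<and> near \<epsilon> p x" using s(1) PV[OF s(2)] by metis
  qed
  hence "p \<in> fibre 0" using p(2) by (simp add: fibre_def)
  then obtain X where X: "lift_over fibre left_half X" "X 0 = p" using lift_exists[OF zero] by blast
  have iL: "\<i> * complex_of_real \<theta> \<in> left_half" for \<theta> by (simp add: left_half_def)
  have XV: "X \<zeta> \<in> affine_patch n C v" "X \<zeta> j \<noteq> 0" "cmod (X \<zeta> j) \<le> \<bar>t\<bar>" "X \<zeta> j = complex_of_real t * exp \<zeta>"
    if "\<zeta> \<in> left_half" for \<zeta>
  proof -
    have "X \<zeta> \<in> fibre \<zeta>" using X that by (simp add: lift_over_def)
    from fibreD[OF this that] this show "X \<zeta> \<in> affine_patch n C v" "X \<zeta> j \<noteq> 0" "cmod (X \<zeta> j) \<le> \<bar>t\<bar>"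
        "X \<zeta> j = complex_of_real t * exp \<zeta>" by (auto simp: fibre_def)
  qed
  have Qprop: "continuous_on {0..} Q" "Q 0 = p" "\<And>\<theta>. \<theta> \<ge> 0 \<Longrightarrow> Q \<theta> \<in> affine_patch n C v \<and> Q \<theta> j = complex_of_real t * cis \<theta>"
    using Q(1) by (auto simp: circular_path_def)
  \<comment> \<open>The circular path of the procedure is the restriction of the lift to the
    imaginary axis.\<close>
  have XQ: "X (\<i> * complex_of_real \<theta>) = Q \<theta>" if \<theta>: "\<theta> \<ge> 0" for \<theta>
  proof (rule path_unique[of "{0..}" "\<lambda>\<theta>. X (\<i> * complex_of_real \<theta>)" Q 0 \<theta>])
    show "connected {0::real..}" by (intro convex_connected) simp
    fix i
    show "continuous_on {0..} (\<lambda>\<theta>. X (\<i> * complex_of_real \<theta>) i)"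
    proof (rule continuous_on_compose2[of left_half "\<lambda>\<zeta>. X \<zeta> i"])
      show "continuous_on left_half (\<lambda>\<zeta>. X \<zeta> i)"
        using X(1) unfolding lift_over_def by (blast intro: continuous_on_product_then_coordinatewise)
    qed (use iL in \<open>auto intro!: continuous_intros\<close>)
    show "continuous_on {0..} (\<lambda>\<theta>. Q \<theta> i)" by (rule continuous_on_product_then_coordinatewise[OF Qprop(1)])
  next
    fix \<theta> :: real assume \<theta>: "\<theta> \<in> {0..}"
    show "X (\<i> * complex_of_real \<theta>) j = Q \<theta> j"
      using XV(4)[OF iL] Qprop(3) \<theta> by (simp add: cis_conv_exp)
    show "Q \<theta> \<in> affine_patch n C v" using Qprop(3) \<theta> by simp
  qed (use XV(1-3)[OF iL] Qprop(2) \<theta> X(2) in simp_all)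
  have c: "c > 0" "Q (2 * pi * real c) = Q 0"
    using Q(2) by (auto simp: cycle_number_def is_least_def)
  have "X (2 * pi * real c * \<i>) = X 0"
    using XQ[of "2 * pi * real c"] c(2) Qprop(2) X(2) by (simp add: mult.commute)
  note c = c(1) this
  have real: "\<And>i. i \<le> n \<Longrightarrow> X 0 i \<in> \<real>" using p(3) X(2) by simp
  obtain A P' where A: "\<And>k. k \<le> n \<Longrightarrow> fps_conv_radius (A k) \<ge> 1"
    "\<And>k s. k \<le> n \<Longrightarrow> 0 < s \<Longrightarrow> s < 1 \<Longrightarrow> X (complex_of_real (real c * ln s)) k = complex_of_real (eval_fps (A k) s)"
    "\<And>k. k \<le> n \<Longrightarrow> A k \<noteq> 0"
    "\<And>k l. k \<le> n \<Longrightarrow> integral {0..2 * pi} (\<lambda>\<theta>. X (\<i> * complex_of_real (real c * \<theta>)) k * cis (- (real l * \<theta>)))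
       = 2 * pi * complex_of_real (fps_nth (A k) l)"
    "\<And>k. k \<le> n \<Longrightarrow> sgn (fps_nth (A k) (subdegree (A k))) = sgn (Re (X 0 k))"
    "subdegree (A j) = c"
    and P': "P' 0 = (\<lambda>k\<in>{0..n}. complex_of_real (fps_nth (A k) 0))"
    "\<And>s. s \<in> {0..1} \<Longrightarrow> P' s \<in> affine_patch n C v \<and> P' s j = complex_of_real (t * s)"
    by (rule real_branch[OF X(1) real c]) (assumption | blast)+
  have u: "u k = subdegree (A k)" if k: "k \<le> n" for k
  proof (rule is_least_fps_nth)
    have "integral {0..2 * pi} (\<lambda>\<theta>. Q (real c * \<theta>) k * cis (- (real l * \<theta>))) =
        integral {0..2 * pi} (\<lambda>\<theta>. X (\<i> * complex_of_real (real c * \<theta>)) k * cis (- (real l * \<theta>)))" for l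
      by (rule integral_cong, subst XQ) auto
    thus "is_least (\<lambda>l. fps_nth (A k) l \<noteq> 0) (u k)"
      using Q(3)[OF k] A(4)[OF k] by (simp add: fourier_order_def)
  qed
  define g where "g = Gcd (u ` {0..n})"
  define r where "r k = reduced_vector n u k" for k
  have "u j \<noteq> 0" using u[OF j] A(6) c(1) by simp
  hence "\<not> u ` {0..n} \<subseteq> {0}" using j by (metis atLeastAtMost_iff image_subset_iff le0 singletonD)
  hence g: "g \<noteq> 0" unfolding g_def Gcd_0_iff .
  have ur: "u k = g * r k" if "k \<le> n" for k
    using Gcd_dvd[of "u k" "u ` {0..n}"] that by (simp add: r_def reduced_vector_def g_def)
  have Gr: "Gcd (r ` {0..n}) = 1"
    using Gcd_div_eq_1[of u "{0..n}"] g by (simp add: r_def[abs_def] reduced_vector_def g_def)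
  \<comment> \<open>The centre of the branch lies in the patch and hence is not the zero vector; a
    coordinate not vanishing there has order zero.\<close>
  have "\<exists>k\<le>n. r k = 0"
  proof -
    have "P' 0 \<in> affine_patch n C v" using P'(2)[of 0] by simp
    hence "(\<Sum>i\<le>n. complex_of_real (v i) * P' 0 i) = 1" by (simp add: affine_patch_iff)
    hence "\<exists>k\<le>n. P' 0 k \<noteq> 0" by (metis (no_types, lifting) atMost_iff mult_zero_right sum.neutral zero_neq_one)
    then obtain k where k: "k \<le> n" "fps_nth (A k) 0 \<noteq> 0" by (auto simp: P'(1))
    hence "u k = 0" using u[OF k(1)] by (simp add: subdegree_eq_0)
    thus ?thesis using ur[OF k(1)] g k(1) by auto
  qed
  then obtain k0 where k0: "k0 \<le> n" "r k0 = 0" by blast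
  have u'r: "u' i = int (r 0) - int (r i)" if "i \<in> {1..n}" for i using that by (simp add: u' r_def)
  have Gu': "Gcd (u' ` {1..n}) = 1"
  proof -
    have "u' ` {1..n} = (\<lambda>i. int (r 0) - int (r i)) ` {1..n}" using u'r by (intro image_cong) auto
    thus ?thesis using Gcd_differences[OF Gr k0] by simp
  qed
  \<comment> \<open>The disc parameter itself serves as the variable of the Puiseux series, with
    denominator 1: valuations matter only up to a positive factor.\<close>
  define L where "L i = fps_to_fls (A i) / fps_to_fls (A 0)" for i
  define y where "y = (\<lambda>i\<in>{1..n}. puiseux_of_fls 1 (L i))"
  have Lnz: "L i \<noteq> 0" if "i \<le> n" for i using A(3)[OF that] A(3)[of 0] by (simp add: L_def)
  have Lsub: "fls_subdegree (L i) = int (u i) - int (u 0)" if "i \<le> n" for i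
    using A(3)[OF that] A(3)[of 0] u[OF that] u[of 0] by (simp add: L_def fls_divide_subdegree fls_subdegree_fls_to_fps)
  have Llead: "sgn (fls_nth (L i) (fls_subdegree (L i))) = sgn (Re (p 0 * p i))" if i: "i \<le> n" for i
  proof -
    have "fls_nth (L i) (fls_subdegree (L i)) = fps_nth (A i) (u i) / fps_nth (A 0) (u 0)"
      using fls_divide_nth_base[of "fps_to_fls (A i)" "fps_to_fls (A 0)"] Lsub[OF i] u[OF i] u[of 0]
      by (simp add: L_def fls_subdegree_fls_to_fps)
    hence "sgn (fls_nth (L i) (fls_subdegree (L i))) = sgn (fps_nth (A i) (u i)) * sgn (fps_nth (A 0) (u 0))"
      by (auto simp: sgn_if zero_less_divide_iff)
    also have "\<dots> = sgn (Re (p i)) * sgn (Re (p 0))"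
      using A(5)[OF i] A(5)[of 0] u[OF i] u[of 0] X(2) by simp
    also have "\<dots> = sgn (Re (p 0 * p i))"
      using p(3)[OF i] p(3)[of 0] by (auto elim!: Reals_cases simp: sgn_mult)
    finally show ?thesis .
  qed
  have "y \<in> real_puiseux_points n C"
    unfolding real_puiseux_points_def
  proof (intro CollectI conjI ballI)
    interpret ph: ring_hom_fun "puiseux_of_fls 1 :: real fls \<Rightarrow> _" by (rule ring_hom_puiseux_of_fls) simp
    show "y \<in> {1..n} \<rightarrow>\<^sub>E UNIV - {0}"
    proof -
      have "puiseux_of_fls 1 (L i) \<noteq> 0" if "i \<le> n" for i
        using Lnz[OF that] puiseux_of_fls_inj[of 1 "L i" 0] unfolding ph.hom_0 by simp
      thus ?thesis by (auto simp: y_def)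
    qed
    fix h assume h: "h \<in> real_ideal n C"
    hence hin: "h \<in> polys_in {1..n}" by (simp add: real_ideal_def)
    let ?N = "homogenize h"
    have N: "?N \<in> polys_in {0..n}" by (rule homogenize_in[OF hin])
    \<comment> \<open>For small positive \<open>s\<close> the series give points of the patch on
      which the homogenized equation vanishes, so the composed series vanishes identically.\<close>
    have "eval_with fps_const ?N A = 0"
    proof (rule real_fps_eqI)
      have ef: "fps_conv_radius (eval_with fps_const ?N A) \<ge> 1 \<and>
        eval_fps (eval_with fps_const ?N A) s = eval_with (\<lambda>a. a) ?N (\<lambda>i. eval_fps (A i) s)" if "\<bar>s\<bar> < 1" for s
        by (rule eval_fps_eval_with[OF N]) (use A(1) that in \<open>auto simp: one_ereal_def\<close>)
      show "fps_conv_radius (eval_with fps_const ?N A) > 0" using ef[of 0] by (simp add: less_le_trans[of 0 1])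
      have "\<forall>\<^sub>F s in at_right 0. s \<in> {0<..<(1::real)}" by (rule eventually_at_right_real) simp
      thus "\<forall>\<^sub>F s in at_right 0. eval_fps (eval_with fps_const ?N A) s = eval_fps 0 s"
      proof eventually_elim
        case (elim s)
        let ?\<zeta> = "complex_of_real (real c * ln s)"
        have \<zeta>: "?\<zeta> \<in> left_half" using elim by (simp add: left_half_def mult_nonneg_nonpos)
        have "complex_of_real (eval_with (\<lambda>a. a) ?N (\<lambda>i. eval_fps (A i) s)) = eval_with complex_of_real ?N (\<lambda>i. complex_of_real (eval_fps (A i) s))"
          by (rule eval_with_of_real[symmetric])
        also have "\<dots> = eval_with complex_of_real ?N (X ?\<zeta>)"
          by (rule eval_with_cong[OF N]) (use A(2) elim in auto)
        also have "\<dots> = 0"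
          by (rule patch_real_ideal[OF C XV(1)[OF \<zeta>] _ h]) (use lift_nonzero[OF X(1) \<zeta>] in auto)
        finally show ?case using ef[of s] elim by simp
      qed
    qed simp
    hence "eval_with fls_const ?N (\<lambda>i. fps_to_fls (A i)) = 0" by (simp add: eval_with_fps_to_fls)
    hence hL: "eval_with fls_const h L = 0"
      using eval_homogenize[OF fls_const_hom.ring_hom_fun_axioms, of "\<lambda>i. fps_to_fls (A i)" h] A(3)[of 0]
      by (simp add: L_def[abs_def])
    have "eval_with puiseux_const h y = puiseux_of_fls 1 (eval_with fls_const h L)"
      by (rule eval_with_puiseux_of_fls[OF _ hin]) (auto simp: y_def)
    thus "eval_with puiseux_const h y = 0" unfolding hL ph.hom_0 .
  qed
  moreover have "- puiseux_val (y i) = real g * real_of_int (u' i)" if i: "i \<in> {1..n}" for i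
  proof -
    have "fls_subdegree (L i) = - (int g * u' i)"
    proof -
      have "fls_subdegree (L i) = int (g * r i) - int (g * r 0)"
        using i Lsub[of i] ur[of i] ur[of 0] by simp
      thus ?thesis unfolding u'r[OF i] by (simp add: algebra_simps)
    qed
    thus ?thesis using i by (simp add: y_def puiseux_val_of_fls)
  qed
  moreover have "sgn (puiseux_coeff (y i)) = \<sigma> i" if i: "i \<in> {1..n}" for i
    using i Llead[of i] by (simp add: y_def puiseux_coeff_of_fls \<sigma>)
  moreover have "u' \<in> {1..n} \<rightarrow>\<^sub>E UNIV" by (simp add: u')
  moreover have "\<sigma> \<in> {1..n} \<rightarrow>\<^sub>E {1, -1}"
  proof -
    have "sgn (Re (p 0 * p i)) \<in> {1, -1}" if i: "i \<le> n" for i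
    proof -
      have "p i \<noteq> 0" "p 0 \<noteq> 0" using lift_nonzero[OF X(1) zero] X(2) i by auto
      thus ?thesis using p(3)[OF i] p(3)[of 0] by (auto elim!: Reals_cases simp: sgn_if)
    qed
    thus ?thesis by (auto simp: \<sigma>)
  qed
  moreover have "\<exists>i\<in>{1..n}. u' i \<noteq> 0"
  proof (rule ccontr)
    assume "\<not> ?thesis"
    hence "u' ` {1..n} \<subseteq> {0}" by auto
    hence "Gcd (u' ` {1..n}) = 0" unfolding Gcd_0_iff .
    thus False using Gu' by linarith
  qed
  ultimately show ?thesis
    unfolding primitive_vectors_with_signs_def using Gu' g
    by (intro CollectI case_prodI conjI bexI[of _ y] exI[of _ "real g"]) auto
qed

section \<open>Algebraic power series converge\<close>

text \<open>A weighted absolute sum of the coefficients up to order \<open>m\<close>. It is finite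
  for every formal series and submultiplicative, so it can be estimated before convergence is
  known.\<close>

definition truncated_norm :: "real \<Rightarrow> nat \<Rightarrow> real fps \<Rightarrow> real" where
  "truncated_norm \<delta> m f = (\<Sum>l\<le>m. \<bar>fps_nth f l\<bar> * \<delta> ^ l)"

lemma truncated_norm_nonneg: "\<delta> \<ge> 0 \<Longrightarrow> truncated_norm \<delta> m f \<ge> 0"
  by (auto simp: truncated_norm_def intro!: sum_nonneg)

lemma truncated_norm_add:
  assumes "\<delta> \<ge> 0"
  shows "truncated_norm \<delta> m (f + g) \<le> truncated_norm \<delta> m f + truncated_norm \<delta> m g"
  unfolding truncated_norm_def sum.distrib[symmetric] distrib_right[symmetric] fps_add_nth
  using assms by (intro sum_mono mult_right_mono abs_triangle_ineq) auto

lemma truncated_norm_sum: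
  assumes "\<delta> \<ge> 0" "finite A"
  shows "truncated_norm \<delta> m (\<Sum>i\<in>A. f i) \<le> (\<Sum>i\<in>A. truncated_norm \<delta> m (f i))"
  using assms(2)
proof (induction A rule: finite_induct)
  case empty
  show ?case by (simp add: truncated_norm_def)
next
  case (insert i A)
  thus ?case using truncated_norm_add[OF assms(1), of m "f i" "\<Sum>i\<in>A. f i"] by simp
qed

lemma truncated_norm_mult:
  assumes "\<delta> \<ge> 0"
  shows "truncated_norm \<delta> m (f * g) \<le> truncated_norm \<delta> m f * truncated_norm \<delta> m g"
proof -
  let ?h = "\<lambda>i j. (\<bar>fps_nth f i\<bar> * \<delta> ^ i) * (\<bar>fps_nth g j\<bar> * \<delta> ^ j)"
  have "truncated_norm \<delta> m (f * g) \<le> (\<Sum>l\<le>m. \<Sum>i\<le>l. ?h i (l - i))"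
    unfolding truncated_norm_def
  proof (rule sum_mono)
    fix l
    have "\<bar>fps_nth (f * g) l\<bar> * \<delta> ^ l \<le> (\<Sum>i\<le>l. \<bar>fps_nth f i\<bar> * \<bar>fps_nth g (l - i)\<bar>) * \<delta> ^ l"
      unfolding fps_mult_nth atLeast0AtMost using assms sum_abs[of "\<lambda>i. fps_nth f i * fps_nth g (l - i)" "{..l}"]
      by (intro mult_right_mono) (auto simp: abs_mult)
    also have "\<dots> = (\<Sum>i\<le>l. ?h i (l - i))"
      unfolding sum_distrib_right
    proof (intro sum.cong refl)
      fix i assume "i \<in> {..l}"
      hence "\<delta> ^ l = \<delta> ^ i * \<delta> ^ (l - i)" by (simp flip: power_add)
      thus "\<bar>fps_nth f i\<bar> * \<bar>fps_nth g (l - i)\<bar> * \<delta> ^ l = ?h i (l - i)" by simp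
    qed
    finally show "\<bar>fps_nth (f * g) l\<bar> * \<delta> ^ l \<le> (\<Sum>i\<le>l. ?h i (l - i))" .
  qed
  also have "\<dots> = (\<Sum>(i, j)\<in>{(i, j). i + j \<le> m}. ?h i j)"
    by (simp add: sum.triangle_reindex_eq)
  also have "\<dots> \<le> (\<Sum>(i, j)\<in>{..m} \<times> {..m}. ?h i j)"
    using assms by (intro sum_mono2) auto
  also have "\<dots> = truncated_norm \<delta> m f * truncated_norm \<delta> m g"
    by (simp add: truncated_norm_def sum_product sum.cartesian_product)
  finally show ?thesis .
qed

lemma truncated_norm_power:
  assumes "\<delta> \<ge> 0"
  shows "truncated_norm \<delta> m (f ^ k) \<le> truncated_norm \<delta> m f ^ k"
proof (induction k)
  case 0
  have "(\<Sum>l\<le>m. \<bar>fps_nth 1 l\<bar> * \<delta> ^ l) = (\<Sum>l\<in>{0}. \<bar>fps_nth 1 l\<bar> * \<delta> ^ l)"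
    by (rule sum.mono_neutral_right) auto
  thus ?case by (simp add: truncated_norm_def)
next
  case (Suc k)
  have "truncated_norm \<delta> m (f ^ Suc k) \<le> truncated_norm \<delta> m f * truncated_norm \<delta> m (f ^ k)"
    using truncated_norm_mult[OF assms, of m f "f ^ k"] by simp
  also have "\<dots> \<le> truncated_norm \<delta> m f * truncated_norm \<delta> m f ^ k"
    by (intro mult_left_mono Suc truncated_norm_nonneg assms)
  finally show ?case by simp
qed

lemma truncated_norm_X_mult: "truncated_norm \<delta> (Suc m) (fps_X * f) = \<delta> * truncated_norm \<delta> m f"
  unfolding truncated_norm_def by (subst sum.atMost_Suc_shift) (simp add: sum_distrib_left mult_ac)

lemma truncated_norm_bounded:
  assumes "fps_conv_radius f > 0"
  shows "\<exists>\<delta>0>0. \<exists>M. \<forall>\<delta> m. 0 \<le> \<delta> \<and> \<delta> \<le> \<delta>0 \<longrightarrow> truncated_norm \<delta> m f \<le> M"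
proof -
  obtain r where r: "0 < r" "ereal r < fps_conv_radius f"
    using ereal_dense2[OF assms] by (auto simp: zero_ereal_def)
  have "summable (\<lambda>l. norm (fps_nth f l * r ^ l))"
    using r by (intro norm_summable_fps) auto
  hence s: "summable (\<lambda>l. \<bar>fps_nth f l\<bar> * r ^ l)" using r by (simp add: abs_mult)
  have "truncated_norm \<delta> m f \<le> suminf (\<lambda>l. \<bar>fps_nth f l\<bar> * r ^ l)" if \<delta>: "0 \<le> \<delta> \<and> \<delta> \<le> r" for \<delta> m
  proof -
    have "truncated_norm \<delta> m f \<le> (\<Sum>l\<le>m. \<bar>fps_nth f l\<bar> * r ^ l)"
      unfolding truncated_norm_def using \<delta> by (intro sum_mono mult_left_mono power_mono) auto
    also have "\<dots> \<le> suminf (\<lambda>l. \<bar>fps_nth f l\<bar> * r ^ l)"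
      using r by (intro sum_le_suminf s) auto
    finally show ?thesis .
  qed
  thus ?thesis using r(1) by blast
qed

text \<open>The factor \<open>fps_X\<close> lets one bound the truncated norm of order \<open>m + 1\<close> by that of order \<open>m\<close>.\<close>

lemma fps_fixed_point_converges:
  fixes w :: "real fps" and k :: "nat \<Rightarrow> real fps"
  assumes w: "w = fps_X * (\<Sum>i\<le>d. k i * w ^ i)" and k: "\<And>i. i \<le> d \<Longrightarrow> fps_conv_radius (k i) > 0"
  shows "fps_conv_radius w > 0"
proof -
  have "\<exists>\<delta>0>0. \<exists>M. \<forall>\<delta> m. 0 \<le> \<delta> \<and> \<delta> \<le> \<delta>0 \<longrightarrow> (\<Sum>i<d'. truncated_norm \<delta> m (k i)) \<le> M" if "d' \<le> Suc d" for d'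
    using that
  proof (induction d')
    case 0
    show ?case by (auto intro: exI[of _ 1])
  next
    case (Suc d')
    then obtain \<delta>1 M1 where 1: "\<delta>1 > 0" "\<forall>\<delta> m. 0 \<le> \<delta> \<and> \<delta> \<le> \<delta>1 \<longrightarrow> (\<Sum>i<d'. truncated_norm \<delta> m (k i)) \<le> M1" by auto
    obtain \<delta>2 M2 where 2: "\<delta>2 > 0" "\<forall>\<delta> m. 0 \<le> \<delta> \<and> \<delta> \<le> \<delta>2 \<longrightarrow> truncated_norm \<delta> m (k d') \<le> M2"
      using truncated_norm_bounded[OF k, of d'] Suc.prems by auto
    show ?case
      using 1 2 by (intro exI[of _ "min \<delta>1 \<delta>2"] conjI exI[of _ "M1 + M2"]) (auto intro: add_mono)
  qed
  from this[of "Suc d"] obtain \<delta>0 M where M: "\<delta>0 > 0"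
    "\<And>\<delta> m. 0 \<le> \<delta> \<Longrightarrow> \<delta> \<le> \<delta>0 \<Longrightarrow> (\<Sum>i\<le>d. truncated_norm \<delta> m (k i)) \<le> M"
    by (auto simp: lessThan_Suc_atMost)
  have "M \<ge> 0"
  proof -
    have "0 \<le> (\<Sum>i\<le>d. truncated_norm 0 0 (k i))" by (intro sum_nonneg truncated_norm_nonneg) auto
    thus ?thesis using M(2)[of 0 0] M(1) by linarith
  qed
  \<comment> \<open>With \<open>\<delta> * M \<le> 1\<close> the bound 1 reproduces itself when
    \<open>m\<close> grows by one.\<close>
  define \<delta> where "\<delta> = min \<delta>0 (1 / (M + 1))"
  have \<delta>: "\<delta> > 0" "\<delta> \<le> \<delta>0" "\<delta> * M \<le> 1"
  proof -
    show "\<delta> > 0" "\<delta> \<le> \<delta>0" using M(1) \<open>M \<ge> 0\<close> by (auto simp: \<delta>_def)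
    have "\<delta> * M \<le> 1 / (M + 1) * M" using \<open>M \<ge> 0\<close> by (intro mult_right_mono) (auto simp: \<delta>_def)
    also have "\<dots> \<le> 1" using \<open>M \<ge> 0\<close> by (simp add: field_simps)
    finally show "\<delta> * M \<le> 1" .
  qed
  have \<delta>': "\<delta> \<ge> 0" using \<delta>(1) by simp
  have tn: "truncated_norm \<delta> m w \<le> 1" for m
  proof (induction m)
    case 0
    have "fps_nth w 0 = 0" by (subst w) simp
    thus ?case by (simp add: truncated_norm_def)
  next
    case (Suc m)
    have "truncated_norm \<delta> (Suc m) w = \<delta> * truncated_norm \<delta> m (\<Sum>i\<le>d. k i * w ^ i)"
      by (subst w) (rule truncated_norm_X_mult)
    also have "truncated_norm \<delta> m (\<Sum>i\<le>d. k i * w ^ i) \<le> (\<Sum>i\<le>d. truncated_norm \<delta> m (k i * w ^ i))"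
      by (rule truncated_norm_sum[OF \<delta>']) simp
    also have "\<dots> \<le> (\<Sum>i\<le>d. truncated_norm \<delta> m (k i) * 1)"
    proof (rule sum_mono)
      fix i
      have "truncated_norm \<delta> m (k i * w ^ i) \<le> truncated_norm \<delta> m (k i) * truncated_norm \<delta> m (w ^ i)"
        by (rule truncated_norm_mult[OF \<delta>'])
      also have "truncated_norm \<delta> m (w ^ i) \<le> 1"
        using truncated_norm_power[OF \<delta>', of m w i] power_le_one[OF truncated_norm_nonneg[OF \<delta>'] Suc, of i] by linarith
      hence "truncated_norm \<delta> m (k i) * truncated_norm \<delta> m (w ^ i) \<le> truncated_norm \<delta> m (k i) * 1"
        by (intro mult_left_mono truncated_norm_nonneg \<delta>')
      finally show "truncated_norm \<delta> m (k i * w ^ i) \<le> truncated_norm \<delta> m (k i) * 1" .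
    qed
    also have "\<dots> \<le> M" using M(2)[OF \<delta>' \<delta>(2), of m] by simp
    finally have "truncated_norm \<delta> (Suc m) w \<le> \<delta> * M" using \<delta>' by (simp add: mult_left_mono)
    thus ?case using \<delta>(3) by simp
  qed
  have "fps_conv_radius w \<ge> ereal \<delta>"
    unfolding fps_conv_radius_def
  proof (rule conv_radius_geI_ex)
    fix r :: real assume r: "0 < r" "ereal r < ereal \<delta>"
    have "summable (\<lambda>l. fps_nth w l * r ^ l)"
    proof (rule summable_comparison_test')
      show "summable (\<lambda>l. (r / \<delta>) ^ l)" using r \<delta> by (intro summable_geometric) auto
      fix l
      have "\<bar>fps_nth w l\<bar> * \<delta> ^ l \<le> truncated_norm \<delta> l w"
        unfolding truncated_norm_def using \<delta>' by (intro member_le_sum) auto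
      hence "\<bar>fps_nth w l\<bar> * \<delta> ^ l \<le> 1" using tn[of l] by linarith
      hence "\<bar>fps_nth w l\<bar> * \<delta> ^ l * (r / \<delta>) ^ l \<le> 1 * (r / \<delta>) ^ l" using r \<delta> by (intro mult_right_mono) auto
      moreover have "\<delta> ^ l * (r / \<delta>) ^ l = r ^ l" using \<delta> by (simp flip: power_mult_distrib)
      ultimately show "norm (fps_nth w l * r ^ l) \<le> (r / \<delta>) ^ l" using r by (simp add: abs_mult mult.assoc)
    qed
    thus "\<exists>z. norm z = r \<and> summable (\<lambda>l. fps_nth w l * z ^ l)" using r by (intro exI[of _ r]) auto
  qed
  moreover have "ereal \<delta> > 0" using \<delta>(1) by simp
  ultimately show ?thesis by (rule less_le_trans[rotated])
qed

section \<open>Convergence of algebraic power series\<close>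

definition convergent_fps :: "real fps \<Rightarrow> bool" where
  "convergent_fps F \<longleftrightarrow> fps_conv_radius F > 0"

lemma convergent_fps_add: "convergent_fps F \<Longrightarrow> convergent_fps G \<Longrightarrow> convergent_fps (F + G)"
  unfolding convergent_fps_def using fps_conv_radius_add[of F G] by (auto simp: min_def split: if_splits intro: less_le_trans)

lemma convergent_fps_mult: "convergent_fps F \<Longrightarrow> convergent_fps G \<Longrightarrow> convergent_fps (F * G)"
  unfolding convergent_fps_def using fps_conv_radius_mult[of F G] by (auto simp: min_def split: if_splits intro: less_le_trans)

lemma convergent_fps_const: "convergent_fps (fps_const c)"
  by (simp add: convergent_fps_def)

lemma convergent_fps_X: "convergent_fps fps_X"
  by (simp add: convergent_fps_def)

lemma convergent_fps_of_nat: "convergent_fps (of_nat k)"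
  using convergent_fps_const[of "of_nat k"] by (simp flip: fps_of_nat)

lemma convergent_fps_power: "convergent_fps F \<Longrightarrow> convergent_fps (F ^ k)"
  by (induction k) (auto simp: convergent_fps_mult, simp add: convergent_fps_def)

lemma convergent_fps_sum: "(\<And>i. i \<in> A \<Longrightarrow> convergent_fps (f i)) \<Longrightarrow> convergent_fps (sum f A)"
  by (induction A rule: infinite_finite_induct) (auto simp: convergent_fps_add, auto simp: convergent_fps_def)

lemma convergent_fps_shift: "convergent_fps F \<Longrightarrow> convergent_fps (fps_shift k F)"
  by (simp add: convergent_fps_def)

lemma convergent_fps_cutoff: "convergent_fps (fps_cutoff k F)"
proof -
  have "fps_cutoff k F = (\<Sum>i<k. fps_const (fps_nth F i) * fps_X ^ i)"
    by (intro fps_ext) (auto simp: fps_sum_nth if_distrib[of "\<lambda>x. _ * x"] cong: if_cong)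
  thus ?thesis
    by (auto intro!: convergent_fps_sum convergent_fps_mult convergent_fps_const convergent_fps_power convergent_fps_X)
qed

lemma fps_dvd_X_power: "(\<And>l. l < k \<Longrightarrow> fps_nth F l = 0) \<Longrightarrow> F = fps_X ^ k * fps_shift k F"
  by (intro fps_ext) (auto simp: fps_X_power_mult_nth)

lemma fps_cong_power_sum:
  fixes z z' :: "real fps"
  assumes "\<And>l. l \<le> e \<Longrightarrow> fps_nth z l = fps_nth z' l" "l \<le> e"
  shows "fps_nth (\<Sum>i\<in>A. P i * z ^ g i) l = fps_nth (\<Sum>i\<in>A. P i * z' ^ g i) l"
proof -
  have mult: "fps_nth (F * H) l = fps_nth (F' * H') l"
    if "l \<le> e" "\<And>l. l \<le> e \<Longrightarrow> fps_nth F l = fps_nth F' l" "\<And>l. l \<le> e \<Longrightarrow> fps_nth H l = fps_nth H' l"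
    for F F' H H' :: "real fps" and l
    using that by (auto simp: fps_mult_nth intro!: sum.cong)
  have pow: "fps_nth (z ^ k) l = fps_nth (z' ^ k) l" if "l \<le> e" for k l
    using that
  proof (induction k arbitrary: l)
    case (Suc k)
    show ?case unfolding power_Suc by (rule mult) (use Suc assms(1) in auto)
  qed simp
  show ?thesis unfolding fps_sum_nth by (intro sum.cong refl mult) (use assms pow in auto)
qed

text \<open>Newton's method: with \<open>e\<close> the order of the derivative at \<open>z\<close>, substitute \<open>z = z\<^sub>0 + t\<^bsup>e+1\<^esup> w\<close>
  for a truncation \<open>z\<^sub>0\<close> of \<open>z\<close> and divide the equation by \<open>t\<^bsup>2e+1\<^esup>\<close>.\<close>

lemma algebraic_fps_converges_simple_root:
  fixes z :: "real fps"
  assumes P: "\<And>b. b \<le> d \<Longrightarrow> convergent_fps (P b)" and eq: "(\<Sum>b\<le>d. P b * z ^ b) = 0"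
    and D: "(\<Sum>b\<in>{1..d}. of_nat b * P b * z ^ (b - 1)) \<noteq> 0"
  shows "convergent_fps z"
proof -
  define D where "D = (\<Sum>b\<in>{1..d}. of_nat b * P b * z ^ (b - 1))"
  define e where "e = subdegree D"
  define N where "N = Suc e"
  \<comment> \<open>Cutting off after the coefficient of order \<open>N\<close> rather than before
    it makes the constant term of \<open>w\<close> vanish.\<close>
  define z0 where "z0 = fps_cutoff (Suc N) z"
  define w where "w = fps_shift N (z - z0)"
  have zw: "z = z0 + fps_X ^ N * w"
    using fps_dvd_X_power[of N "z - z0"] by (simp add: w_def z0_def)
  have w0: "fps_nth w 0 = 0" by (simp add: w_def z0_def)
  have cz0: "convergent_fps z0" unfolding z0_def by (rule convergent_fps_cutoff)
  \<comment> \<open>Taylor coefficients at \<open>z0\<close> of the polynomial with coefficients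
    \<open>P b\<close>.\<close>
  define h where "h i = (\<Sum>b\<in>{i..d}. of_nat (b choose i) * P b * z0 ^ (b - i))" for i
  have ch: "convergent_fps (h i)" for i
    unfolding h_def
    by (intro convergent_fps_sum convergent_fps_mult convergent_fps_of_nat convergent_fps_power cz0 P) auto
  have exp: "(\<Sum>i\<le>d. h i * (fps_X ^ N * w) ^ i) = 0"
  proof -
    have "(\<Sum>b\<le>d. P b * z ^ b) = (\<Sum>b\<le>d. \<Sum>i\<le>b. of_nat (b choose i) * P b * z0 ^ (b - i) * (fps_X ^ N * w) ^ i)"
    proof (intro sum.cong refl)
      fix b
      have "z ^ b = (\<Sum>i\<le>b. of_nat (b choose i) * (fps_X ^ N * w) ^ i * z0 ^ (b - i))"
        unfolding zw by (subst add.commute) (rule binomial_ring)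
      thus "P b * z ^ b = (\<Sum>i\<le>b. of_nat (b choose i) * P b * z0 ^ (b - i) * (fps_X ^ N * w) ^ i)"
        by (simp add: sum_distrib_left mult_ac)
    qed
    also have "\<dots> = (\<Sum>b\<le>d. \<Sum>i\<le>d. if i \<le> b then of_nat (b choose i) * P b * z0 ^ (b - i) * (fps_X ^ N * w) ^ i else 0)"
      by (intro sum.cong refl sum.mono_neutral_cong_left) auto
    also have "\<dots> = (\<Sum>i\<le>d. \<Sum>b\<le>d. if i \<le> b then of_nat (b choose i) * P b * z0 ^ (b - i) * (fps_X ^ N * w) ^ i else 0)"
      by (rule sum.swap)
    also have "\<dots> = (\<Sum>i\<le>d. h i * (fps_X ^ N * w) ^ i)"
      unfolding h_def sum_distrib_right
      by (intro sum.cong refl sum.mono_neutral_cong_right) auto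
    finally show ?thesis using eq by simp
  qed
  have "d \<ge> 1" using assms(3) by (cases d) auto
  \<comment> \<open>\<open>z\<close> and \<open>z0\<close> agree up to order \<open>e\<close>, hence
    so do the derivatives there, and \<open>h 1\<close> has order exactly \<open>e\<close>.\<close>
  have h1: "fps_nth (h 1) l = fps_nth D l" if "l \<le> e" for l
  proof -
    have "h 1 = (\<Sum>b\<in>{1..d}. of_nat b * P b * z0 ^ (b - 1))" by (simp add: h_def)
    thus ?thesis unfolding D_def
      using that by (simp only:, intro fps_cong_power_sum[of e]) (auto simp: z0_def N_def)
  qed
  define \<beta> where "\<beta> = fps_nth D e"
  have "\<beta> \<noteq> 0" using assms(3) by (simp add: \<beta>_def e_def D_def)
  define q where "q = fps_shift N (h 1)"
  have h1': "h 1 = fps_X ^ e * (fps_const \<beta> + fps_X * q)"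
  proof -
    have z: "fps_nth (h 1) l = 0" if "l < e" for l using h1[of l] that nth_less_subdegree_zero[of l D] by (simp add: e_def)
    have "h 1 = fps_X ^ e * fps_shift e (h 1)" by (rule fps_dvd_X_power) (rule z)
    also have "fps_shift e (h 1) = fps_const \<beta> + fps_X * q"
      using h1[of e]
      by (intro fps_ext) (auto simp: q_def N_def \<beta>_def split: nat.splits intro!: arg_cong[where f = "fps_nth (h 1)"])
    finally show ?thesis .
  qed
  define g0 where "g0 = fps_shift (N + N) (h 0)"
  define rest where "rest = (\<Sum>i\<in>{2..d}. h i * fps_X ^ (N * (i - 2)) * w ^ i)"
  have NN: "N + N = N + e + 1" by (simp add: N_def)
  have split: "(\<Sum>i\<le>d. h i * (fps_X ^ N * w) ^ i) = h 0 + fps_X ^ (N + e) * ((fps_const \<beta> + fps_X * q) * w + fps_X * rest)"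
  proof -
    have "{..d} = insert 0 (insert 1 {2..d})" using \<open>d \<ge> 1\<close> by auto
    hence "(\<Sum>i\<le>d. h i * (fps_X ^ N * w) ^ i) = h 0 + (h 1 * (fps_X ^ N * w) + (\<Sum>i\<in>{2..d}. h i * (fps_X ^ N * w) ^ i))"
      by simp
    also have "(\<Sum>i\<in>{2..d}. h i * (fps_X ^ N * w) ^ i) = fps_X ^ (N + N) * rest"
      unfolding rest_def sum_distrib_left
    proof (intro sum.cong refl)
      fix i assume "i \<in> {2..d}"
      then obtain i' where i: "i = i' + 2" by (metis add.commute atLeastAtMost_iff le_Suc_ex)
      have "(fps_X ^ N) ^ i = fps_X ^ (N + N) * (fps_X ^ (N * (i - 2)) :: real fps)"
        by (simp add: i algebra_simps flip: power_mult power_add)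
      thus "h i * (fps_X ^ N * w) ^ i = fps_X ^ (N + N) * (h i * fps_X ^ (N * (i - 2)) * w ^ i)"
        by (simp add: power_mult_distrib mult_ac)
    qed
    also have "h 1 * (fps_X ^ N * w) = fps_X ^ (N + e) * ((fps_const \<beta> + fps_X * q) * w)"
      unfolding h1' by (simp add: power_add mult_ac)
    finally show ?thesis unfolding NN by (simp add: power_add algebra_simps)
  qed
  have bracket0: "fps_nth ((fps_const \<beta> + fps_X * q) * w + fps_X * rest) 0 = 0" using w0 by simp
  \<comment> \<open>All remaining terms are divisible by \<open>fps_X ^ (N + e)\<close>, and their
    cofactor has no constant term because \<open>w\<close> has none. Thus \<open>h 0\<close> is
    divisible by one power more, which is \<open>N + N\<close>.\<close>
  have "h 0 = - (fps_X ^ (N + e) * ((fps_const \<beta> + fps_X * q) * w + fps_X * rest))"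
    using exp unfolding split by (simp add: eq_neg_iff_add_eq_0)
  hence "fps_nth (h 0) l = 0" if "l < N + N" for l
    using that bracket0 by (cases "l = N + e") (auto simp: fps_X_power_mult_nth NN)
  hence h0: "h 0 = fps_X ^ (N + N) * g0" unfolding g0_def by (rule fps_dvd_X_power)
  have "fps_X ^ (N + e) * (fps_X * g0 + ((fps_const \<beta> + fps_X * q) * w + fps_X * rest)) = 0"
    using exp unfolding split h0 NN by (simp add: power_add algebra_simps)
  hence key: "fps_X * g0 + ((fps_const \<beta> + fps_X * q) * w + fps_X * rest) = 0" by simp
  \<comment> \<open>Solves the divided equation for \<open>w\<close> by means of the invertible
    leading coefficient \<beta> of the derivative; all other terms carry a factor
    \<open>fps_X\<close>.\<close>
  define k where "k i = fps_const (- 1 / \<beta>) * (if i = 0 then g0 else if i = 1 then q else h i * fps_X ^ (N * (i - 2)))" for i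
  have "w = fps_X * (\<Sum>i\<le>d. k i * w ^ i)"
  proof -
    have "{..d} = insert 0 (insert 1 {2..d})" using \<open>d \<ge> 1\<close> by auto
    hence "(\<Sum>i\<le>d. k i * w ^ i) = k 0 + (k 1 * w + (\<Sum>i\<in>{2..d}. k i * w ^ i))" by simp
    also have "(\<Sum>i\<in>{2..d}. k i * w ^ i) = fps_const (- 1 / \<beta>) * rest"
      unfolding rest_def sum_distrib_left by (intro sum.cong refl) (auto simp: k_def mult_ac)
    finally have "fps_X * (\<Sum>i\<le>d. k i * w ^ i) = fps_const (- 1 / \<beta>) * (fps_X * g0 + fps_X * q * w + fps_X * rest)"
      by (simp add: k_def algebra_simps)
    also have "fps_X * g0 + fps_X * q * w + fps_X * rest = - (fps_const \<beta> * w)"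
      using key by (simp add: algebra_simps eq_neg_iff_add_eq_0)
    also have "fps_const (- 1 / \<beta>) * - (fps_const \<beta> * w) = w"
      using \<open>\<beta> \<noteq> 0\<close> by (simp flip: mult.assoc fps_const_neg)
    finally show ?thesis by simp
  qed
  moreover have "fps_conv_radius (k i) > 0" for i
  proof -
    have "convergent_fps (k i)"
      unfolding k_def g0_def q_def using ch
      by (auto intro!: convergent_fps_mult convergent_fps_const convergent_fps_shift convergent_fps_power convergent_fps_X)
    thus ?thesis by (simp add: convergent_fps_def)
  qed
  ultimately have "fps_conv_radius w > 0" by (rule fps_fixed_point_converges)
  hence "convergent_fps w" by (simp add: convergent_fps_def)
  thus ?thesis
    unfolding zw using cz0 by (intro convergent_fps_add convergent_fps_mult convergent_fps_power convergent_fps_X)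
qed

text \<open>In a relation of least degree the formal derivative cannot vanish at \<open>z\<close>,
  as it would be a nontrivial relation of smaller degree; characteristic zero keeps its top
  coefficient nonzero. So \<open>z\<close> is a simple root.\<close>

lemma algebraic_fps_converges:
  fixes z :: "real fps"
  assumes "\<And>b. b \<le> d \<Longrightarrow> convergent_fps (P b)" "(\<Sum>b\<le>d. P b * z ^ b) = 0" "\<exists>b\<le>d. P b \<noteq> 0"
  shows "convergent_fps z"
proof -
  define R where "R d \<longleftrightarrow> (\<exists>P. (\<forall>b\<le>d. convergent_fps (P b)) \<and> (\<Sum>b\<le>d. P b * z ^ b) = 0 \<and> (\<exists>b\<le>d. P b \<noteq> 0))" for d
  have "R d" using assms unfolding R_def by blast
  define m where "m = (LEAST d. R d)"
  have "R m" unfolding m_def using \<open>R d\<close> by (rule LeastI)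
  have min: "\<not> R l" if "l < m" for l using that not_less_Least unfolding m_def by blast
  obtain P where P: "\<And>b. b \<le> m \<Longrightarrow> convergent_fps (P b)" "(\<Sum>b\<le>m. P b * z ^ b) = 0" "\<exists>b\<le>m. P b \<noteq> 0"
    using \<open>R m\<close> unfolding R_def by blast
  show ?thesis
  proof (cases m)
    case 0
    thus ?thesis using P(2,3) by simp
  next
    case (Suc l)
    have "P m \<noteq> 0"
    proof
      assume "P m = 0"
      hence "(\<Sum>b\<le>l. P b * z ^ b) = 0" "\<exists>b\<le>l. P b \<noteq> 0"
        using P(2,3) Suc by (auto simp: le_Suc_eq)
      hence "R l" unfolding R_def using P(1) Suc by (intro exI[of _ P]) auto
      thus False using min[of l] Suc by simp
    qed
    show ?thesis
    proof (rule algebraic_fps_converges_simple_root[OF P(1,2)])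
      show "(\<Sum>b\<in>{1..m}. of_nat b * P b * z ^ (b - 1)) \<noteq> 0"
      proof
        assume "(\<Sum>b\<in>{1..m}. of_nat b * P b * z ^ (b - 1)) = 0"
        moreover have "(\<Sum>b\<in>{1..m}. of_nat b * P b * z ^ (b - 1)) = (\<Sum>b\<le>l. of_nat (Suc b) * P (Suc b) * z ^ b)"
          by (rule sum.reindex_bij_witness[of _ Suc "\<lambda>b. b - 1"]) (use Suc in auto)
        ultimately have "(\<Sum>b\<le>l. of_nat (Suc b) * P (Suc b) * z ^ b) = 0" by simp
        moreover have "of_nat (Suc l) * P (Suc l) \<noteq> 0"
          using \<open>P m \<noteq> 0\<close> Suc by (simp del: of_nat_Suc flip: fps_of_nat)
        moreover have "convergent_fps (of_nat (Suc b) * P (Suc b))" if "b \<le> l" for b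
          using P(1) that Suc by (intro convergent_fps_mult convergent_fps_of_nat) auto
        ultimately have "R l" unfolding R_def by (intro exI[of _ "\<lambda>b. of_nat (Suc b) * P (Suc b)"]) blast
        thus False using min[of l] Suc by simp
      qed
    qed
  qed
qed

section \<open>Real arcs from Puiseux points\<close>

interpretation fps_to_fls_hom: ring_hom_fun "fps_to_fls :: 'a::field fps \<Rightarrow> 'a fls"
  by unfold_locales (auto simp: fls_times_fps_to_fls)

lemma puiseux_common_denominator:
  assumes "finite I"
  shows "\<exists>m G. m > 0 \<and> (\<forall>i\<in>I. y i = puiseux_of_fls m (G i))"
  using assms
proof (induction I rule: finite_induct)
  case empty
  show ?case by (intro exI[of _ 1]) auto
next
  case (insert i I)
  then obtain m G where m: "m > 0" "\<And>i. i \<in> I \<Longrightarrow> y i = puiseux_of_fls m (G i)" by blast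
  obtain k F where k: "k > 0" "y i = puiseux_of_fls k F" using puiseux_of_fls_exists by blast
  define G' where "G' l = (if l = i then fls_compose_power F m else fls_compose_power (G l) k)" for l
  have "y l = puiseux_of_fls (m * k) (G' l)" if "l \<in> insert i I" for l
    using that m k insert.hyps puiseux_of_fls_compose[of m k "G l"] puiseux_of_fls_compose[of k m F]
    by (auto simp: G'_def mult.commute)
  thus ?case using m(1) k(1) by (intro exI[of _ "m * k"] exI[of _ G']) auto
qed

section \<open>Signs and reparametrization of real Laurent series\<close>

definition fls_sgn :: "real fls \<Rightarrow> real" where
  "fls_sgn F = sgn (fls_nth F (fls_subdegree F))"

lemma fls_sgn_mult: "fls_sgn (F * G) = fls_sgn F * fls_sgn G"
proof (cases "F = 0 \<or> G = 0")
  case False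
  thus ?thesis unfolding fls_sgn_def by (subst fls_subdegree_mult) (auto simp: sgn_mult)
qed (auto simp: fls_sgn_def)

lemma fls_sgn_1: "fls_sgn 1 = 1"
  by (simp add: fls_sgn_def)

lemma fls_sgn_square: "F \<noteq> 0 \<Longrightarrow> fls_sgn F * fls_sgn F = 1"
  by (simp add: fls_sgn_def sgn_if)

lemma fls_sgn_inverse: "F \<noteq> 0 \<Longrightarrow> fls_sgn (inverse F) = fls_sgn F"
  using fls_sgn_mult[of F "inverse F"] fls_sgn_square[of F]
  by (simp add: fls_sgn_1) (metis mult.assoc mult.right_neutral mult.left_neutral)

lemma fls_sgn_powi:
  assumes "fls_sgn F = 1"
  shows "fls_sgn (F powi e) = 1"
proof -
  have F: "F \<noteq> 0" using assms by (auto simp: fls_sgn_def)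
  have pow: "fls_sgn (G ^ k) = 1" if "fls_sgn G = 1" for G k
    using that by (induction k) (auto simp: fls_sgn_1 fls_sgn_mult)
  show ?thesis using assms pow F by (auto simp: power_int_def fls_sgn_inverse)
qed

lemma fls_sgn_fps_to_fls: "fps_nth B 0 \<noteq> 0 \<Longrightarrow> fls_sgn (fps_to_fls B) = sgn (fps_nth B 0)"
  by (simp add: fls_sgn_def fls_subdegree_fls_to_fps subdegree_eq_0)

lemma fls_sgn_altdef: "fls_sgn F = sgn (fps_nth (fls_base_factor_to_fps F) 0)"
  by (simp add: fls_sgn_def)

lemma fls_decompose:
  fixes F :: "'a::field fls"
  shows "F = fps_to_fls (fls_base_factor_to_fps F) * fls_X powi (fls_subdegree F)"
  unfolding fls_X_power_int fls_X_intpow_times_conv_shift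
  by (rule fls_conv_base_factor_to_fps_shift_subdegree)

text \<open>The new parameter has a positive linear coefficient, so it preserves the side from which
  zero is approached.\<close>

lemma fls_sgn_compose:
  assumes "fps_nth T 0 = 0" "fps_nth T 1 > 0"
  shows "fls_sgn (fls_compose_fps G T) = fls_sgn G"
proof (cases "G = 0")
  case False
  let ?B = "fls_base_factor_to_fps G"
  have B0: "fps_nth ?B 0 \<noteq> 0" by (rule fls_base_factor_to_fps_base[OF False])
  have "subdegree T = 1" by (rule subdegreeI) (use assms in auto)
  hence "fls_sgn (fps_to_fls T) = 1"
    using assms(2) by (simp add: fls_sgn_def fls_subdegree_fls_to_fps)
  hence "fls_sgn (fls_compose_fps G T) = fls_sgn (fps_to_fls (fps_compose ?B T))"
    unfolding fls_compose_fps_def fls_sgn_mult by (simp only: fls_sgn_powi mult_1_right)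
  also have "\<dots> = sgn (fps_nth (fps_compose ?B T) 0)"
    by (rule fls_sgn_fps_to_fls, subst fps_compose_nth_0, rule B0)
  also have "\<dots> = fls_sgn G" unfolding fls_sgn_altdef by (simp only: fps_compose_nth_0)
  finally show ?thesis .
qed simp

lemma fls_reparametrize_pos:
  fixes G :: "real fls"
  assumes e: "fls_subdegree G > 0"
  shows "\<exists>T. fps_nth T 0 = 0 \<and> fps_nth T 1 > 0 \<and>
    fls_compose_fps G T = fls_const (fls_sgn G) * fls_X powi (fls_subdegree G)"
proof -
  have "G \<noteq> 0" using e by auto
  define q where "q = nat (fls_subdegree G)"
  obtain k where k: "q = Suc k" using e by (metis q_def gr0_implies_Suc zero_less_nat_eq)
  have qe: "fls_subdegree G = int q" using e by (simp add: q_def)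
  define B where "B = fls_base_factor_to_fps G"
  define \<epsilon> where "\<epsilon> = fls_sgn G"
  have B0: "fps_nth B 0 \<noteq> 0" unfolding B_def by (rule fls_base_factor_to_fps_base[OF \<open>G \<noteq> 0\<close>])
  have \<epsilon>: "\<epsilon> = sgn (fps_nth B 0)" by (simp add: \<epsilon>_def fls_sgn_altdef B_def)
  have \<epsilon>2: "\<epsilon> * \<epsilon> = 1" using B0 by (simp add: \<epsilon> sgn_if)
  \<comment> \<open>The sign is split off so that the constant term is positive and a real root
    exists.\<close>
  define a where "a = fps_const \<epsilon> * B"
  have a0: "fps_nth a 0 > 0" using B0 by (simp add: a_def \<epsilon> sgn_if)
  define R where "R = fps_radical (\<lambda>k x. root k x) q a"
  have Rq: "R ^ q = a"
  proof -
    have "root (Suc k) (fps_nth a 0) ^ Suc k = fps_nth a 0" using a0 by (intro real_root_pow_pos2) auto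
    thus ?thesis unfolding R_def k using power_radical[of a "\<lambda>k x. root k x" k] a0 by simp
  qed
  have R0: "fps_nth R 0 > 0" using a0 k by (simp add: R_def)
  define s where "s = fps_X * R"
  have s: "fps_nth s 0 = 0" "fps_nth s 1 = fps_nth R 0" by (simp_all add: s_def)
  define T where "T = fps_inv s"
  have sT: "s oo T = fps_X" unfolding T_def by (rule fps_inv_right) (use s R0 in auto)
  have T0: "fps_nth T 0 = 0" by (simp add: T_def fps_inv_def)
  have "fps_nth (s oo T) 1 = fps_nth s 1 * fps_nth T 1"
    by (simp add: fps_compose_nth T0 s)
  hence "fps_nth R 0 * fps_nth T 1 = 1" using sT s(2) by simp
  hence T1: "fps_nth T 1 > 0"
    using zero_less_mult_pos[of "fps_nth R 0" "fps_nth T 1"] R0 by simp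
  have T: "T \<noteq> 0" using T1 by auto
  have "G = fps_to_fls (fps_const \<epsilon> * s ^ q)"
  proof -
    have "fps_const \<epsilon> * s ^ q = (fps_const \<epsilon> * fps_const \<epsilon>) * (B * fps_X ^ q)"
      unfolding s_def power_mult_distrib Rq a_def by (simp only: mult_ac)
    also have "fps_const \<epsilon> * fps_const \<epsilon> = 1" by (simp add: \<epsilon>2)
    finally have "fps_const \<epsilon> * s ^ q = B * fps_X ^ q" by simp
    moreover have "G = fps_to_fls B * fls_X ^ q"
      using fls_decompose[of G] by (simp add: B_def qe del: fls_X_power_int)
    ultimately show ?thesis by (simp add: fls_times_fps_to_fls fps_to_fls_power)
  qed
  hence "fls_compose_fps G T = fps_to_fls ((fps_const \<epsilon> * s ^ q) oo T)"
    using fls_compose_fps_to_fls[OF T T0] by metis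
  also have "(fps_const \<epsilon> * s ^ q) oo T = fps_const \<epsilon> * fps_X ^ q"
    using fps_compose_power[OF T0, of s q] by (simp add: fps_compose_mult_distrib[OF T0] sT)
  also have "fps_to_fls (fps_const \<epsilon> * fps_X ^ q) = fls_const \<epsilon> * fls_X powi (fls_subdegree G)"
    by (simp add: qe fls_times_fps_to_fls fps_to_fls_power del: fls_X_power_int)
  finally show ?thesis using T0 T1 by (auto simp: \<epsilon>_def)
qed

text \<open>Poles reduce to zeros by passing to the inverse series, which has the same sign.\<close>

lemma fls_reparametrize:
  fixes G :: "real fls"
  assumes e: "fls_subdegree G \<noteq> 0"
  obtains T where "fps_nth T 0 = 0" "fps_nth T 1 > 0"
    "fls_compose_fps G T = fls_const (fls_sgn G) * fls_X powi (fls_subdegree G)"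
proof (cases "fls_subdegree G > 0")
  case True
  thus ?thesis using fls_reparametrize_pos that by blast
next
  case False
  have G: "G \<noteq> 0" using e by auto
  have inv: "fls_subdegree (inverse G) = - fls_subdegree G" using G by (simp add: fls_inverse_subdegree)
  then obtain T where T: "fps_nth T 0 = 0" "fps_nth T 1 > 0"
    "fls_compose_fps (inverse G) T = fls_const (fls_sgn (inverse G)) * fls_X powi (fls_subdegree (inverse G))"
    using fls_reparametrize_pos[of "inverse G"] False e by auto
  have Tnz: "T \<noteq> 0" using T(2) by auto
  have "fls_compose_fps G T = inverse (fls_compose_fps (inverse G) T)"
    using fls_compose_fps_inverse[OF Tnz T(1), of "inverse G"] by simp
  also have "\<dots> = fls_const (inverse (fls_sgn G)) * inverse (fls_X powi (- fls_subdegree G))"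
    by (simp add: T(3) fls_sgn_inverse[OF G] inv fls_inverse_const del: fls_X_power_int)
  also have "inverse (fls_sgn G) = fls_sgn G" using G by (simp add: fls_sgn_def sgn_if)
  also have "inverse (fls_X powi (- fls_subdegree G)) = (fls_X powi (fls_subdegree G) :: real fls)"
    by (simp add: power_int_minus del: fls_X_power_int)
  finally show ?thesis using T that by blast
qed

text \<open>As \<open>C\<close> is closed under conjugation, the conjugate of a complex relation
  holds as well. Hence the real and the imaginary parts of the coefficients give relations, and one
  of them is nontrivial.\<close>

lemma real_algebraic_dependence:
  assumes C: "irreducible_curve n C" "defined_over_reals n C" and ik: "i \<in> {1..n}" "k \<in> {1..n}"
  obtains d :: nat and c :: "nat \<Rightarrow> nat \<Rightarrow> real" where "\<exists>a\<le>d. \<exists>b\<le>d. c a b \<noteq> 0"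
    "(\<Sum>a\<le>d. \<Sum>b\<le>d. Poly_Mapping.single (Poly_Mapping.single i a + Poly_Mapping.single k b) (c a b)) \<in> real_ideal n C"
proof -
  obtain R where R: "R \<noteq> 0" "\<And>y. y \<in> C \<Longrightarrow> poly (poly R [:eval (mvar i) y:]) (eval (mvar k) y) = 0"
    using curve_algebraic_dependence[OF C(1)] by blast
  \<comment> \<open>Large enough to bound the degrees in both variables, so that the relation
    becomes a square array of coefficients.\<close>
  define d where "d = degree R + (\<Sum>a\<le>degree R. degree (coeff R a))"
  have deg: "degree (coeff R a) \<le> d" for a
  proof (cases "a \<le> degree R")
    case True
    hence "degree (coeff R a) \<le> (\<Sum>a\<le>degree R. degree (coeff R a))" by (intro member_le_sum) auto
    thus ?thesis by (simp add: d_def)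
  qed (simp add: coeff_eq_0)
  have ext: "poly p x = (\<Sum>b\<le>d. coeff p b * x ^ b)" if "degree p \<le> d" for p :: "'a::comm_ring_1 poly" and x
    unfolding poly_altdef by (rule sum.mono_neutral_left) (use that in \<open>auto simp: coeff_eq_0\<close>)
  have ev: "poly (poly R [:x:]) z = (\<Sum>a\<le>d. \<Sum>b\<le>d. coeff (coeff R a) b * x ^ a * z ^ b)" for x z :: complex
  proof -
    have "poly R [:x:] = (\<Sum>a\<le>d. coeff R a * [:x:] ^ a)" by (rule ext) (simp add: d_def)
    also have "\<dots> = (\<Sum>a\<le>d. smult (x ^ a) (coeff R a))" by (simp add: poly_const_pow mult.commute)
    finally have "poly (poly R [:x:]) z = (\<Sum>a\<le>d. x ^ a * poly (coeff R a) z)" by (simp add: poly_sum)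
    thus ?thesis by (simp add: ext[OF deg] sum_distrib_left mult_ac)
  qed
  define g where "g c = (\<Sum>a\<le>d. \<Sum>b\<le>d. Poly_Mapping.single (Poly_Mapping.single i a + Poly_Mapping.single k b) (c a b))" for c :: "nat \<Rightarrow> nat \<Rightarrow> real"
  have gev: "eval_with complex_of_real (g c) y = (\<Sum>a\<le>d. \<Sum>b\<le>d. complex_of_real (c a b) * y i ^ a * y k ^ b)" for c y
    unfolding g_def by (simp add: of_real_hom.eval_sum monom_val_add mult.assoc)
  have rel: "(\<Sum>a\<le>d. \<Sum>b\<le>d. coeff (coeff R a) b * y i ^ a * y k ^ b) = 0" if "y \<in> C" for y
    using R(2)[OF that] by (simp add: ev)
  have rel': "(\<Sum>a\<le>d. \<Sum>b\<le>d. cnj (coeff (coeff R a) b) * y i ^ a * y k ^ b) = 0" if "y \<in> C" for y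
  proof -
    have "cnj (\<Sum>a\<le>d. \<Sum>b\<le>d. coeff (coeff R a) b * (cnj (y i)) ^ a * (cnj (y k)) ^ b) = 0"
      using rel[OF real_variety_cnj[OF C(2) that]] ik by simp
    thus ?thesis by simp
  qed
  have inI: "g c \<in> real_ideal n C" if "\<And>y. y \<in> C \<Longrightarrow> eval_with complex_of_real (g c) y = 0" for c
  proof -
    have "g c \<in> polys_in {1..n}"
      unfolding g_def
    proof (intro polys_in_sum polys_in_single)
      fix a b
      show "Poly_Mapping.keys (Poly_Mapping.single i a + Poly_Mapping.single k b) \<subseteq> {1..n}"
        using keys_add[of "Poly_Mapping.single i a" "Poly_Mapping.single k b"] ik by (fastforce split: if_splits)
    qed
    thus ?thesis using that by (simp add: real_ideal_def)
  qed
  let ?re = "\<lambda>a b. Re (coeff (coeff R a) b)" and ?im = "\<lambda>a b. Im (coeff (coeff R a) b)"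
  have re: "g ?re \<in> real_ideal n C"
  proof (rule inI)
    fix y assume y: "y \<in> C"
    have "2 * eval_with complex_of_real (g ?re) y = (\<Sum>a\<le>d. \<Sum>b\<le>d. (coeff (coeff R a) b + cnj (coeff (coeff R a) b)) * y i ^ a * y k ^ b)"
      by (simp add: gev complex_add_cnj sum_distrib_left mult_ac)
    also have "\<dots> = 0" using rel[OF y] rel'[OF y] by (simp add: distrib_right sum.distrib)
    finally show "eval_with complex_of_real (g ?re) y = 0" by simp
  qed
  have im: "g ?im \<in> real_ideal n C"
  proof (rule inI)
    fix y assume y: "y \<in> C"
    have "2 * \<i> * eval_with complex_of_real (g ?im) y = (\<Sum>a\<le>d. \<Sum>b\<le>d. (coeff (coeff R a) b - cnj (coeff (coeff R a) b)) * y i ^ a * y k ^ b)"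
      by (simp add: gev complex_diff_cnj sum_distrib_left mult_ac)
    also have "\<dots> = 0" using rel[OF y] rel'[OF y] by (simp add: left_diff_distrib sum_subtractf)
    finally show "eval_with complex_of_real (g ?im) y = 0" by simp
  qed
  define a0 where "a0 = degree R"
  define b0 where "b0 = degree (coeff R a0)"
  have "coeff (coeff R a0) b0 \<noteq> 0" using R(1) by (simp add: a0_def b0_def)
  moreover have "a0 \<le> d" "b0 \<le> d" using deg[of a0] by (auto simp: a0_def b0_def d_def)
  ultimately have "(\<exists>a\<le>d. \<exists>b\<le>d. ?re a b \<noteq> 0) \<or> (\<exists>a\<le>d. \<exists>b\<le>d. ?im a b \<noteq> 0)"
    by (metis complex_eq_0 complex_eq_iff zero_complex.simps)
  thus ?thesis
  proof
    assume "\<exists>a\<le>d. \<exists>b\<le>d. ?re a b \<noteq> 0"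
    thus ?thesis using that[of d ?re] re by (simp add: g_def)
  next
    assume "\<exists>a\<le>d. \<exists>b\<le>d. ?im a b \<noteq> 0"
    thus ?thesis using that[of d ?im] im by (simp add: g_def)
  qed
qed

text \<open>Multiplying the equation by a large power of \<open>t\<close> makes all exponents nonnegative; they stay
  distinct in \<open>a\<close>, so no coefficient cancels.\<close>

lemma algebraic_over_monomial_converges:
  fixes Y :: "real fls" and c :: "nat \<Rightarrow> nat \<Rightarrow> real"
  assumes rel: "(\<Sum>a\<le>d. \<Sum>b\<le>d. fls_const (c a b) * (fls_const \<epsilon> * fls_X powi e) ^ a * Y ^ b) = 0"
    and c: "a0 \<le> d" "b0 \<le> d" "c a0 b0 \<noteq> 0" and e: "e \<noteq> 0" and \<epsilon>: "\<epsilon> \<noteq> 0"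
  shows "convergent_fps (fls_base_factor_to_fps Y)"
proof -
  define U where "U = fls_base_factor_to_fps Y"
  define f where "f = fls_subdegree Y"
  have Y: "Y = fps_to_fls U * fls_X powi f" unfolding U_def f_def by (rule fls_decompose)
  define L where "L = \<bar>e\<bar> * int d + \<bar>f\<bar> * int d"
  define x where "x a b = L + e * int a + f * int b" for a b :: nat
  have x: "x a b \<ge> 0" if "a \<le> d" "b \<le> d" for a b
  proof -
    have "- (e * int a) \<le> \<bar>e\<bar> * int d" "- (f * int b) \<le> \<bar>f\<bar> * int d"
    proof -
      have "- (e * int a) \<le> \<bar>e * int a\<bar>" by linarith
      also have "\<dots> \<le> \<bar>e\<bar> * int d" using that by (simp add: abs_mult mult_left_mono)
      finally show "- (e * int a) \<le> \<bar>e\<bar> * int d" .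
      have "- (f * int b) \<le> \<bar>f * int b\<bar>" by linarith
      also have "\<dots> \<le> \<bar>f\<bar> * int d" using that by (simp add: abs_mult mult_left_mono)
      finally show "- (f * int b) \<le> \<bar>f\<bar> * int d" .
    qed
    thus ?thesis by (simp add: x_def L_def)
  qed
  define P where "P b = (\<Sum>a\<le>d. fps_const (c a b * \<epsilon> ^ a) * fps_X ^ nat (x a b))" for b
  have monomial: "fls_X powi L * (fls_const (c a b) * (fls_const \<epsilon> * fls_X powi e) ^ a * Y ^ b) =
      fps_to_fls (fps_const (c a b * \<epsilon> ^ a) * fps_X ^ nat (x a b) * U ^ b)" if "a \<le> d" "b \<le> d" for a b
  proof -
    have pw: "(fls_X powi z) ^ k = (fls_X powi (z * int k) :: real fls)" for z and k :: nat
      by (simp add: power_int_mult del: fls_X_power_int)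
    have ad: "fls_X powi z * fls_X powi z' = (fls_X powi (z + z') :: real fls)" for z z'
      by (subst power_int_add) auto
    have cp: "fls_const \<epsilon> ^ a = (fls_const (\<epsilon> ^ a) :: real fls)" by (simp add: fls_const_power)
    have "fls_X powi L * (fls_const (c a b) * (fls_const \<epsilon> * fls_X powi e) ^ a * Y ^ b) =
      (fls_const (c a b) * fls_const (\<epsilon> ^ a)) * fps_to_fls U ^ b * (fls_X powi L * fls_X powi (e * int a) * fls_X powi (f * int b))"
      unfolding Y power_mult_distrib pw cp by (simp only: mult_ac)
    also have "fls_X powi L * fls_X powi (e * int a) * fls_X powi (f * int b) = (fls_X powi (int (nat (x a b))) :: real fls)"
      unfolding ad using x[OF that] by (simp add: x_def del: fls_X_power_int)
    also have "\<dots> = fps_to_fls (fps_X ^ nat (x a b))"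
      by (simp only: power_int_of_nat) (simp add: fps_to_fls_power)
    finally show ?thesis
      by (simp add: fls_times_fps_to_fls fps_to_fls_power fls_const_mult_const mult_ac)
  qed
  have "fps_to_fls (\<Sum>b\<le>d. P b * U ^ b) = (\<Sum>b\<le>d. \<Sum>a\<le>d. fps_to_fls (fps_const (c a b * \<epsilon> ^ a) * fps_X ^ nat (x a b) * U ^ b))"
    unfolding P_def sum_distrib_right by (simp only: fps_to_fls_hom.hom_sum[OF finite_atMost])
  also have "\<dots> = (\<Sum>a\<le>d. \<Sum>b\<le>d. fps_to_fls (fps_const (c a b * \<epsilon> ^ a) * fps_X ^ nat (x a b) * U ^ b))"
    by (rule sum.swap)
  also have "\<dots> = (\<Sum>a\<le>d. \<Sum>b\<le>d. fls_X powi L * (fls_const (c a b) * (fls_const \<epsilon> * fls_X powi e) ^ a * Y ^ b))"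
    by (intro sum.cong refl monomial[symmetric]) auto
  also have "\<dots> = fls_X powi L * (\<Sum>a\<le>d. \<Sum>b\<le>d. fls_const (c a b) * (fls_const \<epsilon> * fls_X powi e) ^ a * Y ^ b)"
    by (simp only: sum_distrib_left)
  finally have "fps_to_fls (\<Sum>b\<le>d. P b * U ^ b) = 0" unfolding rel by simp
  hence eqP: "(\<Sum>b\<le>d. P b * U ^ b) = 0" by simp
  have convP: "convergent_fps (P b)" for b
    unfolding P_def by (intro convergent_fps_sum convergent_fps_mult convergent_fps_const convergent_fps_power convergent_fps_X)
  have "P b0 \<noteq> 0"
  proof
    assume "P b0 = 0"
    have "fps_nth (P b0) (nat (x a0 b0)) = (\<Sum>a\<le>d. if a = a0 then c a b0 * \<epsilon> ^ a else 0)"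
      unfolding P_def fps_sum_nth
    proof (intro sum.cong refl)
      fix a assume a: "a \<in> {..d}"
      have eq: "nat (x a0 b0) = nat (x a b0) \<longleftrightarrow> a = a0"
      proof -
        have "nat (x a0 b0) = nat (x a b0) \<longleftrightarrow> x a0 b0 = x a b0"
          using a c by (intro eq_nat_nat_iff x) auto
        also have "\<dots> \<longleftrightarrow> e * int a0 = e * int a" by (simp add: x_def)
        also have "\<dots> \<longleftrightarrow> a = a0" using e by auto
        finally show ?thesis .
      qed
      thus "fps_nth (fps_const (c a b0 * \<epsilon> ^ a) * fps_X ^ nat (x a b0)) (nat (x a0 b0)) = (if a = a0 then c a b0 * \<epsilon> ^ a else 0)"
        by (simp only: fps_mult_left_const_nth fps_X_power_nth eq) simp
    qed
    also have "\<dots> = c a0 b0 * \<epsilon> ^ a0" using c(1) by (subst sum.delta) auto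
    finally have "c a0 b0 * \<epsilon> ^ a0 = 0" using \<open>P b0 = 0\<close> by simp
    thus False using c(3) \<epsilon> by simp
  qed
  hence nzP: "\<exists>b\<le>d. P b \<noteq> 0" using c(2) by blast
  have "convergent_fps U" by (rule algebraic_fps_converges[OF convP eqP nzP])
  thus ?thesis unfolding U_def .
qed

text \<open>After a substitution the coordinate \<open>i0\<close> is a signed monomial. Every other
  coordinate is algebraic over it, hence convergent up to a power of the parameter, and the formal
  equations become equations between functions.\<close>

theorem puiseux_arc:
  assumes C: "irreducible_curve n C" "defined_over_reals n C" and y: "y \<in> real_puiseux_points n C"
    and i0: "i0 \<in> {1..n}" "puiseux_val (y i0) \<noteq> 0"
  obtains m :: nat and e :: "nat \<Rightarrow> int" and U :: "nat \<Rightarrow> real fps" where "m > 0"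
    "\<And>k. k \<in> {1..n} \<Longrightarrow> fps_conv_radius (U k) > 0"
    "\<And>k. k \<in> {1..n} \<Longrightarrow> fps_nth (U k) 0 \<noteq> 0"
    "\<And>k. k \<in> {1..n} \<Longrightarrow> sgn (fps_nth (U k) 0) = sgn (puiseux_coeff (y k))"
    "\<And>k. k \<in> {1..n} \<Longrightarrow> puiseux_val (y k) = real_of_int (e k) / real m"
    "\<forall>\<^sub>F s in at_right 0. (\<lambda>k\<in>{1..n}. complex_of_real (s powi (e k) * eval_fps (U k) s)) \<in> C"
proof -
  obtain m G where m: "m > 0" and G: "\<And>i. i \<in> {1..n} \<Longrightarrow> y i = puiseux_of_fls m (G i)"
    using puiseux_common_denominator[of "{1..n}" y] by auto
  interpret ph: ring_hom_fun "puiseux_of_fls m :: real fls \<Rightarrow> _" by (rule ring_hom_puiseux_of_fls[OF m])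
  have Gnz: "G i \<noteq> 0" if "i \<in> {1..n}" for i
  proof
    assume "G i = 0"
    hence "y i = 0" using G[OF that] ph.hom_0 by simp
    thus False using y that by (auto simp: real_puiseux_points_def)
  qed
  have Gev: "eval_with fls_const g G = 0" if g: "g \<in> real_ideal n C" for g
  proof -
    have "puiseux_of_fls m (eval_with fls_const g G) = eval_with puiseux_const g y"
      by (rule eval_with_puiseux_of_fls[symmetric, OF m _ G]) (use g in \<open>auto simp: real_ideal_def\<close>)
    also have "\<dots> = puiseux_of_fls m 0" using y g ph.hom_0 by (auto simp: real_puiseux_points_def)
    finally show ?thesis using puiseux_of_fls_inj[OF m] by blast
  qed
  have e0: "fls_subdegree (G i0) \<noteq> 0" using i0 G m by (auto simp: puiseux_val_of_fls)
  obtain T where T: "fps_nth T 0 = 0" "fps_nth T 1 > 0"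
    "fls_compose_fps (G i0) T = fls_const (fls_sgn (G i0)) * fls_X powi (fls_subdegree (G i0))"
    using fls_reparametrize[OF e0] by blast
  have Tnz: "T \<noteq> 0" using T(2) by auto
  have "subdegree T = 1" by (rule subdegreeI) (use T in auto)
  define Y where "Y k = fls_compose_fps (G k) T" for k
  define e where "e k = fls_subdegree (Y k)" for k
  define U where "U k = fls_base_factor_to_fps (Y k)" for k
  have eG: "e k = fls_subdegree (G k)" for k
    using subdegree_fls_compose_fps[OF T(1)] \<open>subdegree T = 1\<close> by (simp add: e_def Y_def)
  have Ydec: "Y k = fps_to_fls (U k) * fls_X powi (e k)" for k
    unfolding U_def e_def by (rule fls_decompose)
  have Ysgn: "fls_sgn (Y k) = fls_sgn (G k)" for k unfolding Y_def by (rule fls_sgn_compose[OF T(1,2)])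
  have Yev: "eval_with fls_const g Y = 0" if g: "g \<in> real_ideal n C" for g
  proof -
    \<comment> \<open>Substitution of \<open>T\<close> is a ring homomorphism, so it preserves the
      equations of the curve; having order one, \<open>T\<close> preserves valuations as
      well.\<close>
    have "eval_with fls_const g Y = fls_compose_fps (eval_with fls_const g G) T"
      by (rule eval_with_rel[of g UNIV "\<lambda>a b. a = fls_compose_fps b T"])
        (auto simp: Y_def fls_compose_fps_add[OF Tnz T(1)] fls_compose_fps_mult[OF Tnz T(1)])
    thus ?thesis by (simp add: Gev[OF g])
  qed
  have U0: "fps_nth (U k) 0 \<noteq> 0" if k: "k \<in> {1..n}" for k
  proof -
    have "fls_sgn 0 = 0" by (simp add: fls_sgn_def)
    hence "Y k \<noteq> 0" using Ysgn[of k] fls_sgn_square[OF Gnz[OF k]] by (metis mult_zero_left zero_neq_one)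
    thus ?thesis unfolding U_def by (rule fls_base_factor_to_fps_base)
  qed
  have Usgn: "sgn (fps_nth (U k) 0) = sgn (puiseux_coeff (y k))" if k: "k \<in> {1..n}" for k
  proof -
    have "sgn (fps_nth (U k) 0) = fls_sgn (G k)" unfolding U_def fls_sgn_altdef[symmetric] by (rule Ysgn)
    thus ?thesis using G[OF k] by (simp add: fls_sgn_def puiseux_coeff_of_fls[OF m])
  qed
  have val: "puiseux_val (y k) = real_of_int (e k) / real m" if "k \<in> {1..n}" for k
    using G[OF that] by (simp add: puiseux_val_of_fls[OF m] eG)
  have \<epsilon>: "fls_sgn (G i0) \<noteq> 0" using fls_sgn_square[OF Gnz[OF i0(1)]] by auto
  have conv: "convergent_fps (U k)" if k: "k \<in> {1..n}" for k
  proof -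
    obtain d c where c: "\<exists>a\<le>d. \<exists>b\<le>d. c a b \<noteq> (0::real)"
      "(\<Sum>a\<le>d. \<Sum>b\<le>d. Poly_Mapping.single (Poly_Mapping.single i0 a + Poly_Mapping.single k b) (c a b)) \<in> real_ideal n C"
      using real_algebraic_dependence[OF C i0(1) k] by blast
    from Yev[OF c(2)] have "(\<Sum>a\<le>d. \<Sum>b\<le>d. fls_const (c a b) * Y i0 ^ a * Y k ^ b) = 0"
      by (simp add: fls_const_hom.eval_sum monom_val_add mult.assoc)
    hence "(\<Sum>a\<le>d. \<Sum>b\<le>d. fls_const (c a b) * (fls_const (fls_sgn (G i0)) * fls_X powi (fls_subdegree (G i0))) ^ a * Y k ^ b) = 0"
      unfolding Y_def[of i0] T(3) .
    thus ?thesis using c(1) e0 \<epsilon> unfolding U_def by (blast intro: algebraic_over_monomial_converges)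
  qed
  define R where "R = Min (insert 1 ((\<lambda>k. fps_conv_radius (U k)) ` {1..n}))"
  have R: "R > 0" unfolding R_def using conv by (subst Min_gr_iff) (auto simp: convergent_fps_def)
  have RU: "R \<le> fps_conv_radius (U k)" if "k \<in> {1..n}" for k unfolding R_def using that by (intro Min_le) auto
  \<comment> \<open>A common power that clears all poles. \<open>Z\<close> then holds homogeneous
    coordinates of \<open>Y\<close> made of convergent power series, which can be evaluated at a
    real number.\<close>
  define N where "N = (\<Sum>k\<in>{1..n}. \<bar>e k\<bar>)"
  have Ne: "N + e k \<ge> 0" if "k \<in> {1..n}" for k
  proof -
    have "\<bar>e k\<bar> \<le> N" unfolding N_def using that by (intro member_le_sum) auto
    thus ?thesis by linarith
  qed
  have N0: "N \<ge> 0" unfolding N_def by (intro sum_nonneg) auto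
  define Z where "Z k = (if k = 0 then fps_X ^ nat N else fps_X ^ nat (N + e k) * U k)" for k
  have Zrad: "fps_conv_radius (Z k) \<ge> R" if k: "k \<in> {0..n}" for k
  proof (cases "k = 0")
    case False
    hence "k \<in> {1..n}" using k by auto
    thus ?thesis using RU[of k] fps_conv_radius_mult[of "fps_X ^ nat (N + e k)" "U k"] False
      by (auto simp: Z_def intro: order_trans)
  qed (simp add: Z_def)
  have ZY: "fps_to_fls (Z k) / fps_to_fls (Z 0) = Y k" if k: "k \<in> {1..n}" for k
  proof -
    have X: "fps_to_fls (fps_X ^ nat z) = (fls_X powi z :: real fls)" if "z \<ge> 0" for z
      using that by (simp add: fps_to_fls_power power_int_def del: fls_X_power_int)
    have "fps_to_fls (Z k) = fls_X powi N * Y k"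
      using k unfolding Ydec by (simp add: Z_def fls_times_fps_to_fls X[OF Ne[OF k]] power_int_add del: fls_X_power_int)
    moreover have "fps_to_fls (Z 0) = fls_X powi N" using X[OF N0] by (simp add: Z_def del: fls_X_power_int)
    ultimately show ?thesis by (simp del: fls_X_power_int)
  qed
  have pt: "eval_with (\<lambda>a. a) g (\<lambda>k. s powi (e k) * eval_fps (U k) s) = 0"
    if g: "g \<in> real_ideal n C" and s: "s > 0" "ereal \<bar>s\<bar> < R" for g s
  proof -
    have gin: "g \<in> polys_in {1..n}" using g by (simp add: real_ideal_def)
    let ?h = "homogenize g" and ?Zs = "\<lambda>k. eval_fps (Z k) s"
    have "eval_with fls_const g (\<lambda>k. fps_to_fls (Z k) / fps_to_fls (Z 0)) = eval_with fls_const g Y"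
      by (rule eval_with_cong[OF gin]) (use ZY in auto)
    hence "eval_with fls_const ?h (\<lambda>k. fps_to_fls (Z k)) = 0"
      using eval_homogenize[OF fls_const_hom.ring_hom_fun_axioms, of "\<lambda>k. fps_to_fls (Z k)" g] Yev[OF g]
      by (simp add: Z_def)
    hence "eval_with fps_const ?h Z = 0" by (simp add: eval_with_fps_to_fls)
    moreover have "eval_fps (eval_with fps_const ?h Z) s = eval_with (\<lambda>a. a) ?h ?Zs"
      using eval_fps_eval_with[OF homogenize_in[OF gin] _ s(2), of Z] Zrad by blast
    ultimately have "eval_with (\<lambda>a. a) ?h ?Zs = 0" by simp
    moreover have Z0: "?Zs 0 = s ^ nat N" by (simp add: Z_def)
    ultimately have "eval_with (\<lambda>a. a) g (\<lambda>k. ?Zs k / ?Zs 0) = 0"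
      using eval_homogenize[OF id_hom.ring_hom_fun_axioms, of ?Zs g] s(1) by simp
    moreover have "eval_with (\<lambda>a. a) g (\<lambda>k. ?Zs k / ?Zs 0) = eval_with (\<lambda>a. a) g (\<lambda>k. s powi (e k) * eval_fps (U k) s)"
    proof (rule eval_with_cong[OF gin])
      fix k assume k: "k \<in> {1..n}"
      have "?Zs k = s ^ nat (N + e k) * eval_fps (U k) s"
        using k RU[OF k] s(2) by (simp add: Z_def eval_fps_mult less_le_trans[of _ R])
      also have "s ^ nat (N + e k) = s powi (N + e k)" using Ne[OF k] by (simp add: power_int_def)
      also have "\<dots> = s ^ nat N * s powi (e k)" using s(1) N0 by (simp add: power_int_add power_int_def[of s N])
      finally show "?Zs k / ?Zs 0 = s powi (e k) * eval_fps (U k) s" using s(1) by (simp add: Z0)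
    qed
    ultimately show ?thesis by simp
  qed
  obtain Gr where Gr: "Gr \<subseteq> polys_in {1..n}" "C = {y \<in> torus n. \<forall>g\<in>Gr. eval_with complex_of_real g y = 0}"
    using C(2) by (auto simp: defined_over_reals_def)
  have "\<forall>\<^sub>F s in at_right 0. \<forall>k\<in>{1..n}. eval_fps (U k) s \<noteq> 0"
  proof (rule eventually_ball_finite)
    show "\<forall>k\<in>{1..n}. \<forall>\<^sub>F s in at_right 0. eval_fps (U k) s \<noteq> 0"
    proof
      fix k assume k: "k \<in> {1..n}"
      have "\<forall>\<^sub>F s in at_right 0. sgn (eval_fps (U k) s) = sgn (fps_nth (U k) (subdegree (U k)))"
        using conv[OF k] by (intro eventually_sgn_eval_fps) (simp add: convergent_fps_def)
      moreover have "fps_nth (U k) (subdegree (U k)) \<noteq> 0" using U0[OF k] by auto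
      ultimately show "\<forall>\<^sub>F s in at_right 0. eval_fps (U k) s \<noteq> 0"
        by (elim eventually_mono) (metis sgn_0 sgn_0_0)
    qed
  qed simp
  moreover have "\<forall>\<^sub>F s in at_right 0. s > 0 \<and> ereal \<bar>s\<bar> < R"
  proof -
    obtain r where r: "0 < r" "ereal r < R" using ereal_dense2[OF R] by (auto simp: zero_ereal_def)
    have "\<forall>\<^sub>F s in at_right 0. s \<in> {0<..<r}" by (rule eventually_at_right_real[OF r(1)])
    thus ?thesis by eventually_elim (use r in \<open>auto intro: less_trans[of _ "ereal r"]\<close>)
  qed
  ultimately have "\<forall>\<^sub>F s in at_right 0. (\<lambda>k\<in>{1..n}. complex_of_real (s powi (e k) * eval_fps (U k) s)) \<in> C"
  proof eventually_elim
    case (elim s)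
    let ?y = "\<lambda>k\<in>{1..n}. complex_of_real (s powi (e k) * eval_fps (U k) s)"
    have "?y \<in> torus n" using elim by (auto simp: torus_def)
    moreover have "eval_with complex_of_real g ?y = 0" if "g \<in> Gr" for g
    proof -
      have g: "g \<in> real_ideal n C" using that Gr by (auto simp: real_ideal_def)
      have "eval_with complex_of_real g ?y = eval_with complex_of_real g (\<lambda>k. complex_of_real (s powi (e k) * eval_fps (U k) s))"
        by (rule eval_with_cong[of g "{1..n}"]) (use that Gr in auto)
      also have "eval_with (\<lambda>a. a) g (\<lambda>k. s powi (e k) * eval_fps (U k) s) = 0"
        by (rule pt[OF g]) (use elim in auto)
      hence "eval_with complex_of_real g (\<lambda>k. complex_of_real (s powi (e k) * eval_fps (U k) s)) = 0"
        unfolding eval_with_of_real by simp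
      finally show ?thesis .
    qed
    ultimately show ?case using Gr(2) by blast
  qed
  thus ?thesis using that[OF m, of U e] conv U0 Usgn val by (simp add: convergent_fps_def)
qed

section \<open>Completeness of the procedure\<close>

lemma powers_limit_eq:
  fixes a b :: nat and K :: real
  assumes "((\<lambda>s. s ^ a / s ^ b) \<longlongrightarrow> K) (at_right 0)" "K \<noteq> 0"
  shows "a = b"
proof -
  have le: "a \<le> b" if lim: "((\<lambda>s. s ^ a / s ^ b) \<longlongrightarrow> K) (at_right 0)" and K: "K \<noteq> 0" for a b and K :: real
  proof (rule ccontr)
    assume "\<not> a \<le> b"
    hence ab: "a - b > 0" "a = (a - b) + b" by auto
    have "((\<lambda>s::real. s ^ (a - b)) \<longlongrightarrow> 0 ^ (a - b)) (at_right 0)" by (intro tendsto_intros)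
    moreover have "\<forall>\<^sub>F s in at_right (0::real). s ^ (a - b) = s ^ a / s ^ b"
      using eventually_at_right_less[of "0::real"]
    proof eventually_elim
      case (elim s)
      have "s ^ a = s ^ (a - b) * s ^ b" using ab(2) by (metis power_add)
      thus ?case using elim by simp
    qed
    ultimately have "((\<lambda>s. s ^ a / s ^ b) \<longlongrightarrow> 0 ^ (a - b)) (at_right (0::real))"
      by (rule Lim_transform_eventually)
    hence "K = 0 ^ (a - b)" by (rule tendsto_unique[OF trivial_limit_at_right_real lim])
    thus False using K ab(1) by simp
  qed
  have "((\<lambda>s. s ^ b / s ^ a) \<longlongrightarrow> inverse K) (at_right 0)"
    using tendsto_inverse[OF assms] by simp
  from le[OF assms] le[OF this] assms(2) show ?thesis by simp
qed

text \<open>The multiples \<open>w i0 * u\<close> and \<open>u i0 * w\<close> coincide; comparing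
  their gcds gives equal absolute values of \<open>w i0\<close> and \<open>u i0\<close>, so the
  positive factor \<kappa> is 1.\<close>

lemma primitive_proportional:
  fixes u w :: "nat \<Rightarrow> int"
  assumes u: "Gcd (u ` I) = 1" and w: "Gcd (w ` I) = 1" and "\<kappa> > 0"
    and ratio: "\<And>i. i \<in> I \<Longrightarrow> real_of_int (w i) = \<kappa> * real_of_int (u i)" and i: "i \<in> I"
  shows "w i = u i"
proof -
  have "\<not> u ` I \<subseteq> {0}" using u by (metis Gcd_0_iff zero_neq_one)
  then obtain i0 where i0: "i0 \<in> I" "u i0 \<noteq> 0" by auto
  have "w i0 * u i = u i0 * w i" if "i \<in> I" for i
  proof -
    have "real_of_int (w i0 * u i) = real_of_int (u i0 * w i)"
      by (simp add: ratio[OF i0(1)] ratio[OF that])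
    thus ?thesis by (simp only: of_int_eq_iff)
  qed
  hence "(*) (w i0) ` u ` I = (*) (u i0) ` w ` I" by (auto simp: image_image)
  hence "\<bar>w i0\<bar> = \<bar>u i0\<bar>"
    using Gcd_mult[of "w i0" "u ` I"] Gcd_mult[of "u i0" "w ` I"] u w by simp
  hence "\<kappa> * \<bar>real_of_int (u i0)\<bar> = \<bar>real_of_int (u i0)\<bar>"
    using ratio[OF i0(1)] \<open>\<kappa> > 0\<close> by (metis abs_mult abs_of_pos of_int_abs)
  hence "\<kappa> = 1" using i0(2) by simp
  thus ?thesis using ratio[OF i] by simp
qed

lemma continuous_on_eval_fps_Ioo:
  fixes F :: "real fps"
  assumes "\<And>s. 0 < s \<Longrightarrow> s < b \<Longrightarrow> ereal \<bar>s\<bar> < fps_conv_radius F"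
  shows "continuous_on {0<..<b} (eval_fps F)"
  by (rule continuous_on_subset[OF continuous_on_eval_fps]) (use assms in \<open>auto simp: in_eball_iff\<close>)

lemma eval_fps_tendsto_0:
  fixes F :: "real fps"
  assumes "fps_conv_radius F > 0"
  shows "(eval_fps F \<longlongrightarrow> fps_nth F 0) (at_right 0)"
proof -
  have "isCont (eval_fps F) 0"
    using assms by (intro continuous_eval_fps) (auto simp: zero_ereal_def)
  thus ?thesis by (simp add: isCont_def eval_fps_at_0 filterlim_at_split)
qed

section \<open>Finite cycle numbers and accumulation points on real arcs\<close>

context patch_curve
begin

text \<open>Successive turns land in one fibre of the \<open>j\<close>-th coordinate, which is
  compact by boundedness and discrete by local sections. Hence two turns end at the same
  point.\<close>

lemma lift_cycle:
  assumes X: "lift_over fibre left_half X"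
  obtains c :: nat where "c > 0" "X (2 * pi * real c * \<i>) = X 0"
proof -
  let ?q = "\<lambda>k::nat. X (2 * pi * real k * \<i>)"
  have L: "complex_of_real x * \<i> \<in> left_half" for x by (simp add: left_half_def)
  have ex: "\<exists>k l. k < l \<and> ?q k = ?q l"
  proof (rule ccontr)
    assume neg: "\<nexists>k l. k < l \<and> ?q k = ?q l"
    have q: "?q k \<in> V" "?q k j = complex_of_real \<tau>" "?q k j \<noteq> 0" "cmod (?q k j) \<le> \<bar>\<tau>\<bar>" for k
    proof -
      have Lk: "2 * pi * real k * \<i> \<in> left_half" using L[of "2 * pi * real k"] by simp
      have f: "?q k \<in> fibre (2 * pi * real k * \<i>)" using X Lk by (simp add: lift_over_def)
      have "exp (2 * pi * real k * \<i>) = exp 0" unfolding exp_eq by (intro exI[of _ "int k"]) simp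
      thus "?q k j = complex_of_real \<tau>" using f by (simp add: fibre_def)
      show "?q k \<in> V" "?q k j \<noteq> 0" "cmod (?q k j) \<le> \<bar>\<tau>\<bar>" using fibreD[OF f Lk] by auto
    qed
    obtain M where M: "\<And>x i. x \<in> V \<Longrightarrow> cmod (x j) \<le> \<bar>\<tau>\<bar> \<Longrightarrow> i \<le> n \<Longrightarrow> cmod (x i) \<le> M"
      using bounded by blast
    have "?q k \<in> {0..n} \<rightarrow>\<^sub>E cball 0 M" for k
      using M[OF q(1) q(4)] V_ext[OF q(1)] by (auto simp: PiE_def)
    then obtain z s where z: "z \<in> {0..n} \<rightarrow>\<^sub>E cball 0 M" "strict_mono s" "(?q \<circ> s) \<longlonglongrightarrow> z"
      using compact_box[of n M] unfolding compact_eq_seq_compact_metric seq_compact_def by metis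
    have lim: "(\<lambda>k. ?q (s k) i) \<longlonglongrightarrow> z i" for i
      using tendsto_coordinate[OF z(3)] by (simp add: o_def)
    have zV: "z \<in> V"
      by (rule V_limit[OF sequentially_bot _ lim]) (use q z(1) in \<open>auto simp: PiE_def\<close>)
    have "(\<lambda>k. ?q (s k) j) \<longlonglongrightarrow> complex_of_real \<tau>" unfolding q(2) by (rule tendsto_const)
    hence zj: "z j = complex_of_real \<tau>" using LIMSEQ_unique lim by blast
    obtain \<delta> r \<phi> where sec: "section_at z \<delta> r \<phi>" using local_section[OF zV] zj tau by auto
    hence pos: "\<delta> > 0" "r > 0" by (auto simp: section_at_def)
    have "\<forall>\<^sub>F k in sequentially. near \<delta> z (?q (s k))" using lim pos by (intro eventually_near)
    \<comment> \<open>Two terms of the convergent subsequence close to the limit have the same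
      \<open>j\<close>-th coordinate, so the section identifies them.\<close>
    then obtain k where k: "near \<delta> z (?q (s k))" "near \<delta> z (?q (s (Suc k)))"
      unfolding eventually_sequentially by (metis le_Suc_eq order_refl)
    have "?q (s k) = \<phi> (z j)" "?q (s (Suc k)) = \<phi> (z j)"
      using sec k q(1,2) zj pos unfolding section_at_def by (metis centre_in_ball)+
    hence "?q (s k) = ?q (s (Suc k))" by (rule trans[OF _ sym])
    moreover have "s k < s (Suc k)" using strict_monoD[OF z(2)] by simp
    ultimately show False using neg by blast
  qed
  then obtain k l where kl: "k < l" "?q k = ?q l" by blast
  \<comment> \<open>Translating both lifts back by \<open>k\<close> turns moves the coincidence to
    the base point.\<close>
  have "X (complex_of_real (- 2 * pi * real k) * \<i> + 2 * pi * of_int (int k) * \<i>) =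
      X (complex_of_real (- 2 * pi * real k) * \<i> + 2 * pi * of_int (int l) * \<i>)"
    by (rule lift_unique[OF lift_shift[OF X] lift_shift[OF X], of 0]) (use kl(2) L in \<open>auto simp: left_half_def\<close>)
  moreover have "complex_of_real (- 2 * pi * real k) * \<i> + 2 * pi * of_int (int k) * \<i> = 0" by simp
  moreover have "complex_of_real (- 2 * pi * real k) * \<i> + 2 * pi * of_int (int l) * \<i> = 2 * pi * real (l - k) * \<i>"
    using kl(1) by (simp add: of_nat_diff algebra_simps)
  ultimately show ?thesis using that[of "l - k"] kl(1) by simp
qed

text \<open>An arc consisting of isolated points of \<open>V\<close> would be locally constant,
  hence constant, and its nonzero \<open>j\<close>-th coordinate could not tend to zero.\<close>

lemma accum_on_arc:
  assumes x: "\<And>s. 0 < s \<Longrightarrow> s < b \<Longrightarrow> x s \<in> V" and cont: "\<And>i. i \<le> n \<Longrightarrow> continuous_on {0<..<b} (\<lambda>s. x s i)"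
    and nz: "\<And>s. 0 < s \<Longrightarrow> s < b \<Longrightarrow> x s j \<noteq> 0" and lim: "((\<lambda>s. x s j) \<longlongrightarrow> 0) (at_right 0)" and b: "(0::real) < b"
  shows "\<exists>s. 0 < s \<and> s < b \<and> accum (x s)"
proof (rule ccontr)
  assume neg: "\<nexists>s. 0 < s \<and> s < b \<and> accum (x s)"
  have const: "x s = x (b / 2)" if s: "s \<in> {0<..<b}" for s
  proof (rule connected_local_const[of "{0<..<b}"])
    show "\<forall>a\<in>{0<..<b}. \<forall>\<^sub>F t in at a within {0<..<b}. x a = x t"
    proof
      fix a assume a: "a \<in> {0<..<b}"
      have aV: "x a \<in> V" using x[of a] a by simp
      have "\<not> accum (x a)" using neg a by auto
      then obtain \<epsilon> where \<epsilon>: "\<epsilon> > 0" "\<And>q. q \<in> V \<Longrightarrow> near \<epsilon> (x a) q \<Longrightarrow> q = x a"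
        using aV by (auto simp: accum_def)
      have "\<forall>\<^sub>F t in at a within {0<..<b}. near \<epsilon> (x a) (x t)"
        using cont a \<epsilon>(1) by (intro eventually_near) (auto simp: continuous_on_def)
      moreover have "\<forall>\<^sub>F t in at a within {0<..<b}. t \<in> {0<..<b}" by (simp add: eventually_at_filter)
      ultimately show "\<forall>\<^sub>F t in at a within {0<..<b}. x a = x t"
      proof eventually_elim
        case (elim t)
        show ?case using \<epsilon>(2)[OF _ elim(1)] x[of t] elim(2) by simp
      qed
    qed
  qed (use s b in auto)
  have "\<forall>\<^sub>F s in at_right 0. s \<in> {0<..<b}" by (rule eventually_at_right_real[OF b])
  hence "\<forall>\<^sub>F s in at_right 0. x s j = x (b / 2) j" by eventually_elim (use const in metis)
  hence "((\<lambda>s. x s j) \<longlongrightarrow> x (b / 2) j) (at_right 0)" by (rule tendsto_eventually)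
  hence "x (b / 2) j = 0" using lim tendsto_unique[OF trivial_limit_at_right_real] by blast
  thus False using nz[of "b / 2"] b by simp
qed

end

text \<open>Both parametrizations of the branch, by \<open>s\<close> and by the \<open>c\<close>-th root \<open>w\<close> of the \<open>j\<close>-th
  coordinate, yield the growth of each coordinate.\<close>

lemma orders_proportional:
  fixes w :: "real \<Rightarrow> real" and A :: "real fps"
  assumes w: "\<forall>\<^sub>F s in at_right 0. w s > 0" "(w \<longlongrightarrow> 0) (at_right 0)"
    and wc: "((\<lambda>s. w s ^ c / s ^ dj) \<longlongrightarrow> K) (at_right 0)" "K \<noteq> 0"
    and A: "fps_conv_radius A > 0" "A \<noteq> 0"
    and eq: "\<forall>\<^sub>F s in at_right 0. eval_fps A (w s) = s ^ d * h s" and h: "(h \<longlongrightarrow> H) (at_right 0)" "H \<noteq> 0"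
  shows "c * d = subdegree A * dj"
proof -
  let ?u = "subdegree A" and ?G = "fps_shift (subdegree A) A"
  have filt: "filterlim w (at_right 0) (at_right 0)"
    unfolding filterlim_at using w by (auto elim: eventually_mono)
  define a where "a = fps_nth A ?u"
  have a: "a \<noteq> 0" using A(2) by (simp add: a_def)
  have G: "((\<lambda>s. eval_fps ?G (w s)) \<longlongrightarrow> a) (at_right 0)"
    unfolding a_def by (rule filterlim_compose[OF fps_shift_tendsto[OF A(1)] filt])
  have "\<forall>\<^sub>F s in at_right 0. w s > 0 \<and> ereal \<bar>w s\<bar> < fps_conv_radius A"
    by (rule eventually_compose_filterlim[OF eventually_conv_radius[OF A(1)] filt])
  hence split: "\<forall>\<^sub>F s in at_right 0. w s ^ ?u * eval_fps ?G (w s) = s ^ d * h s"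
    using eq by eventually_elim (metis eval_fps_split)
  \<comment> \<open>The exponents are chosen so that all powers of \<open>w\<close> cancel. What
    remains is a quotient of powers of \<open>s\<close> with a finite nonzero limit, so the two
    powers are equal.\<close>
  have "((\<lambda>s. (h s / eval_fps ?G (w s)) ^ c / (w s ^ c / s ^ dj) ^ ?u) \<longlongrightarrow> (H / a) ^ c / K ^ ?u) (at_right 0)"
    by (intro tendsto_intros h G wc(1) a) (use wc(2) in auto)
  moreover have "\<forall>\<^sub>F s in at_right 0. (h s / eval_fps ?G (w s)) ^ c / (w s ^ c / s ^ dj) ^ ?u = s ^ (?u * dj) / s ^ (c * d)"
    using split w(1) eventually_at_right_less[of "0::real"] tendsto_imp_eventually_ne[OF G a]
  proof eventually_elim
    case (elim s)
    let ?g = "eval_fps ?G (w s)"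
    have "h s / ?g = w s ^ ?u / s ^ d" using elim by (simp add: field_simps)
    hence 1: "(h s / ?g) ^ c = w s ^ (?u * c) / s ^ (c * d)" by (simp add: power_divide power_mult mult.commute[of c])
    have 2: "(w s ^ c / s ^ dj) ^ ?u = w s ^ (?u * c) / s ^ (?u * dj)"
      by (simp add: power_divide power_mult[symmetric] mult.commute[of ?u])
    show ?case unfolding 1 2 using elim by simp
  qed
  ultimately have "((\<lambda>s. s ^ (?u * dj) / s ^ (c * d)) \<longlongrightarrow> (H / a) ^ c / K ^ ?u) (at_right 0)"
    by (rule Lim_transform_eventually)
  moreover have "(H / a) ^ c / K ^ ?u \<noteq> 0" using h(2) a wc(2) by simp
  ultimately show ?thesis using powers_limit_eq by metis
qed

text \<open>Dividing the homogeneous coordinates of the arc by the lowest power of the parameter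
  gives a limit in projective space; dividing further by the form \<open>v\<close> moves arc and
  limit into the patch.\<close>

lemma patch_arc:
  fixes u :: "nat \<Rightarrow> int" and v :: "nat \<Rightarrow> real"
  assumes C: "irreducible_curve n C" "defined_over_reals n C"
    and gen: "{x \<in> projective_closure n C. (\<Sum>i \<le> n. complex_of_real (v i) * x i) = 0} \<inter>
         {x \<in> projective_closure n C. \<exists>i \<le> n. x i = 0} = {}"
    and u\<sigma>: "(u, \<sigma>) \<in> primitive_vectors_with_signs n C"
  obtains d :: "nat \<Rightarrow> nat" and h :: "nat \<Rightarrow> real \<Rightarrow> real" and H :: "nat \<Rightarrow> real" and j b \<kappa> where
    "b > 0" "\<kappa> > 0" "j \<le> n" "d j > 0" "\<exists>k\<le>n. d k = 0"
    "\<And>k. k \<le> n \<Longrightarrow> continuous_on {0<..<b} (h k)"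
    "\<And>k. k \<le> n \<Longrightarrow> (h k \<longlongrightarrow> H k) (at_right 0)" "\<And>k. k \<le> n \<Longrightarrow> H k \<noteq> 0"
    "\<And>s. 0 < s \<Longrightarrow> s < b \<Longrightarrow> (\<lambda>k\<in>{0..n}. complex_of_real (s ^ d k * h k s)) \<in> affine_patch n C v"
    "(\<lambda>k\<in>{0..n}. complex_of_real (0 ^ d k * H k)) \<in> boundary_part n C v j"
    "\<And>k. k \<in> {1..n} \<Longrightarrow> real (d 0) - real (d k) = \<kappa> * real_of_int (u k)"
    "\<And>k. k \<in> {1..n} \<Longrightarrow> sgn (H 0) * sgn (H k) = \<sigma> k"
proof -
  obtain y where y: "y \<in> real_puiseux_points n C"
    and ex: "\<exists>a>0. \<forall>i\<in>{1..n}. - puiseux_val (y i) = a * real_of_int (u i)"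
    and \<sigma>: "\<forall>i\<in>{1..n}. sgn (puiseux_coeff (y i)) = \<sigma> i"
    using u\<sigma> unfolding primitive_vectors_with_signs_def mem_Collect_eq case_prod_conv
    by (elim conjE bexE) (rule that)
  obtain a where a: "a > 0" and val: "\<And>i. i \<in> {1..n} \<Longrightarrow> - puiseux_val (y i) = a * real_of_int (u i)"
    using ex by (elim exE conjE) (rule that, assumption, erule bspec)
  have "\<exists>i\<in>{1..n}. u i \<noteq> 0"
    using u\<sigma> unfolding primitive_vectors_with_signs_def mem_Collect_eq case_prod_conv by (elim conjE)
  then obtain i0 where i0: "i0 \<in> {1..n}" "u i0 \<noteq> 0" by (rule bexE)
  have nz: "puiseux_val (y i0) \<noteq> 0" using val[OF i0(1)] a i0(2) by auto
  obtain m e0 U0 where m: "m > 0"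
    and U0: "\<And>k. k \<in> {1..n} \<Longrightarrow> fps_conv_radius (U0 k) > 0" "\<And>k. k \<in> {1..n} \<Longrightarrow> fps_nth (U0 k) 0 \<noteq> 0"
      "\<And>k. k \<in> {1..n} \<Longrightarrow> sgn (fps_nth (U0 k) 0) = sgn (puiseux_coeff (y k))"
    and e0: "\<And>k. k \<in> {1..n} \<Longrightarrow> puiseux_val (y k) = real_of_int (e0 k) / real m"
    and arc: "\<forall>\<^sub>F s in at_right 0. (\<lambda>k\<in>{1..n}. complex_of_real (s powi (e0 k) * eval_fps (U0 k) s)) \<in> C"
    by (rule puiseux_arc[OF C y i0(1) nz]) (rule that; assumption)
  \<comment> \<open>The zeroth homogeneous coordinate is the constant 1, of exponent zero.\<close>
  define e where "e k = (if k = 0 then 0 else e0 k)" for k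
  define U where "U k = (if k = 0 then 1 else U0 k)" for k
  have U: "fps_conv_radius (U k) > 0" "fps_nth (U k) 0 \<noteq> 0" if "k \<le> n" for k
    using U0(1,2)[of k] that by (auto simp: U_def)
  define f where "f = Min (e ` {0..n})"
  define d where "d k = nat (e k - f)" for k
  have f: "f \<le> e k" if "k \<le> n" for k unfolding f_def using that by (intro Min_le) auto
  have d: "int (d k) = e k - f" if "k \<le> n" for k using f[OF that] by (simp add: d_def)
  obtain k0 where k0: "k0 \<le> n" "d k0 = 0"
  proof -
    have "f \<in> e ` {0..n}" unfolding f_def by (intro Min_in) auto
    thus ?thesis using that by (auto simp: d_def)
  qed
  have eu: "real_of_int (e k) = - (real m * a) * real_of_int (u k)" if "k \<in> {1..n}" for k
    using val[OF that] e0[OF that] m that by (simp add: e_def field_simps)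
  \<comment> \<open>If all exponents were equal, they would all be zero, contradicting that the
    vector \<open>u\<close> is nonzero.\<close>
  have dpos: "\<exists>k. k \<le> n \<and> d k > 0"
  proof (rule ccontr)
    assume neg: "\<not> ?thesis"
    hence "e 0 = e i0" using d[of 0] d[of i0] i0(1) by auto
    hence "real m * a * real_of_int (u i0) = 0" using eu[OF i0(1)] by (simp add: e_def)
    thus False using m a i0(2) by simp
  qed
  \<comment> \<open>The first coordinate vanishing in the limit, to match the ordering built into
    \<open>boundary_part\<close>.\<close>
  define j where "j = (LEAST k. k \<le> n \<and> d k > 0)"
  have j: "j \<le> n" "d j > 0" using LeastI_ex[OF dpos] by (auto simp: j_def)
  have jmin: "d k = 0" if "k < j" for k
    using not_less_Least[of k "\<lambda>k. k \<le> n \<and> d k > 0"] that j(1) by (auto simp: j_def)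
  define g where "g k s = s ^ d k * eval_fps (U k) s" for k s
  define z where "z k = 0 ^ d k * fps_nth (U k) 0" for k
  define l where "l s = (\<Sum>k\<le>n. v k * g k s)" for s
  define l0 where "l0 = (\<Sum>k\<le>n. v k * z k)"
  have Ulim: "(eval_fps (U k) \<longlongrightarrow> fps_nth (U k) 0) (at_right 0)" if "k \<le> n" for k
    by (rule eval_fps_tendsto_0[OF U(1)[OF that]])
  have glim: "(g k \<longlongrightarrow> z k) (at_right 0)" if "k \<le> n" for k
    unfolding g_def z_def by (intro tendsto_intros Ulim that)
  have llim: "(l \<longlongrightarrow> l0) (at_right 0)"
    unfolding l_def l0_def by (intro tendsto_intros glim) simp
  have cone: "\<forall>\<^sub>F s in at_right 0. \<forall>q\<in>cone_equations n C. eval q (\<lambda>k. complex_of_real (g k s)) = 0"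
    using arc eventually_at_right_less[of "0::real"]
  proof eventually_elim
    case (elim s)
    let ?y = "(\<lambda>k\<in>{1..n}. complex_of_real (s powi (e0 k) * eval_fps (U0 k) s))"
    show ?case
    proof
      fix q assume q: "q \<in> cone_equations n C"
      have "eval q (?y(0 := 1)) = 0" using q elim(1) by (auto simp: cone_equations_def)
      thus "eval q (\<lambda>k. complex_of_real (g k s)) = 0"
      proof (rule cone_equations_scale[OF q, where c = "complex_of_real (s powi (- f))"])
        fix k assume k: "k \<le> n"
        have "s ^ d k = s powi (- f) * s powi (e k)"
          using d[OF k] elim(2) by (simp add: power_int_add[symmetric] flip: power_int_of_nat)
        thus "complex_of_real (g k s) = complex_of_real (s powi (- f)) * (?y(0 := 1)) k"
          using k by (cases "k = 0") (simp_all add: g_def e_def U_def)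
      qed
    qed
  qed
  let ?z = "\<lambda>k\<in>{0..n}. complex_of_real (z k)"
  have zpc: "?z \<in> projective_closure n C"
  proof (rule projective_closure_limit[OF trivial_limit_at_right_real cone])
    show "((\<lambda>s. complex_of_real (g k s)) \<longlongrightarrow> ?z k) (at_right 0)" if "k \<le> n" for k
      using tendsto_of_real[OF glim[OF that]] that by simp
    show "\<exists>i\<le>n. ?z i \<noteq> 0" using k0 U(2)[OF k0(1)] by (intro exI[of _ k0]) (simp add: z_def)
  qed simp
  have zj: "z j = 0" using j(2) by (simp add: z_def)
  have sumz: "(\<Sum>i\<le>n. complex_of_real (v i) * ?z i) = complex_of_real l0" by (simp add: l0_def)
  \<comment> \<open>The limit point has a zero coordinate, so general position of \<open>v\<close>
    keeps the form from vanishing there.\<close>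
  have l0: "l0 \<noteq> 0"
  proof
    assume "l0 = 0"
    hence "?z \<in> {x \<in> projective_closure n C. (\<Sum>i \<le> n. complex_of_real (v i) * x i) = 0}"
      using zpc sumz by simp
    moreover have "?z \<in> {x \<in> projective_closure n C. \<exists>i \<le> n. x i = 0}"
      using zpc zj j(1) by (auto intro!: exI[of _ j])
    ultimately show False using gen by blast
  qed
  have patch: "(\<lambda>k\<in>{0..n}. complex_of_real (q k / r)) \<in> affine_patch n C v"
    if "\<And>p. p \<in> cone_equations n C \<Longrightarrow> eval p (\<lambda>k. complex_of_real (q k)) = 0" "r = (\<Sum>k\<le>n. v k * q k)" "r \<noteq> 0" for q r
    unfolding affine_patch_iff
  proof (intro conjI ballI)
    show "eval p (\<lambda>k\<in>{0..n}. complex_of_real (q k / r)) = 0" if p: "p \<in> cone_equations n C" for p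
      using \<open>p \<in> cone_equations n C \<Longrightarrow> eval p (\<lambda>k. complex_of_real (q k)) = 0\<close>[OF p]
      by (rule cone_equations_scale[OF p, where c = "complex_of_real (1 / r)"]) simp
    have "(\<Sum>i\<le>n. complex_of_real (v i) * (\<lambda>k\<in>{0..n}. complex_of_real (q k / r)) i) = complex_of_real (\<Sum>i\<le>n. v i * q i / r)"
      by simp
    also have "(\<Sum>i\<le>n. v i * q i / r) = 1"
      unfolding sum_divide_distrib[symmetric] that(2)[symmetric] using that(3) by simp
    finally show "(\<Sum>i\<le>n. complex_of_real (v i) * (\<lambda>k\<in>{0..n}. complex_of_real (q k / r)) i) = 1" by simp
  qed simp
  have "\<forall>\<^sub>F s in at_right 0. \<forall>k\<in>{0..n}. s > 0 \<and> ereal \<bar>s\<bar> < fps_conv_radius (U k)"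
    by (rule eventually_ball_finite) (use eventually_conv_radius[OF U(1)] in auto)
  hence "\<forall>\<^sub>F s in at_right 0. (\<forall>k\<in>{0..n}. ereal \<bar>s\<bar> < fps_conv_radius (U k)) \<and> l s \<noteq> 0 \<and>
      (\<forall>q\<in>cone_equations n C. eval q (\<lambda>k. complex_of_real (g k s)) = 0)"
    using tendsto_imp_eventually_ne[OF llim l0] cone by eventually_elim auto
  then obtain b where b: "b > 0" "\<And>s. 0 < s \<Longrightarrow> s < b \<Longrightarrow> (\<forall>k\<in>{0..n}. ereal \<bar>s\<bar> < fps_conv_radius (U k)) \<and> l s \<noteq> 0 \<and>
      (\<forall>q\<in>cone_equations n C. eval q (\<lambda>k. complex_of_real (g k s)) = 0)"
    unfolding eventually_at_right_field by blast
  have Ucont: "continuous_on {0<..<b} (eval_fps (U k))" if "k \<le> n" for k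
    using b(2) that by (intro continuous_on_eval_fps_Ioo) auto
  show ?thesis
  proof (rule that[of b "real m * a" j d "\<lambda>k s. eval_fps (U k) s / l s" "\<lambda>k. fps_nth (U k) 0 / l0"])
    show "continuous_on {0<..<b} (\<lambda>s. eval_fps (U k) s / l s)" if "k \<le> n" for k
      unfolding l_def g_def
      by (intro continuous_intros Ucont that) (use b(2) in \<open>auto simp: l_def g_def\<close>)
    show "((\<lambda>s. eval_fps (U k) s / l s) \<longlongrightarrow> fps_nth (U k) 0 / l0) (at_right 0)" if "k \<le> n" for k
      by (intro tendsto_intros Ulim llim l0 that)
    show "fps_nth (U k) 0 / l0 \<noteq> 0" if "k \<le> n" for k using U(2)[OF that] l0 by simp
    show "(\<lambda>k\<in>{0..n}. complex_of_real (s ^ d k * (eval_fps (U k) s / l s))) \<in> affine_patch n C v" if s: "0 < s" "s < b" for s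
      using patch[of "\<lambda>k. g k s" "l s"] b(2)[OF s] by (simp add: l_def g_def)
    have "eval p (\<lambda>k. complex_of_real (z k)) = 0" if p: "p \<in> cone_equations n C" for p
    proof -
      have "eval p ?z = 0" using zpc p by (simp add: projective_closure_iff)
      thus ?thesis by (rule cone_equations_scale[OF p, where c = 1]) simp
    qed
    from patch[OF this l0_def l0] have "(\<lambda>k\<in>{0..n}. complex_of_real (0 ^ d k * (fps_nth (U k) 0 / l0))) \<in> affine_patch n C v"
      by (simp add: z_def)
    thus "(\<lambda>k\<in>{0..n}. complex_of_real (0 ^ d k * (fps_nth (U k) 0 / l0))) \<in> boundary_part n C v j"
      using j jmin U(2) l0 by (auto simp: boundary_part_def boundary_def intro!: bexI[of _ j])
    show "real (d 0) - real (d k) = real m * a * real_of_int (u k)" if k: "k \<in> {1..n}" for k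
    proof -
      have "int (d 0) - int (d k) = - e k" using d[of 0] d[of k] k by (simp add: e_def)
      hence "real (d 0) - real (d k) = - real_of_int (e k)" by linarith
      thus ?thesis using eu[OF k] by simp
    qed
    show "sgn (fps_nth (U 0) 0 / l0) * sgn (fps_nth (U k) 0 / l0) = \<sigma> k" if k: "k \<in> {1..n}" for k
    proof -
      have "sgn (fps_nth (U k) 0) = \<sigma> k" using U0(3)[OF k] bspec[OF \<sigma> k] k by (simp add: U_def)
      thus ?thesis using l0 by (auto simp: U_def sgn_if zero_less_divide_iff split: if_splits)
    qed
  qed (use m a b(1) j k0 in auto)
qed

context patch_curve
begin

text \<open>Some point of the arc is an accumulation point and starts a lift. The arc and this lift
  along the logarithm of \<open>r\<close> have the same \<open>j\<close>-th coordinate, so they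
  agree; realness then spreads along the negative axis to the base point.\<close>

lemma lift_of_arc:
  fixes d :: "nat \<Rightarrow> nat" and h :: "nat \<Rightarrow> real \<Rightarrow> real"
  assumes b: "b > 0" and x: "\<And>s. 0 < s \<Longrightarrow> s < b \<Longrightarrow> (\<lambda>k\<in>{0..n}. complex_of_real (s ^ d k * h k s)) \<in> V"
    and cont: "\<And>k. k \<le> n \<Longrightarrow> continuous_on {0<..<b} (h k)" and lim: "(h j \<longlongrightarrow> H) (at_right 0)"
    and d: "d j > 0" and sgn: "H / \<tau> > 0"
  obtains X \<beta> where "lift_over fibre left_half X" "\<And>i. i \<le> n \<Longrightarrow> X 0 i \<in> \<real>" "0 < \<beta>" "\<beta> \<le> b"
    "\<And>s. 0 < s \<Longrightarrow> s < \<beta> \<Longrightarrow> 0 < s ^ d j * h j s / \<tau> \<and> s ^ d j * h j s / \<tau> < 1"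
    "\<And>s. 0 < s \<Longrightarrow> s < \<beta> \<Longrightarrow>
       X (complex_of_real (ln (s ^ d j * h j s / \<tau>))) = (\<lambda>k\<in>{0..n}. complex_of_real (s ^ d k * h k s))"
proof -
  define x where "x s = (\<lambda>k\<in>{0..n}. complex_of_real (s ^ d k * h k s))" for s
  \<comment> \<open>The \<open>j\<close>-th coordinate in units of \<open>\<tau>\<close>. The sign
    condition makes it positive, so that its real logarithm is defined.\<close>
  define r where "r s = s ^ d j * h j s / \<tau>" for s
  have rlim: "(r \<longlongrightarrow> 0 ^ d j * H / \<tau>) (at_right 0)"
    unfolding r_def by (intro tendsto_intros lim) (use tau in simp)
  hence rlim0: "(r \<longlongrightarrow> 0) (at_right 0)" using d by (simp add: zero_power)
  have "((\<lambda>s. h j s / \<tau>) \<longlongrightarrow> H / \<tau>) (at_right 0)" by (intro tendsto_intros lim tau)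
  from order_tendstoD(1)[OF this sgn] have "\<forall>\<^sub>F s in at_right 0. 0 < r s \<and> r s < 1"
    using order_tendstoD(2)[OF rlim0 zero_less_one] eventually_at_right_less[of "0::real"]
  proof eventually_elim
    case (elim s)
    have "r s = s ^ d j * (h j s / \<tau>)" by (simp add: r_def)
    thus ?case using elim mult_pos_pos[of "s ^ d j" "h j s / \<tau>"] by simp
  qed
  then obtain \<beta>0 where \<beta>0: "\<beta>0 > 0" "\<And>s. 0 < s \<Longrightarrow> s < \<beta>0 \<Longrightarrow> 0 < r s \<and> r s < 1"
    unfolding eventually_at_right_field by blast
  define \<beta> where "\<beta> = min b \<beta>0"
  have \<beta>: "\<beta> > 0" "\<beta> \<le> b" "\<And>s. 0 < s \<Longrightarrow> s < \<beta> \<Longrightarrow> 0 < r s \<and> r s < 1"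
    using b \<beta>0 by (auto simp: \<beta>_def)
  have xV: "x s \<in> V" if "0 < s" "s < \<beta>" for s using assms(2)[of s] that \<beta>(2) by (simp add: x_def)
  have xj: "x s j = complex_of_real (\<tau> * r s)" for s using j tau by (simp add: x_def r_def)
  have xj0: "x s j \<noteq> 0" if "0 < s" "s < \<beta>" for s using \<beta>(3)[OF that] tau by (simp add: xj)
  have hcont: "continuous_on {0<..<\<beta>} (h k)" if "k \<le> n" for k
    by (rule continuous_on_subset[OF cont[OF that]]) (use \<beta>(2) in auto)
  have xcont: "continuous_on {0<..<\<beta>} (\<lambda>s. x s i)" if "i \<le> n" for i
    unfolding x_def using that by (simp, intro continuous_intros hcont)
  have "((\<lambda>s. x s j) \<longlongrightarrow> complex_of_real (\<tau> * 0)) (at_right 0)"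
    unfolding xj by (intro tendsto_intros rlim0)
  hence "\<exists>s. 0 < s \<and> s < \<beta> \<and> accum (x s)"
    by (intro accum_on_arc[OF xV xcont xj0 _ \<beta>(1)]) simp_all
  then obtain s0 where s0: "0 < s0" "s0 < \<beta>" "accum (x s0)" by blast
  have L: "complex_of_real (ln (r s)) \<in> left_half" if "0 < s" "s < \<beta>" for s
    using \<beta>(3)[OF that] by (simp add: left_half_def)
  have "x s0 \<in> fibre (complex_of_real (ln (r s0)))"
    using s0 \<beta>(3)[OF s0(1,2)] by (simp add: fibre_def xj exp_of_real)
  from lift_exists[OF L[OF s0(1,2)] this] obtain X where
    X: "lift_over fibre left_half X" "X (complex_of_real (ln (r s0))) = x s0" by blast
  have Xx: "X (complex_of_real (ln (r s))) = x s" if s: "0 < s" "s < \<beta>" for s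
  proof (rule path_unique[of "{0<..<\<beta>}" "\<lambda>s. X (complex_of_real (ln (r s)))" x s0])
    show "connected {0<..<\<beta>}" by (intro convex_connected) simp
    show "continuous_on {0<..<\<beta>} (\<lambda>s. X (complex_of_real (ln (r s))) i)" for i
    proof (rule continuous_on_compose2[of left_half "\<lambda>\<zeta>. X \<zeta> i"])
      show "continuous_on left_half (\<lambda>\<zeta>. X \<zeta> i)"
        using X(1) unfolding lift_over_def by (blast intro: continuous_on_product_then_coordinatewise)
      have "r s \<noteq> 0" if "s \<in> {0<..<\<beta>}" for s using \<beta>(3)[of s] that by simp
      thus "continuous_on {0<..<\<beta>} (\<lambda>s. complex_of_real (ln (r s)))"
        unfolding r_def by (intro continuous_intros hcont j) (use tau in auto)
    qed (use L in auto)
    fix s assume s: "s \<in> {0<..<\<beta>}"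
    hence s': "0 < s" "s < \<beta>" by auto
    have "X (complex_of_real (ln (r s))) \<in> fibre (complex_of_real (ln (r s)))"
      using X(1) L[OF s'] by (simp add: lift_over_def)
    note fib = this fibreD[OF this L[OF s']]
    show "X (complex_of_real (ln (r s))) \<in> V" "X (complex_of_real (ln (r s))) j \<noteq> 0"
      "cmod (X (complex_of_real (ln (r s))) j) \<le> \<bar>\<tau>\<bar>" using fib by auto
    show "X (complex_of_real (ln (r s))) j = x s j"
      using fib(1) \<beta>(3)[OF s'] by (simp add: fibre_def xj exp_of_real)
    show "x s \<in> V" by (rule xV[OF s'])
  qed (use xcont s s0 X(2) in auto)
  have "X (complex_of_real 0) i \<in> \<real>" if i: "i \<le> n" for i
  proof (rule lift_Real[OF X(1), of "ln (r s0)"])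
    show "X (complex_of_real (ln (r s0))) i \<in> \<real>" if "i \<le> n" for i
      using that by (simp add: X(2) x_def)
  qed (use \<beta>(3)[OF s0(1,2)] i in auto)
  thus ?thesis using that[of X \<beta>] X(1) \<beta> Xx by (simp add: x_def r_def)
qed

end

text \<open>The lift through the arc of the given vector supplies every datum of the procedure: base
  point, radial path, circular path, cycle number and Fourier orders. The orders are then compared
  with the exponents of the arc.\<close>

lemma circle_output_complete:
  assumes C: "irreducible_curve n C" "defined_over_reals n C"
    and gen: "{x \<in> projective_closure n C. (\<Sum>i \<le> n. complex_of_real (v i) * x i) = 0} \<inter>
         {x \<in> projective_closure n C. \<exists>i \<le> n. x i = 0} = {}"
    and pc: "\<And>j t. j \<le> n \<Longrightarrow> boundary_part n C v j \<noteq> {} \<Longrightarrow> \<bar>t\<bar> = \<tau> j \<Longrightarrow>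
      patch_curve n j (affine_patch n C v) E G t" and pos: "\<And>j. j \<le> n \<Longrightarrow> boundary_part n C v j \<noteq> {} \<Longrightarrow> 0 < \<tau> j"
    and u\<sigma>: "(u, \<sigma>) \<in> primitive_vectors_with_signs n C"
  shows "\<exists>j\<le>n. boundary_part n C v j \<noteq> {} \<and> (u, \<sigma>) \<in> circle_output n C v j (\<tau> j) \<union> circle_output n C v j (- \<tau> j)"
proof -
  obtain d :: "nat \<Rightarrow> nat" and h :: "nat \<Rightarrow> real \<Rightarrow> real" and H :: "nat \<Rightarrow> real" and j b \<kappa> where
    b: "b > 0" and \<kappa>: "\<kappa> > 0" and j: "j \<le> n" and d: "d j > 0" "\<exists>k\<le>n. d k = 0"
    and h: "\<And>k. k \<le> n \<Longrightarrow> continuous_on {0<..<b} (h k)"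
      "\<And>k. k \<le> n \<Longrightarrow> (h k \<longlongrightarrow> H k) (at_right 0)" and H: "\<And>k. k \<le> n \<Longrightarrow> H k \<noteq> 0"
    and x: "\<And>s. 0 < s \<Longrightarrow> s < b \<Longrightarrow> (\<lambda>k\<in>{0..n}. complex_of_real (s ^ d k * h k s)) \<in> affine_patch n C v"
    and x0: "(\<lambda>k\<in>{0..n}. complex_of_real (0 ^ d k * H k)) \<in> boundary_part n C v j"
    and du: "\<And>k. k \<in> {1..n} \<Longrightarrow> real (d 0) - real (d k) = \<kappa> * real_of_int (u k)"
    and \<sigma>: "\<And>k. k \<in> {1..n} \<Longrightarrow> sgn (H 0) * sgn (H k) = \<sigma> k"
    by (rule patch_arc[OF C gen u\<sigma>]) (rule that; assumption)
  have ne: "boundary_part n C v j \<noteq> {}" using x0 by blast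
  \<comment> \<open>The sign of the \<open>j\<close>-th coordinate of the arc decides which of the
    two base values is hit.\<close>
  define t where "t = sgn (H j) * \<tau> j"
  have \<tau>: "0 < \<tau> j" by (rule pos[OF j ne])
  have t: "\<bar>t\<bar> = \<tau> j" "t = \<tau> j \<or> t = - \<tau> j" "H j / t > 0"
    using \<tau> H[OF j] by (auto simp: t_def sgn_if divide_neg_pos)
  interpret patch_curve n j "affine_patch n C v" E G t by (rule pc[OF j ne t(1)])
  obtain X \<beta> where X: "lift_over fibre left_half X" and real: "\<And>i. i \<le> n \<Longrightarrow> X 0 i \<in> \<real>" and \<beta>: "0 < \<beta>"
    and r01: "\<And>s. 0 < s \<Longrightarrow> s < \<beta> \<Longrightarrow> 0 < s ^ d j * h j s / t \<and> s ^ d j * h j s / t < 1"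
    and Xx: "\<And>s. 0 < s \<Longrightarrow> s < \<beta> \<Longrightarrow> X (complex_of_real (ln (s ^ d j * h j s / t))) = (\<lambda>k\<in>{0..n}. complex_of_real (s ^ d k * h k s))"
    by (rule lift_of_arc[OF b x h(1) h(2)[OF j] d(1) t(3)]) (assumption | (rule that; assumption))+
  have zero: "(0::complex) \<in> left_half" by (simp add: left_half_def)
  have iL: "\<i> * complex_of_real \<theta> \<in> left_half" for \<theta> by (simp add: left_half_def)
  have XV: "X \<zeta> \<in> affine_patch n C v" "X \<zeta> j = complex_of_real t * exp \<zeta>" if "\<zeta> \<in> left_half" for \<zeta>
  proof -
    have "X \<zeta> \<in> fibre \<zeta>" using X that by (simp add: lift_over_def)
    thus "X \<zeta> \<in> affine_patch n C v" "X \<zeta> j = complex_of_real t * exp \<zeta>"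
      by (simp_all add: fibre_def accum_def)
  qed
  define Q where "Q \<theta> = X (\<i> * complex_of_real \<theta>)" for \<theta>
  have Qc: "Q (2 * pi * real c) = X (2 * pi * real c * \<i>)" for c by (simp add: Q_def mult.commute)
  have Q0: "Q 0 = X 0" by (simp add: Q_def)
  have Q: "circular_path n C v j t (X 0) Q"
    unfolding circular_path_def
  proof (intro conjI allI impI Q0)
    show "continuous_on {0..} Q" unfolding Q_def
    proof (rule continuous_on_compose2[of left_half X])
      show "continuous_on left_half X" using X by (simp add: lift_over_def)
    qed (use iL in \<open>auto intro!: continuous_intros\<close>)
    show "Q \<theta> \<in> affine_patch n C v" "Q \<theta> j = complex_of_real t * cis \<theta>" for \<theta>
      using XV[OF iL] by (simp_all add: Q_def cis_conv_exp)
  qed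
  define c where "c = (LEAST c. 0 < c \<and> Q (2 * pi * real c) = Q 0)"
  have "\<exists>c. 0 < c \<and> Q (2 * pi * real c) = Q 0"
    by (rule lift_cycle[OF X]) (metis Qc Q0)
  from LeastI_ex[OF this] have c: "0 < c" "Q (2 * pi * real c) = Q 0" by (simp_all add: c_def)
  have cyc: "cycle_number Q c"
    unfolding cycle_number_def is_least_def
    using c not_less_Least[of _ "\<lambda>c. 0 < c \<and> Q (2 * pi * real c) = Q 0"] by (auto simp: c_def)
  have Xc: "X (2 * pi * real c * \<i>) = X 0" using c(2) Qc Q0 by simp
  obtain A P where A: "\<And>k. k \<le> n \<Longrightarrow> fps_conv_radius (A k) \<ge> 1"
    "\<And>k s. k \<le> n \<Longrightarrow> 0 < s \<Longrightarrow> s < 1 \<Longrightarrow> X (complex_of_real (real c * ln s)) k = complex_of_real (eval_fps (A k) s)"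
    "\<And>k. k \<le> n \<Longrightarrow> A k \<noteq> 0"
    "\<And>k l. k \<le> n \<Longrightarrow> integral {0..2 * pi} (\<lambda>\<theta>. X (\<i> * complex_of_real (real c * \<theta>)) k * cis (- (real l * \<theta>)))
       = 2 * pi * complex_of_real (fps_nth (A k) l)"
    and P: "P 1 = X 0" "continuous_on {0..1} P"
    "\<And>s. s \<in> {0..1} \<Longrightarrow> P s \<in> affine_patch n C v \<and> P s j = complex_of_real (t * s)"
    "\<And>s. 0 < s \<Longrightarrow> s \<le> 1 \<Longrightarrow> P s = X (complex_of_real (ln s))"
    by (rule real_branch[OF X real c(1) Xc]) (assumption | blast)+
  define r where "r s = s ^ d j * h j s / t" for s
  note r01 = r01[folded r_def] and Xx = Xx[folded r_def]
  have ev: "\<forall>\<^sub>F s in at_right 0. s \<in> {0<..<\<beta>}" by (rule eventually_at_right_real[OF \<beta>])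
  have rlim: "(r \<longlongrightarrow> 0) (at_right 0)"
  proof -
    have "(r \<longlongrightarrow> 0 ^ d j * H j / t) (at_right 0)" unfolding r_def by (intro tendsto_intros h(2) j tau)
    thus ?thesis using d(1) by (simp add: zero_power)
  qed
  \<comment> \<open>Radial path and arc run on the same lift, so they share their limit, which is
    already known to be a boundary point in part \<open>j\<close>.\<close>
  have P0: "P 0 = (\<lambda>k\<in>{0..n}. complex_of_real (0 ^ d k * H k))"
  proof (rule ext_eqI)
    fix k assume k: "k \<le> n"
    have lim1: "((\<lambda>s. P s k) \<longlongrightarrow> P 0 k) (at_right 0)"
      using continuous_on_product_then_coordinatewise[OF P(2), of k]
      by (auto simp: continuous_on_def at_within_Icc_at_right dest: bspec[of _ _ 0])
    have filt: "filterlim r (at_right 0) (at_right 0)"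
      unfolding filterlim_at
    proof
      show "\<forall>\<^sub>F s in at_right 0. r s \<in> {0<..} \<and> r s \<noteq> 0"
        using ev by eventually_elim (use r01 in force)
    qed (rule rlim)
    have "((\<lambda>s. P (r s) k) \<longlongrightarrow> P 0 k) (at_right 0)" by (rule filterlim_compose[OF lim1 filt])
    moreover have "\<forall>\<^sub>F s in at_right 0. P (r s) k = complex_of_real (s ^ d k * h k s)"
      using ev by eventually_elim (use P(4) r01 Xx k in \<open>simp add: less_imp_le\<close>)
    ultimately have "((\<lambda>s. complex_of_real (s ^ d k * h k s)) \<longlongrightarrow> P 0 k) (at_right 0)"
      by (rule Lim_transform_eventually)
    moreover have "((\<lambda>s. complex_of_real (s ^ d k * h k s)) \<longlongrightarrow> complex_of_real (0 ^ d k * H k)) (at_right 0)"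
      by (intro tendsto_intros h(2) k)
    ultimately show "P 0 k = (\<lambda>k\<in>{0..n}. complex_of_real (0 ^ d k * H k)) k"
      using tendsto_unique[OF trivial_limit_at_right_real] k by simp
  qed (use P(3)[of 0] in \<open>auto simp: affine_patch_iff\<close>)
  define U where "U k = subdegree (A k)" for k
  have four: "fourier_order Q c k (U k)" if k: "k \<le> n" for k
    unfolding fourier_order_def is_least_def
  proof (intro conjI allI impI)
    show "integral {0..2 * pi} (\<lambda>\<theta>. Q (real c * \<theta>) k * cis (- (real (U k) * \<theta>))) \<noteq> 0"
      unfolding Q_def A(4)[OF k] using A(3)[OF k] by (simp add: U_def)
    show "\<not> integral {0..2 * pi} (\<lambda>\<theta>. Q (real c * \<theta>) k * cis (- (real l * \<theta>))) \<noteq> 0" if "l < U k" for l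
      unfolding Q_def A(4)[OF k] using nth_less_subdegree_zero[of l "A k"] that by (simp add: U_def)
  qed
  \<comment> \<open>The disc parameter along the arc is the \<open>c\<close>-th root of
    \<open>r\<close>; comparing growth rates gives \<open>U k / d k = c / d j\<close> up to clearing
    denominators.\<close>
  have growth: "c * d k = U k * d j" if k: "k \<le> n" for k
    unfolding U_def
  proof (rule orders_proportional[of "\<lambda>s. exp (ln (r s) / real c)"])
    have "((\<lambda>s. h j s / t) \<longlongrightarrow> H j / t) (at_right 0)" by (intro tendsto_intros h(2) j tau)
    moreover have "\<forall>\<^sub>F s in at_right 0. h j s / t = exp (ln (r s) / real c) ^ c / s ^ d j"
      using ev
    proof eventually_elim
      case (elim s)
      have "exp (ln (r s) / real c) ^ c = r s"
        using c(1) r01[of s] elim by (simp flip: exp_of_nat_mult)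
      thus ?case using elim by (simp add: r_def)
    qed
    ultimately show "((\<lambda>s. exp (ln (r s) / real c) ^ c / s ^ d j) \<longlongrightarrow> H j / t) (at_right 0)"
      by (rule Lim_transform_eventually)
    have "((\<lambda>s. root c (r s)) \<longlongrightarrow> root c 0) (at_right 0)" by (intro tendsto_intros rlim)
    moreover have "\<forall>\<^sub>F s in at_right 0. root c (r s) = exp (ln (r s) / real c)"
      using ev
    proof eventually_elim
      case (elim s)
      thus ?case using r01[of s] c(1) by (simp add: root_powr_inverse powr_def)
    qed
    ultimately have "((\<lambda>s. exp (ln (r s) / real c)) \<longlongrightarrow> root c 0) (at_right 0)"
      by (rule Lim_transform_eventually)
    thus "((\<lambda>s. exp (ln (r s) / real c)) \<longlongrightarrow> 0) (at_right 0)" by simp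
    show "\<forall>\<^sub>F s in at_right 0. eval_fps (A k) (exp (ln (r s) / real c)) = s ^ d k * h k s"
      using ev
    proof eventually_elim
      case (elim s)
      have "exp (ln (r s) / real c) < 1" using r01[of s] elim c(1) by (simp add: divide_neg_pos)
      hence "complex_of_real (eval_fps (A k) (exp (ln (r s) / real c))) = X (complex_of_real (ln (r s))) k"
        using A(2)[OF k, of "exp (ln (r s) / real c)"] c(1) by simp
      also have "\<dots> = complex_of_real (s ^ d k * h k s)" using Xx[of s] elim k by simp
      finally show ?case by (simp only: of_real_eq_iff)
    qed
    show "fps_conv_radius (A k) > 0" using A(1)[OF k] by (rule less_le_trans[rotated]) simp
  qed (use t(3) A(3)[OF k] h(2)[OF k] H[OF k] in auto)
  define g where "g = Gcd (U ` {0..n})"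
  define \<rho> where "\<rho> k = reduced_vector n U k" for k
  have "U j \<noteq> 0" using growth[OF j] d(1) c(1) by (metis mult_is_0 less_numeral_extra(3))
  hence "\<not> U ` {0..n} \<subseteq> {0}" using j by (metis atLeastAtMost_iff image_subset_iff le0 singletonD)
  hence g: "g \<noteq> 0" unfolding g_def Gcd_0_iff .
  have Ug: "U k = g * \<rho> k" if "k \<le> n" for k
    using Gcd_dvd[of "U k" "U ` {0..n}"] that by (simp add: \<rho>_def reduced_vector_def g_def)
  have G\<rho>: "Gcd (\<rho> ` {0..n}) = 1"
    using Gcd_div_eq_1[of U "{0..n}"] g by (simp add: \<rho>_def[abs_def] reduced_vector_def g_def)
  obtain k0 where k0: "k0 \<le> n" "d k0 = 0" using d(2) by blast
  have "\<rho> k0 = 0" using growth[OF k0(1)] Ug[OF k0(1)] g d(1) k0(2) by simp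
  note Gdiff = Gcd_differences[OF G\<rho> k0(1) this]
  have ratio: "real_of_int (int (\<rho> 0) - int (\<rho> i)) = (real c * \<kappa> / (real g * real (d j))) * real_of_int (u i)" if i: "i \<in> {1..n}" for i
  proof -
    have "real c * real (d k) = real g * real (\<rho> k) * real (d j)" if "k \<le> n" for k
      using growth[OF that] Ug[OF that] by (metis of_nat_mult)
    from this[of 0] this[of i] have "real c * (real (d 0) - real (d i)) = real g * real (d j) * (real (\<rho> 0) - real (\<rho> i))"
      using i by (simp add: algebra_simps)
    thus ?thesis using du[OF i] g d(1) by (simp add: field_simps)
  qed
  have Gu: "Gcd (u ` {1..n}) = 1" and ue: "u \<in> {1..n} \<rightarrow>\<^sub>E UNIV" and \<sigma>e: "\<sigma> \<in> {1..n} \<rightarrow>\<^sub>E {1, -1}"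
    using u\<sigma> by (auto simp: primitive_vectors_with_signs_def)
  \<comment> \<open>Both vectors are primitive and positively proportional.\<close>
  have "int (\<rho> 0) - int (\<rho> i) = u i" if i: "i \<in> {1..n}" for i
    by (rule primitive_proportional[OF Gu Gdiff _ ratio i]) (use c(1) \<kappa> g d(1) in simp_all)
  hence u: "u = (\<lambda>i\<in>{1..n}. int (reduced_vector n U 0) - int (reduced_vector n U i))"
    using ue by (intro ext) (auto simp: \<rho>_def PiE_def extensional_def)
  have sg: "sgn (Re (X 0 k)) = sgn (H k)" if k: "k \<le> n" for k
  proof -
    have lim: "((\<lambda>s. h k s / H k) \<longlongrightarrow> H k / H k) (at_right 0)" by (intro tendsto_intros h(2) k H)
    have "0 < H k / H k" using H[OF k] by simp
    from order_tendstoD(1)[OF lim this] have "\<forall>\<^sub>F s in at_right 0. sgn (h k s) = sgn (H k)"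
      by eventually_elim (auto simp: zero_less_divide_iff)
    hence "\<forall>\<^sub>F s in at_right 0. sgn (h k s) = sgn (H k) \<and> s \<in> {0<..<\<beta>}" using ev by (rule eventually_conj)
    from eventually_happens'[OF trivial_limit_at_right_real this]
    obtain s where s: "sgn (h k s) = sgn (H k)" "0 < s" "s < \<beta>" by auto
    have "sgn (Re (X (complex_of_real (ln (r s))) k)) = sgn (H k)"
      using Xx[OF s(2,3)] s k by (simp add: sgn_mult)
    thus ?thesis using lift_sgn[OF X real _ k, of "ln (r s)"] r01[OF s(2,3)] by simp
  qed
  have "sgn (Re (X 0 0 * X 0 i)) = \<sigma> i" if i: "i \<in> {1..n}" for i
  proof -
    have "sgn (Re (X 0 0 * X 0 i)) = sgn (Re (X 0 0)) * sgn (Re (X 0 i))"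
      using real[of i] real[of 0] i by (auto elim!: Reals_cases simp: sgn_mult)
    thus ?thesis using sg[of 0] sg[of i] \<sigma>[OF i] i by simp
  qed
  hence \<sigma>': "\<sigma> = (\<lambda>i\<in>{1..n}. sgn (Re (X 0 0 * X 0 i)))"
    using \<sigma>e by (intro ext) (auto simp: PiE_def extensional_def)
  have "radial_path n C v j t (X 0) P" using P by (simp add: radial_path_def)
  moreover have "X 0 j = complex_of_real t" using XV(2)[OF zero] by simp
  ultimately have "(u, \<sigma>) \<in> circle_output n C v j t"
    unfolding circle_output_def mem_Collect_eq u \<sigma>'
    using XV(1)[OF zero] real Q cyc four x0 P0 by metis
  thus ?thesis using t(2) j ne by blast
qed

theorem theorem21:
  fixes n :: nat
    and C :: "(nat \<Rightarrow> complex) set"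
    and F :: "complex mvpoly set"
    and v \<tau> :: "nat \<Rightarrow> real"
  assumes "irreducible_curve n C"
    and "defined_over_reals n C"
    and "C \<inter> real_torus n \<noteq> {}"
    and "finite F" and "F \<subseteq> polys_in {1..n}"
    and "component_of_multiplicity_one n C F"
    and "\<forall>i \<le> n. v i \<noteq> 0"
    and "{x \<in> projective_closure n C. (\<Sum>i \<le> n. complex_of_real (v i) * x i) = 0} \<inter>
         {x \<in> projective_closure n C. \<exists>i \<le> n. x i = 0} = {}"
    and "admissible_radii n C F v \<tau>"
  shows "procedure_output n C v \<tau> = primitive_vectors_with_signs n C"
proof -
  have C: "irreducible_curve n C" "defined_over_reals n C" by fact+
  have cl: "zariski_closed n C"
    using C(1) by (simp add: irreducible_curve_def irreducible_variety_def)
  have "C \<subseteq> solution_set n F"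
    using assms(6) by (simp add: component_of_multiplicity_one_def irreducible_component_def)
  note pc = patch_curve_affine_patch[OF C(2) assms(4,5) this assms(8,9)]
  have pos: "0 < \<tau> j" if "j \<le> n" "boundary_part n C v j \<noteq> {}" for j
    using assms(9) that by (auto simp: admissible_radii_def)
  have sound: "(u, \<sigma>) \<in> primitive_vectors_with_signs n C"
    if "j \<le> n" "boundary_part n C v j \<noteq> {}" "(u, \<sigma>) \<in> circle_output n C v j (\<tau> j) \<union> circle_output n C v j (- \<tau> j)" for j u \<sigma>
    using circle_output_sound[OF cl pc[OF that(1,2)], of "\<tau> j"]
      circle_output_sound[OF cl pc[OF that(1,2)], of "- \<tau> j"] pos[OF that(1,2)] that(3) by auto
  have complete: "\<exists>j\<le>n. boundary_part n C v j \<noteq> {} \<and> (u, \<sigma>) \<in> circle_output n C v j (\<tau> j) \<union> circle_output n C v j (- \<tau> j)"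
    if "(u, \<sigma>) \<in> primitive_vectors_with_signs n C" for u \<sigma>
    by (rule circle_output_complete[OF C assms(8) pc pos that])
  show ?thesis
  proof (cases "boundary n C v = {}")
    case True
    hence "boundary_part n C v j = {}" for j by (simp add: boundary_part_def)
    \<comment> \<open>A primitive vector would produce a boundary point by completeness.\<close>
    hence "primitive_vectors_with_signs n C = {}" using complete by force
    thus ?thesis using True by (simp add: procedure_output_def)
  next
    case False
    show ?thesis
    proof (intro set_eqI)
      fix z :: "(nat \<Rightarrow> int) \<times> (nat \<Rightarrow> real)"
      obtain u \<sigma> where z: "z = (u, \<sigma>)" by fastforce
      have "z \<in> procedure_output n C v \<tau> \<longleftrightarrow> (\<exists>j\<le>n. boundary_part n C v j \<noteq> {} \<and>
          (u, \<sigma>) \<in> circle_output n C v j (\<tau> j) \<union> circle_output n C v j (- \<tau> j))"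
        unfolding z procedure_output_def using False by auto
      also have "\<dots> \<longleftrightarrow> z \<in> primitive_vectors_with_signs n C"
        unfolding z using sound complete by blast
      finally show "z \<in> procedure_output n C v \<tau> \<longleftrightarrow> z \<in> primitive_vectors_with_signs n C" .
    qed
  qed
qed

end
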